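(* Let $\mathcal{G}$ be a convex class of distributions with $E_Gu^2(X,\theta)<\infty$ for all $G\in\mathcal{G}$, and let $G_0\in\mathcal{G}$. Define $$\mathcal{G}_{G_0}\equiv\Big\{G\in\mathcal{G}:E_{G_0}\big(f_G(X)/f_{G_0}(X)\big)^2<\infty,\ \int f_GI\{f_{G_0}>0\}\,d\nu=1\Big\},$$ $$\mathcal{V}_{G_0}\equiv\{v(x):E_Gv(X)=E_Gu(X,\theta)\ \ \forall G\in\mathcal{G}_{G_0}\}.$$ (i) If $\mathcal{V}_{G_0}$ is nonempty, then $\{\widehat S_n,n\ge1\}$ is an asymptotically efficient estimator of $S_n=\sum_{j=1}^nu(X_j,\theta_j)$ at $P_{G_0}$ if and only if $$\widehat S_n=\Big\{\sum_{j=1}^nv_{G_0}(X_j)\Big\}+o_{P_{G_0}}(n^{1/2}),\qquad v_{G_0}\equiv\arg\min\{E_{G_0}(v(X)-u(X,\theta))^2:v\in\mathcal{V}_{G_0}\}.$$ (ii) If $\mathcal{V}_{G_0}$ is empty, then there does not exist any regular $n^{-1/2}$-consistent estimator of $E_Gu(X,\theta)$ or of $S_n/n$ in contiguous neighborhoods of $P_{G_0}$.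
   Context: Under $P_G$ (with expectation $E_G$), $(X,\theta),(X_1,\theta_1),(X_2,\theta_2),\dots$ are i.i.d. with $\theta\sim G$ and, given $\theta$, $X$ has density $f(x|\theta)$ with respect to a measure $\nu$, where $f(\cdot|\cdot)$ is known; $f_G(x)\equiv\int f(x|\vartheta)G(d\vartheta)$ is the marginal density of $X$. The $X_j$ are observed, the $\theta_j$ and $G\in\mathcal{G}$ are unknown; estimators are functions of $X_1,\dots,X_n$. The utility $u(x,\vartheta)$ is a known Borel function, and $v$ denotes Borel functions of $x$ only. Regularity and efficiency are along the curves $G_t\equiv(1-t)G_0+tG$, $0\le t\le1$, $G\in\mathcal{G}_{G_0}$. An estimator $\widetilde S_n$ of $S_n$ (equivalently $\widetilde S_n/n$ of $S_n/n$) is regular at $P_{G_0}$ if there is a random variable $\xi_0$ such that for all $c>0$ and all $G\in\mathcal{G}_{G_0}$ the law of $n^{-1/2}(\widetilde S_n-S_n)$ under $P_{G_{c/\sqrt n}}$ converges weakly to the law of $\xi_0$ (the same for all $c$ and $G$). An estimator $\widetilde\mu_n$ of $\mu(G)=E_Gu(X,\theta)$ is regular at $P_{G_0}$ if there is a random variable $\zeta_0$ such that for all $c>0$ and $G\in\mathcal{G}_{G_0}$ the law of $n^{1/2}(\widetilde\mu_n-\mu(G_{c/\sqrt n}))$ under $P_{G_{c/\sqrt n}}$ converges weakly to the law of $\zeta_0$. An estimator of $S_n$ is asymptotically efficient at $P_{G_0}$ if it is regular at $P_{G_0}$ and $E\xi_0^2$ equals the sharp lower bound for the variance of the limits $\xi_0$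 of all estimators of $S_n$ regular at $P_{G_0}$.
   Formalization: The measure ν is taken to be σ-finite, and v_{G_0} is required to have finite risk E_{G_0}(v-u)^2; if every v in V_{G_0} has infinite risk, no v_{G_0} exists and no estimator is efficient. *)

theory Defs
  imports "HOL-Probability.Probability"
begin

text \<open>
  Conventions.  \<open>\<nu>\<close> is the dominating measure on the sample space, \<open>T\<close> is a measure used only for
  the measurable structure of the parameter space, and \<open>f x \<theta>\<close> stands for $f(x|\theta)$.  Random
  variables \<open>\<xi>\<^sub>0\<close>, \<open>\<zeta>\<^sub>0\<close> enter regularity only through their laws, so they are represented by Borel
  probability measures \<open>L\<close> on the real line.
\<close>

definition mixture :: "real \<Rightarrow> 'p measure \<Rightarrow> 'p measure \<Rightarrow> 'p measure" where
  "mixture t G H =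
     measure_of (space G) (sets G) (\<lambda>A. ennreal (1 - t) * emeasure G A + ennreal t * emeasure H A)"

definition convex_class :: "'p measure \<Rightarrow> 'p measure set \<Rightarrow> bool" where
  "convex_class T \<G> \<longleftrightarrow>
     (\<forall>G\<in>\<G>. prob_space G \<and> sets G = sets T) \<and>
     (\<forall>G\<in>\<G>. \<forall>H\<in>\<G>. \<forall>t\<in>{0..1}. mixture t G H \<in> \<G>)"

definition conditional_density :: "'x measure \<Rightarrow> 'p measure \<Rightarrow> ('x \<Rightarrow> 'p \<Rightarrow> real) \<Rightarrow> bool" where
  "conditional_density \<nu> T f \<longleftrightarrow>
     (\<lambda>(x, \<theta>). f x \<theta>) \<in> borel_measurable (\<nu> \<Otimes>\<^sub>M T) \<and>
     (\<forall>x\<in>space \<nu>. \<forall>\<theta>\<in>space T. 0 \<le> f x \<theta>) \<and>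
     (\<forall>\<theta>\<in>space T. (\<integral>\<^sup>+x. ennreal (f x \<theta>) \<partial>\<nu>) = 1)"

text \<open>The law of \<open>(X, \<theta>)\<close> under \<open>P\<^sub>G\<close>: \<open>\<theta>\<close> has law \<open>G\<close>, and \<open>X\<close> has density \<open>f(\<cdot>|\<theta>)\<close> given \<open>\<theta>\<close>.\<close>

definition joint_law :: "'x measure \<Rightarrow> ('x \<Rightarrow> 'p \<Rightarrow> real) \<Rightarrow> 'p measure \<Rightarrow> ('x \<times> 'p) measure" where
  "joint_law \<nu> f G = density (\<nu> \<Otimes>\<^sub>M G) (\<lambda>(x, \<theta>). ennreal (f x \<theta>))"

text \<open>The law of \<open>(X\<^sub>1, \<theta>\<^sub>1), \<dots>, (X\<^sub>n, \<theta>\<^sub>n)\<close>, with indices shifted to \<open>{..<n}\<close>.\<close>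

definition sample_law ::
  "'x measure \<Rightarrow> ('x \<Rightarrow> 'p \<Rightarrow> real) \<Rightarrow> 'p measure \<Rightarrow> nat \<Rightarrow> (nat \<Rightarrow> 'x \<times> 'p) measure" where
  "sample_law \<nu> f G n = Pi\<^sub>M {..<n} (\<lambda>_. joint_law \<nu> f G)"

definition marginal_density :: "('x \<Rightarrow> 'p \<Rightarrow> real) \<Rightarrow> 'p measure \<Rightarrow> 'x \<Rightarrow> ennreal" where
  "marginal_density f G x = (\<integral>\<^sup>+\<theta>. ennreal (f x \<theta>) \<partial>G)"

definition mean_utility ::
  "'x measure \<Rightarrow> ('x \<Rightarrow> 'p \<Rightarrow> real) \<Rightarrow> ('x \<Rightarrow> 'p \<Rightarrow> real) \<Rightarrow> 'p measure \<Rightarrow> real" where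
  "mean_utility \<nu> f u G = (\<integral>z. u (fst z) (snd z) \<partial>joint_law \<nu> f G)"

text \<open>
  The quotient of marginal densities is taken in \<^typ>\<open>ennreal\<close>; its value where \<open>f\<^bsub>G0\<^esub>\<close> vanishes is
  immaterial, because \<open>P\<^sub>G\<^sub>0\<close> gives no mass to that set.
\<close>

definition local_class ::
  "'x measure \<Rightarrow> ('x \<Rightarrow> 'p \<Rightarrow> real) \<Rightarrow> 'p measure set \<Rightarrow> 'p measure \<Rightarrow> 'p measure set" where
  "local_class \<nu> f \<G> G0 =
     {G\<in>\<G>.
        (\<integral>\<^sup>+z. (marginal_density f G (fst z) / marginal_density f G0 (fst z))\<^sup>2 \<partial>joint_law \<nu> f G0) < \<infinity> \<and>
        (\<integral>\<^sup>+x. marginal_density f G x * indicator {x. marginal_density f G0 x > 0} x \<partial>\<nu>) = 1}"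

text \<open>
  The integrability clause says that the expectation of \<open>v(X)\<close> exists; without it the Bochner
  integral of a non-integrable \<open>v\<close> would be \<open>0\<close> by convention.
\<close>

definition unbiased_class ::
  "'x measure \<Rightarrow> ('x \<Rightarrow> 'p \<Rightarrow> real) \<Rightarrow> ('x \<Rightarrow> 'p \<Rightarrow> real) \<Rightarrow> 'p measure set \<Rightarrow> 'p measure
     \<Rightarrow> ('x \<Rightarrow> real) set" where
  "unbiased_class \<nu> f u \<G> G0 =
     {v\<in>borel_measurable \<nu>. \<forall>G\<in>local_class \<nu> f \<G> G0.
        integrable (joint_law \<nu> f G) (\<lambda>z. v (fst z)) \<and>
        (\<integral>z. v (fst z) \<partial>joint_law \<nu> f G) = mean_utility \<nu> f u G}"

definition risk ::
  "'x measure \<Rightarrow> ('x \<Rightarrow> 'p \<Rightarrow> real) \<Rightarrow> ('x \<Rightarrow> 'p \<Rightarrow> real) \<Rightarrow> 'p measure \<Rightarrow> ('x \<Rightarrow> real) \<Rightarrow> ennreal" where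
  "risk \<nu> f u G0 v = (\<integral>\<^sup>+z. ennreal ((v (fst z) - u (fst z) (snd z))\<^sup>2) \<partial>joint_law \<nu> f G0)"

text \<open>
  \<open>v\<^sub>0\<close> is a version of \<open>v\<^bsub>G0\<^esub>\<close>.  The finiteness clause matters only if the risk is infinite on the
  whole of \<^const>\<open>unbiased_class\<close>: there is then no \<open>v\<^bsub>G0\<^esub>\<close>, instead of every \<open>v\<close> being a minimizer.
\<close>

definition is_optimal_v ::
  "'x measure \<Rightarrow> ('x \<Rightarrow> 'p \<Rightarrow> real) \<Rightarrow> ('x \<Rightarrow> 'p \<Rightarrow> real) \<Rightarrow> 'p measure set \<Rightarrow> 'p measure
     \<Rightarrow> ('x \<Rightarrow> real) \<Rightarrow> bool" where
  "is_optimal_v \<nu> f u \<G> G0 v0 \<longleftrightarrow>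
     is_arg_min (risk \<nu> f u G0) (\<lambda>v. v \<in> unbiased_class \<nu> f u \<G> G0) v0 \<and>
     risk \<nu> f u G0 v0 < \<infinity>"

definition estimator :: "'x measure \<Rightarrow> (nat \<Rightarrow> (nat \<Rightarrow> 'x) \<Rightarrow> real) \<Rightarrow> bool" where
  "estimator \<nu> S \<longleftrightarrow> (\<forall>n. S n \<in> borel_measurable (Pi\<^sub>M {..<n} (\<lambda>_. \<nu>)))"

definition observed :: "nat \<Rightarrow> (nat \<Rightarrow> 'x \<times> 'p) \<Rightarrow> nat \<Rightarrow> 'x" where
  "observed n \<omega> = (\<lambda>j\<in>{..<n}. fst (\<omega> j))"

definition utility_sum :: "('x \<Rightarrow> 'p \<Rightarrow> real) \<Rightarrow> nat \<Rightarrow> (nat \<Rightarrow> 'x \<times> 'p) \<Rightarrow> real" where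
  "utility_sum u n \<omega> = (\<Sum>j<n. u (fst (\<omega> j)) (snd (\<omega> j)))"

text \<open>
  In the next two definitions \<open>mixture (c / sqrt n) G0 G\<close> is the point \<open>G\<^bsub>c/\<surd>n\<^esub>\<close> of the curve
  through \<open>G\<^sub>0\<close> and \<open>G\<close>.  It is a probability measure once \<open>n \<ge> c\<^sup>2\<close>; the finitely many smaller \<open>n\<close>
  do not affect the weak limit.
\<close>

definition regular_sum_with_limit ::
  "'x measure \<Rightarrow> ('x \<Rightarrow> 'p \<Rightarrow> real) \<Rightarrow> ('x \<Rightarrow> 'p \<Rightarrow> real) \<Rightarrow> 'p measure set \<Rightarrow> 'p measure
     \<Rightarrow> (nat \<Rightarrow> (nat \<Rightarrow> 'x) \<Rightarrow> real) \<Rightarrow> real measure \<Rightarrow> bool" where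
  "regular_sum_with_limit \<nu> f u \<G> G0 S L \<longleftrightarrow>
     estimator \<nu> S \<and> real_distribution L \<and>
     (\<forall>c>0. \<forall>G\<in>local_class \<nu> f \<G> G0.
        weak_conv_m
          (\<lambda>n. distr (sample_law \<nu> f (mixture (c / sqrt (real n)) G0 G) n) borel
                 (\<lambda>\<omega>. (S n (observed n \<omega>) - utility_sum u n \<omega>) / sqrt (real n)))
          L)"

definition regular_mean_with_limit ::
  "'x measure \<Rightarrow> ('x \<Rightarrow> 'p \<Rightarrow> real) \<Rightarrow> ('x \<Rightarrow> 'p \<Rightarrow> real) \<Rightarrow> 'p measure set \<Rightarrow> 'p measure
     \<Rightarrow> (nat \<Rightarrow> (nat \<Rightarrow> 'x) \<Rightarrow> real) \<Rightarrow> real measure \<Rightarrow> bool" where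
  "regular_mean_with_limit \<nu> f u \<G> G0 m L \<longleftrightarrow>
     estimator \<nu> m \<and> real_distribution L \<and>
     (\<forall>c>0. \<forall>G\<in>local_class \<nu> f \<G> G0.
        weak_conv_m
          (\<lambda>n. distr (sample_law \<nu> f (mixture (c / sqrt (real n)) G0 G) n) borel
                 (\<lambda>\<omega>. sqrt (real n) *
                    (m n (observed n \<omega>) - mean_utility \<nu> f u (mixture (c / sqrt (real n)) G0 G))))
          L)"

definition second_moment :: "real measure \<Rightarrow> ennreal" where
  "second_moment L = (\<integral>\<^sup>+x. ennreal (x\<^sup>2) \<partial>L)"

text \<open>
  Variance with values in \<open>[0, \<infinity>]\<close>.  If \<open>L\<close> has infinite second moment, the integral is infinite
  whatever number is subtracted, in particular if the mean does not exist.
\<close>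

definition extended_variance :: "real measure \<Rightarrow> ennreal" where
  "extended_variance L = (\<integral>\<^sup>+x. ennreal ((x - (\<integral>y. y \<partial>L))\<^sup>2) \<partial>L)"

definition variance_bound ::
  "'x measure \<Rightarrow> ('x \<Rightarrow> 'p \<Rightarrow> real) \<Rightarrow> ('x \<Rightarrow> 'p \<Rightarrow> real) \<Rightarrow> 'p measure set \<Rightarrow> 'p measure
     \<Rightarrow> ennreal" where
  "variance_bound \<nu> f u \<G> G0 =
     (INF L\<in>{L. \<exists>S. regular_sum_with_limit \<nu> f u \<G> G0 S L}. extended_variance L)"

definition asymptotically_efficient ::
  "'x measure \<Rightarrow> ('x \<Rightarrow> 'p \<Rightarrow> real) \<Rightarrow> ('x \<Rightarrow> 'p \<Rightarrow> real) \<Rightarrow> 'p measure set \<Rightarrow> 'p measure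
     \<Rightarrow> (nat \<Rightarrow> (nat \<Rightarrow> 'x) \<Rightarrow> real) \<Rightarrow> bool" where
  "asymptotically_efficient \<nu> f u \<G> G0 S \<longleftrightarrow>
     (\<exists>L. regular_sum_with_limit \<nu> f u \<G> G0 S L \<and>
          second_moment L = variance_bound \<nu> f u \<G> G0)"

text \<open>\<open>S\<^sub>n = {\<Sum>\<^sub>j v(X\<^sub>j)} + o(\<surd>n)\<close> in \<open>P\<^bsub>G0\<^esub>\<close>-probability.\<close>

definition asymptotically_sum_of ::
  "'x measure \<Rightarrow> ('x \<Rightarrow> 'p \<Rightarrow> real) \<Rightarrow> 'p measure \<Rightarrow> (nat \<Rightarrow> (nat \<Rightarrow> 'x) \<Rightarrow> real)
     \<Rightarrow> ('x \<Rightarrow> real) \<Rightarrow> bool" where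
  "asymptotically_sum_of \<nu> f G0 S v \<longleftrightarrow>
     (\<forall>\<epsilon>>0. (\<lambda>n. measure (sample_law \<nu> f G0 n)
        {\<omega>\<in>space (sample_law \<nu> f G0 n).
           \<bar>S n (observed n \<omega>) - (\<Sum>j<n. v (fst (\<omega> j)))\<bar> > \<epsilon> * sqrt (real n)})
        \<longlonglongrightarrow> 0)"

end

theory Submission
  imports Defs "HOL-Real_Asymp.Real_Asymp"
begin

text \<open>
  Along a curve the law of \<open>(X, \<theta>)\<close> need not be dominated by, or contiguous to, the law under \<open>G0\<close>;
  only the law of \<open>X\<close> is.  So the \<open>\<theta>\<^sub>j\<close> are integrated out first: with \<open>u\<^sub>0 = E(u | X)\<close>, the
  characteristic function of \<open>(S - S\<^sub>n)/\<surd>n\<close> under \<open>G\<^bsub>c/\<surd>n\<^esub>\<close> equals, up to \<open>o(1)\<close>, the Gaussian factor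
  \<open>exp(-\<sigma>\<^sup>2\<tau>\<^sup>2/2)\<close>, \<open>\<sigma>\<^sup>2 = E Var(u | X)\<close>, times \<open>exp(-i\<tau>c b(G))\<close>, \<open>b(G) = E\<^sub>G(u - u\<^sub>0)\<close>, times the expectation
  of \<open>exp(i\<tau>Y\<^sub>n)\<close>, \<open>Y\<^sub>n = (S - \<Sum>\<^sub>j u\<^sub>0(X\<^sub>j))/\<surd>n\<close>, against the likelihood ratio of the observations.
  The error is an \<open>L\<^sup>2\<close> distance of two products, computed from three one-dimensional integrals.

  Regularity thus says that the tilted characteristic functions of \<open>Y\<^sub>n\<close> tend to \<open>exp(i\<tau>c b) \<psi>(\<tau>)\<close>.
  Expanding the likelihood ratio at \<open>c = 0\<close> gives \<open>E exp(i\<tau>Y\<^sub>n) \<Delta>\<^sub>n(g) \<rightarrow> i\<tau> b(g) \<psi>(\<tau>)\<close> for the normalised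
  sum \<open>\<Delta>\<^sub>n(g)\<close> of every score \<open>g\<close>.  As \<open>\<Delta>\<^sub>n\<close> is an isometry, \<open>b\<close> is a bounded functional on the tangent
  space and is represented by some \<open>w\<close> in its closure.  Then \<open>u\<^sub>0 + w\<close> is unbiased, which proves (ii), and
  it is the optimal \<open>v\<close>.  With \<open>g = w\<close> the same limit and Cauchy--Schwarz bound the variance of the limit law
  from below by \<open>\<parallel>w\<parallel>\<^sup>2 + \<sigma>\<^sup>2\<close>, and if the bound is attained they force \<open>Y\<^sub>n - \<Delta>\<^sub>n(w) \<rightarrow> 0\<close> in probability.
\<close>

section \<open>Square-integrable functions\<close>

text \<open>Characteristic functions are used because they factorise over the observations: the
  parameters can be integrated out exactly, and since the Gaussian factor and the phase never
  vanish, they can be divided out in either direction. What remains concerns a single law \<mu> of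
  X, under which every likelihood ratio is a product of factors 1 + c g / sqrt n with g in
  L2(\<mu>). Second moments of such products are explicit, so no expansion of a log-likelihood is
  made, and uniform L2 bounds do the work of contiguity. Regularity speaks only of c > 0. The value
  at c = 0 is recovered because G0 belongs to its own local class and the curve from G0 to G0 is
  constant. Boundedness of b comes from one \<tau> with \<psi>(\<tau>) \<noteq> 0, the variance
  bound from small \<tau>. No moments of the normalised estimator are assumed, only those of the
  limit law. The abstract argument is run twice: with b the mean of u - u0 for estimators of the
  sum, and with b the increment of the mean of u for estimators of the mean.\<close>

definition sq_int :: "'a measure \<Rightarrow> ('a \<Rightarrow> real) \<Rightarrow> bool" where
  "sq_int M h \<longleftrightarrow> h \<in> borel_measurable M \<and> integrable M (\<lambda>x. (h x)\<^sup>2)"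

lemma sq_int_measurable [measurable_dest]: "sq_int M h \<Longrightarrow> h \<in> borel_measurable M"
  by (simp add: sq_int_def)

lemma sq_int_integrable_sq: "sq_int M h \<Longrightarrow> integrable M (\<lambda>x. (h x)\<^sup>2)"
  by (simp add: sq_int_def)

lemma sq_int_mult:
  assumes "sq_int M h" "sq_int M k"
  shows "integrable M (\<lambda>x. h x * k x)"
proof (rule Bochner_Integration.integrable_bound)
  show "integrable M (\<lambda>x. (h x)\<^sup>2 + (k x)\<^sup>2)"
    using assms by (auto simp: sq_int_def)
  show "(\<lambda>x. h x * k x) \<in> borel_measurable M"
    using assms by (auto simp: sq_int_def)
  show "AE x in M. norm (h x * k x) \<le> norm ((h x)\<^sup>2 + (k x)\<^sup>2)"
  proof (rule AE_I2)
    fix x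
    have "2 * (\<bar>h x\<bar> * \<bar>k x\<bar>) \<le> (h x)\<^sup>2 + (k x)\<^sup>2"
      using sum_squares_bound[of "\<bar>h x\<bar>" "\<bar>k x\<bar>"] by simp
    moreover have "0 \<le> \<bar>h x\<bar> * \<bar>k x\<bar>" by simp
    ultimately have "\<bar>h x\<bar> * \<bar>k x\<bar> \<le> (h x)\<^sup>2 + (k x)\<^sup>2" by linarith
    then show "norm (h x * k x) \<le> norm ((h x)\<^sup>2 + (k x)\<^sup>2)"
      by (simp add: abs_mult)
  qed
qed

lemma sq_int_add:
  assumes "sq_int M h" "sq_int M k"
  shows "sq_int M (\<lambda>x. h x + k x)"
proof -
  have "integrable M (\<lambda>x. (h x)\<^sup>2 + 2 * (h x * k x) + (k x)\<^sup>2)"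
    using assms sq_int_mult[OF assms] by (auto simp: sq_int_def)
  then show ?thesis
    using assms by (auto simp: sq_int_def power2_sum algebra_simps)
qed

lemma sq_int_scale: "sq_int M h \<Longrightarrow> sq_int M (\<lambda>x. a * h x)"
  by (auto simp: sq_int_def power_mult_distrib)

lemma sq_int_diff:
  assumes "sq_int M h" "sq_int M k"
  shows "sq_int M (\<lambda>x. h x - k x)"
  using sq_int_add[OF assms(1) sq_int_scale[OF assms(2), of "-1"]] by simp

lemma (in finite_measure) sq_int_const: "sq_int M (\<lambda>_. a)"
  by (simp add: sq_int_def)

lemma (in finite_measure) sq_int_integrable: "sq_int M h \<Longrightarrow> integrable M h"
  using square_integrable_imp_integrable unfolding sq_int_def by blast

text \<open>The integral of \<open>(s * h x - t * k x)\<^sup>2\<close> is nonnegative for all real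
  \<open>s\<close> and \<open>t\<close>; suitable values give the discriminant inequality without
  dividing by a norm.\<close>

lemma integral_Cauchy_Schwarz:
  assumes h: "sq_int M h" and k: "sq_int M k"
  shows "\<bar>\<integral>x. h x * k x \<partial>M\<bar> \<le> sqrt (\<integral>x. (h x)\<^sup>2 \<partial>M) * sqrt (\<integral>x. (k x)\<^sup>2 \<partial>M)"
proof -
  define a where "a = (\<integral>x. (h x)\<^sup>2 \<partial>M)"
  define b where "b = (\<integral>x. (k x)\<^sup>2 \<partial>M)"
  define c where "c = (\<integral>x. h x * k x \<partial>M)"
  have a: "a \<ge> 0" and b: "b \<ge> 0" by (auto simp: a_def b_def)
  have q: "0 \<le> s\<^sup>2 * a - 2 * s * t * c + t\<^sup>2 * b" for s t
  proof -
    have "0 \<le> (\<integral>x. (s * h x - t * k x)\<^sup>2 \<partial>M)" by simp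
    also have "\<dots> = (\<integral>x. s\<^sup>2 * (h x)\<^sup>2 - 2 * s * t * (h x * k x) + t\<^sup>2 * (k x)\<^sup>2 \<partial>M)"
      by (simp add: power2_diff power_mult_distrib algebra_simps)
    also have "\<dots> = s\<^sup>2 * a - 2 * s * t * c + t\<^sup>2 * b"
      unfolding a_def b_def c_def
      using h k sq_int_mult[OF h k] by (simp add: sq_int_def)
    finally show ?thesis .
  qed
  have "c\<^sup>2 \<le> a * b"
  proof (cases "b = 0")
    case True
    show ?thesis
    proof (cases "c = 0")
      case False
      \<comment> \<open>With \<open>b = 0\<close> the form is affine in \<open>t\<close>; this
        \<open>t\<close> makes it equal to -1.\<close>
      have "0 \<le> 1 * a - 2 * 1 * ((a + 1) / (2 * c)) * c + ((a + 1) / (2 * c))\<^sup>2 * b"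
        using q[of 1 "(a + 1) / (2 * c)"] by simp
      then show ?thesis using True False by simp
    qed (use True in simp)
  next
    case False
    then have "0 < b" using b by simp
    \<comment> \<open>The values \<open>s = b\<close> and \<open>t = c\<close> leave a multiple of
      \<open>a * b - c\<^sup>2\<close>.\<close>
    have "0 \<le> b\<^sup>2 * a - 2 * b * c * c + c\<^sup>2 * b" by (rule q)
    also have "\<dots> = b * (a * b - c\<^sup>2)" by (simp add: power2_eq_square algebra_simps)
    finally show ?thesis using \<open>0 < b\<close> by (simp add: zero_le_mult_iff)
  qed
  then have "sqrt (c\<^sup>2) \<le> sqrt (a * b)" by (rule real_sqrt_le_mono)
  then show ?thesis by (simp add: real_sqrt_mult a_def b_def c_def)
qed

lemma complex_integral_Cauchy_Schwarz:
  fixes F :: "'a \<Rightarrow> complex"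
  assumes F [measurable]: "F \<in> borel_measurable M" and F2: "integrable M (\<lambda>x. (cmod (F x))\<^sup>2)"
    and k: "sq_int M k"
  shows "integrable M (\<lambda>x. F x * of_real (k x))"
    and "cmod (\<integral>x. F x * of_real (k x) \<partial>M)
           \<le> sqrt (\<integral>x. (cmod (F x))\<^sup>2 \<partial>M) * sqrt (\<integral>x. (k x)\<^sup>2 \<partial>M)"
proof -
  have F': "sq_int M (\<lambda>x. cmod (F x))" using F2 by (simp add: sq_int_def)
  have k': "sq_int M (\<lambda>x. \<bar>k x\<bar>)" using k by (auto simp: sq_int_def)
  show i: "integrable M (\<lambda>x. F x * of_real (k x))"
    by (rule Bochner_Integration.integrable_bound[OF sq_int_mult[OF F' k']])
      (use sq_int_measurable[OF k] in \<open>auto simp: norm_mult\<close>)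
  have "cmod (\<integral>x. F x * of_real (k x) \<partial>M) \<le> (\<integral>x. cmod (F x * of_real (k x)) \<partial>M)"
    by (rule integral_norm_bound)
  also have "\<dots> = (\<integral>x. cmod (F x) * \<bar>k x\<bar> \<partial>M)" by (simp add: norm_mult)
  also have "\<dots> \<le> sqrt (\<integral>x. (cmod (F x))\<^sup>2 \<partial>M) * sqrt (\<integral>x. (\<bar>k x\<bar>)\<^sup>2 \<partial>M)"
    using integral_Cauchy_Schwarz[OF F' k'] by linarith
  finally show "cmod (\<integral>x. F x * of_real (k x) \<partial>M)
      \<le> sqrt (\<integral>x. (cmod (F x))\<^sup>2 \<partial>M) * sqrt (\<integral>x. (k x)\<^sup>2 \<partial>M)" by simp
qed

lemma (in prob_space) cmod_integral_le_sqrt: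
  fixes F :: "'a \<Rightarrow> complex"
  assumes "F \<in> borel_measurable M" "integrable M (\<lambda>x. (cmod (F x))\<^sup>2)"
  shows "cmod (\<integral>x. F x \<partial>M) \<le> sqrt (\<integral>x. (cmod (F x))\<^sup>2 \<partial>M)"
  using complex_integral_Cauchy_Schwarz(2)[OF assms sq_int_const[of 1]] by (simp add: prob_space)

text \<open>The intended \<open>e\<close> is \<open>iexp\<close> of a real statistic: whatever that
  statistic is, replacing one square-integrable weight by another changes the expectation by at most
  their L2 distance.\<close>

lemma (in prob_space) cmod_integral_bounded_mult:
  fixes e :: "'a \<Rightarrow> complex"
  assumes e [measurable]: "e \<in> borel_measurable M" and "\<And>x. cmod (e x) \<le> 1" and h: "sq_int M h"
  shows "integrable M (\<lambda>x. e x * of_real (h x))"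
    and "cmod (\<integral>x. e x * of_real (h x) \<partial>M) \<le> sqrt (\<integral>x. (h x)\<^sup>2 \<partial>M)"
proof -
  have 1: "(cmod (e x))\<^sup>2 \<le> 1" for x using assms(2)[of x] by (simp add: power_le_one)
  have i: "integrable M (\<lambda>x. (cmod (e x))\<^sup>2)"
    by (rule integrable_const_bound[of _ 1]) (use 1 in auto)
  show "integrable M (\<lambda>x. e x * of_real (h x))"
    by (rule complex_integral_Cauchy_Schwarz(1)[OF e i h])
  have "(\<integral>x. (cmod (e x))\<^sup>2 \<partial>M) \<le> (\<integral>x. 1 \<partial>M)" by (rule integral_mono[OF i]) (use 1 in auto)
  then have "sqrt (\<integral>x. (cmod (e x))\<^sup>2 \<partial>M) \<le> 1" by (simp add: prob_space)
  then have "sqrt (\<integral>x. (cmod (e x))\<^sup>2 \<partial>M) * sqrt (\<integral>x. (h x)\<^sup>2 \<partial>M) \<le> 1 * sqrt (\<integral>x. (h x)\<^sup>2 \<partial>M)"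
    by (intro mult_right_mono) auto
  with complex_integral_Cauchy_Schwarz(2)[OF e i h]
  show "cmod (\<integral>x. e x * of_real (h x) \<partial>M) \<le> sqrt (\<integral>x. (h x)\<^sup>2 \<partial>M)" by linarith
qed

lemma tendsto_integral_L2:
  assumes s: "\<And>n. sq_int M (s n)" and w: "sq_int M w" and k: "sq_int M k"
    and lim: "(\<lambda>n. \<integral>x. (s n x - w x)\<^sup>2 \<partial>M) \<longlonglongrightarrow> 0"
  shows "(\<lambda>n. \<integral>x. s n x * k x \<partial>M) \<longlonglongrightarrow> (\<integral>x. w x * k x \<partial>M)"
proof (rule Lim_null[THEN iffD2], rule Lim_null_comparison)
  show "\<forall>\<^sub>F n in sequentially. norm ((\<integral>x. s n x * k x \<partial>M) - (\<integral>x. w x * k x \<partial>M))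
      \<le> sqrt (\<integral>x. (s n x - w x)\<^sup>2 \<partial>M) * sqrt (\<integral>x. (k x)\<^sup>2 \<partial>M)"
  proof (rule always_eventually, rule allI)
    fix n
    have "(\<integral>x. s n x * k x \<partial>M) - (\<integral>x. w x * k x \<partial>M) = (\<integral>x. (s n x - w x) * k x \<partial>M)"
      by (subst Bochner_Integration.integral_diff[symmetric])
        (auto intro!: sq_int_mult s w k simp: algebra_simps)
    then show "norm ((\<integral>x. s n x * k x \<partial>M) - (\<integral>x. w x * k x \<partial>M))
      \<le> sqrt (\<integral>x. (s n x - w x)\<^sup>2 \<partial>M) * sqrt (\<integral>x. (k x)\<^sup>2 \<partial>M)"
      using integral_Cauchy_Schwarz[OF sq_int_diff[OF s w] k] by simp
  qed
  have "(\<lambda>n. sqrt (\<integral>x. (s n x - w x)\<^sup>2 \<partial>M) * sqrt (\<integral>x. (k x)\<^sup>2 \<partial>M)) \<longlonglongrightarrow> sqrt 0 * sqrt (\<integral>x. (k x)\<^sup>2 \<partial>M)"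
    by (intro tendsto_intros lim)
  then show "(\<lambda>n. sqrt (\<integral>x. (s n x - w x)\<^sup>2 \<partial>M) * sqrt (\<integral>x. (k x)\<^sup>2 \<partial>M)) \<longlonglongrightarrow> 0" by simp
qed

text \<open>Cauchy in L2 implies Cauchy in L1, by Cauchy-Schwarz against the constant 1, and an
  L1-Cauchy sequence has an almost everywhere convergent subsequence. Fatou along that subsequence
  turns the pointwise limit into an L2 limit of the whole sequence.\<close>

lemma (in prob_space) L2_complete:
  assumes s: "\<And>n. sq_int M (s n)"
    and cauchy: "\<And>e. e > 0 \<Longrightarrow> \<exists>N. \<forall>i\<ge>N. \<forall>j\<ge>N. (\<integral>x. (s i x - s j x)\<^sup>2 \<partial>M) < e"
  obtains w where "sq_int M w" "(\<lambda>n. \<integral>x. (s n x - w x)\<^sup>2 \<partial>M) \<longlonglongrightarrow> 0"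
proof -
  have sm [measurable]: "s n \<in> borel_measurable M" for n using s by (rule sq_int_measurable)
  have L1: "\<exists>N. \<forall>i\<ge>N. \<forall>j\<ge>N. (\<integral>x. norm (s i x - s j x) \<partial>M) < e" if e: "e > 0" for e
  proof -
    obtain N where N: "\<And>i j. i \<ge> N \<Longrightarrow> j \<ge> N \<Longrightarrow> (\<integral>x. (s i x - s j x)\<^sup>2 \<partial>M) < e\<^sup>2"
      using cauchy[OF zero_less_power[OF e]] by metis
    have "(\<integral>x. norm (s i x - s j x) \<partial>M) < e" if ij: "i \<ge> N" "j \<ge> N" for i j
    proof -
      have d: "sq_int M (\<lambda>x. \<bar>s i x - s j x\<bar>)"
        using sq_int_diff[OF s s, of i j] by (auto simp: sq_int_def)
      have "(\<integral>x. norm (s i x - s j x) \<partial>M) \<le> sqrt (\<integral>x. (s i x - s j x)\<^sup>2 \<partial>M)"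
        using integral_Cauchy_Schwarz[OF d sq_int_const[of 1]] by (simp add: prob_space)
      also have "\<dots> < sqrt (e\<^sup>2)" using N[OF ij] by (rule real_sqrt_less_mono)
      finally show ?thesis using e by simp
    qed
    then show ?thesis by blast
  qed
  obtain r where r: "strict_mono r" "AE x in M. Cauchy (\<lambda>i. s (r i) x)"
    by (rule cauchy_L1_AE_cauchy_subseq[of M s, OF sq_int_integrable[OF s] L1])
  define w where "w x = lim (\<lambda>i. s (r i) x)" for x
  have wm [measurable]: "w \<in> borel_measurable M" unfolding w_def by measurable
  have lim: "AE x in M. (\<lambda>i. s (r i) x) \<longlonglongrightarrow> w x"
    using r(2) by eventually_elim (simp add: w_def Cauchy_convergent_iff convergent_LIMSEQ_iff)
  have fatou: "(\<integral>\<^sup>+x. ennreal ((s n x - w x)\<^sup>2) \<partial>M) \<le> ennreal e"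
    if N: "\<And>i j. i \<ge> N \<Longrightarrow> j \<ge> N \<Longrightarrow> (\<integral>x. (s i x - s j x)\<^sup>2 \<partial>M) < e" and n: "n \<ge> N" for e N n
  proof -
    have "(\<integral>\<^sup>+x. ennreal ((s n x - w x)\<^sup>2) \<partial>M)
        = (\<integral>\<^sup>+x. liminf (\<lambda>i. ennreal ((s n x - s (r i) x)\<^sup>2)) \<partial>M)"
    proof (rule nn_integral_cong_AE, use lim in eventually_elim)
      fix x assume "(\<lambda>i. s (r i) x) \<longlonglongrightarrow> w x"
      then have "(\<lambda>i. ennreal ((s n x - s (r i) x)\<^sup>2)) \<longlonglongrightarrow> ennreal ((s n x - w x)\<^sup>2)"
        by (intro tendsto_ennrealI tendsto_intros)
      then show "ennreal ((s n x - w x)\<^sup>2) = liminf (\<lambda>i. ennreal ((s n x - s (r i) x)\<^sup>2))"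
        by (rule lim_imp_Liminf[OF sequentially_bot, symmetric])
    qed
    also have "\<dots> \<le> liminf (\<lambda>i. \<integral>\<^sup>+x. ennreal ((s n x - s (r i) x)\<^sup>2) \<partial>M)"
      by (rule nn_integral_liminf) simp
    also have "\<dots> \<le> ennreal e"
    proof (rule Liminf_le, simp, rule eventually_sequentiallyI[of N])
      fix i assume "i \<ge> N"
      then have "r i \<ge> N" using seq_suble[OF r(1), of i] by simp
      have "(\<integral>\<^sup>+x. ennreal ((s n x - s (r i) x)\<^sup>2) \<partial>M) = ennreal (\<integral>x. (s n x - s (r i) x)\<^sup>2 \<partial>M)"
        using sq_int_diff[OF s s] by (intro nn_integral_eq_integral) (auto simp: sq_int_def)
      also have "\<dots> \<le> ennreal e" using N[OF n \<open>r i \<ge> N\<close>] by (intro ennreal_leI) simp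
      finally show "(\<integral>\<^sup>+x. ennreal ((s n x - s (r i) x)\<^sup>2) \<partial>M) \<le> ennreal e" .
    qed
    finally show ?thesis .
  qed
  have d: "sq_int M (\<lambda>x. s n x - w x)"
    if N: "\<And>i j. i \<ge> N \<Longrightarrow> j \<ge> N \<Longrightarrow> (\<integral>x. (s i x - s j x)\<^sup>2 \<partial>M) < e" and n: "n \<ge> N" for e N n
    unfolding sq_int_def
  proof
    have "(\<integral>\<^sup>+x. ennreal ((s n x - w x)\<^sup>2) \<partial>M) < \<infinity>"
      using fatou[OF N n] by (simp add: order_le_less_trans)
    then show "integrable M (\<lambda>x. (s n x - w x)\<^sup>2)" by (intro integrableI_nonneg) auto
  qed simp
  obtain N1 where N1: "\<And>i j. i \<ge> N1 \<Longrightarrow> j \<ge> N1 \<Longrightarrow> (\<integral>x. (s i x - s j x)\<^sup>2 \<partial>M) < 1"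
    using cauchy[OF zero_less_one] by metis
  \<comment> \<open>\<open>w\<close> is \<open>s N1\<close> minus a function already known to be in
    L2.\<close>
  have "sq_int M (\<lambda>x. s N1 x - (s N1 x - w x))"
    by (rule sq_int_diff[OF s d[OF N1 order_refl]])
  then have w: "sq_int M w" by simp
  have "(\<lambda>n. \<integral>x. (s n x - w x)\<^sup>2 \<partial>M) \<longlonglongrightarrow> 0"
  proof (rule LIMSEQ_I)
    fix e :: real assume e: "e > 0"
    obtain N where N: "\<And>i j. i \<ge> N \<Longrightarrow> j \<ge> N \<Longrightarrow> (\<integral>x. (s i x - s j x)\<^sup>2 \<partial>M) < e / 2"
      using cauchy[OF half_gt_zero[OF e]] by metis
    have "norm ((\<integral>x. (s n x - w x)\<^sup>2 \<partial>M) - 0) < e" if n: "n \<ge> N" for n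
    proof -
      have "ennreal (\<integral>x. (s n x - w x)\<^sup>2 \<partial>M) = (\<integral>\<^sup>+x. ennreal ((s n x - w x)\<^sup>2) \<partial>M)"
        using sq_int_diff[OF s w] by (intro nn_integral_eq_integral[symmetric]) (auto simp: sq_int_def)
      also have "\<dots> \<le> ennreal (e / 2)" by (rule fatou[OF N n])
      finally have "(\<integral>x. (s n x - w x)\<^sup>2 \<partial>M) \<le> e / 2"
        using e by (simp add: ennreal_le_iff)
      then show ?thesis using e by simp
    qed
    then show "\<exists>no. \<forall>n\<ge>no. norm ((\<integral>x. (s n x - w x)\<^sup>2 \<partial>M) - 0) < e" by blast
  qed
  with w show thesis by (rule that)
qed

text \<open>The graph of the linear extension of \<open>g i \<mapsto> b i\<close>, without assuming it to be single-valued.\<close>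

inductive_set lin_graph :: "'i set \<Rightarrow> ('i \<Rightarrow> 'a \<Rightarrow> real) \<Rightarrow> ('i \<Rightarrow> real) \<Rightarrow> (('a \<Rightarrow> real) \<times> real) set"
  for I g b where
  base: "i \<in> I \<Longrightarrow> (g i, b i) \<in> lin_graph I g b"
| add: "(h, p) \<in> lin_graph I g b \<Longrightarrow> (k, q) \<in> lin_graph I g b
    \<Longrightarrow> ((\<lambda>x. h x + k x), p + q) \<in> lin_graph I g b"
| scale: "(h, p) \<in> lin_graph I g b \<Longrightarrow> ((\<lambda>x. a * h x), a * p) \<in> lin_graph I g b"

lemma lin_graph_sq_int:
  assumes "(h, p) \<in> lin_graph I g b" and "\<And>i. i \<in> I \<Longrightarrow> sq_int M (g i)"
  shows "sq_int M h"
  using assms(1) by (induction rule: lin_graph.induct) (auto intro: assms(2) sq_int_add sq_int_scale)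

text \<open>Minimise \<open>\<parallel>h\<parallel>\<^sup>2 - 2 p\<close> over the graph: a minimising sequence is Cauchy by the
  parallelogram law, and its limit represents the functional.\<close>

lemma (in prob_space) riesz_lin_graph:
  assumes I: "I \<noteq> {}" and g: "\<And>i. i \<in> I \<Longrightarrow> sq_int M (g i)"
    and bound: "\<And>h p. (h, p) \<in> lin_graph I g b \<Longrightarrow> \<bar>p\<bar> \<le> K * sqrt (\<integral>x. (h x)\<^sup>2 \<partial>M)"
  obtains w s where "sq_int M w" "\<And>n. sq_int M (s n)"
    "\<And>n. \<exists>p. (s n, p) \<in> lin_graph I g b"
    "(\<lambda>n. \<integral>x. (s n x - w x)\<^sup>2 \<partial>M) \<longlonglongrightarrow> 0"
    "\<And>h p. (h, p) \<in> lin_graph I g b \<Longrightarrow> (\<integral>x. w x * h x \<partial>M) = p"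
proof -
  let ?\<Gamma> = "lin_graph I g b"
  have sq: "sq_int M h" if "(h, p) \<in> ?\<Gamma>" for h p using lin_graph_sq_int[OF that g] by simp
  define J where "J z = (\<integral>x. (fst z x)\<^sup>2 \<partial>M) - 2 * snd z" for z :: "('a \<Rightarrow> real) \<times> real"
  \<comment> \<open>Complete the square: \<open>H\<^sup>2 - 2 * K * H \<ge> - K\<^sup>2\<close>, so
    boundedness of the functional keeps \<open>J\<close> bounded below.\<close>
  have Jb: "- K\<^sup>2 \<le> J z" if "z \<in> ?\<Gamma>" for z
  proof -
    define H where "H = sqrt (\<integral>x. (fst z x)\<^sup>2 \<partial>M)"
    have "(\<integral>x. (fst z x)\<^sup>2 \<partial>M) = H\<^sup>2" by (simp add: H_def)
    moreover have "snd z \<le> K * H" using bound[of "fst z" "snd z"] that by (simp add: H_def)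
    moreover have "0 \<le> (H - K)\<^sup>2" by simp
    ultimately show ?thesis by (simp add: J_def power2_diff algebra_simps)
  qed
  have ne: "?\<Gamma> \<noteq> {}" using I lin_graph.base[of _ I g b] by blast
  have bdd: "bdd_below (J ` ?\<Gamma>)" using Jb by (auto intro!: bdd_belowI)
  define m where "m = (INF z\<in>?\<Gamma>. J z)"
  have m: "m \<le> J z" if "z \<in> ?\<Gamma>" for z unfolding m_def by (rule cINF_lower[OF bdd that])
  have "\<exists>z\<in>?\<Gamma>. J z < m + 1 / Suc n" for n :: nat
    using cINF_less_iff[OF ne bdd, of "m + 1 / Suc n"] by (simp add: m_def)
  then obtain z where z: "\<And>n. z n \<in> ?\<Gamma>" and zm: "\<And>n::nat. J (z n) < m + 1 / Suc n" by metis
  define s where "s n = fst (z n)" for n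
  define p where "p n = snd (z n)" for n
  have sp: "(s n, p n) \<in> ?\<Gamma>" for n using z by (simp add: s_def p_def)
  have s: "sq_int M (s n)" for n using sq[OF sp] .
  \<comment> \<open>Parallelogram law for the quadratic part of \<open>J\<close>; the linear part is
    exact at the midpoint and cancels.\<close>
  have para: "(\<integral>x. (s i x - s j x)\<^sup>2 \<partial>M) = 2 * J (s i, p i) + 2 * J (s j, p j)
      - 4 * J (\<lambda>x. (1/2) * (s i x + s j x), (1/2) * (p i + p j))" for i j
  proof -
    have "(\<integral>x. ((1/2) * (s i x + s j x))\<^sup>2 \<partial>M) = (1/4) * (\<integral>x. (s i x + s j x)\<^sup>2 \<partial>M)"
      unfolding power_mult_distrib by (simp add: power2_eq_square)
    moreover have "(\<integral>x. (s i x + s j x)\<^sup>2 \<partial>M) + (\<integral>x. (s i x - s j x)\<^sup>2 \<partial>M)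
        = 2 * (\<integral>x. (s i x)\<^sup>2 \<partial>M) + 2 * (\<integral>x. (s j x)\<^sup>2 \<partial>M)"
    proof -
      have "(\<integral>x. (s i x + s j x)\<^sup>2 \<partial>M) + (\<integral>x. (s i x - s j x)\<^sup>2 \<partial>M)
          = (\<integral>x. (s i x + s j x)\<^sup>2 + (s i x - s j x)\<^sup>2 \<partial>M)"
        by (rule Bochner_Integration.integral_add[symmetric])
          (rule sq_int_integrable_sq[OF sq_int_add[OF s s]] sq_int_integrable_sq[OF sq_int_diff[OF s s]])+
      also have "\<dots> = (\<integral>x. 2 * (s i x)\<^sup>2 + 2 * (s j x)\<^sup>2 \<partial>M)"
        by (simp add: power2_sum power2_diff algebra_simps)
      finally show ?thesis using sq_int_integrable_sq[OF s] by simp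
    qed
    moreover have "z = 2 * (c - 2 * k) + 2 * (d - 2 * l) - 4 * (a - 2 * (1/2 * (k + l)))"
      if "a = 1/4 * b'" "b' + z = 2 * c + 2 * d" for a b' c d k l z :: real
      using that by (simp add: field_simps)
    ultimately show ?thesis unfolding J_def fst_conv snd_conv by blast
  qed
  have mid: "m \<le> J (\<lambda>x. (1/2) * (s i x + s j x), (1/2) * (p i + p j))" for i j
    by (rule m, rule lin_graph.scale, rule lin_graph.add[OF sp sp])
  have c: "(\<integral>x. (s i x - s j x)\<^sup>2 \<partial>M) < 2 / Suc i + 2 / Suc j" for i j
    using para[of i j] mid[of i j] zm[of i] zm[of j] by (simp add: s_def p_def)
  have "\<exists>N. \<forall>i\<ge>N. \<forall>j\<ge>N. (\<integral>x. (s i x - s j x)\<^sup>2 \<partial>M) < e" if e: "e > 0" for e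
  proof -
    obtain N :: nat where N: "4 / e < N" using reals_Archimedean2 by blast
    have *: "2 / Suc i \<le> e / 2" if "i \<ge> N" for i
    proof -
      have "4 / e \<le> Suc i" using N that by simp
      then show ?thesis using e by (simp add: field_simps)
    qed
    have "(\<integral>x. (s i x - s j x)\<^sup>2 \<partial>M) < e" if "i \<ge> N" "j \<ge> N" for i j
      using c[of i j] *[OF that(1)] *[OF that(2)] by linarith
    then show ?thesis by blast
  qed
  from L2_complete[OF s this] obtain w where w: "sq_int M w" "(\<lambda>n. \<integral>x. (s n x - w x)\<^sup>2 \<partial>M) \<longlonglongrightarrow> 0"
    by blast
  have "(\<integral>x. w x * h x \<partial>M) = q" if hq: "(h, q) \<in> ?\<Gamma>" for h q
  proof -
    define H where "H = (\<integral>x. (h x)\<^sup>2 \<partial>M)"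
    define C where "C n = (\<integral>x. s n x * h x \<partial>M) - q" for n
    have lim: "C \<longlonglongrightarrow> (\<integral>x. w x * h x \<partial>M) - q"
      unfolding C_def by (intro tendsto_intros tendsto_integral_L2 s w sq[OF hq])
    \<comment> \<open>Minimality tested in the direction of \<open>h\<close>; \<open>s n\<close> is
      optimal only up to \<open>1 / Suc n\<close>, which is the slack on the left.\<close>
    have var: "- (1 / Suc n) \<le> 2 * t * C n + t\<^sup>2 * H" for t n
    proof -
      have "m \<le> J (\<lambda>x. s n x + t * h x, p n + t * q)"
        by (rule m, rule lin_graph.add[OF sp lin_graph.scale[OF hq]])
      also have "\<dots> = J (s n, p n) + (2 * t * C n + t\<^sup>2 * H)"
      proof -
        have "(\<integral>x. (s n x + t * h x)\<^sup>2 \<partial>M) = (\<integral>x. (s n x)\<^sup>2 + 2 * t * (s n x * h x) + t\<^sup>2 * (h x)\<^sup>2 \<partial>M)"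
          by (simp add: power2_sum power_mult_distrib algebra_simps)
        also have "\<dots> = (\<integral>x. (s n x)\<^sup>2 \<partial>M) + 2 * t * (\<integral>x. s n x * h x \<partial>M) + t\<^sup>2 * H"
          unfolding H_def using sq_int_integrable_sq[OF s] sq_int_mult[OF s sq[OF hq]]
            sq_int_integrable_sq[OF sq[OF hq]] by simp
        finally show ?thesis by (simp add: J_def C_def algebra_simps)
      qed
      finally show ?thesis using zm[of n] by (simp add: s_def p_def)
    qed
    define c where "c = (\<integral>x. w x * h x \<partial>M) - q"
    have var': "0 \<le> 2 * t * c + t\<^sup>2 * H" for t
    proof (rule LIMSEQ_le)
      have "(\<lambda>n. 1 / real (Suc n)) \<longlonglongrightarrow> 0" using lim_1_over_n by (rule LIMSEQ_Suc)
      then show "(\<lambda>n. - (1 / real (Suc n))) \<longlonglongrightarrow> 0" using tendsto_minus by fastforce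
      show "(\<lambda>n. 2 * t * C n + t\<^sup>2 * H) \<longlonglongrightarrow> 2 * t * c + t\<^sup>2 * H"
        unfolding c_def by (intro tendsto_intros lim)
    qed (use var in blast)
    have "H \<ge> 0" by (simp add: H_def)
    \<comment> \<open>Almost the minimiser \<open>- c / H\<close> of the quadratic; the added 1
      covers \<open>H = 0\<close> and still gives
      \<open>0 \<le> - (t\<^sup>2 * (H + 2))\<close>.\<close>
    define t where "t = - c / (H + 1)"
    have ct: "c = - (t * (H + 1))" using \<open>H \<ge> 0\<close> by (simp add: t_def)
    have "0 \<le> - (t\<^sup>2 * (H + 2))"
      using var'[of t] unfolding ct by (simp add: power2_eq_square algebra_simps)
    then have "t = 0" using \<open>H \<ge> 0\<close> by (simp add: mult_le_0_iff)
    then have "c = 0" using ct by simp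
    then show ?thesis by (simp add: c_def)
  qed
  then show thesis using that[OF w(1) s _ w(2)] sp by blast
qed

section \<open>Likelihood ratios and scores on product spaces\<close>

abbreviation (input) iid :: "'a measure \<Rightarrow> nat \<Rightarrow> (nat \<Rightarrow> 'a) measure" where
  "iid M n \<equiv> Pi\<^sub>M {..<n} (\<lambda>_. M)"

section \<open>Taylor bounds for exp(ix) and limits of their integrals\<close>

lemma iexp_approx_0: "cmod (iexp x - 1) \<le> \<bar>x\<bar>"
  using iexp_approx1[of x 0] by simp

lemma iexp_approx_1: "cmod (iexp x - 1 - \<i> * x) \<le> x\<^sup>2"
proof -
  have "cmod (iexp x - 1 - \<i> * x) \<le> x\<^sup>2 / 2"
    using iexp_approx1[of x 1] by (simp add: numeral_2_eq_2[symmetric] diff_diff_eq)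
  also have "\<dots> \<le> x\<^sup>2" by simp
  finally show ?thesis .
qed

lemma iexp_approx_2: "cmod (iexp x - 1 - \<i> * x + x\<^sup>2 / 2) \<le> \<bar>x\<bar> ^ 3"
proof -
  have "(\<Sum>k\<le>2. (\<i> * complex_of_real x) ^ k / fact k) = 1 + \<i> * x - x\<^sup>2 / 2"
  proof -
    have "{..2::nat} = {0, 1, 2}" by auto
    then show ?thesis by (simp add: power_mult_distrib)
  qed
  then have "cmod (iexp x - (1 + \<i> * x - x\<^sup>2 / 2)) \<le> \<bar>x\<bar> ^ 3 / 6"
    using iexp_approx1[of x 2] by (simp add: fact_numeral)
  also have "iexp x - (1 + \<i> * x - x\<^sup>2 / 2) = iexp x - 1 - \<i> * x + x\<^sup>2 / 2" by simp
  also have "\<bar>x\<bar> ^ 3 / 6 \<le> \<bar>x\<bar> ^ 3" by simp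
  finally show ?thesis .
qed

lemma iexp_sqrt_limit1: "(\<lambda>n. sqrt (real n) * (iexp (x / sqrt (real n)) - 1)) \<longlonglongrightarrow> \<i> * x"
proof (rule LIM_zero_cancel, rule Lim_null_comparison)
  show "\<forall>\<^sub>F n in sequentially. norm (sqrt (real n) * (iexp (x / sqrt (real n)) - 1) - \<i> * x) \<le> x\<^sup>2 / sqrt (real n)"
    using eventually_gt_at_top[of "0::nat"]
  proof eventually_elim
    fix n :: nat assume n: "0 < n"
    have "sqrt (real n) * (iexp (x / sqrt (real n)) - 1) - \<i> * x
        = sqrt (real n) * (iexp (x / sqrt (real n)) - 1 - \<i> * (x / sqrt (real n)))"
      using n by (simp add: algebra_simps)
    then have "norm (sqrt (real n) * (iexp (x / sqrt (real n)) - 1) - \<i> * x)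
        = sqrt n * cmod (iexp (x / sqrt (real n)) - 1 - \<i> * (x / sqrt (real n)))"
      by (simp add: norm_mult)
    also have "\<dots> \<le> sqrt n * (x / sqrt n)\<^sup>2" using iexp_approx_1[of "x / sqrt n"] by (intro mult_left_mono) auto
    also have "\<dots> = x\<^sup>2 / sqrt n" using n by (simp add: power2_eq_square field_simps)
    finally show "norm (sqrt (real n) * (iexp (x / sqrt (real n)) - 1) - \<i> * x) \<le> x\<^sup>2 / sqrt n" .
  qed
  show "(\<lambda>n. x\<^sup>2 / sqrt (real n)) \<longlonglongrightarrow> 0" by real_asymp
qed

lemma iexp_sqrt_limit2:
  "(\<lambda>n. real n * (iexp (x / sqrt (real n)) - 1 - \<i> * (x / sqrt (real n)))) \<longlonglongrightarrow> - complex_of_real (x\<^sup>2 / 2)"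
proof (rule LIM_zero_cancel, rule Lim_null_comparison)
  show "\<forall>\<^sub>F n in sequentially. norm (real n * (iexp (x / sqrt (real n)) - 1 - \<i> * (x / sqrt (real n))) - - complex_of_real (x\<^sup>2 / 2))
      \<le> \<bar>x\<bar> ^ 3 / sqrt (real n)"
    using eventually_gt_at_top[of "0::nat"]
  proof eventually_elim
    fix n :: nat assume n: "0 < n"
    let ?y = "x / sqrt (real n)"
    have y: "real n * ?y\<^sup>2 = x\<^sup>2" using n by (simp add: power_divide)
    have "real n * (iexp ?y - 1 - \<i> * ?y) - - complex_of_real (x\<^sup>2 / 2) = real n * (iexp ?y - 1 - \<i> * ?y + ?y\<^sup>2 / 2)"
      unfolding y[symmetric] by (simp add: algebra_simps)
    then have "norm (real n * (iexp ?y - 1 - \<i> * ?y) - - complex_of_real (x\<^sup>2 / 2)) = n * cmod (iexp ?y - 1 - \<i> * ?y + ?y\<^sup>2 / 2)"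
      by (simp only: norm_mult norm_of_real abs_of_nat)
    also have "\<dots> \<le> n * \<bar>?y\<bar> ^ 3" using iexp_approx_2[of ?y] by (intro mult_left_mono) auto
    also have "\<dots> = \<bar>x\<bar> ^ 3 / sqrt n" using n by (simp add: power3_eq_cube power_divide field_simps)
    finally show "norm (real n * (iexp ?y - 1 - \<i> * ?y) - - complex_of_real (x\<^sup>2 / 2)) \<le> \<bar>x\<bar> ^ 3 / sqrt n" .
  qed
  show "(\<lambda>n. \<bar>x\<bar> ^ 3 / sqrt (real n)) \<longlonglongrightarrow> 0" by real_asymp
qed

text \<open>The bound \<open>cmod (iexp y - 1) \<le> \<bar>y\<bar>\<close> makes
  \<open>\<bar>w x * h x\<bar>\<close> a dominating function for every \<open>n\<close>, so
  integrability of the product is the only moment condition. With \<open>h = 1\<close> this is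
  applied under laws other than that of \<open>G0\<close>, where \<open>w\<close> is merely
  integrable.\<close>

lemma integral_iexp_limit1:
  assumes [measurable]: "w \<in> borel_measurable M" "h \<in> borel_measurable M"
    and i: "integrable M (\<lambda>x. w x * h x)"
  shows "(\<lambda>n. \<integral>x. sqrt (real n) * (iexp (w x / sqrt (real n)) - 1) * of_real (h x) \<partial>M)
    \<longlonglongrightarrow> \<i> * complex_of_real (\<integral>x. w x * h x \<partial>M)"
proof -
  have "(\<lambda>n. \<integral>x. sqrt (real n) * (iexp (w x / sqrt (real n)) - 1) * of_real (h x) \<partial>M)
    \<longlonglongrightarrow> (\<integral>x. \<i> * w x * of_real (h x) \<partial>M)"
  proof (rule integral_dominated_convergence[where w="\<lambda>x. \<bar>w x * h x\<bar>"])
    show "AE x in M. (\<lambda>n. sqrt (real n) * (iexp (w x / sqrt (real n)) - 1) * of_real (h x)) \<longlonglongrightarrow> \<i> * w x * of_real (h x)"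
      by (intro AE_I2 tendsto_mult[OF iexp_sqrt_limit1] tendsto_const)
    show "AE x in M. norm (sqrt (real n) * (iexp (w x / sqrt (real n)) - 1) * of_real (h x)) \<le> \<bar>w x * h x\<bar>" for n
    proof (rule AE_I2)
      fix x
      have "sqrt (real n) * cmod (iexp (w x / sqrt (real n)) - 1) \<le> sqrt (real n) * \<bar>w x / sqrt (real n)\<bar>"
        by (intro mult_left_mono iexp_approx_0) auto
      also have "\<dots> \<le> \<bar>w x\<bar>" by (cases "n = 0") auto
      finally show "norm (sqrt (real n) * (iexp (w x / sqrt (real n)) - 1) * of_real (h x)) \<le> \<bar>w x * h x\<bar>"
        by (simp add: norm_mult abs_mult mult_right_mono)
    qed
  qed (use i in auto)
  also have "(\<integral>x. \<i> * w x * of_real (h x) \<partial>M) = \<i> * complex_of_real (\<integral>x. w x * h x \<partial>M)"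
    by (simp add: mult.assoc flip: of_real_mult)
  finally show ?thesis .
qed

text \<open>Once the linear term is subtracted, the integrand is bounded by
  \<open>(w x)\<^sup>2\<close> for every \<open>n\<close>, so a second moment suffices for the rate
  1/n.\<close>

lemma integral_iexp_limit2:
  assumes [measurable]: "w \<in> borel_measurable M" and i: "integrable M (\<lambda>x. (w x)\<^sup>2)"
  shows "(\<lambda>n. \<integral>x. real n * (iexp (w x / sqrt (real n)) - 1 - \<i> * (w x / sqrt (real n))) \<partial>M)
    \<longlonglongrightarrow> - complex_of_real ((\<integral>x. (w x)\<^sup>2 \<partial>M) / 2)"
proof -
  have "(\<lambda>n. \<integral>x. real n * (iexp (w x / sqrt (real n)) - 1 - \<i> * (w x / sqrt (real n))) \<partial>M)
    \<longlonglongrightarrow> (\<integral>x. complex_of_real (- ((w x)\<^sup>2 / 2)) \<partial>M)"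
  proof (rule integral_dominated_convergence[where w="\<lambda>x. (w x)\<^sup>2"])
    show "AE x in M. norm (real n * (iexp (w x / sqrt (real n)) - 1 - \<i> * (w x / sqrt (real n)))) \<le> (w x)\<^sup>2" for n
    proof (rule AE_I2)
      fix x
      have "norm (real n * (iexp (w x / sqrt (real n)) - 1 - \<i> * (w x / sqrt (real n)))) \<le> real n * (w x / sqrt (real n))\<^sup>2"
        unfolding norm_mult norm_of_real abs_of_nat by (intro mult_left_mono iexp_approx_1) auto
      also have "\<dots> \<le> (w x)\<^sup>2" by (cases "n = 0") (auto simp: power_divide)
      finally show "norm (real n * (iexp (w x / sqrt (real n)) - 1 - \<i> * (w x / sqrt (real n)))) \<le> (w x)\<^sup>2" .
    qed
  qed (use i iexp_sqrt_limit2 in auto)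
  also have "(\<integral>x. complex_of_real (- ((w x)\<^sup>2 / 2)) \<partial>M) = - complex_of_real ((\<integral>x. (w x)\<^sup>2 \<partial>M) / 2)"
    by (subst integral_complex_of_real) simp
  finally show ?thesis .
qed

text \<open>In \<open>a n ^ n = exp (n * Ln (a n))\<close>, the Caratheodory form of the derivative
  of \<open>Ln\<close> at 1 replaces \<open>Ln (a n)\<close> by
  \<open>\<phi> (a n) * (a n - 1)\<close> with \<open>\<phi> (a n)\<close> tending to 1. The
  expectations of n-fold products below pass to the limit through this lemma.\<close>

lemma power_n_limit:
  fixes a :: "nat \<Rightarrow> complex"
  assumes "(\<lambda>n. of_nat n * (a n - 1)) \<longlonglongrightarrow> z"
  shows "(\<lambda>n. a n ^ n) \<longlonglongrightarrow> exp z"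
proof -
  have "(Ln has_field_derivative 1) (at 1)"
    using has_field_derivative_Ln[of 1] by simp
  then obtain \<phi> where \<phi>: "\<And>w. Ln w - Ln 1 = \<phi> w * (w - 1)" "isCont \<phi> 1" "\<phi> 1 = 1"
    unfolding CARAT_DERIV by blast
  have "(\<lambda>n. (1 / of_nat n) * (of_nat n * (a n - 1))) \<longlonglongrightarrow> 0 * z"
    by (intro tendsto_mult assms lim_1_over_n)
  moreover have "\<forall>\<^sub>F n in sequentially. (1 / of_nat n) * (of_nat n * (a n - 1)) = a n - 1"
    using eventually_gt_at_top[of "0::nat"] by eventually_elim simp
  ultimately have "(\<lambda>n. a n - 1) \<longlonglongrightarrow> 0"
    by (simp add: tendsto_cong)
  then have a: "a \<longlonglongrightarrow> 1" by (rule LIM_zero_cancel)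
  have "(\<lambda>n. \<phi> (a n) * (of_nat n * (a n - 1))) \<longlonglongrightarrow> 1 * z"
    by (intro tendsto_mult assms isCont_tendsto_compose[OF \<phi>(2) a, unfolded \<phi>(3)])
  then have "(\<lambda>n. exp (\<phi> (a n) * (of_nat n * (a n - 1)))) \<longlonglongrightarrow> exp (1 * z)"
    by (rule tendsto_exp)
  moreover have "\<forall>\<^sub>F n in sequentially. exp (\<phi> (a n) * (of_nat n * (a n - 1))) = a n ^ n"
  proof -
    have "\<forall>\<^sub>F n in sequentially. a n \<noteq> 0"
      using a by (rule tendsto_imp_eventually_ne) simp
    then show ?thesis
    proof eventually_elim
      fix n assume "a n \<noteq> 0"
      have "\<phi> (a n) * (of_nat n * (a n - 1)) = of_nat n * Ln (a n)"
        using \<phi>(1)[of "a n"] by simp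
      then show "exp (\<phi> (a n) * (of_nat n * (a n - 1))) = a n ^ n"
        using \<open>a n \<noteq> 0\<close> by (metis exp_of_nat_mult exp_Ln)
    qed
  qed
  ultimately show ?thesis by (simp add: tendsto_cong)
qed

text \<open>For \<open>h = c * gs G\<close> this is the likelihood ratio of the observations at the
  point \<open>c / sqrt n\<close> of the curve from \<open>G0\<close> to \<open>G\<close>, relative
  to \<open>G0\<close>: marginal densities are affine along the curve.\<close>

definition tilt :: "('a \<Rightarrow> real) \<Rightarrow> nat \<Rightarrow> (nat \<Rightarrow> 'a) \<Rightarrow> real" where
  "tilt h n x = (\<Prod>j<n. 1 + h (x j) / sqrt (real n))"

text \<open>The part of \<open>tilt h n\<close> that is linear in \<open>h\<close>, in the
  normalisation of the central limit theorem.\<close>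

definition score :: "('a \<Rightarrow> real) \<Rightarrow> nat \<Rightarrow> (nat \<Rightarrow> 'a) \<Rightarrow> real" where
  "score h n x = (\<Sum>j<n. h (x j)) / sqrt (real n)"

lemma measurable_coord:
  "h \<in> borel_measurable M \<Longrightarrow> j < n \<Longrightarrow> (\<lambda>x. h (x j)) \<in> borel_measurable (iid M n)"
  by (rule measurable_compose[where f="\<lambda>x. x j" and g=h]) auto

lemma tilt_measurable [measurable]: "h \<in> borel_measurable M \<Longrightarrow> tilt h n \<in> borel_measurable (iid M n)"
  unfolding tilt_def
  by (intro borel_measurable_prod borel_measurable_add borel_measurable_divide measurable_coord[of h]) auto

lemma score_measurable [measurable]: "h \<in> borel_measurable M \<Longrightarrow> score h n \<in> borel_measurable (iid M n)"
  unfolding score_def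
  by (intro borel_measurable_sum borel_measurable_divide measurable_coord[of h]) auto

lemma score_add: "score (\<lambda>x. h x + k x) n x = score h n x + score k n x"
  by (simp add: score_def sum.distrib add_divide_distrib)

lemma score_scale: "score (\<lambda>x. a * h x) n x = a * score h n x"
  by (simp add: score_def sum_distrib_left)

lemma score_diff: "score (\<lambda>x. h x - k x) n x = score h n x - score k n x"
  by (simp add: score_def sum_subtractf diff_divide_distrib)

context prob_space
begin

lemma prob_space_iid: "prob_space (iid M n)"
  by (intro prob_space_PiM prob_space_axioms)

lemma product_sigma_finite_iid: "product_sigma_finite (\<lambda>_. M)"
  by standard

lemma
  fixes f :: "nat \<Rightarrow> 'a \<Rightarrow> 'b :: {real_normed_field,banach,second_countable_topology}"
  assumes "\<And>i. i < n \<Longrightarrow> integrable M (f i)"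
  shows integrable_iid_prod: "integrable (iid M n) (\<lambda>x. \<Prod>i<n. f i (x i))"
    and integral_iid_prod: "(\<integral>x. (\<Prod>i<n. f i (x i)) \<partial>iid M n) = (\<Prod>i<n. \<integral>x. f i x \<partial>M)"
proof -
  interpret P: product_sigma_finite "\<lambda>_::nat. M" by (rule product_sigma_finite_iid)
  show "integrable (iid M n) (\<lambda>x. \<Prod>i<n. f i (x i))"
    by (rule P.product_integrable_prod) (use assms in auto)
  show "(\<integral>x. (\<Prod>i<n. f i (x i)) \<partial>iid M n) = (\<Prod>i<n. \<integral>x. f i x \<partial>M)"
    by (rule P.product_integral_prod) (use assms in auto)
qed

text \<open>One coordinate carries a different factor: this is the shape of each summand of
  \<open>tilt h n x * score h n x\<close>.\<close>

lemma
  fixes f k :: "'a \<Rightarrow> 'b :: {real_normed_field,banach,second_countable_topology}"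
  assumes f: "integrable M f" and k: "integrable M k" and j: "j < n"
  shows integrable_iid_prod_one: "integrable (iid M n) (\<lambda>x. (\<Prod>i\<in>{..<n}-{j}. f (x i)) * k (x j))"
    and integral_iid_prod_one: "(\<integral>x. (\<Prod>i\<in>{..<n}-{j}. f (x i)) * k (x j) \<partial>iid M n)
      = (\<integral>x. f x \<partial>M) ^ (n - 1) * (\<integral>x. k x \<partial>M)"
proof -
  have *: "(\<Prod>i\<in>{..<n}-{j}. f (x i)) * k (x j) = (\<Prod>i<n. (if i = j then k else f) (x i))" for x
    using j by (subst prod.remove[of "{..<n}" j]) (auto simp: mult.commute intro!: prod.cong)
  show "integrable (iid M n) (\<lambda>x. (\<Prod>i\<in>{..<n}-{j}. f (x i)) * k (x j))"
    unfolding * by (rule integrable_iid_prod) (use f k in auto)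
  show "(\<integral>x. (\<Prod>i\<in>{..<n}-{j}. f (x i)) * k (x j) \<partial>iid M n)
      = (\<integral>x. f x \<partial>M) ^ (n - 1) * (\<integral>x. k x \<partial>M)"
    unfolding * by (subst integral_iid_prod, use f k in simp)
      (use j in \<open>subst prod.remove[of "{..<n}" j], auto simp: mult.commute\<close>)
qed

lemma integral_coord:
  fixes k :: "'a \<Rightarrow> 'b :: {real_normed_field,banach,second_countable_topology}"
  assumes "integrable M k" "j < n"
  shows "integrable (iid M n) (\<lambda>x. k (x j))" "(\<integral>x. k (x j) \<partial>iid M n) = (\<integral>x. k x \<partial>M)"
  using integrable_iid_prod_one[of "\<lambda>_. 1" k j n] integral_iid_prod_one[of "\<lambda>_. 1" k j n] assms
  by (simp_all add: prob_space)

text \<open>Distinct coordinates are independent and \<open>h\<close> is centred, so only the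
  diagonal survives.\<close>

lemma
  assumes h: "sq_int M h" and k: "sq_int M k" and h0: "(\<integral>x. h x \<partial>M) = 0" and i: "i < n" and j: "j < n"
  shows integrable_coord_mult: "integrable (iid M n) (\<lambda>x. h (x i) * k (x j))"
    and integral_coord_mult: "(\<integral>x. h (x i) * k (x j) \<partial>iid M n) = (if i = j then \<integral>x. h x * k x \<partial>M else 0)"
proof -
  have hi: "integrable M h" "integrable M k" using h k by (auto intro: sq_int_integrable)
  have *: "integrable (iid M n) (\<lambda>x. h (x i) * k (x j)) \<and>
    (\<integral>x. h (x i) * k (x j) \<partial>iid M n) = (if i = j then \<integral>x. h x * k x \<partial>M else 0)"
  proof (cases "i = j")
    case True
    then show ?thesis using integral_coord[OF sq_int_mult[OF h k] i] by simp
  next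
    case False
    let ?f = "\<lambda>l. if l = i then h else if l = j then k else (\<lambda>_. 1)"
    have fi: "integrable M (?f l)" for l using hi by auto
    have e: "h (x i) * k (x j) = (\<Prod>l<n. ?f l (x l))" for x
    proof -
      have "(\<Prod>l<n. ?f l (x l)) = (\<Prod>l\<in>{i, j}. ?f l (x l))"
        using i j by (intro prod.mono_neutral_right) auto
      then show ?thesis using False by simp
    qed
    have z: "(\<Prod>l<n. \<integral>x. ?f l x \<partial>M) = 0"
      using i h0 by (intro prod_zero) (auto intro!: bexI[of _ i])
    show ?thesis
      unfolding e using integrable_iid_prod[of n ?f] integral_iid_prod[of n ?f] fi z False by simp
  qed
  then show "integrable (iid M n) (\<lambda>x. h (x i) * k (x j))"
    "(\<integral>x. h (x i) * k (x j) \<partial>iid M n) = (if i = j then \<integral>x. h x * k x \<partial>M else 0)" by auto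
qed

text \<open>Centring kills the off-diagonal terms of the square, so normalised sums preserve the L2
  norm. The inequality also covers \<open>n = 0\<close>, where division by \<open>sqrt 0\<close>
  makes the score 0.\<close>

lemma
  assumes h: "sq_int M h" and h0: "(\<integral>x. h x \<partial>M) = 0"
  shows sq_int_score: "sq_int (iid M n) (score h n)"
    and integral_score: "(\<integral>x. score h n x \<partial>iid M n) = 0"
    and integral_score_sq: "n > 0 \<Longrightarrow> (\<integral>x. (score h n x)\<^sup>2 \<partial>iid M n) = (\<integral>x. (h x)\<^sup>2 \<partial>M)"
    and integral_score_sq_le: "(\<integral>x. (score h n x)\<^sup>2 \<partial>iid M n) \<le> (\<integral>x. (h x)\<^sup>2 \<partial>M)"
proof -
  have hm [measurable]: "h \<in> borel_measurable M" using h by (rule sq_int_measurable)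
  have hi: "integrable M h" using h by (rule sq_int_integrable)
  have e: "(score h n x)\<^sup>2 = (\<Sum>i<n. \<Sum>j<n. h (x i) * h (x j)) / n" for x
    by (simp add: score_def power2_eq_square sum_product)
  have i: "integrable (iid M n) (\<lambda>x. (score h n x)\<^sup>2)"
    unfolding e by (intro Bochner_Integration.integrable_divide Bochner_Integration.integrable_sum
        integrable_coord_mult[OF h h h0]) auto
  then show s: "sq_int (iid M n) (score h n)" by (simp add: sq_int_def)
  show "(\<integral>x. score h n x \<partial>iid M n) = 0"
    unfolding score_def using h0 integral_coord[OF hi]
    by (simp add: Bochner_Integration.integral_sum)
  show 1: "(\<integral>x. (score h n x)\<^sup>2 \<partial>iid M n) = (\<integral>x. (h x)\<^sup>2 \<partial>M)" if n: "n > 0"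
  proof -
    have "(\<integral>x. (score h n x)\<^sup>2 \<partial>iid M n)
        = (\<Sum>i<n. \<Sum>j<n. \<integral>x. h (x i) * h (x j) \<partial>iid M n) / n"
      unfolding e using integrable_coord_mult[OF h h h0]
      by (subst Bochner_Integration.integral_divide_zero)
        (subst Bochner_Integration.integral_sum, auto intro!: Bochner_Integration.integral_sum)
    also have "\<dots> = (\<Sum>i<n. \<Sum>j<n. if i = j then \<integral>x. (h x)\<^sup>2 \<partial>M else 0) / n"
      using integral_coord_mult[OF h h h0] by (simp add: power2_eq_square)
    finally show ?thesis using n by simp
  qed
  show "(\<integral>x. (score h n x)\<^sup>2 \<partial>iid M n) \<le> (\<integral>x. (h x)\<^sup>2 \<partial>M)"
  proof (cases "n = 0")
    case True
    then show ?thesis by (simp add: score_def)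
  qed (use 1 in simp)
qed

text \<open>All are exact because expectations of products factorise over the coordinates. The last
  one reflects that \<open>score h n\<close> is the linear part of \<open>tilt h n\<close> and that
  the parts of other degrees are orthogonal to it.\<close>

lemma
  assumes h: "sq_int M h" and h0: "(\<integral>x. h x \<partial>M) = 0"
  shows sq_int_tilt: "sq_int (iid M n) (tilt h n)"
    and integral_tilt: "(\<integral>x. tilt h n x \<partial>iid M n) = 1"
    and integral_tilt_sq: "(\<integral>x. (tilt h n x)\<^sup>2 \<partial>iid M n) = (1 + (\<integral>x. (h x)\<^sup>2 \<partial>M) / n) ^ n"
    and integral_tilt_score: "n > 0 \<Longrightarrow> (\<integral>x. tilt h n x * score h n x \<partial>iid M n) = (\<integral>x. (h x)\<^sup>2 \<partial>M)"
proof -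
  have hm [measurable]: "h \<in> borel_measurable M" using h by (rule sq_int_measurable)
  have hi: "integrable M h" using h by (rule sq_int_integrable)
  have h2: "integrable M (\<lambda>x. (h x)\<^sup>2)" using h by (rule sq_int_integrable_sq)
  have i1: "integrable M (\<lambda>x. 1 + h x / sqrt n)" using hi by simp
  have I1: "(\<integral>x. 1 + h x / sqrt n \<partial>M) = 1" using hi h0 by (simp add: prob_space)
  have ee: "(1 + h x / sqrt n)\<^sup>2 = 1 + 2 * h x / sqrt n + (h x)\<^sup>2 / n" for x
    by (simp add: power2_sum power_divide)
  have i2: "integrable M (\<lambda>x. (1 + h x / sqrt n)\<^sup>2)" unfolding ee using hi h2 by simp
  have I2: "(\<integral>x. (1 + h x / sqrt n)\<^sup>2 \<partial>M) = 1 + (\<integral>x. (h x)\<^sup>2 \<partial>M) / n"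
    unfolding ee using hi h2 h0 by (simp add: prob_space)
  have t2: "(tilt h n x)\<^sup>2 = (\<Prod>j<n. (1 + h (x j) / sqrt n)\<^sup>2)" for x
    by (simp add: tilt_def prod_power_distrib)
  show s: "sq_int (iid M n) (tilt h n)"
    unfolding sq_int_def t2
    using integrable_iid_prod[of n "\<lambda>_ x. (1 + h x / sqrt n)\<^sup>2"] i2 by simp
  show "(\<integral>x. (tilt h n x)\<^sup>2 \<partial>iid M n) = (1 + (\<integral>x. (h x)\<^sup>2 \<partial>M) / n) ^ n"
    unfolding t2 using integral_iid_prod[of n "\<lambda>_ x. (1 + h x / sqrt n)\<^sup>2"] i2 I2 by simp
  show "(\<integral>x. tilt h n x \<partial>iid M n) = 1"
    unfolding tilt_def using integral_iid_prod[of n "\<lambda>_ x. 1 + h x / sqrt n"] i1 I1 by simp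
  show "(\<integral>x. tilt h n x * score h n x \<partial>iid M n) = (\<integral>x. (h x)\<^sup>2 \<partial>M)" if n: "n > 0"
  proof -
    let ?k = "\<lambda>x. (1 + h x / sqrt n) * h x"
    have kk: "?k x = h x + (h x)\<^sup>2 / sqrt n" for x by (simp add: power2_eq_square algebra_simps)
    have ki: "integrable M ?k" unfolding kk using hi h2 by simp
    have kI: "(\<integral>x. ?k x \<partial>M) = (\<integral>x. (h x)\<^sup>2 \<partial>M) / sqrt n" unfolding kk using hi h2 h0 by simp
    have "tilt h n x * score h n x
        = (\<Sum>j<n. (\<Prod>i\<in>{..<n}-{j}. 1 + h (x i) / sqrt n) * ?k (x j)) / sqrt n" for x
    proof -
      \<comment> \<open>The factor \<open>h (x j)\<close> is absorbed into the \<open>j\<close>-th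
        factor of the product.\<close>
      have "tilt h n x * h (x j) = (\<Prod>i\<in>{..<n}-{j}. 1 + h (x i) / sqrt n) * ?k (x j)" if "j < n" for j
        unfolding tilt_def using that by (subst prod.remove[of "{..<n}" j]) (auto simp: ac_simps)
      then have "(\<Sum>j<n. tilt h n x * h (x j))
          = (\<Sum>j<n. (\<Prod>i\<in>{..<n}-{j}. 1 + h (x i) / sqrt n) * ?k (x j))"
        by (intro sum.cong) auto
      then show ?thesis by (simp only: score_def sum_distrib_left[symmetric] times_divide_eq_right)
    qed
    then have "(\<integral>x. tilt h n x * score h n x \<partial>iid M n)
        = (\<integral>x. (\<Sum>j<n. (\<Prod>i\<in>{..<n}-{j}. 1 + h (x i) / sqrt n) * ?k (x j)) / sqrt n \<partial>iid M n)"
      by presburger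
    also have "\<dots> = (\<Sum>j<n. \<integral>x. (\<Prod>i\<in>{..<n}-{j}. 1 + h (x i) / sqrt n) * ?k (x j) \<partial>iid M n) / sqrt n"
      by (subst Bochner_Integration.integral_divide_zero, subst Bochner_Integration.integral_sum)
        (use integrable_iid_prod_one[OF i1 ki] in auto)
    also have "\<dots> = (\<Sum>j<n. (\<integral>x. (h x)\<^sup>2 \<partial>M) / sqrt n) / sqrt n"
      using integral_iid_prod_one[OF i1 ki] I1 kI by simp
    also have "\<dots> = (\<integral>x. (h x)\<^sup>2 \<partial>M)" using n by simp
    finally show ?thesis .
  qed
qed

text \<open>From \<open>1 + y \<le> exp y\<close>. The bound is uniform in \<open>n\<close>, so
  approximations in L2 under the base law carry over to the tilted laws; this takes the place of
  contiguity.\<close>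

lemma integral_tilt_sq_le:
  assumes "sq_int M h" "(\<integral>x. h x \<partial>M) = 0"
  shows "(\<integral>x. (tilt h n x)\<^sup>2 \<partial>iid M n) \<le> exp (\<integral>x. (h x)\<^sup>2 \<partial>M)"
proof -
  define H where "H = (\<integral>x. (h x)\<^sup>2 \<partial>M)"
  have "0 \<le> H" by (simp add: H_def)
  then have "(1 + H / n) ^ n \<le> exp (H / n) ^ n"
    by (intro power_mono exp_ge_add_one_self) auto
  also have "\<dots> \<le> exp H" using \<open>0 \<le> H\<close> by (cases "n = 0") (auto simp flip: exp_of_nat_mult)
  finally show ?thesis using integral_tilt_sq[OF assms] by (simp add: H_def)
qed

text \<open>Inserting the exact moments into the expanded square gives
  \<open>(1 + H / n) ^ n - 1 - H\<close>, with \<open>H\<close> the second moment of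
  \<open>h\<close>. This is at most \<open>exp H - 1 - H\<close>, hence at most
  \<open>H\<^sup>2\<close> for \<open>H \<le> 1\<close>.\<close>

lemma tilt_remainder:
  assumes h: "sq_int M h" and h0: "(\<integral>x. h x \<partial>M) = 0" and n: "n > 0" and le: "(\<integral>x. (h x)\<^sup>2 \<partial>M) \<le> 1"
  shows "(\<integral>x. (tilt h n x - 1 - score h n x)\<^sup>2 \<partial>iid M n) \<le> (\<integral>x. (h x)\<^sup>2 \<partial>M)\<^sup>2"
proof -
  interpret P: prob_space "iid M n" by (rule prob_space_iid)
  define H where "H = (\<integral>x. (h x)\<^sup>2 \<partial>M)"
  have H: "0 \<le> H" "H \<le> 1" using le by (auto simp: H_def)
  note t = sq_int_tilt[OF h h0, of n] and s = sq_int_score[OF h h0, of n]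
  have i: "integrable (iid M n) (\<lambda>x. (tilt h n x)\<^sup>2)" "integrable (iid M n) (tilt h n)"
    "integrable (iid M n) (\<lambda>x. tilt h n x * score h n x)" "integrable (iid M n) (score h n)"
    "integrable (iid M n) (\<lambda>x. (score h n x)\<^sup>2)"
    using t s by (auto intro: sq_int_mult sq_int_integrable_sq P.sq_int_integrable)
  have "(\<integral>x. (tilt h n x - 1 - score h n x)\<^sup>2 \<partial>iid M n)
     = (\<integral>x. (tilt h n x)\<^sup>2 - 2 * tilt h n x - 2 * (tilt h n x * score h n x) + 1 + 2 * score h n x
          + (score h n x)\<^sup>2 \<partial>iid M n)"
    by (rule Bochner_Integration.integral_cong) (auto simp: power2_eq_square algebra_simps)
  also have "\<dots> = (1 + H / n) ^ n - 1 - H"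
    using i n integral_score_sq[OF h h0 n]
    by (simp add: integral_tilt_sq[OF h h0] integral_tilt[OF h h0] integral_tilt_score[OF h h0]
        integral_score[OF h h0] P.prob_space H_def)
  also have "\<dots> \<le> exp H - 1 - H"
    using integral_tilt_sq_le[OF h h0, of n] integral_tilt_sq[OF h h0, of n] by (simp add: H_def)
  also have "\<dots> \<le> H\<^sup>2" using exp_bound[of H] H by simp
  finally show ?thesis by (simp add: H_def)
qed

text \<open>Differentiating the tilted characteristic functions at \<open>c = 0\<close>; the remainder of the
  likelihood ratio is of order \<open>c\<^sup>2\<close> in \<open>L\<^sup>2\<close>, uniformly in \<open>n\<close>.\<close>

lemma score_char_limit:
  assumes Y: "\<And>n. Y n \<in> borel_measurable (iid M n)"
    and h: "sq_int M h" and h0: "(\<integral>x. h x \<partial>M) = 0"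
    and base: "(\<lambda>n. \<integral>x. iexp (\<tau> * Y n x) \<partial>iid M n) \<longlonglongrightarrow> \<psi>"
    and tilted: "\<And>c. c > 0 \<Longrightarrow> (\<lambda>n. \<integral>x. iexp (\<tau> * Y n x) * of_real (tilt (\<lambda>x. c * h x) n x) \<partial>iid M n)
      \<longlonglongrightarrow> iexp (\<tau> * c * \<beta>) * \<psi>"
  shows "(\<lambda>n. \<integral>x. iexp (\<tau> * Y n x) * of_real (score h n x) \<partial>iid M n) \<longlonglongrightarrow> \<i> * \<tau> * \<beta> * \<psi>"
proof -
  define H where "H = (\<integral>x. (h x)\<^sup>2 \<partial>M)"
  have H: "0 \<le> H" by (simp add: H_def)
  define E where "E n = (\<integral>x. iexp (\<tau> * Y n x) \<partial>iid M n)" for n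
  define T where "T c n = (\<integral>x. iexp (\<tau> * Y n x) * of_real (tilt (\<lambda>x. c * h x) n x) \<partial>iid M n)" for c n
  define S where "S n = (\<integral>x. iexp (\<tau> * Y n x) * of_real (score h n x) \<partial>iid M n)" for n
  have bound: "cmod (T c n - E n - c * S n) \<le> c\<^sup>2 * H" if c: "c > 0" "c\<^sup>2 * H \<le> 1" and n: "n > 0" for c n
  proof -
    interpret P: prob_space "iid M n" by (rule prob_space_iid)
    have [measurable]: "Y n \<in> borel_measurable (iid M n)" by (rule Y)
    let ?h = "\<lambda>x. c * h x"
    have ch: "sq_int M ?h" "(\<integral>x. ?h x \<partial>M) = 0" "(\<integral>x. (?h x)\<^sup>2 \<partial>M) = c\<^sup>2 * H"
      using h h0 by (auto simp: sq_int_scale power_mult_distrib H_def)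
    note t = sq_int_tilt[OF ch(1,2), of n] and s = sq_int_score[OF h h0, of n]
    have s': "sq_int (iid M n) (\<lambda>x. c * score h n x)" by (rule sq_int_scale[OF s])
    have r: "sq_int (iid M n) (\<lambda>x. tilt ?h n x - 1 - c * score h n x)"
      by (intro sq_int_diff t s' P.sq_int_const)
    have e [measurable]: "(\<lambda>x. iexp (\<tau> * Y n x)) \<in> borel_measurable (iid M n)" by measurable
    have e1: "cmod (iexp (\<tau> * Y n x)) \<le> 1" for x by simp
    note B = P.cmod_integral_bounded_mult[OF e e1]
    have "T c n - E n - c * S n
       = (\<integral>x. iexp (\<tau> * Y n x) * of_real (tilt ?h n x) - iexp (\<tau> * Y n x) * of_real 1
            - iexp (\<tau> * Y n x) * of_real (c * score h n x) \<partial>iid M n)"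
    proof -
      have "c * S n = (\<integral>x. iexp (\<tau> * Y n x) * of_real (c * score h n x) \<partial>iid M n)"
        unfolding S_def by (subst integral_mult_right_zero[symmetric]) (simp add: ac_simps)
      then show ?thesis
        unfolding T_def E_def using B(1)[OF t] B(1)[OF s'] B(1)[OF P.sq_int_const[of 1]] by simp
    qed
    also have "\<dots> = (\<integral>x. iexp (\<tau> * Y n x) * of_real (tilt ?h n x - 1 - c * score h n x) \<partial>iid M n)"
      by (simp add: algebra_simps)
    finally have "cmod (T c n - E n - c * S n)
       \<le> sqrt (\<integral>x. (tilt ?h n x - 1 - c * score h n x)\<^sup>2 \<partial>iid M n)"
      using B(2)[OF r] by simp
    also have "\<dots> \<le> sqrt ((c\<^sup>2 * H)\<^sup>2)"
      using tilt_remainder[OF ch(1,2) n] ch(3) c by (intro real_sqrt_le_mono) (simp add: score_scale)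
    finally show ?thesis using H by simp
  qed
  \<comment> \<open>Collects the two errors of second order in \<open>c\<close>: the remainder of
    the likelihood ratio and that of \<open>iexp (\<tau> * c * \<beta>)\<close>.\<close>
  define C where "C = H + cmod \<psi> * (\<tau> * \<beta>)\<^sup>2"
  have C: "0 \<le> C" using H by (simp add: C_def)
  have "(\<lambda>n. S n - \<i> * \<tau> * \<beta> * \<psi>) \<longlonglongrightarrow> 0"
  proof (rule tendstoI)
    fix e :: real assume e: "e > 0"
    \<comment> \<open>Fixed before \<open>n\<close> grows: after division by \<open>c\<close> the
      second-order errors contribute \<open>c * C < e / 2\<close>. The second entry of the minimum
      secures \<open>c\<^sup>2 * H \<le> 1\<close>, which \<open>bound\<close> requires.\<close>
    define c where "c = min (e / (2 * (C + 1))) (1 / (H + 1))"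
    have c: "c > 0" using e H C by (simp add: c_def)
    have "c \<le> 1 / (H + 1)" by (simp add: c_def)
    then have "c * (H + 1) \<le> 1" using H by (simp add: pos_le_divide_eq)
    then have c1: "c \<le> 1" "c * H \<le> 1" using c H by (auto simp: algebra_simps intro: order_trans[rotated])
    have cH: "c\<^sup>2 * H \<le> 1"
      using mult_mono[OF c1] c H by (simp add: power2_eq_square ac_simps)
    have "c \<le> e / (2 * (C + 1))" by (simp add: c_def)
    then have "c * (2 * (C + 1)) \<le> e" using C by (simp add: pos_le_divide_eq)
    then have cC: "c * C < e / 2" using c by (simp add: algebra_simps)
    define R where "R n = T c n - iexp (\<tau> * c * \<beta>) * \<psi>" for n
    define Q where "Q n = E n - \<psi>" for n
    have RQ: "(\<lambda>n. cmod (R n) + cmod (Q n)) \<longlonglongrightarrow> 0"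
      unfolding R_def Q_def T_def E_def
      by (intro tendsto_add_zero tendsto_norm_zero LIM_zero tilted[OF c] base)
    have i2: "cmod (iexp (\<tau> * c * \<beta>) - 1 - \<i> * (\<tau> * c * \<beta>)) \<le> (\<tau> * c * \<beta>)\<^sup>2"
      using iexp_approx_1[of "\<tau> * c * \<beta>"] by simp
    have "eventually (\<lambda>n. cmod (R n) + cmod (Q n) < c * (e / 2)) sequentially"
      using order_tendstoD(2)[OF RQ, of "c * (e / 2)"] c e by simp
    then show "eventually (\<lambda>n. dist (S n - \<i> * \<tau> * \<beta> * \<psi>) 0 < e) sequentially"
      using eventually_gt_at_top[of "0::nat"]
    proof eventually_elim
      fix n :: nat assume 1: "cmod (R n) + cmod (Q n) < c * (e / 2)" and n: "0 < n"
      have "c * (S n - \<i> * \<tau> * \<beta> * \<psi>) = R n - Q n - (T c n - E n - c * S n)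
           + \<psi> * (iexp (\<tau> * c * \<beta>) - 1 - \<i> * (\<tau> * c * \<beta>))"
        by (simp add: R_def Q_def algebra_simps)
      then have "c * cmod (S n - \<i> * \<tau> * \<beta> * \<psi>) = cmod (R n - Q n - (T c n - E n - c * S n)
           + \<psi> * (iexp (\<tau> * c * \<beta>) - 1 - \<i> * (\<tau> * c * \<beta>)))"
        using c by (metis abs_of_pos norm_mult norm_of_real)
      also have "\<dots> \<le> cmod (R n) + cmod (Q n) + cmod (T c n - E n - c * S n)
           + cmod (\<psi> * (iexp (\<tau> * c * \<beta>) - 1 - \<i> * (\<tau> * c * \<beta>)))"
        by (intro norm_triangle_mono norm_triangle_le_diff norm_triangle_ineq4[THEN order_trans]
            add_mono order_refl)
      also have "\<dots> < c * (e / 2) + c\<^sup>2 * H + cmod \<psi> * (\<tau> * c * \<beta>)\<^sup>2"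
        using 1 bound[OF c cH n] mult_left_mono[OF i2, of "cmod \<psi>"] by (simp add: norm_mult)
      also have "\<dots> = c * (e / 2 + c * C)"
        by (simp add: C_def power2_eq_square algebra_simps)
      also have "\<dots> < c * e" using c cC by simp
      finally show "dist (S n - \<i> * \<tau> * \<beta> * \<psi>) 0 < e" using c by simp
    qed
  qed
  then show ?thesis unfolding S_def by (rule LIM_zero_cancel)
qed

end

section \<open>Consequences of regularity along the tilted laws\<close>

text \<open>\<open>b\<close> is left open because it is the mean of \<open>u - u0\<close> for
  estimators of the sum and the increment of the mean utility for estimators of the mean.
  \<open>\<psi>\<close> is any function tending to 1 at 0, since for sums it is a characteristic
  function divided by a Gaussian one.\<close>

locale tilted_limits = prob_space M for M :: "'a measure" +
  fixes I :: "'i set" and g :: "'i \<Rightarrow> 'a \<Rightarrow> real" and b :: "'i \<Rightarrow> real"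
    and Y :: "nat \<Rightarrow> (nat \<Rightarrow> 'a) \<Rightarrow> real" and \<psi> :: "real \<Rightarrow> complex"
  assumes nonempty: "I \<noteq> {}"
    and g: "\<And>i. i \<in> I \<Longrightarrow> sq_int M (g i)"
    and g0: "\<And>i. i \<in> I \<Longrightarrow> (\<integral>x. g i x \<partial>M) = 0"
    and Y: "\<And>n. Y n \<in> borel_measurable (iid M n)"
    and base: "\<And>\<tau>. (\<lambda>n. \<integral>x. iexp (\<tau> * Y n x) \<partial>iid M n) \<longlonglongrightarrow> \<psi> \<tau>"
    and tilted: "\<And>i c \<tau>. i \<in> I \<Longrightarrow> c > 0 \<Longrightarrow>
      (\<lambda>n. \<integral>x. iexp (\<tau> * Y n x) * of_real (tilt (\<lambda>x. c * g i x) n x) \<partial>iid M n)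
        \<longlonglongrightarrow> iexp (\<tau> * c * b i) * \<psi> \<tau>"
    and psi: "(\<psi> \<longlongrightarrow> 1) (at 0)"
begin

lemma iexp_Y_measurable: "(\<lambda>x. iexp (\<tau> * Y n x)) \<in> borel_measurable (iid M n)"
proof -
  have [measurable]: "Y n \<in> borel_measurable (iid M n)" by (rule Y)
  show ?thesis by measurable
qed

lemma integrable_iexp_Y_mult:
  "sq_int (iid M n) h \<Longrightarrow> integrable (iid M n) (\<lambda>x. iexp (\<tau> * Y n x) * of_real (h x))"
  using prob_space.cmod_integral_bounded_mult(1)[OF prob_space_iid iexp_Y_measurable] by simp

lemma norm_iexp_Y_mult_le:
  "sq_int (iid M n) h \<Longrightarrow> cmod (\<integral>x. iexp (\<tau> * Y n x) * of_real (h x) \<partial>iid M n) \<le> sqrt (\<integral>x. (h x)\<^sup>2 \<partial>iid M n)"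
  using prob_space.cmod_integral_bounded_mult(2)[OF prob_space_iid iexp_Y_measurable] by simp

lemma graph_sq_int: "(h, p) \<in> lin_graph I g b \<Longrightarrow> sq_int M h"
  using lin_graph_sq_int g by blast

lemma graph_mean: "(h, p) \<in> lin_graph I g b \<Longrightarrow> (\<integral>x. h x \<partial>M) = 0"
proof (induction rule: lin_graph.induct)
  case (add h p k q)
  then show ?case using sq_int_integrable[OF graph_sq_int[OF add(1)]] sq_int_integrable[OF graph_sq_int[OF add(2)]]
    by simp
qed (auto simp: g0)

text \<open>The limit holds for the generators by differentiation at \<open>c = 0\<close>, and both
  sides are linear in the pair \<open>(h, p)\<close>.\<close>

lemma graph_limit:
  "(h, p) \<in> lin_graph I g b \<Longrightarrow>
    (\<lambda>n. \<integral>x. iexp (\<tau> * Y n x) * of_real (score h n x) \<partial>iid M n) \<longlonglongrightarrow> \<i> * \<tau> * p * \<psi> \<tau>"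
proof (induction rule: lin_graph.induct)
  case (base i)
  show ?case by (rule score_char_limit[OF Y g[OF base] g0[OF base] tilted_limits.base tilted[OF base]])
      (rule tilted_limits_axioms)
next
  case (add h p k q)
  have h: "sq_int (iid M n) (score h n)" "sq_int (iid M n) (score k n)" for n
    using add(1,2)[THEN graph_sq_int] add(1,2)[THEN graph_mean] by (auto intro: sq_int_score)
  have "(\<lambda>n. (\<integral>x. iexp (\<tau> * Y n x) * of_real (score h n x) \<partial>iid M n)
      + (\<integral>x. iexp (\<tau> * Y n x) * of_real (score k n x) \<partial>iid M n)) \<longlonglongrightarrow> \<i> * \<tau> * p * \<psi> \<tau> + \<i> * \<tau> * q * \<psi> \<tau>"
    by (intro tendsto_add add.IH)
  moreover have "(\<integral>x. iexp (\<tau> * Y n x) * of_real (score h n x) \<partial>iid M n)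
      + (\<integral>x. iexp (\<tau> * Y n x) * of_real (score k n x) \<partial>iid M n)
    = (\<integral>x. iexp (\<tau> * Y n x) * of_real (score (\<lambda>x. h x + k x) n x) \<partial>iid M n)" for n
    using integrable_iexp_Y_mult[OF h(1)] integrable_iexp_Y_mult[OF h(2)]
    by (subst Bochner_Integration.integral_add[symmetric]) (auto simp: score_add algebra_simps)
  ultimately show ?case by (simp add: algebra_simps)
next
  case (scale h p a)
  have "(\<lambda>n. a * (\<integral>x. iexp (\<tau> * Y n x) * of_real (score h n x) \<partial>iid M n)) \<longlonglongrightarrow> a * (\<i> * \<tau> * p * \<psi> \<tau>)"
    by (intro tendsto_mult tendsto_const scale.IH)
  moreover have "a * (\<integral>x. iexp (\<tau> * Y n x) * of_real (score h n x) \<partial>iid M n)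
      = (\<integral>x. iexp (\<tau> * Y n x) * of_real (score (\<lambda>x. a * h x) n x) \<partial>iid M n)" for n
    by (subst integral_mult_right_zero[symmetric]) (simp add: score_scale ac_simps)
  ultimately show ?case by (simp add: ac_simps)
qed

text \<open>Since \<open>\<psi>\<close> tends to 1 at 0, some \<open>\<tau> > 0\<close> has
  \<open>\<psi> \<tau> \<noteq> 0\<close>. At this \<open>\<tau>\<close> the limit in
  \<open>graph_limit\<close> is bounded by the L2 norm of the score, and dividing by
  \<open>\<tau> * cmod (\<psi> \<tau>)\<close> bounds \<open>p\<close>. In particular
  \<open>h\<close> determines \<open>p\<close>.\<close>

lemma graph_bound:
  obtains K where "\<And>h p. (h, p) \<in> lin_graph I g b \<Longrightarrow> \<bar>p\<bar> \<le> K * sqrt (\<integral>x. (h x)\<^sup>2 \<partial>M)"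
proof -
  have "eventually (\<lambda>\<tau>. \<psi> \<tau> \<noteq> 0) (at 0)"
    using psi by (rule tendsto_imp_eventually_ne) simp
  then obtain d where d: "d > 0" "\<And>\<tau>. \<tau> \<noteq> 0 \<Longrightarrow> dist \<tau> 0 < d \<Longrightarrow> \<psi> \<tau> \<noteq> 0"
    unfolding eventually_at by auto
  define \<tau> where "\<tau> = d / 2"
  have \<tau>: "\<tau> > 0" "\<psi> \<tau> \<noteq> 0" using d by (auto simp: \<tau>_def)
  define r where "r = \<tau> * cmod (\<psi> \<tau>)"
  have r: "r > 0" using \<tau> by (simp add: r_def)
  show thesis
  proof (rule that[of "1 / r"])
    fix h p assume hp: "(h, p) \<in> lin_graph I g b"
    have "cmod (\<i> * \<tau> * p * \<psi> \<tau>) \<le> sqrt (\<integral>x. (h x)\<^sup>2 \<partial>M)"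
    proof (rule Lim_bounded[OF tendsto_norm[OF graph_limit[OF hp, of \<tau>]]], rule allI, rule impI)
      fix n
      have "cmod (\<integral>x. iexp (\<tau> * Y n x) * of_real (score h n x) \<partial>iid M n) \<le> sqrt (\<integral>x. (score h n x)\<^sup>2 \<partial>iid M n)"
        by (rule norm_iexp_Y_mult_le[OF sq_int_score[OF graph_sq_int[OF hp] graph_mean[OF hp]]])
      also have "\<dots> \<le> sqrt (\<integral>x. (h x)\<^sup>2 \<partial>M)"
        by (rule real_sqrt_le_mono[OF integral_score_sq_le[OF graph_sq_int[OF hp] graph_mean[OF hp]]])
      finally show "cmod (\<integral>x. iexp (\<tau> * Y n x) * of_real (score h n x) \<partial>iid M n) \<le> sqrt (\<integral>x. (h x)\<^sup>2 \<partial>M)" .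
    qed
    then have "\<bar>p\<bar> * r \<le> sqrt (\<integral>x. (h x)\<^sup>2 \<partial>M)"
      using \<tau> by (simp add: norm_mult r_def ac_simps)
    then show "\<bar>p\<bar> \<le> 1 / r * sqrt (\<integral>x. (h x)\<^sup>2 \<partial>M)" using r by (simp add: field_simps)
  qed
qed

end

text \<open>The efficient influence function: it represents \<open>b\<close> and lies in the closed span of the \<open>g i\<close>.\<close>

definition tangent_rep :: "'a measure \<Rightarrow> 'i set \<Rightarrow> ('i \<Rightarrow> 'a \<Rightarrow> real) \<Rightarrow> ('i \<Rightarrow> real) \<Rightarrow> ('a \<Rightarrow> real) \<Rightarrow> bool" where
  "tangent_rep M I g b w \<longleftrightarrow> sq_int M w \<and>
     (\<forall>(h, p)\<in>lin_graph I g b. (\<integral>x. w x * h x \<partial>M) = p) \<and>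
     (\<exists>s. (\<forall>n. sq_int M (s n) \<and> (\<exists>p. (s n, p) \<in> lin_graph I g b)) \<and>
        (\<lambda>n. \<integral>x. (s n x - w x)\<^sup>2 \<partial>M) \<longlonglongrightarrow> 0)"

lemma (in prob_space) tangent_rep_exists:
  assumes "I \<noteq> {}" "\<And>i. i \<in> I \<Longrightarrow> sq_int M (g i)"
    and "\<And>h p. (h, p) \<in> lin_graph I g b \<Longrightarrow> \<bar>p\<bar> \<le> K * sqrt (\<integral>x. (h x)\<^sup>2 \<partial>M)"
  obtains w where "tangent_rep M I g b w"
proof (rule riesz_lin_graph[OF assms])
  fix w s assume *: "sq_int M w" "\<And>n. sq_int M (s n)"
    "\<And>n. \<exists>p. (s n, p) \<in> lin_graph I g b"
    "(\<lambda>n. \<integral>x. (s n x - w x)\<^sup>2 \<partial>M) \<longlonglongrightarrow> 0"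
    "\<And>h p. (h, p) \<in> lin_graph I g b \<Longrightarrow> (\<integral>x. w x * h x \<partial>M) = p"
  have "tangent_rep M I g b w"
    unfolding tangent_rep_def using *(1,5) by (intro conjI exI[of _ s]) (auto intro: *)
  then show thesis by (rule that)
qed

text \<open>Orthogonality to the graph passes to L2 limits. This is where membership of
  \<open>w\<close> in the closed tangent space enters: \<open>k = 1\<close> shows that
  \<open>w\<close> is centred, and \<open>k = v - w\<close> yields the Pythagorean identity.\<close>

lemma (in prob_space) tangent_rep_orthogonal:
  assumes w: "tangent_rep M I g b w" and k: "sq_int M k"
    and orth: "\<And>h p. (h, p) \<in> lin_graph I g b \<Longrightarrow> (\<integral>x. h x * k x \<partial>M) = 0"
  shows "(\<integral>x. w x * k x \<partial>M) = 0"
proof -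
  obtain s where s: "\<And>n. sq_int M (s n)" "\<And>n. \<exists>p. (s n, p) \<in> lin_graph I g b"
    "(\<lambda>n. \<integral>x. (s n x - w x)\<^sup>2 \<partial>M) \<longlonglongrightarrow> 0"
    using w unfolding tangent_rep_def by auto
  have w': "sq_int M w" using w by (simp add: tangent_rep_def)
  have "(\<lambda>n. \<integral>x. s n x * k x \<partial>M) \<longlonglongrightarrow> (\<integral>x. w x * k x \<partial>M)"
    by (rule tendsto_integral_L2[OF s(1) w' k s(3)])
  moreover have "(\<integral>x. s n x * k x \<partial>M) = 0" for n using s(2) orth by blast
  ultimately have "(\<lambda>n::nat. 0) \<longlonglongrightarrow> (\<integral>x. w x * k x \<partial>M)" by simp
  then show ?thesis by (simp add: LIMSEQ_const_iff)
qed

context tilted_limits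
begin

lemma rep_exists: obtains w where "tangent_rep M I g b w"
proof (rule graph_bound)
  fix K assume K: "\<And>h p. (h, p) \<in> lin_graph I g b \<Longrightarrow> \<bar>p\<bar> \<le> K * sqrt (\<integral>x. (h x)\<^sup>2 \<partial>M)"
  show thesis by (rule tangent_rep_exists[OF nonempty g K that])
qed

context
  fixes w :: "'a \<Rightarrow> real" and A :: real
  assumes rep: "tangent_rep M I g b w"
  defines "A \<equiv> \<integral>x. (w x)\<^sup>2 \<partial>M"
begin

lemma rep_sq_int: "sq_int M w"
  using rep by (simp add: tangent_rep_def)

lemma rep_mean: "(\<integral>x. w x \<partial>M) = 0"
  using tangent_rep_orthogonal[OF rep sq_int_const[of 1]] graph_mean by auto

text \<open>The identity is known on the graph. Scores do not increase L2 norms, so replacing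
  \<open>w\<close> by an approximating \<open>s k\<close> costs at most their distance, uniformly in
  \<open>n\<close>; the functional at \<open>s k\<close> is the inner product with \<open>w\<close>,
  which tends to \<open>A\<close>.\<close>

lemma rep_limit: "(\<lambda>n. \<integral>x. iexp (\<tau> * Y n x) * of_real (score w n x) \<partial>iid M n) \<longlonglongrightarrow> \<i> * \<tau> * A * \<psi> \<tau>"
proof -
  obtain s where s: "\<And>k. sq_int M (s k)" "\<And>k. \<exists>p. (s k, p) \<in> lin_graph I g b"
    "(\<lambda>k. \<integral>x. (s k x - w x)\<^sup>2 \<partial>M) \<longlonglongrightarrow> 0"
    using rep unfolding tangent_rep_def by auto
  have wp: "(\<integral>x. w x * h x \<partial>M) = p" if "(h, p) \<in> lin_graph I g b" for h p
    using rep that unfolding tangent_rep_def by auto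
  define p where "p k = (\<integral>x. w x * s k x \<partial>M)" for k
  have sp: "(s k, p k) \<in> lin_graph I g b" for k using s(2)[of k] wp by (auto simp: p_def)
  have s0: "(\<integral>x. s k x \<partial>M) = 0" for k by (rule graph_mean[OF sp])
  have pA: "p \<longlonglongrightarrow> A"
    using tendsto_integral_L2[OF s(1) rep_sq_int rep_sq_int s(3)]
    by (simp add: p_def[abs_def] A_def power2_eq_square mult.commute)
  define F where "F h n = (\<integral>x. iexp (\<tau> * Y n x) * of_real (score h n x) \<partial>iid M n)" for h n
  have close: "cmod (F w n - F (s k) n) \<le> sqrt (\<integral>x. (s k x - w x)\<^sup>2 \<partial>M)" for n k
  proof -
    have d: "sq_int M (\<lambda>x. w x - s k x)" "(\<integral>x. w x - s k x \<partial>M) = 0"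
      using sq_int_diff[OF rep_sq_int s(1)] s0 rep_mean sq_int_integrable[OF rep_sq_int] sq_int_integrable[OF s(1)]
      by auto
    have "F w n - F (s k) n = (\<integral>x. iexp (\<tau> * Y n x) * of_real (score (\<lambda>x. w x - s k x) n x) \<partial>iid M n)"
      unfolding F_def
      using integrable_iexp_Y_mult[OF sq_int_score[OF rep_sq_int rep_mean]]
        integrable_iexp_Y_mult[OF sq_int_score[OF s(1) s0]]
      by (subst Bochner_Integration.integral_diff[symmetric]) (auto simp: score_diff algebra_simps)
    then have "cmod (F w n - F (s k) n) \<le> sqrt (\<integral>x. (score (\<lambda>x. w x - s k x) n x)\<^sup>2 \<partial>iid M n)"
      using norm_iexp_Y_mult_le[OF sq_int_score[OF d]] by simp
    also have "\<dots> \<le> sqrt (\<integral>x. (w x - s k x)\<^sup>2 \<partial>M)"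
      by (rule real_sqrt_le_mono[OF integral_score_sq_le[OF d]])
    finally show ?thesis by (simp add: power2_commute)
  qed
  have "F w \<longlonglongrightarrow> \<i> * \<tau> * A * \<psi> \<tau>"
  proof (rule tendstoI)
    fix e :: real assume e: "e > 0"
    have "(\<lambda>k. sqrt (\<integral>x. (s k x - w x)\<^sup>2 \<partial>M) + cmod (\<i> * \<tau> * p k * \<psi> \<tau> - \<i> * \<tau> * A * \<psi> \<tau>))
        \<longlonglongrightarrow> sqrt 0 + cmod (\<i> * \<tau> * A * \<psi> \<tau> - \<i> * \<tau> * A * \<psi> \<tau>)"
      by (intro tendsto_intros s(3) pA)
    then have "eventually (\<lambda>k. sqrt (\<integral>x. (s k x - w x)\<^sup>2 \<partial>M)
        + cmod (\<i> * \<tau> * p k * \<psi> \<tau> - \<i> * \<tau> * A * \<psi> \<tau>) < e / 2) sequentially"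
      by (rule order_tendstoD(2)) (use e in simp)
    then obtain k where k: "sqrt (\<integral>x. (s k x - w x)\<^sup>2 \<partial>M)
        + cmod (\<i> * \<tau> * p k * \<psi> \<tau> - \<i> * \<tau> * A * \<psi> \<tau>) < e / 2"
      by (auto simp: eventually_sequentially)
    have "eventually (\<lambda>n. dist (F (s k) n) (\<i> * \<tau> * p k * \<psi> \<tau>) < e / 2) sequentially"
      unfolding F_def by (rule tendstoD[OF graph_limit[OF sp]]) (use e in simp)
    then show "eventually (\<lambda>n. dist (F w n) (\<i> * \<tau> * A * \<psi> \<tau>) < e) sequentially"
    proof eventually_elim
      fix n assume 1: "dist (F (s k) n) (\<i> * \<tau> * p k * \<psi> \<tau>) < e / 2"
      have "F w n - \<i> * \<tau> * A * \<psi> \<tau> = (F w n - F (s k) n) + (F (s k) n - \<i> * \<tau> * p k * \<psi> \<tau>)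
          + (\<i> * \<tau> * p k * \<psi> \<tau> - \<i> * \<tau> * A * \<psi> \<tau>)" by simp
      then have "cmod (F w n - \<i> * \<tau> * A * \<psi> \<tau>) \<le> cmod (F w n - F (s k) n)
          + cmod (F (s k) n - \<i> * \<tau> * p k * \<psi> \<tau>) + cmod (\<i> * \<tau> * p k * \<psi> \<tau> - \<i> * \<tau> * A * \<psi> \<tau>)"
        by (simp only:) (intro norm_triangle_mono norm_triangle_ineq order_refl)
      then show "dist (F w n) (\<i> * \<tau> * A * \<psi> \<tau>) < e"
        using k 1 close[of n k] unfolding dist_norm by linarith
    qed
  qed
  then show ?thesis unfolding F_def .
qed

text \<open>By Cauchy--Schwarz for the centred \<open>exp (i \<tau> Y\<^sub>n)\<close> against the score.\<close>

lemma char_bound: "A * (\<tau>\<^sup>2 * (cmod (\<psi> \<tau>))\<^sup>2) \<le> 1 - (cmod (\<psi> \<tau>))\<^sup>2"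
proof -
  define E where "E n = (\<integral>x. iexp (\<tau> * Y n x) \<partial>iid M n)" for n
  define F where "F n = (\<integral>x. iexp (\<tau> * Y n x) * of_real (score w n x) \<partial>iid M n)" for n
  have E: "E \<longlonglongrightarrow> \<psi> \<tau>" unfolding E_def by (rule base)
  have F: "F \<longlonglongrightarrow> \<i> * \<tau> * A * \<psi> \<tau>" unfolding F_def by (rule rep_limit)
  have A: "A \<ge> 0" by (simp add: A_def)
  have n: "(cmod (F n))\<^sup>2 \<le> (1 - (cmod (E n))\<^sup>2) * A \<and> cmod (E n) \<le> 1" for n
  proof -
    interpret P: prob_space "iid M n" by (rule prob_space_iid)
    let ?e = "\<lambda>x. iexp (\<tau> * Y n x)"
    have em [measurable]: "?e \<in> borel_measurable (iid M n)" by (rule iexp_Y_measurable)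
    have ei: "integrable (iid M n) ?e" by (rule P.integrable_const_bound[of _ 1, OF _ em]) simp
    have sq: "(cmod (?e x - E n))\<^sup>2 = 1 + (cmod (E n))\<^sup>2 - 2 * Re (cnj (E n) * ?e x)" for x
    proof -
      have "(cmod (?e x - E n))\<^sup>2 = (cmod (?e x))\<^sup>2 + (cmod (E n))\<^sup>2 - 2 * Re (cnj (E n) * ?e x)"
        unfolding cmod_power2 by (simp add: power2_eq_square algebra_simps)
      then show ?thesis by simp
    qed
    have i2: "integrable (iid M n) (\<lambda>x. (cmod (?e x - E n))\<^sup>2)"
      unfolding sq using ei by auto
    have "(\<integral>x. (cmod (?e x - E n))\<^sup>2 \<partial>iid M n) = 1 + (cmod (E n))\<^sup>2 - 2 * Re (cnj (E n) * E n)"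
      unfolding sq using ei by (simp add: P.prob_space integral_Re E_def)
    also have "\<dots> = 1 - (cmod (E n))\<^sup>2"
      unfolding cmod_power2 by (simp add: power2_eq_square)
    finally have v: "(\<integral>x. (cmod (?e x - E n))\<^sup>2 \<partial>iid M n) = 1 - (cmod (E n))\<^sup>2" .
    note s = sq_int_score[OF rep_sq_int rep_mean, of n]
    have si: "integrable (iid M n) (score w n)" by (rule P.sq_int_integrable[OF s])
    \<comment> \<open>The score is centred, so the constant \<open>E n\<close> may be subtracted
      from the exponential.\<close>
    have "F n = (\<integral>x. (?e x - E n) * of_real (score w n x) \<partial>iid M n)"
      using integrable_iexp_Y_mult[OF s, of \<tau>] si
      by (simp add: left_diff_distrib F_def integral_score[OF rep_sq_int rep_mean])
    then have "cmod (F n) \<le> sqrt (\<integral>x. (cmod (?e x - E n))\<^sup>2 \<partial>iid M n) * sqrt (\<integral>x. (score w n x)\<^sup>2 \<partial>iid M n)"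
      using complex_integral_Cauchy_Schwarz(2)[OF borel_measurable_diff[OF em borel_measurable_const] i2 s] by simp
    also have "\<dots> \<le> sqrt (1 - (cmod (E n))\<^sup>2) * sqrt A"
      unfolding v A_def by (intro mult_left_mono real_sqrt_le_mono integral_score_sq_le rep_sq_int rep_mean)
        (use v in \<open>simp add: real_sqrt_ge_0_iff flip: v\<close>)
    finally have "(cmod (F n))\<^sup>2 \<le> (sqrt (1 - (cmod (E n))\<^sup>2) * sqrt A)\<^sup>2" by (rule power_mono) simp
    moreover have "0 \<le> 1 - (cmod (E n))\<^sup>2" unfolding v[symmetric] by simp
    ultimately show ?thesis using A by (simp add: power_mult_distrib) (simp add: abs_square_le_1)
  qed
  have "(cmod (\<i> * \<tau> * A * \<psi> \<tau>))\<^sup>2 \<le> (1 - (cmod (\<psi> \<tau>))\<^sup>2) * A"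
    by (rule LIMSEQ_le[of "\<lambda>n. (cmod (F n))\<^sup>2" _ "\<lambda>n. (1 - (cmod (E n))\<^sup>2) * A"])
      (use n in \<open>auto intro!: tendsto_intros F E\<close>)
  \<comment> \<open>Both sides carry a factor \<open>A\<close>; it is cancelled below, and for
    \<open>A = 0\<close> the claim is just \<open>cmod (\<psi> \<tau>) \<le> 1\<close>.\<close>
  then have *: "A * (A * (\<tau>\<^sup>2 * (cmod (\<psi> \<tau>))\<^sup>2)) \<le> A * (1 - (cmod (\<psi> \<tau>))\<^sup>2)"
    by (simp add: norm_mult power_mult_distrib power2_eq_square ac_simps)
  have "cmod (\<psi> \<tau>) \<le> 1"
    by (rule Lim_bounded[OF tendsto_norm[OF E]]) (use n in blast)
  then have "(cmod (\<psi> \<tau>))\<^sup>2 \<le> 1" by (simp add: power_le_one)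
  then show ?thesis using * A by (cases "A = 0") auto
qed

text \<open>\<open>sin (\<tau> Y\<^sub>n) / \<tau>\<close> is a bounded surrogate for \<open>Y\<^sub>n\<close>: its \<open>L\<^sup>2\<close> distance to the score is computed
  from characteristic functions alone.\<close>

lemma score_approximation:
  assumes tight: "\<And>\<delta>. \<delta> > 0 \<Longrightarrow> \<exists>K>0. \<forall>\<^sub>F n in sequentially. measure (iid M n) {x\<in>space (iid M n). \<bar>Y n x\<bar> > K} < \<delta>"
    and efficient: "\<And>\<delta>. \<delta> > 0 \<Longrightarrow> \<forall>\<^sub>F \<tau> in at_right 0. (1 - Re (\<psi> (2 * \<tau>))) / (2 * \<tau>\<^sup>2) \<le> A + \<delta>"
    and \<epsilon>: "\<epsilon> > 0"
  shows "(\<lambda>n. measure (iid M n) {x\<in>space (iid M n). \<bar>Y n x - score w n x\<bar> > \<epsilon>}) \<longlonglongrightarrow> 0"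
proof (rule tendstoI)
  fix \<delta> :: real assume \<delta>: "\<delta> > 0"
  obtain K where K: "K > 0"
    "\<forall>\<^sub>F n in sequentially. measure (iid M n) {x\<in>space (iid M n). \<bar>Y n x\<bar> > K} < \<delta> / 2"
    using tight[of "\<delta> / 2"] \<delta> by auto
  \<comment> \<open>Calibrated so that the Markov inequality at level
    \<open>(\<epsilon> / 2)\<^sup>2\<close> yields probability \<open>\<delta> / 2\<close>.\<close>
  define \<eta> where "\<eta> = (\<epsilon> / 2)\<^sup>2 * (\<delta> / 2)"
  have \<eta>: "\<eta> > 0" using \<epsilon> \<delta> by (simp add: \<eta>_def)
  \<comment> \<open>The limit in \<open>n\<close> of the second moment of \<open>D n\<close>; for
    small \<tau> the hypotheses bound it by nearly \<open>A - 2 * A + A = 0\<close>.\<close>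
  define B where "B \<tau> = (1 - Re (\<psi> (2 * \<tau>))) / (2 * \<tau>\<^sup>2) - 2 * A * Re (\<psi> \<tau>) + A" for \<tau>
  have "((\<lambda>\<tau>. 2 * A * Re (\<psi> \<tau>)) \<longlongrightarrow> 2 * A * Re 1) (at 0)"
    by (intro tendsto_intros psi)
  then have "((\<lambda>\<tau>. 2 * A * Re (\<psi> \<tau>)) \<longlongrightarrow> 2 * A) (at_right 0)"
    by (simp add: filterlim_at_split)
  then have "\<forall>\<^sub>F \<tau> in at_right 0. 2 * A * Re (\<psi> \<tau>) > 2 * A - \<eta> / 2"
    by (rule order_tendstoD(1)) (use \<eta> in simp)
  moreover have "\<forall>\<^sub>F \<tau> in at_right 0. (1 - Re (\<psi> (2 * \<tau>))) / (2 * \<tau>\<^sup>2) \<le> A + \<eta> / 2"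
    by (rule efficient) (use \<eta> in simp)
  \<comment> \<open>Where \<open>\<bar>Y n x\<bar> \<le> K\<close>, replacing \<open>Y n x\<close>
    by \<open>sin (\<tau> * Y n x) / \<tau>\<close> costs at most
    \<open>\<tau> * K\<^sup>2\<close>.\<close>
  moreover have "\<forall>\<^sub>F \<tau> in at_right 0. \<tau> * K\<^sup>2 < \<epsilon> / 2"
  proof -
    have "((\<lambda>\<tau>. \<tau> * K\<^sup>2) \<longlongrightarrow> 0 * K\<^sup>2) (at_right 0)" by (intro tendsto_intros)
    then show ?thesis by (rule order_tendstoD(2)) (use \<epsilon> in simp)
  qed
  moreover have "\<forall>\<^sub>F \<tau> in at_right (0::real). \<tau> > 0" by (rule eventually_at_right_less)
  ultimately have "\<forall>\<^sub>F \<tau> in at_right 0. B \<tau> < \<eta> \<and> \<tau> * K\<^sup>2 < \<epsilon> / 2 \<and> \<tau> > 0"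
    by eventually_elim (simp add: B_def)
  then have "\<exists>\<tau>. B \<tau> < \<eta> \<and> \<tau> * K\<^sup>2 < \<epsilon> / 2 \<and> \<tau> > 0"
    by (rule eventually_happens'[rotated]) simp
  then obtain \<tau> where \<tau>: "B \<tau> < \<eta>" "\<tau> * K\<^sup>2 < \<epsilon> / 2" "\<tau> > 0" by blast
  define D where "D n x = sin (\<tau> * Y n x) / \<tau> - score w n x" for n x
  have s: "sq_int (iid M n) (score w n)" for n by (rule sq_int_score[OF rep_sq_int rep_mean])
  have Ym [measurable]: "Y n \<in> borel_measurable (iid M n)" for n by (rule Y)
  have sm [measurable]: "score w n \<in> borel_measurable (iid M n)" for n using s by (rule sq_int_measurable)
  have D: "sq_int (iid M n) (D n)" for n
  proof -
    interpret P: prob_space "iid M n" by (rule prob_space_iid)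
    have "integrable (iid M n) (\<lambda>x. (sin (\<tau> * Y n x))\<^sup>2)"
      by (rule P.integrable_const_bound[of _ 1]) (auto simp: abs_square_le_1)
    then have "sq_int (iid M n) (\<lambda>x. (1 / \<tau>) * sin (\<tau> * Y n x))"
      by (intro sq_int_scale) (simp add: sq_int_def)
    then have "sq_int (iid M n) (\<lambda>x. (1 / \<tau>) * sin (\<tau> * Y n x) - score w n x)"
      by (rule sq_int_diff[OF _ s])
    then show ?thesis by (simp add: D_def[abs_def])
  qed
  have D2: "(\<integral>x. (D n x)\<^sup>2 \<partial>iid M n) = (1 - Re (\<integral>x. iexp (2 * \<tau> * Y n x) \<partial>iid M n)) / (2 * \<tau>\<^sup>2)
      - 2 / \<tau> * Im (\<integral>x. iexp (\<tau> * Y n x) * of_real (score w n x) \<partial>iid M n) + A" if n: "n > 0" for n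
  proof -
    interpret P: prob_space "iid M n" by (rule prob_space_iid)
    have i1: "integrable (iid M n) (\<lambda>x. iexp (2 * \<tau> * Y n x))"
      by (rule P.integrable_const_bound[of _ 1]) (auto simp: iexp_Y_measurable)
    note i2 = integrable_iexp_Y_mult[OF s[of n], of \<tau>]
    \<comment> \<open>The squared sine is read off at frequency \<open>2 * \<tau>\<close>, its
      product with the score from the imaginary part at frequency \<open>\<tau>\<close>.\<close>
    have c: "Re (iexp (2 * \<tau> * Y n x)) = 1 - 2 * (sin (\<tau> * Y n x))\<^sup>2" for x
      by (simp add: Re_exp cos_double_sin[of "\<tau> * Y n x", simplified mult.assoc[symmetric]])
    have "(D n x)\<^sup>2 = (1 - Re (iexp (2 * \<tau> * Y n x))) / (2 * \<tau>\<^sup>2)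
        - 2 / \<tau> * Im (iexp (\<tau> * Y n x) * of_real (score w n x)) + (score w n x)\<^sup>2" for x
      unfolding D_def c by (simp add: Im_exp power2_diff power_divide)
    then have "(\<integral>x. (D n x)\<^sup>2 \<partial>iid M n) = (\<integral>x. (1 - Re (iexp (2 * \<tau> * Y n x))) / (2 * \<tau>\<^sup>2)
        - 2 / \<tau> * Im (iexp (\<tau> * Y n x) * of_real (score w n x)) + (score w n x)\<^sup>2 \<partial>iid M n)"
      by presburger
    also have "\<dots> = (1 - (\<integral>x. Re (iexp (2 * \<tau> * Y n x)) \<partial>iid M n)) / (2 * \<tau>\<^sup>2)
        - 2 / \<tau> * (\<integral>x. Im (iexp (\<tau> * Y n x) * of_real (score w n x)) \<partial>iid M n) + (\<integral>x. (score w n x)\<^sup>2 \<partial>iid M n)"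
      using integrable_Re[OF i1] integrable_Im[OF i2] sq_int_integrable_sq[OF s, of n]
      by (simp add: P.prob_space)
    finally show ?thesis
      using integral_score_sq[OF rep_sq_int rep_mean n] integral_Re[OF i1] integral_Im[OF i2]
      by (simp add: A_def)
  qed
  have "(\<lambda>n. (1 - Re (\<integral>x. iexp (2 * \<tau> * Y n x) \<partial>iid M n)) / (2 * \<tau>\<^sup>2)
      - 2 / \<tau> * Im (\<integral>x. iexp (\<tau> * Y n x) * of_real (score w n x) \<partial>iid M n) + A) \<longlonglongrightarrow>
      (1 - Re (\<psi> (2 * \<tau>))) / (2 * \<tau>\<^sup>2) - 2 / \<tau> * Im (\<i> * \<tau> * A * \<psi> \<tau>) + A"
    by (intro tendsto_intros base rep_limit) (use \<tau> in simp)
  also have "(1 - Re (\<psi> (2 * \<tau>))) / (2 * \<tau>\<^sup>2) - 2 / \<tau> * Im (\<i> * \<tau> * A * \<psi> \<tau>) + A = B \<tau>"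
    using \<tau> by (simp add: B_def)
  finally have "\<forall>\<^sub>F n in sequentially. (1 - Re (\<integral>x. iexp (2 * \<tau> * Y n x) \<partial>iid M n)) / (2 * \<tau>\<^sup>2)
      - 2 / \<tau> * Im (\<integral>x. iexp (\<tau> * Y n x) * of_real (score w n x) \<partial>iid M n) + A < \<eta>"
    by (rule order_tendstoD(2)) (use \<tau> in simp)
  then have "\<forall>\<^sub>F n in sequentially. (\<integral>x. (D n x)\<^sup>2 \<partial>iid M n) < \<eta>"
    using eventually_gt_at_top[of "0::nat"] by eventually_elim (simp add: D2)
  with K(2) show "\<forall>\<^sub>F n in sequentially.
      dist (measure (iid M n) {x\<in>space (iid M n). \<bar>Y n x - score w n x\<bar> > \<epsilon>}) 0 < \<delta>"
  proof eventually_elim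
    fix n assume 1: "measure (iid M n) {x\<in>space (iid M n). \<bar>Y n x\<bar> > K} < \<delta> / 2"
      and 2: "(\<integral>x. (D n x)\<^sup>2 \<partial>iid M n) < \<eta>"
    interpret P: prob_space "iid M n" by (rule prob_space_iid)
    have [measurable]: "D n \<in> borel_measurable (iid M n)" using D by (rule sq_int_measurable)
    have "{x\<in>space (iid M n). \<bar>Y n x - score w n x\<bar> > \<epsilon>}
      \<subseteq> {x\<in>space (iid M n). \<bar>Y n x\<bar> > K} \<union> {x\<in>space (iid M n). (D n x)\<^sup>2 \<ge> (\<epsilon> / 2)\<^sup>2}"
    proof safe
      fix x assume x: "\<epsilon> < \<bar>Y n x - score w n x\<bar>" and small: "\<not> (\<epsilon> / 2)\<^sup>2 \<le> (D n x)\<^sup>2"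
      have d: "\<bar>D n x\<bar> < \<epsilon> / 2"
        using small \<epsilon> abs_le_square_iff[of "\<epsilon> / 2" "D n x"] by auto
      show "K < \<bar>Y n x\<bar>"
      proof (rule ccontr)
        assume "\<not> K < \<bar>Y n x\<bar>"
        then have "(Y n x)\<^sup>2 \<le> K\<^sup>2" using K(1) abs_le_square_iff[of "Y n x" K] by auto
        have "\<bar>sin (\<tau> * Y n x) - \<tau> * Y n x\<bar> \<le> cmod (iexp (\<tau> * Y n x) - 1 - \<i> * (\<tau> * Y n x))"
          using abs_Im_le_cmod[of "iexp (\<tau> * Y n x) - 1 - \<i> * (\<tau> * Y n x)"] by (simp add: Im_exp)
        also have "\<dots> \<le> (\<tau> * Y n x)\<^sup>2" using iexp_approx_1[of "\<tau> * Y n x"] by simp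
        finally have "\<bar>sin (\<tau> * Y n x) - \<tau> * Y n x\<bar> / \<tau> \<le> (\<tau> * Y n x)\<^sup>2 / \<tau>"
          using \<tau> by (simp add: divide_right_mono)
        moreover have "\<bar>sin (\<tau> * Y n x) - \<tau> * Y n x\<bar> / \<tau> = \<bar>sin (\<tau> * Y n x) / \<tau> - Y n x\<bar>"
        proof -
          have "sin (\<tau> * Y n x) / \<tau> - Y n x = (sin (\<tau> * Y n x) - \<tau> * Y n x) / \<tau>"
            using \<tau>(3) by (simp add: diff_divide_distrib)
          then show ?thesis by (simp only: abs_divide abs_of_pos[OF \<tau>(3)])
        qed
        moreover have "(\<tau> * Y n x)\<^sup>2 / \<tau> = \<tau> * (Y n x)\<^sup>2" using \<tau>(3) by (simp add: power2_eq_square)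
        moreover have "\<tau> * (Y n x)\<^sup>2 \<le> \<tau> * K\<^sup>2" using \<open>(Y n x)\<^sup>2 \<le> K\<^sup>2\<close> \<tau>(3) by (intro mult_left_mono) auto
        ultimately have "\<bar>sin (\<tau> * Y n x) / \<tau> - Y n x\<bar> < \<epsilon> / 2" using \<tau>(2) by linarith
        then show False using x d unfolding D_def by linarith
      qed
    qed
    then have "measure (iid M n) {x\<in>space (iid M n). \<bar>Y n x - score w n x\<bar> > \<epsilon>}
      \<le> measure (iid M n) ({x\<in>space (iid M n). \<bar>Y n x\<bar> > K} \<union> {x\<in>space (iid M n). (D n x)\<^sup>2 \<ge> (\<epsilon> / 2)\<^sup>2})"
      by (intro P.finite_measure_mono) measurable
    also have "\<dots> \<le> measure (iid M n) {x\<in>space (iid M n). \<bar>Y n x\<bar> > K}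
        + measure (iid M n) {x\<in>space (iid M n). (D n x)\<^sup>2 \<ge> (\<epsilon> / 2)\<^sup>2}"
      by (intro measure_Un_le) measurable
    also have "measure (iid M n) {x\<in>space (iid M n). (D n x)\<^sup>2 \<ge> (\<epsilon> / 2)\<^sup>2} \<le> (\<integral>x. (D n x)\<^sup>2 \<partial>iid M n) / (\<epsilon> / 2)\<^sup>2"
      using integral_Markov_inequality_measure[of "iid M n" "\<lambda>x. (D n x)\<^sup>2" "space (iid M n)" "(\<epsilon> / 2)\<^sup>2"]
        sq_int_integrable_sq[OF D] \<epsilon> by simp
    also have "\<dots> < \<eta> / (\<epsilon> / 2)\<^sup>2" using 2 \<epsilon> by (intro divide_strict_right_mono) auto
    also have "\<dots> = \<delta> / 2" using \<epsilon> by (simp add: \<eta>_def)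
    finally show "dist (measure (iid M n) {x\<in>space (iid M n). \<bar>Y n x - score w n x\<bar> > \<epsilon>}) 0 < \<delta>"
      using 1 by simp
  qed
qed

end

end

section \<open>Gaussian limit of the score under the tilted laws\<close>

context prob_space
begin

text \<open>The expectation is the n-th power of a one-dimensional integral \<open>a n\<close>. Here
  \<open>n * (a n - 1)\<close> splits into a second-order term of the exponential alone, which gives
  the variance, and a first-order term against \<open>h\<close>, which gives a shift by the inner
  product of \<open>w\<close> and \<open>h\<close>.\<close>

lemma score_tilt_limit:
  assumes w: "sq_int M w" and w0: "(\<integral>x. w x \<partial>M) = 0"
    and h: "sq_int M h" and h0: "(\<integral>x. h x \<partial>M) = 0"
  shows "(\<lambda>n. \<integral>x. iexp (\<tau> * score w n x) * of_real (tilt h n x) \<partial>iid M n)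
    \<longlonglongrightarrow> exp (\<i> * \<tau> * (\<integral>x. w x * h x \<partial>M) - \<tau>\<^sup>2 * (\<integral>x. (w x)\<^sup>2 \<partial>M) / 2)"
proof -
  define A where "A = (\<integral>x. (w x)\<^sup>2 \<partial>M)"
  define C where "C = (\<integral>x. w x * h x \<partial>M)"
  have [measurable]: "w \<in> borel_measurable M" "h \<in> borel_measurable M"
    using w h by (auto dest: sq_int_measurable)
  have tw: "sq_int M (\<lambda>x. \<tau> * w x)" by (rule sq_int_scale[OF w])
  let ?e = "\<lambda>n x. iexp (\<tau> * w x / sqrt (real n))"
  define a where "a n = (\<integral>x. ?e n x * of_real (1 + h x / sqrt n) \<partial>M)" for n
  have hi: "integrable M h" "integrable M w" using h w by (auto intro: sq_int_integrable)
  have ei: "integrable M (?e n)" for n by (rule integrable_const_bound[of _ 1]) auto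
  have ehi: "integrable M (\<lambda>x. ?e n x * of_real (h x))" for n
    using cmod_integral_bounded_mult(1)[of "?e n" h] h by simp
  have fi: "integrable M (\<lambda>x. ?e n x * of_real (1 + h x / sqrt n))" for n
  proof -
    have "integrable M (\<lambda>x. ?e n x + ?e n x * of_real (h x) / of_real (sqrt n))"
      using ei[of n] ehi[of n] by simp
    then show ?thesis by (simp add: algebra_simps)
  qed
  have eq: "(\<integral>x. iexp (\<tau> * score w n x) * of_real (tilt h n x) \<partial>iid M n) = a n ^ n" for n
  proof -
    have "iexp (\<tau> * score w n x) * of_real (tilt h n x) = (\<Prod>j<n. ?e n (x j) * of_real (1 + h (x j) / sqrt n))" for x
    proof -
      have "iexp (\<tau> * score w n x) = exp (\<Sum>j<n. \<i> * complex_of_real (\<tau> * w (x j) / sqrt (real n)))"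
        by (simp add: score_def sum_distrib_left sum_divide_distrib)
      then show ?thesis by (simp add: tilt_def prod.distrib exp_sum)
    qed
    then show ?thesis
      unfolding a_def using integral_iid_prod[of n "\<lambda>_ x. ?e n x * of_real (1 + h x / sqrt n)"] fi by simp
  qed
  have lim: "(\<lambda>n. (\<integral>x. real n * (?e n x - 1 - \<i> * (\<tau> * w x / sqrt (real n))) \<partial>M)
      + (\<integral>x. sqrt (real n) * (?e n x - 1) * of_real (h x) \<partial>M))
    \<longlonglongrightarrow> - complex_of_real ((\<integral>x. (\<tau> * w x)\<^sup>2 \<partial>M) / 2) + \<i> * complex_of_real (\<integral>x. \<tau> * w x * h x \<partial>M)"
    by (intro tendsto_add integral_iexp_limit1 integral_iexp_limit2 sq_int_integrable_sq[OF tw] sq_int_mult[OF tw h])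
      measurable
  have L: "- complex_of_real ((\<integral>x. (\<tau> * w x)\<^sup>2 \<partial>M) / 2) + \<i> * complex_of_real (\<integral>x. \<tau> * w x * h x \<partial>M)
      = \<i> * \<tau> * C - \<tau>\<^sup>2 * A / 2"
    by (simp add: power_mult_distrib A_def C_def mult.assoc)
  have "(\<lambda>n. of_nat n * (a n - 1)) \<longlonglongrightarrow> \<i> * \<tau> * C - \<tau>\<^sup>2 * A / 2"
  proof (rule Lim_transform_eventually[OF lim[unfolded L]])
    show "\<forall>\<^sub>F n in sequentially. (\<integral>x. real n * (?e n x - 1 - \<i> * (\<tau> * w x / sqrt (real n))) \<partial>M)
      + (\<integral>x. sqrt (real n) * (?e n x - 1) * of_real (h x) \<partial>M) = of_nat n * (a n - 1)"
      using eventually_gt_at_top[of "0::nat"]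
    proof eventually_elim
      fix n :: nat assume n: "n > 0"
      \<comment> \<open>The subtracted linear term integrates to 0 because \<open>w\<close> is
        centred.\<close>
      have 1: "(\<integral>x. real n * (?e n x - 1 - \<i> * (\<tau> * w x / sqrt (real n))) \<partial>M) = n * ((\<integral>x. ?e n x \<partial>M) - 1)"
        using ei[of n] hi w0 by (simp add: prob_space)
      have 2: "(\<integral>x. sqrt (real n) * (?e n x - 1) * of_real (h x) \<partial>M) = sqrt n * (\<integral>x. ?e n x * of_real (h x) \<partial>M)"
        using ehi[of n] hi h0 by (simp add: left_diff_distrib mult.assoc)
      have "a n = (\<integral>x. ?e n x + ?e n x * of_real (h x) / of_real (sqrt n) \<partial>M)"
        unfolding a_def by (simp add: algebra_simps)
      also have "\<dots> = (\<integral>x. ?e n x \<partial>M) + (\<integral>x. ?e n x * of_real (h x) \<partial>M) / of_real (sqrt n)"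
        using ei[of n] ehi[of n] by simp
      finally have a: "a n = (\<integral>x. ?e n x \<partial>M) + (\<integral>x. ?e n x * of_real (h x) \<partial>M) / of_real (sqrt n)" .
      have nn: "of_nat n = complex_of_real (sqrt n) * of_real (sqrt n)"
        by (simp flip: of_real_mult)
      have *: "r * r * (E + J / r - 1) = r * r * (E - 1) + r * J" if "r \<noteq> 0" for r E J :: complex
        using that by (simp add: algebra_simps)
      have key: "of_nat n * (E + J / of_real (sqrt n) - 1) = of_nat n * (E - 1) + of_real (sqrt n) * J"
        for E J :: complex
        unfolding nn by (rule *) (use n in simp)
      show "(\<integral>x. real n * (?e n x - 1 - \<i> * (\<tau> * w x / sqrt (real n))) \<partial>M)
        + (\<integral>x. sqrt (real n) * (?e n x - 1) * of_real (h x) \<partial>M) = of_nat n * (a n - 1)"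
        unfolding 1 2 a key ..
    qed
  qed
  then show ?thesis
    unfolding eq A_def[symmetric] C_def[symmetric] by (rule power_n_limit)
qed

end

section \<open>Products that are asymptotically proportional in \<open>L\<^sup>2\<close>\<close>

text \<open>Each term of the expanded square is the expectation of a product, hence an n-th power.
  With the limits \<open>exp (H + 2 * Re z)\<close>, \<open>exp (H + z)\<close> and
  \<open>exp H\<close> the three terms combine to \<open>exp (H + 2 * Re z) * (1 - 2 + 1)\<close>. A
  perturbation \<open>D n\<close> whose squared norm is of smaller order than 1/n thus acts on the
  product only through its inner product with \<open>p n\<close>.\<close>

lemma (in prob_space) product_L2_limit:
  fixes p :: "nat \<Rightarrow> 'a \<Rightarrow> real" and D :: "nat \<Rightarrow> 'a \<Rightarrow> complex"
  assumes p: "\<And>n. sq_int M (p n)"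
    and Dm: "\<And>n. D n \<in> borel_measurable M"
    and D2: "\<And>n. integrable M (\<lambda>x. (cmod (D n x))\<^sup>2)"
    and H: "(\<lambda>n. real n * ((\<integral>x. (p n x)\<^sup>2 \<partial>M) - 1)) \<longlonglongrightarrow> H"
    and z: "(\<lambda>n. real n * (\<integral>x. D n x * of_real (p n x) \<partial>M)) \<longlonglongrightarrow> z"
    and small: "(\<lambda>n. real n * (\<integral>x. (cmod (D n x))\<^sup>2 \<partial>M)) \<longlonglongrightarrow> 0"
  shows "(\<lambda>n. \<integral>x. (cmod ((\<Prod>j<n. of_real (p n (x j)) + D n (x j)) - exp z * of_real (\<Prod>j<n. p n (x j))))\<^sup>2 \<partial>iid M n)
    \<longlonglongrightarrow> 0"
    and "\<And>n. integrable (iid M n) (\<lambda>x. (cmod ((\<Prod>j<n. of_real (p n (x j)) + D n (x j)) - exp z * of_real (\<Prod>j<n. p n (x j))))\<^sup>2)"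
proof -
  have pm [measurable]: "p n \<in> borel_measurable M" for n using p by (rule sq_int_measurable)
  note Dm [measurable]
  have p2: "integrable M (\<lambda>x. (p n x)\<^sup>2)" for n by (rule sq_int_integrable_sq[OF p])
  have Dp: "integrable M (\<lambda>x. D n x * of_real (p n x))" for n
    by (rule complex_integral_Cauchy_Schwarz(1)[OF Dm D2 p])
  define a where "a n x = of_real (p n x) + D n x" for n x
  define P where "P n = (\<integral>x. (p n x)\<^sup>2 \<partial>M)" for n
  define Q where "Q n = (\<integral>x. D n x * of_real (p n x) \<partial>M)" for n
  define R where "R n = (\<integral>x. (cmod (D n x))\<^sup>2 \<partial>M)" for n
  have a2: "(cmod (a n x))\<^sup>2 = (p n x)\<^sup>2 + 2 * Re (D n x * of_real (p n x)) + (cmod (D n x))\<^sup>2" for n x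
    unfolding a_def cmod_power2 by (simp add: power2_eq_square algebra_simps)
  have a2i: "integrable M (\<lambda>x. (cmod (a n x))\<^sup>2)" for n
    unfolding a2 using p2[of n] integrable_Re[OF Dp[of n]] D2[of n] by simp
  have a2I: "(\<integral>x. (cmod (a n x))\<^sup>2 \<partial>M) = P n + 2 * Re (Q n) + R n" for n
    unfolding a2 P_def Q_def R_def using p2[of n] integrable_Re[OF Dp[of n]] D2[of n] integral_Re[OF Dp[of n]]
    by simp
  have ap: "a n x * of_real (p n x) = of_real ((p n x)\<^sup>2) + D n x * of_real (p n x)" for n x
    by (simp add: a_def power2_eq_square algebra_simps)
  have api: "integrable M (\<lambda>x. a n x * of_real (p n x))" for n
    unfolding ap by (rule Bochner_Integration.integrable_add[OF integrable_of_real[OF p2] Dp])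
  have apI: "(\<integral>x. a n x * of_real (p n x) \<partial>M) = of_real (P n) + Q n" for n
    unfolding ap P_def Q_def Bochner_Integration.integral_add[OF integrable_of_real[OF p2[of n]] Dp[of n]]
    by (simp only: integral_complex_of_real)
  define F where "F n x = (cmod ((\<Prod>j<n. a n (x j)) - exp z * of_real (\<Prod>j<n. p n (x j))))\<^sup>2" for n x
  define X where "X n x = Re (cnj (exp z) * (\<Prod>j<n. a n (x j) * of_real (p n (x j))))" for n x
  have Fe: "F n x = (\<Prod>j<n. (cmod (a n (x j)))\<^sup>2) - 2 * X n x + (cmod (exp z))\<^sup>2 * (\<Prod>j<n. (p n (x j))\<^sup>2)" for n x
  proof -
    have gen: "(cmod (A - e * of_real r))\<^sup>2 = (cmod A)\<^sup>2 - 2 * Re (cnj e * (A * of_real r)) + (cmod e)\<^sup>2 * r\<^sup>2" for A e r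
      unfolding cmod_power2 by (simp add: power2_eq_square algebra_simps)
    show ?thesis
      unfolding F_def gen X_def by (simp add: prod_norm[symmetric] prod_power_distrib prod.distrib)
  qed
  have i1: "integrable (iid M n) (\<lambda>x. \<Prod>j<n. (cmod (a n (x j)))\<^sup>2)" for n
    using integrable_iid_prod[of n "\<lambda>_ x. (cmod (a n x))\<^sup>2"] a2i by simp
  have i2: "integrable (iid M n) (\<lambda>x. \<Prod>j<n. a n (x j) * of_real (p n (x j)))" for n
    using integrable_iid_prod[of n "\<lambda>_ x. a n x * of_real (p n x)"] api by simp
  have i3: "integrable (iid M n) (\<lambda>x. \<Prod>j<n. (p n (x j))\<^sup>2)" for n
    using integrable_iid_prod[of n "\<lambda>_ x. (p n x)\<^sup>2"] p2 by simp
  have i2': "integrable (iid M n) (X n)" for n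
    unfolding X_def[abs_def] by (rule integrable_Re[OF integrable_mult_right[OF i2[of n]]])
  show Fi: "integrable (iid M n) (\<lambda>x. (cmod ((\<Prod>j<n. of_real (p n (x j)) + D n (x j)) - exp z * of_real (\<Prod>j<n. p n (x j))))\<^sup>2)" for n
    using i1[of n] i2'[of n] i3[of n] unfolding a_def[symmetric] F_def[symmetric] Fe by simp
  have FI: "(\<integral>x. F n x \<partial>iid M n) = (P n + 2 * Re (Q n) + R n) ^ n
      - 2 * Re (cnj (exp z) * (of_real (P n) + Q n) ^ n) + (cmod (exp z))\<^sup>2 * P n ^ n" for n
  proof -
    have "(\<integral>x. X n x \<partial>iid M n) = Re (\<integral>x. cnj (exp z) * (\<Prod>j<n. a n (x j) * of_real (p n (x j))) \<partial>iid M n)"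
      unfolding X_def by (rule integral_Re[OF integrable_mult_right[OF i2[of n]]])
    also have "\<dots> = Re (cnj (exp z) * (of_real (P n) + Q n) ^ n)"
      unfolding integral_mult_right_zero
      using integral_iid_prod[of n "\<lambda>_ x. a n x * of_real (p n x)"] api apI by simp
    finally have "(\<integral>x. X n x \<partial>iid M n) = Re (cnj (exp z) * (of_real (P n) + Q n) ^ n)" .
    moreover have "(\<integral>x. (\<Prod>j<n. (cmod (a n (x j)))\<^sup>2) \<partial>iid M n) = (P n + 2 * Re (Q n) + R n) ^ n"
      using integral_iid_prod[of n "\<lambda>_ x. (cmod (a n x))\<^sup>2"] a2i a2I by simp
    moreover have "(\<integral>x. (\<Prod>j<n. (p n (x j))\<^sup>2) \<partial>iid M n) = P n ^ n"
      using integral_iid_prod[of n "\<lambda>_ x. (p n x)\<^sup>2"] p2 by (simp add: P_def)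
    ultimately show ?thesis
      unfolding Fe using i1[of n] i2'[of n] i3[of n] by simp
  qed
  have HC: "(\<lambda>n. complex_of_real (real n * (P n - 1))) \<longlonglongrightarrow> of_real H"
    by (rule tendsto_of_real) (use H in \<open>simp add: P_def\<close>)
  have zC: "(\<lambda>n. real n * Q n) \<longlonglongrightarrow> z" using z by (simp add: Q_def)
  have L1: "(\<lambda>n. complex_of_real (P n) ^ n) \<longlonglongrightarrow> exp (of_real H)"
    by (rule power_n_limit) (use HC in simp)
  have L2: "(\<lambda>n. (of_real (P n) + Q n) ^ n) \<longlonglongrightarrow> exp (of_real H + z)"
    by (rule power_n_limit) (use tendsto_add[OF HC zC] in \<open>simp add: algebra_simps\<close>)
  have L3: "(\<lambda>n. complex_of_real (P n + 2 * Re (Q n) + R n) ^ n) \<longlonglongrightarrow> exp (of_real (H + 2 * Re z))"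
  proof (rule power_n_limit)
    have "(\<lambda>n. real n * (P n - 1) + 2 * Re (real n * Q n) + real n * R n) \<longlonglongrightarrow> H + 2 * Re z + 0"
      by (intro tendsto_intros zC) (use H small in \<open>simp_all add: P_def R_def\<close>)
    from tendsto_of_real[OF this, where 'a = complex]
    show "(\<lambda>n. of_nat n * (complex_of_real (P n + 2 * Re (Q n) + R n) - 1)) \<longlonglongrightarrow> of_real (H + 2 * Re z)"
      by (simp add: algebra_simps)
  qed
  have "(\<lambda>n. Re (complex_of_real (P n + 2 * Re (Q n) + R n) ^ n)
      - 2 * Re (cnj (exp z) * (of_real (P n) + Q n) ^ n) + (cmod (exp z))\<^sup>2 * Re (complex_of_real (P n) ^ n))
    \<longlonglongrightarrow> Re (exp (of_real (H + 2 * Re z))) - 2 * Re (cnj (exp z) * exp (of_real H + z)) + (cmod (exp z))\<^sup>2 * Re (exp (of_real H))"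
    by (intro tendsto_intros L1 L2 L3)
  also have "Re (exp (of_real (H + 2 * Re z))) - 2 * Re (cnj (exp z) * exp (of_real H + z)) + (cmod (exp z))\<^sup>2 * Re (exp (of_real H)) = 0"
  proof -
    have "cnj (exp z) * exp (of_real H + z) = of_real (exp H * (cmod (exp z))\<^sup>2)"
      by (simp only: of_real_mult complex_norm_square exp_add exp_of_real ac_simps)
    moreover have "(cmod (exp z))\<^sup>2 = exp (2 * Re z)"
      by (simp add: norm_exp_eq_Re power2_eq_square flip: exp_add)
    ultimately show ?thesis
      by (simp only: exp_of_real Re_complex_of_real exp_add) simp
  qed
  finally have "(\<lambda>n. \<integral>x. F n x \<partial>iid M n) \<longlonglongrightarrow> 0"
    unfolding FI by (simp flip: of_real_power)
  then show "(\<lambda>n. \<integral>x. (cmod ((\<Prod>j<n. of_real (p n (x j)) + D n (x j)) - exp z * of_real (\<Prod>j<n. p n (x j))))\<^sup>2 \<partial>iid M n)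
    \<longlonglongrightarrow> 0"
    unfolding F_def a_def .
qed

section \<open>Mixtures\<close>

lemma mixture_sets [simp]: "sets (mixture t G H) = sets G" "space (mixture t G H) = space G"
  by (simp_all add: mixture_def sets.sigma_sets_eq)

lemma emeasure_mixture:
  assumes "sets H = sets G" "A \<in> sets G"
  shows "emeasure (mixture t G H) A = ennreal (1 - t) * emeasure G A + ennreal t * emeasure H A"
  unfolding mixture_def
proof (rule emeasure_measure_of_sigma)
  show "sigma_algebra (space G) (sets G)" by (rule sets.sigma_algebra_axioms)
  show "positive (sets G) (\<lambda>A. ennreal (1 - t) * emeasure G A + ennreal t * emeasure H A)"
    by (simp add: positive_def)
  show "countably_additive (sets G) (\<lambda>A. ennreal (1 - t) * emeasure G A + ennreal t * emeasure H A)"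
  proof (rule countably_additiveI)
    fix B :: "nat \<Rightarrow> 'a set" assume B: "range B \<subseteq> sets G" "disjoint_family B" "(\<Union>i. B i) \<in> sets G"
    then have BH: "range B \<subseteq> sets H" using assms by simp
    show "(\<Sum>i. ennreal (1 - t) * emeasure G (B i) + ennreal t * emeasure H (B i))
        = ennreal (1 - t) * emeasure G (\<Union>i. B i) + ennreal t * emeasure H (\<Union>i. B i)"
      by (simp add: suminf_add[symmetric] suminf_emeasure[OF B(1,2)] suminf_emeasure[OF BH B(2)])
  qed
qed (rule assms)

lemma prob_space_mixture:
  assumes "prob_space G" "prob_space H" "sets H = sets G" "t \<in> {0..1}"
  shows "prob_space (mixture t G H)"
proof (rule prob_spaceI)
  have "space H = space G" using assms(3) by (rule sets_eq_imp_space_eq)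
  then show "emeasure (mixture t G H) (space (mixture t G H)) = 1"
    using assms prob_space.emeasure_space_1[OF assms(1)] prob_space.emeasure_space_1[OF assms(2)]
    by (simp add: emeasure_mixture flip: ennreal_plus)
qed

lemma nn_integral_mixture:
  assumes sets: "sets H = sets G" and F: "F \<in> borel_measurable G"
  shows "(\<integral>\<^sup>+x. F x \<partial>mixture t G H) = ennreal (1 - t) * (\<integral>\<^sup>+x. F x \<partial>G) + ennreal t * (\<integral>\<^sup>+x. F x \<partial>H)"
proof -
  have mH: "\<And>F. F \<in> borel_measurable G \<Longrightarrow> F \<in> borel_measurable H"
    and mM: "\<And>F. F \<in> borel_measurable G \<Longrightarrow> F \<in> borel_measurable (mixture t G H)"
    using sets by (auto cong: measurable_cong_sets)
  have sp: "space H = space G" using sets by (rule sets_eq_imp_space_eq)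
  show ?thesis
    using F
  proof (induction rule: borel_measurable_induct)
    case (cong f g)
    have "(\<integral>\<^sup>+x. f x \<partial>N) = (\<integral>\<^sup>+x. g x \<partial>N)" if "space N = space G" for N
      by (rule nn_integral_cong) (use cong that in auto)
    then show ?case using cong sp by simp
  next
    case (set A)
    then show ?case using emeasure_mixture[OF sets set] sets by simp
  next
    case (mult u c)
    then show ?case using mH[OF mult(2)] mM[OF mult(2)]
      by (simp add: nn_integral_cmult distrib_left ac_simps)
  next
    case (add u v)
    then show ?case using mH[OF add(1)] mM[OF add(1)] mH[OF add(3)] mM[OF add(3)]
      by (simp add: nn_integral_add distrib_left ac_simps)
  next
    case (seq U)
    have S: "(\<integral>\<^sup>+x. (SUP i. U i) x \<partial>N) = (SUP i. \<integral>\<^sup>+x. U i x \<partial>N)"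
      if "\<And>i. U i \<in> borel_measurable N" for N
      unfolding SUP_apply using that by (intro nn_integral_monotone_convergence_SUP seq) auto
    have inc: "incseq (\<lambda>i. ennreal c * (\<integral>\<^sup>+x. U i x \<partial>N))" for c N
      using seq(3) by (intro incseq_SucI mult_left_mono nn_integral_mono) (auto simp: incseq_Suc_iff le_fun_def)
    have "(\<integral>\<^sup>+x. (SUP i. U i) x \<partial>mixture t G H)
        = (SUP i. ennreal (1 - t) * (\<integral>\<^sup>+x. U i x \<partial>G) + ennreal t * (\<integral>\<^sup>+x. U i x \<partial>H))"
      using S[OF mM[OF seq(1)]] by (simp add: seq)
    also have "\<dots> = (SUP i. ennreal (1 - t) * (\<integral>\<^sup>+x. U i x \<partial>G)) + (SUP i. ennreal t * (\<integral>\<^sup>+x. U i x \<partial>H))"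
      by (intro ennreal_SUP_add inc)
    also have "\<dots> = ennreal (1 - t) * (\<integral>\<^sup>+x. (SUP i. U i) x \<partial>G) + ennreal t * (\<integral>\<^sup>+x. (SUP i. U i) x \<partial>H)"
      unfolding S[OF seq(1)] S[OF mH[OF seq(1)]] SUP_mult_left_ennreal ..
    finally show ?case by (simp add: seq)
  qed
qed

section \<open>Joint laws\<close>

lemma sets_joint_law: "sets G = sets T \<Longrightarrow> sets (joint_law \<nu> f G) = sets (\<nu> \<Otimes>\<^sub>M T)"
  unfolding joint_law_def sets_density by (rule sets_pair_measure_cong) auto

lemma measurable_joint_law:
  "sets G = sets T \<Longrightarrow> F \<in> borel_measurable (\<nu> \<Otimes>\<^sub>M T) \<Longrightarrow> F \<in> borel_measurable (joint_law \<nu> f G)"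
  using sets_joint_law[of G T \<nu> f] by (simp cong: measurable_cong_sets)

lemma nn_integral_joint_law:
  assumes G: "prob_space G" "sets G = sets T"
    and f: "conditional_density \<nu> T f"
    and F: "F \<in> borel_measurable (\<nu> \<Otimes>\<^sub>M T)"
  shows "(\<integral>\<^sup>+z. F z \<partial>joint_law \<nu> f G) = (\<integral>\<^sup>+x. \<integral>\<^sup>+\<theta>. ennreal (f x \<theta>) * F (x, \<theta>) \<partial>G \<partial>\<nu>)"
    and "(\<lambda>x. \<integral>\<^sup>+\<theta>. ennreal (f x \<theta>) * F (x, \<theta>) \<partial>G) \<in> borel_measurable \<nu>"
proof -
  interpret G: prob_space G by fact
  have s: "sets (\<nu> \<Otimes>\<^sub>M G) = sets (\<nu> \<Otimes>\<^sub>M T)" using G by (intro sets_pair_measure_cong) auto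
  have fm: "(\<lambda>(x, \<theta>). f x \<theta>) \<in> borel_measurable (\<nu> \<Otimes>\<^sub>M G)"
    using f s by (simp add: conditional_density_def cong: measurable_cong_sets)
  have fm' [measurable]: "(\<lambda>(x, \<theta>). ennreal (f x \<theta>)) \<in> borel_measurable (\<nu> \<Otimes>\<^sub>M G)"
    using measurable_compose[OF fm measurable_ennreal] by (simp add: case_prod_beta')
  have Fm [measurable]: "F \<in> borel_measurable (\<nu> \<Otimes>\<^sub>M G)" using F s by (simp cong: measurable_cong_sets)
  have m: "(\<lambda>z. (case z of (x, \<theta>) \<Rightarrow> ennreal (f x \<theta>)) * F z) \<in> borel_measurable (\<nu> \<Otimes>\<^sub>M G)"
    by measurable
  show "(\<integral>\<^sup>+z. F z \<partial>joint_law \<nu> f G) = (\<integral>\<^sup>+x. \<integral>\<^sup>+\<theta>. ennreal (f x \<theta>) * F (x, \<theta>) \<partial>G \<partial>\<nu>)"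
    unfolding joint_law_def
    by (subst nn_integral_density[OF fm' Fm], subst G.nn_integral_fst[symmetric, OF m]) simp
  show "(\<lambda>x. \<integral>\<^sup>+\<theta>. ennreal (f x \<theta>) * F (x, \<theta>) \<partial>G) \<in> borel_measurable \<nu>"
    using G.borel_measurable_nn_integral_fst[OF m] by simp
qed

lemma prob_space_joint_law:
  assumes \<nu>: "sigma_finite_measure \<nu>" and G: "prob_space G" "sets G = sets T" and f: "conditional_density \<nu> T f"
  shows "prob_space (joint_law \<nu> f G)"
proof (rule prob_spaceI)
  interpret G: prob_space G by fact
  interpret \<nu>: sigma_finite_measure \<nu> by fact
  interpret P: pair_sigma_finite \<nu> G ..
  have s: "sets (\<nu> \<Otimes>\<^sub>M G) = sets (\<nu> \<Otimes>\<^sub>M T)" using G by (intro sets_pair_measure_cong) auto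
  have fm: "(\<lambda>(x, \<theta>). f x \<theta>) \<in> borel_measurable (\<nu> \<Otimes>\<^sub>M G)"
    using f s by (simp add: conditional_density_def cong: measurable_cong_sets)
  have fm': "(\<lambda>(x, \<theta>). ennreal (f x \<theta>)) \<in> borel_measurable (\<nu> \<Otimes>\<^sub>M G)"
    using measurable_compose[OF fm measurable_ennreal] by (simp add: case_prod_beta')
  have "emeasure (joint_law \<nu> f G) (space (joint_law \<nu> f G)) = (\<integral>\<^sup>+z. 1 \<partial>joint_law \<nu> f G)" by simp
  also have "\<dots> = (\<integral>\<^sup>+x. \<integral>\<^sup>+\<theta>. ennreal (f x \<theta>) \<partial>G \<partial>\<nu>)"
    using nn_integral_joint_law(1)[OF G f, of "\<lambda>_. 1"] by simp
  also have "\<dots> = (\<integral>\<^sup>+\<theta>. \<integral>\<^sup>+x. ennreal (f x \<theta>) \<partial>\<nu> \<partial>G)"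
    using P.Fubini'[of "\<lambda>x \<theta>. ennreal (f x \<theta>)"] fm' by simp
  also have "\<dots> = (\<integral>\<^sup>+\<theta>. 1 \<partial>G)"
    by (rule nn_integral_cong) (use f sets_eq_imp_space_eq[OF G(2)] in \<open>simp add: conditional_density_def\<close>)
  finally show "emeasure (joint_law \<nu> f G) (space (joint_law \<nu> f G)) = 1"
    by (simp add: G.emeasure_space_1)
qed

lemma nn_integral_joint_law_mixture:
  assumes G: "prob_space G" "sets G = sets T" and H: "prob_space H" "sets H = sets T" and t: "t \<in> {0..1}"
    and f: "conditional_density \<nu> T f"
    and F: "F \<in> borel_measurable (\<nu> \<Otimes>\<^sub>M T)"
  shows "(\<integral>\<^sup>+z. F z \<partial>joint_law \<nu> f (mixture t G H))
    = ennreal (1 - t) * (\<integral>\<^sup>+z. F z \<partial>joint_law \<nu> f G) + ennreal t * (\<integral>\<^sup>+z. F z \<partial>joint_law \<nu> f H)"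
proof -
  have sHG: "sets H = sets G" using G H by simp
  have M: "prob_space (mixture t G H)" "sets (mixture t G H) = sets T"
    using prob_space_mixture[OF G(1) H(1) sHG t] G by auto
  have s: "sets (\<nu> \<Otimes>\<^sub>M G) = sets (\<nu> \<Otimes>\<^sub>M T)" using G by (intro sets_pair_measure_cong) auto
  have fm: "(\<lambda>(x, \<theta>). f x \<theta>) \<in> borel_measurable (\<nu> \<Otimes>\<^sub>M G)"
    using f s by (simp add: conditional_density_def cong: measurable_cong_sets)
  have m: "(\<lambda>\<theta>. ennreal (f x \<theta>) * F (x, \<theta>)) \<in> borel_measurable G" if "x \<in> space \<nu>" for x
  proof -
    have "(\<lambda>\<theta>. f x \<theta>) \<in> borel_measurable G"
      using measurable_compose[OF measurable_Pair1'[OF that, of G] fm] by simp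
    moreover have "(\<lambda>\<theta>. F (x, \<theta>)) \<in> borel_measurable G"
      using measurable_compose[OF measurable_Pair1'[OF that, of G], of F] F s by (simp cong: measurable_cong_sets)
    ultimately show ?thesis by measurable
  qed
  have "(\<integral>\<^sup>+z. F z \<partial>joint_law \<nu> f (mixture t G H))
      = (\<integral>\<^sup>+x. ennreal (1 - t) * (\<integral>\<^sup>+\<theta>. ennreal (f x \<theta>) * F (x, \<theta>) \<partial>G)
          + ennreal t * (\<integral>\<^sup>+\<theta>. ennreal (f x \<theta>) * F (x, \<theta>) \<partial>H) \<partial>\<nu>)"
    unfolding nn_integral_joint_law(1)[OF M f F]
    by (rule nn_integral_cong) (rule nn_integral_mixture[OF sHG m])
  also have "\<dots> = ennreal (1 - t) * (\<integral>\<^sup>+z. F z \<partial>joint_law \<nu> f G) + ennreal t * (\<integral>\<^sup>+z. F z \<partial>joint_law \<nu> f H)"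
    using nn_integral_joint_law[OF G f F] nn_integral_joint_law[OF H f F]
    by (simp add: nn_integral_add nn_integral_cmult)
  finally show ?thesis .
qed

text \<open>Affinity of the extended-real integral, applied to positive and negative parts;
  integrability at both end points keeps these finite.\<close>

lemma integral_joint_law_mixture:
  assumes G: "prob_space G" "sets G = sets T" and H: "prob_space H" "sets H = sets T" and t: "t \<in> {0..1}"
    and f: "conditional_density \<nu> T f"
    and F: "(F :: 'x \<times> 'p \<Rightarrow> real) \<in> borel_measurable (\<nu> \<Otimes>\<^sub>M T)"
    and iG: "integrable (joint_law \<nu> f G) F" and iH: "integrable (joint_law \<nu> f H) F"
  shows "integrable (joint_law \<nu> f (mixture t G H)) F"
    and "(\<integral>z. F z \<partial>joint_law \<nu> f (mixture t G H)) = (1 - t) * (\<integral>z. F z \<partial>joint_law \<nu> f G) + t * (\<integral>z. F z \<partial>joint_law \<nu> f H)"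
proof -
  let ?J = "joint_law \<nu> f"
  note mix = nn_integral_joint_law_mixture[OF G H t f]
  have M: "sets (mixture t G H) = sets T" using G by simp
  have fin: "(\<integral>\<^sup>+z. ennreal (F z) \<partial>?J K) < \<infinity>" "(\<integral>\<^sup>+z. ennreal (- F z) \<partial>?J K) < \<infinity>"
    if "integrable (?J K) F" for K
    using that by (auto simp: real_integrable_def less_top)
  have m1: "(\<lambda>z. ennreal (F z)) \<in> borel_measurable (\<nu> \<Otimes>\<^sub>M T)" "(\<lambda>z. ennreal (- F z)) \<in> borel_measurable (\<nu> \<Otimes>\<^sub>M T)"
    using F by measurable
  show iM: "integrable (?J (mixture t G H)) F"
    unfolding real_integrable_def mix[OF m1(1)] mix[OF m1(2)]
    using fin[OF iG] fin[OF iH] measurable_joint_law[OF M F]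
    by (auto simp: ennreal_mult_eq_top_iff)
  have e: "enn2real (ennreal (1 - t) * a + ennreal t * b) = (1 - t) * enn2real a + t * enn2real b"
    if "a < \<infinity>" "b < \<infinity>" for a b
    using that t by (cases a; cases b) (auto simp: enn2real_mult enn2real_plus ennreal_mult_less_top)
  show "(\<integral>z. F z \<partial>?J (mixture t G H)) = (1 - t) * (\<integral>z. F z \<partial>?J G) + t * (\<integral>z. F z \<partial>?J H)"
    unfolding real_lebesgue_integral_def[OF iM] real_lebesgue_integral_def[OF iG] real_lebesgue_integral_def[OF iH]
      mix[OF m1(1)] mix[OF m1(2)]
    e[OF fin(1)[OF iG] fin(1)[OF iH]] e[OF fin(2)[OF iG] fin(2)[OF iH]]
    by (simp add: algebra_simps)
qed

lemma complex_integral_joint_law_mixture: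
  assumes G: "prob_space G" "sets G = sets T" and H: "prob_space H" "sets H = sets T" and t: "t \<in> {0..1}"
    and f: "conditional_density \<nu> T f"
    and F: "(F :: 'x \<times> 'p \<Rightarrow> complex) \<in> borel_measurable (\<nu> \<Otimes>\<^sub>M T)"
    and iG: "integrable (joint_law \<nu> f G) F" and iH: "integrable (joint_law \<nu> f H) F"
  shows "integrable (joint_law \<nu> f (mixture t G H)) F"
    and "(\<integral>z. F z \<partial>joint_law \<nu> f (mixture t G H)) = (1 - t) * (\<integral>z. F z \<partial>joint_law \<nu> f G) + t * (\<integral>z. F z \<partial>joint_law \<nu> f H)"
proof -
  let ?J = "joint_law \<nu> f"
  have R: "(\<lambda>z. Re (F z)) \<in> borel_measurable (\<nu> \<Otimes>\<^sub>M T)" "(\<lambda>z. Im (F z)) \<in> borel_measurable (\<nu> \<Otimes>\<^sub>M T)"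
    using F by measurable
  note r = integral_joint_law_mixture[OF G H t f R(1) integrable_Re[OF iG] integrable_Re[OF iH]]
  note i = integral_joint_law_mixture[OF G H t f R(2) integrable_Im[OF iG] integrable_Im[OF iH]]
  have "integrable (?J (mixture t G H)) (\<lambda>z. complex_of_real (Re (F z)) + \<i> * complex_of_real (Im (F z)))"
    using r(1) i(1) by auto
  then show iM: "integrable (?J (mixture t G H)) F" by (simp flip: complex_eq)
  show "(\<integral>z. F z \<partial>?J (mixture t G H)) = (1 - t) * (\<integral>z. F z \<partial>?J G) + t * (\<integral>z. F z \<partial>?J H)"
    by (rule complex_eqI)
      (simp_all add: r(2) i(2) integral_Re[OF iM, symmetric] integral_Im[OF iM, symmetric]
        integral_Re[OF iG, symmetric] integral_Im[OF iG, symmetric]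
        integral_Re[OF iH, symmetric] integral_Im[OF iH, symmetric])
qed

lemma observed_measurable:
  assumes "fst \<in> measurable J M"
  shows "observed n \<in> measurable (iid J n) (iid M n)"
  unfolding observed_def
  by (intro measurable_restrict measurable_compose[of "\<lambda>x. x j" for j, OF _ assms] measurable_component_singleton)

lemma observed_upd: "observed (Suc n) (fun_upd \<omega> n z) = fun_upd (observed n \<omega>) n (fst z)"
  by (auto simp: observed_def fun_eq_iff restrict_def)

text \<open>The unobserved parameters are integrated out one observation at a time: by
  \<open>mq\<close>, the complex measure with density \<open>m\<close> on \<open>J\<close>,
  projected to the first component, has density \<open>q\<close> with respect to \<open>M\<close>.
  In the induction step the last coordinate is absorbed into the test function. \<open>M\<close> is
  a reference law of the observations, in the application that under \<open>G0\<close>, while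
  \<open>J\<close> belongs to another point of a curve.\<close>

lemma integral_sample_observed:
  fixes m :: "'x \<times> 'p \<Rightarrow> complex" and q :: "'x \<Rightarrow> complex"
  assumes J: "prob_space J" and fst_J: "fst \<in> measurable J M" and M: "prob_space M"
    and m: "m \<in> borel_measurable J" "\<And>z. cmod (m z) \<le> 1"
    and q: "integrable M q"
    and mq: "\<And>\<phi> B. \<phi> \<in> borel_measurable M \<Longrightarrow> (\<And>x. cmod (\<phi> x) \<le> B) \<Longrightarrow>
      (\<integral>z. \<phi> (fst z) * m z \<partial>J) = (\<integral>x. \<phi> x * q x \<partial>M)"
    and \<Phi>: "\<Phi> \<in> borel_measurable (iid M n)" "\<And>x. cmod (\<Phi> x) \<le> B"
  shows "(\<integral>\<omega>. \<Phi> (observed n \<omega>) * (\<Prod>j<n. m (\<omega> j)) \<partial>iid J n) = (\<integral>x. \<Phi> x * (\<Prod>j<n. q (x j)) \<partial>iid M n)"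
  using \<Phi>
proof (induction n arbitrary: \<Phi> B)
  case 0
  interpret J0: prob_space "iid J 0" by (intro prob_space_PiM J)
  interpret M0: prob_space "iid M 0" by (intro prob_space_PiM M)
  have "(\<integral>\<omega>. \<Phi> (observed 0 \<omega>) \<partial>iid J 0) = (\<integral>\<omega>. \<Phi> (\<lambda>_. undefined) \<partial>iid J 0)"
    by (simp add: observed_def restrict_def)
  moreover have "(\<integral>x. \<Phi> x \<partial>iid M 0) = (\<integral>x. \<Phi> (\<lambda>_. undefined) \<partial>iid M 0)"
    by (rule Bochner_Integration.integral_cong) (auto simp: space_PiM)
  ultimately show ?case using J0.prob_space M0.prob_space by simp
next
  case (Suc n)
  interpret J: prob_space J by (rule J)
  interpret M: prob_space M by (rule M)
  interpret PJ: product_sigma_finite "\<lambda>_::nat. J" by standard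
  interpret PM: product_sigma_finite "\<lambda>_::nat. M" by standard
  interpret Jn: prob_space "iid J n" by (intro prob_space_PiM J)
  interpret Mn: prob_space "iid M n" by (intro prob_space_PiM M)
  note [measurable] = Suc.prems(1) m(1) borel_measurable_integrable[OF q]
  have [measurable]: "observed k \<in> measurable (iid J k) (iid M k)" for k
    by (rule observed_measurable[OF fst_J])
  have ins: "{..<Suc n} = insert n {..<n}" by auto
  have mi: "integrable J m" by (rule J.integrable_const_bound[of _ 1]) (use m in auto)
  have Pj: "integrable (iid J k) (\<lambda>\<omega>. \<Prod>j<k. m (\<omega> j))" for k
    using J.integrable_iid_prod[of k "\<lambda>_. m"] mi by simp
  have Pq: "integrable (iid M k) (\<lambda>x. \<Prod>j<k. q (x j))" for k
    using M.integrable_iid_prod[of k "\<lambda>_. q"] q by simp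
  have bm: "integrable N (\<lambda>x. F x * G x)"
    if "integrable N G" "F \<in> borel_measurable N" "\<And>x. cmod (F x) \<le> b"
    for N :: "'c measure" and F G :: "'c \<Rightarrow> complex" and b
  proof (rule Bochner_Integration.integrable_bound[of N "\<lambda>x. of_real b * G x"])
    show "integrable N (\<lambda>x. of_real b * G x)" using that(1) by simp
    show "(\<lambda>x. F x * G x) \<in> borel_measurable N" using that by measurable
    have "norm (F x * G x) \<le> norm (of_real b * G x)" for x
      using that(3)[of x] by (simp add: norm_mult mult_right_mono)
    then show "AE x in N. norm (F x * G x) \<le> norm (of_real b * G x)" by simp
  qed
  define \<Phi>' where "\<Phi>' y = (\<integral>x. \<Phi> (fun_upd y n x) * q x \<partial>M)" for y
  have upd [measurable]: "(\<lambda>(y, x). fun_upd y n x) \<in> measurable (iid M n \<Otimes>\<^sub>M M) (iid M (Suc n))"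
    unfolding ins by (rule measurable_add_dim)
  have \<Phi>'m: "\<Phi>' \<in> borel_measurable (iid M n)"
  proof -
    have "(\<lambda>(y, x). \<Phi> (fun_upd y n x)) \<in> borel_measurable (iid M n \<Otimes>\<^sub>M M)"
      using measurable_compose[OF upd Suc.prems(1)] by (simp add: case_prod_beta')
    then have "(\<lambda>(y, x). \<Phi> (fun_upd y n x) * q x) \<in> borel_measurable (iid M n \<Otimes>\<^sub>M M)"
      by measurable
    then show ?thesis unfolding \<Phi>'_def by (rule M.borel_measurable_lebesgue_integral)
  qed
  have \<phi>m: "(\<lambda>x. \<Phi> (fun_upd y n x)) \<in> borel_measurable M" if "y \<in> space (iid M n)" for y
  proof -
    have "(\<lambda>x. (y, x)) \<in> measurable M (iid M n \<Otimes>\<^sub>M M)" using that by (rule measurable_Pair1')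
    from measurable_compose[OF this measurable_compose[OF upd Suc.prems(1)]]
    show ?thesis by (simp add: fun_upd_def)
  qed
  \<comment> \<open>The bound must hold for every \<open>y\<close>, also where the integrand fails
    to be integrable; there the integral is 0 by convention.\<close>
  have \<Phi>'b: "cmod (\<Phi>' y) \<le> \<bar>B\<bar> * (\<integral>x. cmod (q x) \<partial>M)" for y
  proof -
    have "cmod (\<Phi>' y) \<le> (\<integral>x. \<bar>B\<bar> * cmod (q x) \<partial>M)"
      unfolding \<Phi>'_def
    proof (cases "integrable M (\<lambda>x. \<Phi> (fun_upd y n x) * q x)")
      case True
      then show "cmod (\<integral>x. \<Phi> (fun_upd y n x) * q x \<partial>M) \<le> (\<integral>x. \<bar>B\<bar> * cmod (q x) \<partial>M)"
        by (intro order_trans[OF integral_norm_bound integral_mono] integrable_norm)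
          (use q Suc.prems(2) in \<open>auto simp: norm_mult intro!: mult_right_mono order_trans[OF _ abs_ge_self]\<close>)
    qed (simp add: not_integrable_integral_eq)
    then show ?thesis by simp
  qed
  let ?F = "\<lambda>\<omega>. \<Phi> (observed (Suc n) \<omega>) * (\<Prod>j<Suc n. m (\<omega> j))"
  let ?G = "\<lambda>x. \<Phi> x * (\<Prod>j<Suc n. q (x j))"
  have Fi: "integrable (iid J (Suc n)) ?F"
    by (rule bm[OF Pj, of _ _ B])
      (rule measurable_compose[OF observed_measurable[OF fst_J] Suc.prems(1)] Suc.prems(2))+
  have Gi: "integrable (iid M (Suc n)) ?G"
    by (rule bm[OF Pq, of _ _ B]) (use Suc.prems in auto)
  have "(\<integral>\<omega>. ?F \<omega> \<partial>iid J (Suc n)) = (\<integral>\<omega>. (\<integral>z. ?F (fun_upd \<omega> n z) \<partial>J) \<partial>iid J n)"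
    using PJ.product_integral_insert[of "{..<n}" n ?F] Fi unfolding ins by simp
  also have "\<dots> = (\<integral>\<omega>. \<Phi>' (observed n \<omega>) * (\<Prod>j<n. m (\<omega> j)) \<partial>iid J n)"
  proof (rule Bochner_Integration.integral_cong[OF refl])
    fix \<omega> assume "\<omega> \<in> space (iid J n)"
    then have o: "observed n \<omega> \<in> space (iid M n)" by (rule measurable_space[OF observed_measurable[OF fst_J]])
    have "(\<integral>z. ?F (fun_upd \<omega> n z) \<partial>J)
        = (\<integral>z. (\<Prod>j<n. m (\<omega> j)) * (\<Phi> (fun_upd (observed n \<omega>) n (fst z)) * m z) \<partial>J)"
      by (simp add: observed_upd ac_simps)
    also have "\<dots> = (\<Prod>j<n. m (\<omega> j)) * (\<integral>z. \<Phi> (fun_upd (observed n \<omega>) n (fst z)) * m z \<partial>J)"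
      by (rule integral_mult_right_zero)
    also have "(\<integral>z. \<Phi> (fun_upd (observed n \<omega>) n (fst z)) * m z \<partial>J) = \<Phi>' (observed n \<omega>)"
      unfolding \<Phi>'_def by (rule mq[OF \<phi>m[OF o] Suc.prems(2)])
    finally show "(\<integral>z. ?F (fun_upd \<omega> n z) \<partial>J) = \<Phi>' (observed n \<omega>) * (\<Prod>j<n. m (\<omega> j))"
      by (simp add: mult.commute fun_upd_def)
  qed
  also have "\<dots> = (\<integral>y. \<Phi>' y * (\<Prod>j<n. q (y j)) \<partial>iid M n)"
    by (rule Suc.IH[OF \<Phi>'m \<Phi>'b])
  also have "\<dots> = (\<integral>y. (\<integral>x. ?G (fun_upd y n x) \<partial>M) \<partial>iid M n)"
  proof (rule Bochner_Integration.integral_cong[OF refl])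
    fix y
    have "(\<integral>x. ?G (fun_upd y n x) \<partial>M) = (\<integral>x. (\<Prod>j<n. q (y j)) * (\<Phi> (fun_upd y n x) * q x) \<partial>M)"
      by (simp add: ac_simps)
    also have "\<dots> = (\<Prod>j<n. q (y j)) * \<Phi>' y"
      unfolding \<Phi>'_def by (rule integral_mult_right_zero)
    finally show "\<Phi>' y * (\<Prod>j<n. q (y j)) = (\<integral>x. ?G (fun_upd y n x) \<partial>M)" by (simp add: mult.commute fun_upd_def)
  qed
  also have "\<dots> = (\<integral>x. ?G x \<partial>iid M (Suc n))"
    using PM.product_integral_insert[of "{..<n}" n ?G] Gi unfolding ins by simp
  finally show ?case .
qed

section \<open>Conditional expectations under the base law\<close>

text \<open>With \<open>\<mu>\<close> the law of \<open>X\<close> under \<open>G0\<close> and \<open>\<kappa> = f / f\<^sub>0\<close>, the joint law of every \<open>G\<close> whose marginal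
  is dominated by \<open>\<mu>\<close> has density \<open>\<kappa>\<close> with respect to \<open>\<mu> \<otimes> G\<close>.  Thus \<open>cnd G F\<close> is the conditional
  expectation of \<open>F\<close> given \<open>X\<close> under \<open>G\<close>, multiplied by the likelihood ratio \<open>lr G = cnd G 1\<close>.\<close>

locale base_model = sigma_finite_measure \<nu> for \<nu> :: "'x measure" +
  fixes T :: "'p measure" and f :: "'x \<Rightarrow> 'p \<Rightarrow> real" and G0 :: "'p measure"
  assumes f: "conditional_density \<nu> T f"
    and G0: "prob_space G0" "sets G0 = sets T"
begin

definition f0 :: "'x \<Rightarrow> ennreal" where "f0 = marginal_density f G0"

definition \<mu> :: "'x measure" where "\<mu> = density \<nu> f0"

text \<open>\<open>enn2real\<close> sends 0 and \<infinity> to 0 and division by 0 gives 0, so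
  \<open>\<kappa>\<close> vanishes where \<open>f0\<close> is 0 or infinite; both sets are
  \<mu>-null.\<close>

definition \<kappa> :: "'x \<Rightarrow> 'p \<Rightarrow> real" where "\<kappa> x \<theta> = f x \<theta> / enn2real (f0 x)"

definition cnd :: "'p measure \<Rightarrow> ('x \<Rightarrow> 'p \<Rightarrow> 'b::{banach,second_countable_topology}) \<Rightarrow> 'x \<Rightarrow> 'b" where
  "cnd G F x = (\<integral>\<theta>. \<kappa> x \<theta> *\<^sub>R F x \<theta> \<partial>G)"

definition lr :: "'p measure \<Rightarrow> 'x \<Rightarrow> real" where "lr G = cnd G (\<lambda>_ _. 1)"

text \<open>Only the marginal laws of X are compared; as a law of the parameter, \<open>G\<close>
  may be singular to \<open>G0\<close>.\<close>

definition dominated :: "'p measure \<Rightarrow> bool" where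
  "dominated G \<longleftrightarrow> prob_space G \<and> sets G = sets T \<and> (AE x in \<nu>. f0 x = 0 \<longrightarrow> marginal_density f G x = 0)"

abbreviation J :: "'p measure \<Rightarrow> ('x \<times> 'p) measure" where "J \<equiv> joint_law \<nu> f"

lemma f_measurable: "(\<lambda>(x, \<theta>). f x \<theta>) \<in> borel_measurable (\<nu> \<Otimes>\<^sub>M T)"
  using f by (simp add: conditional_density_def)

lemma marginal_density_measurable:
  "prob_space G \<Longrightarrow> sets G = sets T \<Longrightarrow> marginal_density f G \<in> borel_measurable \<nu>"
  using nn_integral_joint_law(2)[OF _ _ f, of G "\<lambda>_. 1"] by (simp add: marginal_density_def[abs_def])

lemma nn_integral_marginal_density:
  assumes "prob_space G" "sets G = sets T"
  shows "(\<integral>\<^sup>+x. marginal_density f G x \<partial>\<nu>) = 1"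
proof -
  interpret JG: prob_space "J G" by (rule prob_space_joint_law[OF sigma_finite_measure_axioms assms f])
  have "(\<integral>\<^sup>+z. 1 \<partial>J G) = (\<integral>\<^sup>+x. marginal_density f G x \<partial>\<nu>)"
    using nn_integral_joint_law(1)[OF assms f, of "\<lambda>_. 1"] by (simp add: marginal_density_def[abs_def])
  then show ?thesis by (simp add: JG.emeasure_space_1)
qed

lemma f0_measurable [measurable]: "f0 \<in> borel_measurable \<nu>"
  unfolding f0_def by (rule marginal_density_measurable[OF G0])

lemma f0_finite: "AE x in \<nu>. f0 x \<noteq> \<infinity>"
  by (rule nn_integral_PInf_AE[OF f0_measurable])
    (use nn_integral_marginal_density[OF G0] in \<open>simp add: f0_def\<close>)

lemma sets_\<mu> [simp, measurable_cong]: "sets \<mu> = sets \<nu>" and space_\<mu> [simp]: "space \<mu> = space \<nu>"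
  by (simp_all add: \<mu>_def)

lemma prob_space_\<mu>: "prob_space \<mu>"
  by (rule prob_spaceI)
    (use nn_integral_marginal_density[OF G0] in \<open>simp add: \<mu>_def f0_def[symmetric] emeasure_density nn_integral_indicator_finite\<close>)

lemma AE_\<mu>: "(AE x in \<mu>. P x) \<longleftrightarrow> (AE x in \<nu>. 0 < f0 x \<longrightarrow> P x)"
  unfolding \<mu>_def by (rule AE_density) simp

lemma f0_pos: "AE x in \<mu>. 0 < f0 x \<and> f0 x < \<infinity>"
  unfolding AE_\<mu> using f0_finite by eventually_elim (simp add: less_top)

lemma dominated_G0: "dominated G0"
  using G0 by (simp add: dominated_def f0_def)

lemma \<kappa>_measurable [measurable]: "(\<lambda>(x, \<theta>). \<kappa> x \<theta>) \<in> borel_measurable (\<nu> \<Otimes>\<^sub>M T)"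
proof -
  note f_measurable [measurable]
  have "(\<lambda>z. (case z of (x, \<theta>) \<Rightarrow> f x \<theta>) / enn2real (f0 (fst z))) \<in> borel_measurable (\<nu> \<Otimes>\<^sub>M T)"
    by measurable
  then show ?thesis by (simp add: \<kappa>_def case_prod_beta')
qed

lemma \<kappa>_nonneg: "x \<in> space \<nu> \<Longrightarrow> \<theta> \<in> space T \<Longrightarrow> 0 \<le> \<kappa> x \<theta>"
  using f by (simp add: \<kappa>_def conditional_density_def)

context
  fixes G assumes G: "dominated G"
begin

lemma dominated_prob: "prob_space G" and dominated_sets: "sets G = sets T" and dominated_space: "space G = space T"
  using G sets_eq_imp_space_eq[of G T] by (auto simp: dominated_def)

lemma sets_pair_G: "sets (\<mu> \<Otimes>\<^sub>M G) = sets (\<nu> \<Otimes>\<^sub>M T)"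
  using dominated_sets by (intro sets_pair_measure_cong) auto

lemma measurable_pair_G: "F \<in> borel_measurable (\<nu> \<Otimes>\<^sub>M T) \<Longrightarrow> F \<in> borel_measurable (\<mu> \<Otimes>\<^sub>M G)"
  using sets_pair_G by (simp cong: measurable_cong_sets)

lemma prob_space_J: "prob_space (J G)"
  by (rule prob_space_joint_law[OF sigma_finite_measure_axioms dominated_prob dominated_sets f])

lemma sets_J: "sets (J G) = sets (\<nu> \<Otimes>\<^sub>M T)"
  by (rule sets_joint_law[OF dominated_sets])

lemma measurable_J: "F \<in> measurable (\<nu> \<Otimes>\<^sub>M T) N \<Longrightarrow> F \<in> measurable (J G) N"
  using sets_J by (simp cong: measurable_cong_sets)

lemma pair_sigma_finite_G: "pair_sigma_finite \<mu> G"
  using prob_space_\<mu> dominated_prob by (simp add: pair_sigma_finite_def prob_space_imp_sigma_finite)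

text \<open>Where \<open>f0\<close> is finite and positive, \<open>f0 * \<kappa> = f\<close>. Where
  \<open>f0 = 0\<close>, domination makes the marginal density of \<open>G\<close> vanish, so
  \<open>f x\<close> is 0 almost surely under \<open>G\<close> and both integrands are 0.\<close>

lemma nn_integral_J:
  assumes F: "F \<in> borel_measurable (\<nu> \<Otimes>\<^sub>M T)"
  shows "(\<integral>\<^sup>+z. F z \<partial>J G) = (\<integral>\<^sup>+x. \<integral>\<^sup>+\<theta>. ennreal (\<kappa> x \<theta>) * F (x, \<theta>) \<partial>G \<partial>\<mu>)"
proof -
  interpret G: prob_space G by (rule dominated_prob)
  interpret P: pair_sigma_finite \<mu> G by (rule pair_sigma_finite_G)
  have m: "(\<lambda>z. ennreal (case z of (x, \<theta>) \<Rightarrow> \<kappa> x \<theta>) * F z) \<in> borel_measurable (\<mu> \<Otimes>\<^sub>M G)"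
    using F \<kappa>_measurable by (intro measurable_pair_G borel_measurable_times measurable_compose[OF \<kappa>_measurable measurable_ennreal]) auto
  have M: "(\<lambda>x. \<integral>\<^sup>+\<theta>. ennreal (\<kappa> x \<theta>) * F (x, \<theta>) \<partial>G) \<in> borel_measurable \<nu>"
    using G.borel_measurable_nn_integral_fst[OF m] by (simp cong: measurable_cong_sets)
  have AEm: "AE x in \<nu>. f0 x = 0 \<longrightarrow> marginal_density f G x = 0"
    using G by (simp add: dominated_def)
  have "(\<integral>\<^sup>+x. \<integral>\<^sup>+\<theta>. ennreal (\<kappa> x \<theta>) * F (x, \<theta>) \<partial>G \<partial>\<mu>)
     = (\<integral>\<^sup>+x. f0 x * (\<integral>\<^sup>+\<theta>. ennreal (\<kappa> x \<theta>) * F (x, \<theta>) \<partial>G) \<partial>\<nu>)"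
    unfolding \<mu>_def by (rule nn_integral_density) (auto simp: M)
  also have "\<dots> = (\<integral>\<^sup>+x. \<integral>\<^sup>+\<theta>. ennreal (f x \<theta>) * F (x, \<theta>) \<partial>G \<partial>\<nu>)"
  proof (rule nn_integral_cong_AE, use f0_finite AEm AE_space in eventually_elim)
    fix x assume fin: "f0 x \<noteq> \<infinity>" and null: "f0 x = 0 \<longrightarrow> marginal_density f G x = 0" and x: "x \<in> space \<nu>"
    have fx [measurable]: "(\<lambda>\<theta>. f x \<theta>) \<in> borel_measurable G"
      using measurable_compose[OF measurable_Pair1'[OF x] f_measurable] dominated_sets
      by (simp cong: measurable_cong_sets)
    have Fx [measurable]: "(\<lambda>\<theta>. F (x, \<theta>)) \<in> borel_measurable G"
      using measurable_compose[OF measurable_Pair1'[OF x] F] dominated_sets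
      by (simp cong: measurable_cong_sets)
    have kx [measurable]: "(\<lambda>\<theta>. \<kappa> x \<theta>) \<in> borel_measurable G"
      unfolding \<kappa>_def by measurable
    show "f0 x * (\<integral>\<^sup>+\<theta>. ennreal (\<kappa> x \<theta>) * F (x, \<theta>) \<partial>G) = (\<integral>\<^sup>+\<theta>. ennreal (f x \<theta>) * F (x, \<theta>) \<partial>G)"
    proof (cases "f0 x = 0")
      case True
      then have "(\<integral>\<^sup>+\<theta>. ennreal (f x \<theta>) \<partial>G) = 0" using null by (simp add: marginal_density_def)
      then have "AE \<theta> in G. ennreal (f x \<theta>) = 0" by (subst (asm) nn_integral_0_iff_AE) auto
      then have "(\<integral>\<^sup>+\<theta>. ennreal (f x \<theta>) * F (x, \<theta>) \<partial>G) = (\<integral>\<^sup>+\<theta>. 0 \<partial>G)"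
        by (intro nn_integral_cong_AE) auto
      then show ?thesis using True by simp
    next
      case False
      obtain c where c: "f0 x = ennreal c" "c > 0"
        using fin False by (cases "f0 x") (auto simp: less_le)
      have "f0 x * (\<integral>\<^sup>+\<theta>. ennreal (\<kappa> x \<theta>) * F (x, \<theta>) \<partial>G) = (\<integral>\<^sup>+\<theta>. f0 x * (ennreal (\<kappa> x \<theta>) * F (x, \<theta>)) \<partial>G)"
        by (rule nn_integral_cmult[symmetric]) measurable
      also have "\<dots> = (\<integral>\<^sup>+\<theta>. ennreal (f x \<theta>) * F (x, \<theta>) \<partial>G)"
        using c by (intro nn_integral_cong) (simp add: \<kappa>_def mult.assoc[symmetric] flip: ennreal_mult')
      finally show ?thesis .
    qed
  qed
  also have "\<dots> = (\<integral>\<^sup>+z. F z \<partial>J G)"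
    by (rule nn_integral_joint_law(1)[OF dominated_prob dominated_sets f F, symmetric])
  finally show ?thesis by simp
qed

text \<open>In the form of a density on a product measure the joint law is open to Fubini for
  Bochner integrals, which the properties of \<open>cnd\<close> rest on.\<close>

lemma J_eq_density: "J G = density (\<mu> \<Otimes>\<^sub>M G) (\<lambda>z. ennreal (\<kappa> (fst z) (snd z)))"
proof (rule measure_eqI)
  interpret G: prob_space G by (rule dominated_prob)
  show "sets (J G) = sets (density (\<mu> \<Otimes>\<^sub>M G) (\<lambda>z. ennreal (\<kappa> (fst z) (snd z))))"
    using sets_J sets_pair_G by simp
  fix A assume "A \<in> sets (J G)"
  then have A: "A \<in> sets (\<nu> \<Otimes>\<^sub>M T)" "A \<in> sets (\<mu> \<Otimes>\<^sub>M G)" using sets_J sets_pair_G by auto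
  have km: "(\<lambda>z. ennreal (\<kappa> (fst z) (snd z))) \<in> borel_measurable (\<nu> \<Otimes>\<^sub>M T)"
    using measurable_compose[OF \<kappa>_measurable measurable_ennreal] by (simp add: case_prod_beta')
  have "emeasure (J G) A = (\<integral>\<^sup>+z. indicator A z \<partial>J G)" using A sets_J by simp
  also have "\<dots> = (\<integral>\<^sup>+x. \<integral>\<^sup>+\<theta>. ennreal (\<kappa> x \<theta>) * indicator A (x, \<theta>) \<partial>G \<partial>\<mu>)"
    by (rule nn_integral_J) (use A in simp)
  also have "\<dots> = (\<integral>\<^sup>+z. ennreal (\<kappa> (fst z) (snd z)) * indicator A z \<partial>(\<mu> \<Otimes>\<^sub>M G))"
    using G.nn_integral_fst[of "\<lambda>z. ennreal (\<kappa> (fst z) (snd z)) * indicator A z" \<mu>]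
      measurable_pair_G[OF km] A by simp
  also have "\<dots> = emeasure (density (\<mu> \<Otimes>\<^sub>M G) (\<lambda>z. ennreal (\<kappa> (fst z) (snd z)))) A"
    by (rule emeasure_density[symmetric]) (use measurable_pair_G[OF km] A in auto)
  finally show "emeasure (J G) A = emeasure (density (\<mu> \<Otimes>\<^sub>M G) (\<lambda>z. ennreal (\<kappa> (fst z) (snd z)))) A" .
qed

lemma
  fixes F :: "'x \<Rightarrow> 'p \<Rightarrow> 'b::{banach,second_countable_topology}"
  assumes F: "(\<lambda>(x, \<theta>). F x \<theta>) \<in> borel_measurable (\<nu> \<Otimes>\<^sub>M T)"
  shows cnd_measurable: "cnd G F \<in> borel_measurable \<nu>"
    and cnd_AE_integrable: "integrable (J G) (\<lambda>z. F (fst z) (snd z)) \<Longrightarrow> AE x in \<mu>. integrable G (\<lambda>\<theta>. \<kappa> x \<theta> *\<^sub>R F x \<theta>)"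
    and cnd_integrable: "integrable (J G) (\<lambda>z. F (fst z) (snd z)) \<Longrightarrow> integrable \<mu> (cnd G F)"
    and cnd_integral: "integrable (J G) (\<lambda>z. F (fst z) (snd z)) \<Longrightarrow> (\<integral>x. cnd G F x \<partial>\<mu>) = (\<integral>z. F (fst z) (snd z) \<partial>J G)"
proof -
  interpret G: prob_space G by (rule dominated_prob)
  interpret P: pair_sigma_finite \<mu> G by (rule pair_sigma_finite_G)
  have km: "(\<lambda>z. \<kappa> (fst z) (snd z)) \<in> borel_measurable (\<mu> \<Otimes>\<^sub>M G)"
    using measurable_pair_G[OF \<kappa>_measurable] by (simp add: case_prod_beta')
  have Fm: "(\<lambda>z. F (fst z) (snd z)) \<in> borel_measurable (\<mu> \<Otimes>\<^sub>M G)"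
    using measurable_pair_G[OF F] by (simp add: case_prod_beta')
  have kF: "(\<lambda>(x, \<theta>). \<kappa> x \<theta> *\<^sub>R F x \<theta>) \<in> borel_measurable (\<mu> \<Otimes>\<^sub>M G)"
    using borel_measurable_scaleR[OF km Fm] by (simp add: case_prod_beta')
  have nn: "AE z in \<mu> \<Otimes>\<^sub>M G. 0 \<le> \<kappa> (fst z) (snd z)"
    by (rule AE_I2) (auto simp: space_pair_measure dominated_space intro!: \<kappa>_nonneg)
  show "cnd G F \<in> borel_measurable \<nu>"
    unfolding cnd_def using G.borel_measurable_lebesgue_integral[OF kF] by (simp cong: measurable_cong_sets)
  assume i: "integrable (J G) (\<lambda>z. F (fst z) (snd z))"
  then have i': "integrable (\<mu> \<Otimes>\<^sub>M G) (\<lambda>(x, \<theta>). \<kappa> x \<theta> *\<^sub>R F x \<theta>)"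
    unfolding J_eq_density integrable_density[OF Fm km nn] by (simp add: case_prod_beta')
  show "AE x in \<mu>. integrable G (\<lambda>\<theta>. \<kappa> x \<theta> *\<^sub>R F x \<theta>)" by (rule P.AE_integrable_fst[OF i'])
  show "integrable \<mu> (cnd G F)" unfolding cnd_def by (rule P.integrable_fst[OF i'])
  show "(\<integral>x. cnd G F x \<partial>\<mu>) = (\<integral>z. F (fst z) (snd z) \<partial>J G)"
    unfolding cnd_def P.integral_fst[OF i'] J_eq_density integral_density[OF Fm km nn]
    by (simp add: case_prod_beta')
qed

lemma integrable_J_bounded:
  fixes F :: "'x \<times> 'p \<Rightarrow> 'b::{banach,second_countable_topology}"
  assumes "F \<in> borel_measurable (\<nu> \<Otimes>\<^sub>M T)" "\<And>z. norm (F z) \<le> B"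
  shows "integrable (J G) F"
proof -
  interpret JG: prob_space "J G" by (rule prob_space_J)
  show ?thesis by (rule JG.integrable_const_bound[of _ B]) (use assms measurable_J in auto)
qed

lemma lr_integrable: "integrable \<mu> (lr G)" and lr_integral: "(\<integral>x. lr G x \<partial>\<mu>) = 1"
  and lr_AE_integrable: "AE x in \<mu>. integrable G (\<lambda>\<theta>. \<kappa> x \<theta>)"
  and lr_measurable: "lr G \<in> borel_measurable \<nu>"
proof -
  interpret JG: prob_space "J G" by (rule prob_space_J)
  have i: "integrable (J G) (\<lambda>z. 1::real)" by simp
  have m: "(\<lambda>(x, \<theta>). 1::real) \<in> borel_measurable (\<nu> \<Otimes>\<^sub>M T)" by (simp add: case_prod_beta')
  show "integrable \<mu> (lr G)" unfolding lr_def by (rule cnd_integrable[OF m i])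
  have "(\<integral>x. lr G x \<partial>\<mu>) = (\<integral>z. 1 \<partial>J G)" unfolding lr_def by (rule cnd_integral[OF m i])
  then show "(\<integral>x. lr G x \<partial>\<mu>) = 1" by (simp add: JG.prob_space)
  have "AE x in \<mu>. integrable G (\<lambda>\<theta>. \<kappa> x \<theta> *\<^sub>R (1::real))" by (rule cnd_AE_integrable[OF m i])
  then show "AE x in \<mu>. integrable G (\<lambda>\<theta>. \<kappa> x \<theta>)" by simp
  show "lr G \<in> borel_measurable \<nu>" unfolding lr_def by (rule cnd_measurable[OF m])
qed

lemma lr_nonneg: "x \<in> space \<nu> \<Longrightarrow> 0 \<le> lr G x"
  unfolding lr_def cnd_def by (rule integral_nonneg_AE, rule AE_I2) (auto simp: dominated_space intro: \<kappa>_nonneg)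

lemma cnd_mult:
  fixes F :: "'x \<Rightarrow> 'p \<Rightarrow> 'b::{real_normed_field,banach,second_countable_topology}"
  shows "cnd G (\<lambda>x \<theta>. \<phi> x * F x \<theta>) x = \<phi> x * cnd G F x"
  unfolding cnd_def by (subst integral_mult_right_zero[symmetric]) simp

lemma cnd_norm_le: "x \<in> space \<nu> \<Longrightarrow> norm (cnd G F x) \<le> cnd G (\<lambda>x \<theta>. norm (F x \<theta>)) x"
  unfolding cnd_def
proof (rule order_trans[OF integral_norm_bound], rule eq_refl, rule Bochner_Integration.integral_cong[OF refl])
  fix \<theta> assume "x \<in> space \<nu>" "\<theta> \<in> space G"
  then show "norm (\<kappa> x \<theta> *\<^sub>R F x \<theta>) = \<kappa> x \<theta> *\<^sub>R norm (F x \<theta>)"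
    using \<kappa>_nonneg dominated_space by simp
qed

text \<open>One direction is Fubini. For the converse the norm is integrated as a nonnegative
  function, where the inner integral over the parameter produces \<open>lr G x\<close>.\<close>

lemma
  fixes \<phi> :: "'x \<Rightarrow> real"
  assumes \<phi>: "\<phi> \<in> borel_measurable \<nu>"
  shows integrable_J_fst: "integrable (J G) (\<lambda>z. \<phi> (fst z)) \<longleftrightarrow> integrable \<mu> (\<lambda>x. \<phi> x * lr G x)"
    and integral_J_fst: "integrable \<mu> (\<lambda>x. \<phi> x * lr G x) \<Longrightarrow> (\<integral>z. \<phi> (fst z) \<partial>J G) = (\<integral>x. \<phi> x * lr G x \<partial>\<mu>)"
proof -
  have \<phi>m: "(\<lambda>(x, \<theta>). \<phi> x) \<in> borel_measurable (\<nu> \<Otimes>\<^sub>M T)"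
    using measurable_compose[OF measurable_fst \<phi>] by (simp add: case_prod_beta')
  have c: "cnd G (\<lambda>x \<theta>. \<phi> x) = (\<lambda>x. \<phi> x * lr G x)"
    unfolding lr_def using cnd_mult[of \<phi> "\<lambda>_ _. 1::real"] by (simp add: fun_eq_iff)
  have 1: "integrable \<mu> (\<lambda>x. \<phi> x * lr G x)" if "integrable (J G) (\<lambda>z. \<phi> (fst z))"
    using cnd_integrable[OF \<phi>m] that unfolding c by simp
  have 2: "integrable (J G) (\<lambda>z. \<phi> (fst z))" if i: "integrable \<mu> (\<lambda>x. \<phi> x * lr G x)"
  proof -
    have \<phi>f: "(\<lambda>z. \<phi> (fst z)) \<in> borel_measurable (\<nu> \<Otimes>\<^sub>M T)" using \<phi>m by (simp add: case_prod_beta')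
    have "(\<integral>\<^sup>+z. ennreal (norm (\<phi> (fst z))) \<partial>J G) = (\<integral>\<^sup>+x. \<integral>\<^sup>+\<theta>. ennreal (\<kappa> x \<theta>) * ennreal (norm (\<phi> x)) \<partial>G \<partial>\<mu>)"
      using nn_integral_J[of "\<lambda>z. ennreal (norm (\<phi> (fst z)))"] \<phi>f by simp
    also have "\<dots> = (\<integral>\<^sup>+x. ennreal (norm (\<phi> x * lr G x)) \<partial>\<mu>)"
    proof (rule nn_integral_cong_AE, use lr_AE_integrable AE_space in eventually_elim)
      fix x assume k: "integrable G (\<lambda>\<theta>. \<kappa> x \<theta>)" and x: "x \<in> space \<mu>"
      have "(\<integral>\<^sup>+\<theta>. ennreal (\<kappa> x \<theta>) \<partial>G) = ennreal (lr G x)"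
        unfolding lr_def cnd_def using k x
        by (subst nn_integral_eq_integral) (auto intro!: AE_I2 \<kappa>_nonneg simp: dominated_space)
      then have "(\<integral>\<^sup>+\<theta>. ennreal (\<kappa> x \<theta>) * ennreal (norm (\<phi> x)) \<partial>G) = ennreal (lr G x) * ennreal (norm (\<phi> x))"
        using k by (subst nn_integral_multc) auto
      then show "(\<integral>\<^sup>+\<theta>. ennreal (\<kappa> x \<theta>) * ennreal (norm (\<phi> x)) \<partial>G) = ennreal (norm (\<phi> x * lr G x))"
        using lr_nonneg x by (simp add: abs_mult ennreal_mult' mult.commute)
    qed
    also have "\<dots> < \<infinity>" using i by (simp add: integrable_iff_bounded)
    finally show ?thesis using measurable_J[OF \<phi>f] by (simp add: integrable_iff_bounded)
  qed
  show "integrable (J G) (\<lambda>z. \<phi> (fst z)) \<longleftrightarrow> integrable \<mu> (\<lambda>x. \<phi> x * lr G x)" using 1 2 by blast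
  show "(\<integral>z. \<phi> (fst z) \<partial>J G) = (\<integral>x. \<phi> x * lr G x \<partial>\<mu>)" if "integrable \<mu> (\<lambda>x. \<phi> x * lr G x)"
    using cnd_integral[OF \<phi>m 2[OF that]] unfolding c by simp
qed

end

lemma lr_G0: "AE x in \<mu>. lr G0 x = 1"
  using f0_pos AE_space
proof eventually_elim
  fix x assume x: "0 < f0 x \<and> f0 x < \<infinity>" "x \<in> space \<mu>"
  have fx: "(\<lambda>\<theta>. f x \<theta>) \<in> borel_measurable G0"
    using measurable_compose[OF measurable_Pair1' f_measurable, of x] x G0(2) by (simp cong: measurable_cong_sets)
  have "(\<integral>\<theta>. f x \<theta> \<partial>G0) = enn2real (\<integral>\<^sup>+\<theta>. ennreal (f x \<theta>) \<partial>G0)"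
    by (rule integral_eq_nn_integral[OF fx], rule AE_I2)
      (use f x G0 sets_eq_imp_space_eq[OF G0(2)] in \<open>auto simp: conditional_density_def\<close>)
  then have "lr G0 x = enn2real (f0 x) / enn2real (f0 x)"
    by (simp add: lr_def cnd_def \<kappa>_def f0_def marginal_density_def)
  moreover have "enn2real (f0 x) \<noteq> 0" using x by (auto simp: enn2real_eq_0_iff)
  ultimately show "lr G0 x = 1" by simp
qed

text \<open>Links the extended-real quotient in \<open>local_class\<close> to the real function
  \<open>lr G\<close>.\<close>

lemma lr_marginal:
  assumes G: "dominated G"
  shows "AE x in \<mu>. marginal_density f G x / f0 x = ennreal (lr G x)"
  using f0_pos AE_space lr_AE_integrable[OF G]
proof eventually_elim
  fix x assume x: "0 < f0 x \<and> f0 x < \<infinity>" "x \<in> space \<mu>" and k: "integrable G (\<lambda>\<theta>. \<kappa> x \<theta>)"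
  obtain c where c: "f0 x = ennreal c" "c > 0" using x by (cases "f0 x") auto
  have fk: "f x \<theta> = c * \<kappa> x \<theta>" for \<theta> using c by (simp add: \<kappa>_def)
  have "marginal_density f G x = (\<integral>\<^sup>+\<theta>. ennreal c * ennreal (\<kappa> x \<theta>) \<partial>G)"
    unfolding marginal_density_def fk using c by (simp add: ennreal_mult')
  also have "\<dots> = ennreal c * (\<integral>\<^sup>+\<theta>. ennreal (\<kappa> x \<theta>) \<partial>G)"
    using k by (intro nn_integral_cmult) auto
  also have "(\<integral>\<^sup>+\<theta>. ennreal (\<kappa> x \<theta>) \<partial>G) = ennreal (lr G x)"
    unfolding lr_def cnd_def using k x
    by (subst nn_integral_eq_integral) (auto intro!: AE_I2 \<kappa>_nonneg simp: dominated_space[OF G])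
  finally have m: "marginal_density f G x = ennreal c * ennreal (lr G x)" .
  have nn: "0 \<le> lr G x" using lr_nonneg[OF G] x(2) by simp
  have "marginal_density f G x = ennreal (c * lr G x)"
    unfolding m using c(2) nn by (intro ennreal_mult[symmetric]) auto
  then have "marginal_density f G x / f0 x = ennreal (c * lr G x / c)"
    unfolding c(1) using c(2) nn by (simp only:) (intro divide_ennreal, auto)
  then show "marginal_density f G x / f0 x = ennreal (lr G x)" using c(2) by simp
qed

lemma integrable_J0_fst:
  fixes \<phi> :: "'x \<Rightarrow> real"
  assumes \<phi>: "\<phi> \<in> borel_measurable \<nu>"
  shows "integrable (J G0) (\<lambda>z. \<phi> (fst z)) \<longleftrightarrow> integrable \<mu> \<phi>"
    and "integrable \<mu> \<phi> \<Longrightarrow> (\<integral>z. \<phi> (fst z) \<partial>J G0) = (\<integral>x. \<phi> x \<partial>\<mu>)"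
proof -
  note [measurable] = \<phi> lr_measurable[OF dominated_G0]
  have AEe: "AE x in \<mu>. \<phi> x * lr G0 x = \<phi> x" using lr_G0 by eventually_elim simp
  have 1: "integrable \<mu> (\<lambda>x. \<phi> x * lr G0 x) \<longleftrightarrow> integrable \<mu> \<phi>"
    by (rule integrable_cong_AE[OF _ _ AEe]) measurable
  have 2: "(\<integral>x. \<phi> x * lr G0 x \<partial>\<mu>) = (\<integral>x. \<phi> x \<partial>\<mu>)"
    by (rule integral_cong_AE[OF _ _ AEe]) measurable
  show "integrable (J G0) (\<lambda>z. \<phi> (fst z)) \<longleftrightarrow> integrable \<mu> \<phi>"
    unfolding integrable_J_fst[OF dominated_G0 \<phi>] 1 ..
  show "(\<integral>z. \<phi> (fst z) \<partial>J G0) = (\<integral>x. \<phi> x \<partial>\<mu>)" if "integrable \<mu> \<phi>"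
    using integral_J_fst[OF dominated_G0 \<phi>] that 1 2 by simp
qed

lemma AE_J0_fst:
  assumes "Measurable.pred \<nu> P" "AE x in \<mu>. P x"
  shows "AE z in J G0. P (fst z)"
proof -
  define \<phi> :: "'x \<Rightarrow> real" where "\<phi> x = (if P x then 0 else 1)" for x
  have \<phi>m: "\<phi> \<in> borel_measurable \<nu>"
    unfolding \<phi>_def using assms(1) by measurable
  interpret M: prob_space \<mu> by (rule prob_space_\<mu>)
  have i: "integrable \<mu> \<phi>"
    by (rule M.integrable_const_bound[of _ 1]) (use \<phi>m in \<open>auto simp: \<phi>_def\<close>)
  have "AE x in \<mu>. \<phi> x = 0" using assms(2) by eventually_elim (simp add: \<phi>_def)
  then have "(\<integral>x. \<phi> x \<partial>\<mu>) = 0" by (rule integral_eq_zero_AE)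
  then have "(\<integral>z. \<phi> (fst z) \<partial>J G0) = 0" using integrable_J0_fst(2)[OF \<phi>m i] by simp
  moreover have "integrable (J G0) (\<lambda>z. \<phi> (fst z))" using integrable_J0_fst(1)[OF \<phi>m] i by simp
  ultimately have "AE z in J G0. \<phi> (fst z) = 0"
    by (subst (asm) integral_nonneg_eq_0_iff_AE) (auto simp: \<phi>_def)
  then show ?thesis by eventually_elim (simp add: \<phi>_def split: if_splits)
qed

end

section \<open>Reduction to the observed sample\<close>

locale utility_model = base_model +
  fixes u :: "'a \<Rightarrow> 'b \<Rightarrow> real"
  assumes u: "(\<lambda>(x, \<theta>). u x \<theta>) \<in> borel_measurable (\<nu> \<Otimes>\<^sub>M T)"
    and u_sq: "integrable (J G0) (\<lambda>z. (u (fst z) (snd z))\<^sup>2)"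
begin

text \<open>\<open>u0\<close> is a version of \<open>E(u(X, \<theta>) | X)\<close> under \<open>G0\<close>, and \<open>s2\<close> is the variance of \<open>u\<close> that cannot be
  predicted from \<open>X\<close>.  Along the curve from \<open>G0\<close> to \<open>G\<close>, \<open>gs G\<close> is the score of the law of \<open>X\<close>, and
  \<open>bias G\<close> is the derivative of the mean of \<open>u - u0\<close>.\<close>

definition u0 :: "'a \<Rightarrow> real" where "u0 = cnd G0 u"

definition ub :: "'a \<Rightarrow> 'b \<Rightarrow> real" where "ub x \<theta> = u x \<theta> - u0 x"

definition s2 :: real where "s2 = (\<integral>z. (ub (fst z) (snd z))\<^sup>2 \<partial>J G0)"

definition bias :: "'b measure \<Rightarrow> real" where "bias G = (\<integral>z. ub (fst z) (snd z) \<partial>J G)"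

definition gs :: "'b measure \<Rightarrow> 'a \<Rightarrow> real" where "gs G x = lr G x - 1"

definition smooth :: "'b measure \<Rightarrow> bool" where
  "smooth G \<longleftrightarrow> dominated G \<and> sq_int \<mu> (lr G) \<and> integrable (J G) (\<lambda>z. (u (fst z) (snd z))\<^sup>2)"

sublocale M: prob_space \<mu> by (rule prob_space_\<mu>)
sublocale J0: prob_space "J G0" by (rule prob_space_J[OF dominated_G0])

lemma measurable_mu: "borel_measurable \<mu> = borel_measurable \<nu>"
  by (rule measurable_cong_sets) simp_all

lemma u_fst_snd: "(\<lambda>z. u (fst z) (snd z)) \<in> borel_measurable (\<nu> \<Otimes>\<^sub>M T)"
  using u by (simp add: case_prod_beta')

lemma u0_measurable [measurable]: "u0 \<in> borel_measurable \<nu>"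
  unfolding u0_def by (rule cnd_measurable[OF dominated_G0 u])

lemma ub_fst_snd [measurable]: "(\<lambda>z. ub (fst z) (snd z)) \<in> borel_measurable (\<nu> \<Otimes>\<^sub>M T)"
  unfolding ub_def using u_fst_snd by measurable

lemma lr_G0_sq_int: "sq_int \<mu> (lr G0)"
proof -
  note [measurable] = lr_measurable[OF dominated_G0]
  have "integrable \<mu> (\<lambda>x. (lr G0 x)\<^sup>2) \<longleftrightarrow> integrable \<mu> (\<lambda>x. 1 :: real)"
  proof (rule integrable_cong_AE)
    show "AE x in \<mu>. (lr G0 x)\<^sup>2 = 1" using lr_G0 by eventually_elim simp
  qed measurable
  then show ?thesis by (simp add: sq_int_def)
qed

lemma smooth_G0: "smooth G0"
  using dominated_G0 lr_G0_sq_int u_sq by (simp add: smooth_def)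

text \<open>For \<mu>-almost every x the function \<open>\<kappa> x\<close> is a probability density
  with respect to \<open>G0\<close>, because \<open>lr G0 x = 1\<close>; the inequality is
  nonnegativity of the conditional variance.\<close>

lemma cnd_jensen:
  fixes F :: "'a \<Rightarrow> 'b \<Rightarrow> real"
  assumes F: "(\<lambda>(x, \<theta>). F x \<theta>) \<in> borel_measurable (\<nu> \<Otimes>\<^sub>M T)"
    and i2: "integrable (J G0) (\<lambda>z. (F (fst z) (snd z))\<^sup>2)"
  shows "AE x in \<mu>. (cnd G0 F x)\<^sup>2 \<le> cnd G0 (\<lambda>x \<theta>. (F x \<theta>)\<^sup>2) x"
proof -
  have Ff: "(\<lambda>z. F (fst z) (snd z)) \<in> borel_measurable (\<nu> \<Otimes>\<^sub>M T)" using F by (simp add: case_prod_beta')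
  have F2: "(\<lambda>(x, \<theta>). (F x \<theta>)\<^sup>2) \<in> borel_measurable (\<nu> \<Otimes>\<^sub>M T)"
    using borel_measurable_power[OF Ff, of 2] by (simp add: case_prod_beta')
  have i1: "integrable (J G0) (\<lambda>z. F (fst z) (snd z))"
    by (rule J0.square_integrable_imp_integrable[OF measurable_J[OF dominated_G0 Ff] i2])
  show ?thesis
    using cnd_AE_integrable[OF dominated_G0 F i1] cnd_AE_integrable[OF dominated_G0 F2 i2]
      lr_AE_integrable[OF dominated_G0] lr_G0 AE_space
  proof eventually_elim
    fix x assume a: "integrable G0 (\<lambda>\<theta>. \<kappa> x \<theta> *\<^sub>R F x \<theta>)" and b: "integrable G0 (\<lambda>\<theta>. \<kappa> x \<theta> *\<^sub>R (F x \<theta>)\<^sup>2)"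
      and k: "integrable G0 (\<lambda>\<theta>. \<kappa> x \<theta>)" and l: "lr G0 x = 1" and x: "x \<in> space \<mu>"
    define m where "m = cnd G0 F x"
    have k1: "(\<integral>\<theta>. \<kappa> x \<theta> \<partial>G0) = 1" using l by (simp add: lr_def cnd_def)
    have "0 \<le> (\<integral>\<theta>. \<kappa> x \<theta> * (F x \<theta> - m)\<^sup>2 \<partial>G0)"
      by (rule integral_nonneg_AE, rule AE_I2)
        (use x \<kappa>_nonneg dominated_space[OF dominated_G0] in auto)
    also have "\<dots> = (\<integral>\<theta>. \<kappa> x \<theta> *\<^sub>R (F x \<theta>)\<^sup>2 - 2 * m * (\<kappa> x \<theta> *\<^sub>R F x \<theta>) + m\<^sup>2 * \<kappa> x \<theta> \<partial>G0)"
      by (simp add: power2_diff algebra_simps)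
    also have "\<dots> = cnd G0 (\<lambda>x \<theta>. (F x \<theta>)\<^sup>2) x - 2 * m * m + m\<^sup>2"
      unfolding cnd_def m_def using a b k k1 by simp
    finally show "(cnd G0 F x)\<^sup>2 \<le> cnd G0 (\<lambda>x \<theta>. (F x \<theta>)\<^sup>2) x"
      by (simp add: m_def power2_eq_square)
  qed
qed

lemma cnd_sq_int:
  fixes F :: "'a \<Rightarrow> 'b \<Rightarrow> real"
  assumes F: "(\<lambda>(x, \<theta>). F x \<theta>) \<in> borel_measurable (\<nu> \<Otimes>\<^sub>M T)"
    and i2: "integrable (J G0) (\<lambda>z. (F (fst z) (snd z))\<^sup>2)"
  shows "sq_int \<mu> (cnd G0 F)"
  unfolding sq_int_def
proof
  have Ff: "(\<lambda>z. F (fst z) (snd z)) \<in> borel_measurable (\<nu> \<Otimes>\<^sub>M T)" using F by (simp add: case_prod_beta')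
  have F2: "(\<lambda>(x, \<theta>). (F x \<theta>)\<^sup>2) \<in> borel_measurable (\<nu> \<Otimes>\<^sub>M T)"
    using borel_measurable_power[OF Ff, of 2] by (simp add: case_prod_beta')
  show m: "cnd G0 F \<in> borel_measurable \<mu>" unfolding measurable_mu by (rule cnd_measurable[OF dominated_G0 F])
  show "integrable \<mu> (\<lambda>x. (cnd G0 F x)\<^sup>2)"
  proof (rule Bochner_Integration.integrable_bound[OF cnd_integrable[OF dominated_G0 F2 i2]])
    show "AE x in \<mu>. norm ((cnd G0 F x)\<^sup>2) \<le> norm (cnd G0 (\<lambda>x \<theta>. (F x \<theta>)\<^sup>2) x)"
      using cnd_jensen[OF F i2] by eventually_elim simp
  qed (use m in measurable)
qed

lemma u0_sq_int: "sq_int \<mu> u0"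
  unfolding u0_def by (rule cnd_sq_int[OF u u_sq])

lemma sq_int_J0_fst:
  assumes "sq_int \<mu> \<phi>" shows "sq_int (J G0) (\<lambda>z. \<phi> (fst z))"
proof -
  have m: "\<phi> \<in> borel_measurable \<nu>" using sq_int_measurable[OF assms] measurable_mu by simp
  then have "(\<lambda>x. (\<phi> x)\<^sup>2) \<in> borel_measurable \<nu>" by measurable
  from integrable_J0_fst(1)[OF this] have "integrable (J G0) (\<lambda>z. (\<phi> (fst z))\<^sup>2)"
    using sq_int_integrable_sq[OF assms] by simp
  moreover have "(\<lambda>z. \<phi> (fst z)) \<in> borel_measurable (J G0)"
    by (rule measurable_J[OF dominated_G0 measurable_compose[OF measurable_fst m]])
  ultimately show ?thesis by (simp add: sq_int_def)
qed

lemma u_J0_sq_int: "sq_int (J G0) (\<lambda>z. u (fst z) (snd z))"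
  using u_sq measurable_J[OF dominated_G0 u_fst_snd] by (simp add: sq_int_def)

lemma ub_J0_sq_int: "sq_int (J G0) (\<lambda>z. ub (fst z) (snd z))"
  unfolding ub_def by (rule sq_int_diff[OF u_J0_sq_int sq_int_J0_fst[OF u0_sq_int]])

lemma cnd_ub: "AE x in \<mu>. cnd G0 ub x = 0"
  using cnd_AE_integrable[OF dominated_G0 u J0.sq_int_integrable[OF u_J0_sq_int]]
    lr_AE_integrable[OF dominated_G0] lr_G0
proof eventually_elim
  fix x assume a: "integrable G0 (\<lambda>\<theta>. \<kappa> x \<theta> *\<^sub>R u x \<theta>)" and k: "integrable G0 (\<lambda>\<theta>. \<kappa> x \<theta>)" and l: "lr G0 x = 1"
  have k1: "(\<integral>\<theta>. \<kappa> x \<theta> \<partial>G0) = 1" using l by (simp add: lr_def cnd_def)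
  have "cnd G0 ub x = (\<integral>\<theta>. \<kappa> x \<theta> *\<^sub>R u x \<theta> - u0 x * \<kappa> x \<theta> \<partial>G0)"
    unfolding cnd_def ub_def by (simp add: algebra_simps)
  also have "\<dots> = cnd G0 u x - u0 x" unfolding cnd_def using a k k1 by simp
  finally show "cnd G0 ub x = 0" by (simp add: u0_def)
qed

text \<open>Given X the residual \<open>ub\<close> has mean 0 under \<open>G0\<close>, and a
  function of X can be taken out of the conditional expectation: \<open>u0\<close> is the L2
  projection of the utility on functions of X.\<close>

lemma ub_orthogonal:
  assumes "sq_int \<mu> \<phi>"
  shows "integrable (J G0) (\<lambda>z. ub (fst z) (snd z) * \<phi> (fst z))"
    and "(\<integral>z. ub (fst z) (snd z) * \<phi> (fst z) \<partial>J G0) = 0"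
proof -
  have \<phi>m: "\<phi> \<in> borel_measurable \<nu>" using sq_int_measurable[OF assms] measurable_mu by simp
  show i: "integrable (J G0) (\<lambda>z. ub (fst z) (snd z) * \<phi> (fst z))"
    by (rule sq_int_mult[OF ub_J0_sq_int sq_int_J0_fst[OF assms]])
  have m: "(\<lambda>(x, \<theta>). \<phi> x * ub x \<theta>) \<in> borel_measurable (\<nu> \<Otimes>\<^sub>M T)"
    using borel_measurable_times[OF measurable_compose[OF measurable_fst \<phi>m] ub_fst_snd] by (simp add: case_prod_beta')
  have "(\<integral>z. \<phi> (fst z) * ub (fst z) (snd z) \<partial>J G0) = (\<integral>x. cnd G0 (\<lambda>x \<theta>. \<phi> x * ub x \<theta>) x \<partial>\<mu>)"
    by (rule cnd_integral[OF dominated_G0 m, symmetric]) (use i in \<open>simp add: mult.commute\<close>)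
  also have "\<dots> = (\<integral>x. \<phi> x * cnd G0 ub x \<partial>\<mu>)"
    using cnd_mult[OF dominated_G0, of \<phi> ub] by simp
  also have "\<dots> = 0"
    by (rule integral_eq_zero_AE) (use cnd_ub in eventually_elim, simp)
  finally show "(\<integral>z. ub (fst z) (snd z) * \<phi> (fst z) \<partial>J G0) = 0" by (simp add: mult.commute)
qed

lemma ub_mean: "(\<integral>z. ub (fst z) (snd z) \<partial>J G0) = 0"
  using ub_orthogonal(2)[OF M.sq_int_const[of 1]] by simp

lemma bias_G0: "bias G0 = 0"
  by (simp add: bias_def ub_mean)

context
  fixes G assumes G: "smooth G"
begin

lemma smooth_dominated: "dominated G" and smooth_lr: "sq_int \<mu> (lr G)"
  using G by (auto simp: smooth_def)

lemma sq_int_lr_J: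
  assumes "sq_int \<mu> \<phi>"
  shows "integrable (J G) (\<lambda>z. \<phi> (fst z))" "(\<integral>z. \<phi> (fst z) \<partial>J G) = (\<integral>x. \<phi> x * lr G x \<partial>\<mu>)"
proof -
  have \<phi>m: "\<phi> \<in> borel_measurable \<nu>" using sq_int_measurable[OF assms] measurable_mu by simp
  note i = sq_int_mult[OF assms smooth_lr]
  show "integrable (J G) (\<lambda>z. \<phi> (fst z))" using integrable_J_fst[OF smooth_dominated \<phi>m] i by simp
  show "(\<integral>z. \<phi> (fst z) \<partial>J G) = (\<integral>x. \<phi> x * lr G x \<partial>\<mu>)" by (rule integral_J_fst[OF smooth_dominated \<phi>m i])
qed

lemma u_integrable: "integrable (J G) (\<lambda>z. u (fst z) (snd z))"
proof -
  interpret JG: prob_space "J G" by (rule prob_space_J[OF smooth_dominated])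
  show ?thesis
    by (rule JG.square_integrable_imp_integrable[OF measurable_J[OF smooth_dominated u_fst_snd]])
      (use G in \<open>simp add: smooth_def\<close>)
qed

lemma ub_integrable: "integrable (J G) (\<lambda>z. ub (fst z) (snd z))"
  unfolding ub_def using u_integrable sq_int_lr_J(1)[OF u0_sq_int] by simp

lemma bias_eq: "bias G = (\<integral>z. u (fst z) (snd z) \<partial>J G) - (\<integral>x. u0 x * lr G x \<partial>\<mu>)"
  unfolding bias_def ub_def using u_integrable sq_int_lr_J[OF u0_sq_int] by simp

lemma gs_sq_int: "sq_int \<mu> (gs G)"
  unfolding gs_def by (rule sq_int_diff[OF smooth_lr M.sq_int_const])

lemma gs_mean: "(\<integral>x. gs G x \<partial>\<mu>) = 0"
  unfolding gs_def using lr_integrable[OF smooth_dominated] lr_integral[OF smooth_dominated]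
  by (simp add: M.prob_space[simplified])

text \<open>Conditional second moments of the utility under \<open>G\<close> are not controlled
  against \<mu>; a bounded \<open>F\<close> together with a square-integrable \<open>lr G\<close>
  takes their place.\<close>

lemma cnd_bounded:
  fixes F :: "'a \<Rightarrow> 'b \<Rightarrow> complex"
  assumes F: "(\<lambda>(x, \<theta>). F x \<theta>) \<in> borel_measurable (\<nu> \<Otimes>\<^sub>M T)" and B: "\<And>x \<theta>. cmod (F x \<theta>) \<le> B"
  shows "AE x in \<mu>. cmod (cnd G F x) \<le> B * lr G x"
    and "integrable \<mu> (\<lambda>x. (cmod (cnd G F x))\<^sup>2)"
proof -
  have Ff: "(\<lambda>z. F (fst z) (snd z)) \<in> borel_measurable (\<nu> \<Otimes>\<^sub>M T)" using F by (simp add: case_prod_beta')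
  have nF: "(\<lambda>(x, \<theta>). cmod (F x \<theta>)) \<in> borel_measurable (\<nu> \<Otimes>\<^sub>M T)"
    using measurable_compose[OF Ff borel_measurable_norm] by (simp add: case_prod_beta')
  have i: "integrable (J G) (\<lambda>z. cmod (F (fst z) (snd z)))"
    by (rule integrable_J_bounded[OF smooth_dominated measurable_compose[OF Ff borel_measurable_norm], of B]) (simp add: B)
  show b: "AE x in \<mu>. cmod (cnd G F x) \<le> B * lr G x"
    using cnd_AE_integrable[OF smooth_dominated nF i] lr_AE_integrable[OF smooth_dominated] AE_space
  proof eventually_elim
    fix x assume a: "integrable G (\<lambda>\<theta>. \<kappa> x \<theta> *\<^sub>R cmod (F x \<theta>))" and k: "integrable G (\<lambda>\<theta>. \<kappa> x \<theta>)" and x: "x \<in> space \<mu>"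
    have "cmod (cnd G F x) \<le> cnd G (\<lambda>x \<theta>. cmod (F x \<theta>)) x" using cnd_norm_le[OF smooth_dominated] x by simp
    also have "\<dots> \<le> (\<integral>\<theta>. B * \<kappa> x \<theta> \<partial>G)"
      unfolding cnd_def
    proof (rule integral_mono[OF a])
      show "integrable G (\<lambda>\<theta>. B * \<kappa> x \<theta>)" using k by simp
      fix \<theta> assume "\<theta> \<in> space G"
      then show "\<kappa> x \<theta> *\<^sub>R cmod (F x \<theta>) \<le> B * \<kappa> x \<theta>"
        using \<kappa>_nonneg[of x \<theta>] x dominated_space[OF smooth_dominated] B[of x \<theta>]
        by (simp add: mult.commute mult_right_mono)
    qed
    also have "\<dots> = B * lr G x" by (simp add: lr_def cnd_def)
    finally show "cmod (cnd G F x) \<le> B * lr G x" .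
  qed
  have m: "cnd G F \<in> borel_measurable \<mu>" unfolding measurable_mu by (rule cnd_measurable[OF smooth_dominated F])
  show "integrable \<mu> (\<lambda>x. (cmod (cnd G F x))\<^sup>2)"
  proof (rule Bochner_Integration.integrable_bound)
    show "integrable \<mu> (\<lambda>x. (B * lr G x)\<^sup>2)" by (rule sq_int_integrable_sq[OF sq_int_scale[OF smooth_lr]])
    show "AE x in \<mu>. norm ((cmod (cnd G F x))\<^sup>2) \<le> norm ((B * lr G x)\<^sup>2)"
      using b
    proof eventually_elim
      fix x assume "cmod (cnd G F x) \<le> B * lr G x"
      then have "(cmod (cnd G F x))\<^sup>2 \<le> (B * lr G x)\<^sup>2" by (intro power_mono) auto
      then show "norm ((cmod (cnd G F x))\<^sup>2) \<le> norm ((B * lr G x)\<^sup>2)" by simp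
    qed
  qed (use m in measurable)
qed

end

text \<open>The minus sign comes from the error being estimator minus utility. Subtracting 1
  isolates the quantity that tends to 0; at \<open>n = 0\<close> it is 0, since division by
  \<open>sqrt 0\<close> gives 0.\<close>

definition em1 :: "real \<Rightarrow> nat \<Rightarrow> 'a \<Rightarrow> 'b \<Rightarrow> complex" where
  "em1 \<tau> n x \<theta> = iexp ((- \<tau> * ub x \<theta>) / sqrt (real n)) - 1"

lemma em1_fst_snd: "(\<lambda>z. em1 \<tau> n (fst z) (snd z)) \<in> borel_measurable (\<nu> \<Otimes>\<^sub>M T)"
  unfolding em1_def by measurable

lemma em1_measurable: "(\<lambda>(x, \<theta>). em1 \<tau> n x \<theta>) \<in> borel_measurable (\<nu> \<Otimes>\<^sub>M T)"
  using em1_fst_snd by (simp add: case_prod_beta')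

lemma em1_le2: "cmod (em1 \<tau> n x \<theta>) \<le> 2"
  unfolding em1_def using norm_triangle_ineq4[of "iexp ((- \<tau> * ub x \<theta>) / sqrt (real n))" 1] by simp

lemma em1_le: "sqrt (real n) * cmod (em1 \<tau> n x \<theta>) \<le> \<bar>\<tau> * ub x \<theta>\<bar>"
proof -
  have "sqrt (real n) * cmod (em1 \<tau> n x \<theta>) \<le> sqrt (real n) * \<bar>(- \<tau> * ub x \<theta>) / sqrt (real n)\<bar>"
    unfolding em1_def by (intro mult_left_mono iexp_approx_0) auto
  also have "\<dots> \<le> \<bar>\<tau> * ub x \<theta>\<bar>" by (cases "n = 0") auto
  finally show ?thesis .
qed

lemma em1_limit: "(\<lambda>n. em1 \<tau> n x \<theta>) \<longlonglongrightarrow> 0"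
proof (rule Lim_null_comparison)
  show "\<forall>\<^sub>F n in sequentially. norm (em1 \<tau> n x \<theta>) \<le> \<bar>\<tau> * ub x \<theta>\<bar> / sqrt (real n)"
    using eventually_gt_at_top[of "0::nat"]
  proof eventually_elim
    fix n :: nat assume "0 < n"
    then show "norm (em1 \<tau> n x \<theta>) \<le> \<bar>\<tau> * ub x \<theta>\<bar> / sqrt (real n)"
      using em1_le[of n \<tau> x \<theta>] by (simp add: pos_le_divide_eq mult.commute)
  qed
  show "(\<lambda>n. \<bar>\<tau> * ub x \<theta>\<bar> / sqrt (real n)) \<longlonglongrightarrow> 0"
  proof -
    have "(\<lambda>n. C / sqrt (real n)) \<longlonglongrightarrow> 0" for C :: real by real_asymp
    then show ?thesis .
  qed
qed

text \<open>\<open>ub\<close> is centred under \<open>G0\<close>, so the linear term drops out and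
  the second moment \<open>s2\<close> appears at the rate 1/n.\<close>

lemma em1_integral_limit_G0: "(\<lambda>n. real n * (\<integral>x. cnd G0 (em1 \<tau> n) x \<partial>\<mu>)) \<longlonglongrightarrow> - complex_of_real (\<tau>\<^sup>2 * s2 / 2)"
proof -
  let ?W = "\<lambda>z. - \<tau> * ub (fst z) (snd z)"
  have W: "sq_int (J G0) ?W" by (rule sq_int_scale[OF ub_J0_sq_int])
  have Wi: "integrable (J G0) ?W" by (rule J0.sq_int_integrable[OF W])
  have L: "(\<lambda>n. \<integral>z. real n * (iexp (?W z / sqrt (real n)) - 1 - \<i> * (?W z / sqrt (real n))) \<partial>J G0)
    \<longlonglongrightarrow> - complex_of_real ((\<integral>z. (?W z)\<^sup>2 \<partial>J G0) / 2)"
    by (rule integral_iexp_limit2[OF sq_int_measurable[OF W] sq_int_integrable_sq[OF W]])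
  have S: "(\<integral>z. (?W z)\<^sup>2 \<partial>J G0) = \<tau>\<^sup>2 * s2" by (simp add: power_mult_distrib s2_def)
  have E: "(\<integral>z. real n * (iexp (?W z / sqrt (real n)) - 1 - \<i> * (?W z / sqrt (real n))) \<partial>J G0)
      = real n * (\<integral>x. cnd G0 (em1 \<tau> n) x \<partial>\<mu>)" for n
  proof -
    have i: "integrable (J G0) (\<lambda>z. em1 \<tau> n (fst z) (snd z))"
      by (rule integrable_J_bounded[OF dominated_G0 em1_fst_snd em1_le2])
    have W0: "(\<integral>z. complex_of_real (?W z / sqrt (real n)) \<partial>J G0) = 0"
      by (subst integral_complex_of_real) (simp add: ub_mean)
    have Wc: "integrable (J G0) (\<lambda>z. complex_of_real (?W z / sqrt (real n)))"
      using Wi by (intro integrable_of_real) simp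
    have "(\<integral>z. real n * (iexp (?W z / sqrt (real n)) - 1 - \<i> * (?W z / sqrt (real n))) \<partial>J G0)
        = (\<integral>z. real n * (em1 \<tau> n (fst z) (snd z) - \<i> * complex_of_real (?W z / sqrt (real n))) \<partial>J G0)"
      unfolding em1_def ..
    also have "\<dots> = real n * ((\<integral>z. em1 \<tau> n (fst z) (snd z) \<partial>J G0) - \<i> * (\<integral>z. complex_of_real (?W z / sqrt (real n)) \<partial>J G0))"
      by (subst integral_mult_right_zero, subst Bochner_Integration.integral_diff[OF i integrable_mult_right[OF Wc]],
          subst integral_mult_right_zero) (rule refl)
    finally show ?thesis unfolding W0 cnd_integral[OF dominated_G0 em1_measurable i] by simp
  qed
  show ?thesis using L by (simp only: S E)
qed

text \<open>The first-order expansion leaves the inner product of \<open>ub\<close> with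
  \<open>g\<close>, which is 0 because \<open>ub\<close> is orthogonal to functions of X.\<close>

lemma em1_score_limit_G0:
  assumes g: "sq_int \<mu> g"
  shows "(\<lambda>n. sqrt (real n) * (\<integral>x. cnd G0 (em1 \<tau> n) x * of_real (g x) \<partial>\<mu>)) \<longlonglongrightarrow> 0"
proof -
  let ?W = "\<lambda>z. - \<tau> * ub (fst z) (snd z)"
  have gm: "g \<in> borel_measurable \<nu>" using sq_int_measurable[OF g] measurable_mu by simp
  have W: "sq_int (J G0) ?W" by (rule sq_int_scale[OF ub_J0_sq_int])
  note gJ = sq_int_J0_fst[OF g]
  have "(\<lambda>n. \<integral>z. sqrt (real n) * (iexp (?W z / sqrt (real n)) - 1) * of_real (g (fst z)) \<partial>J G0)
    \<longlonglongrightarrow> \<i> * complex_of_real (\<integral>z. ?W z * g (fst z) \<partial>J G0)"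
    by (rule integral_iexp_limit1[OF sq_int_measurable[OF W] sq_int_measurable[OF gJ] sq_int_mult[OF W gJ]])
  moreover have "(\<integral>z. ?W z * g (fst z) \<partial>J G0) = 0"
    using ub_orthogonal(2)[OF g] by (simp add: mult.assoc)
  moreover have "(\<integral>z. sqrt (real n) * (iexp (?W z / sqrt (real n)) - 1) * of_real (g (fst z)) \<partial>J G0)
      = sqrt (real n) * (\<integral>x. cnd G0 (em1 \<tau> n) x * of_real (g x) \<partial>\<mu>)" for n
  proof -
    have m: "(\<lambda>z. of_real (g (fst z)) * em1 \<tau> n (fst z) (snd z)) \<in> borel_measurable (\<nu> \<Otimes>\<^sub>M T)"
      using em1_fst_snd measurable_compose[OF measurable_fst gm] by measurable
    then have m': "(\<lambda>(x, \<theta>). of_real (g x) * em1 \<tau> n x \<theta>) \<in> borel_measurable (\<nu> \<Otimes>\<^sub>M T)"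
      by (simp add: case_prod_beta')
    have i: "integrable (J G0) (\<lambda>z. of_real (g (fst z)) * em1 \<tau> n (fst z) (snd z))"
    proof (rule Bochner_Integration.integrable_bound)
      show "integrable (J G0) (\<lambda>z. 2 * g (fst z))" using J0.sq_int_integrable[OF gJ] by simp
      have "norm (of_real (g (fst z)) * em1 \<tau> n (fst z) (snd z)) \<le> norm (2 * g (fst z))" for z
        using mult_left_mono[OF em1_le2[of \<tau> n "fst z" "snd z"], of "\<bar>g (fst z)\<bar>"] by (simp add: norm_mult)
      then show "AE z in J G0. norm (of_real (g (fst z)) * em1 \<tau> n (fst z) (snd z)) \<le> norm (2 * g (fst z))" by simp
    qed (rule measurable_J[OF dominated_G0 m])
    have "(\<integral>z. sqrt (real n) * (iexp (?W z / sqrt (real n)) - 1) * of_real (g (fst z)) \<partial>J G0)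
        = (\<integral>z. sqrt (real n) * (of_real (g (fst z)) * em1 \<tau> n (fst z) (snd z)) \<partial>J G0)"
      unfolding em1_def by (simp only: ac_simps)
    also have "\<dots> = sqrt (real n) * (\<integral>x. cnd G0 (\<lambda>x \<theta>. of_real (g x) * em1 \<tau> n x \<theta>) x \<partial>\<mu>)"
      unfolding cnd_integral[OF dominated_G0 m' i] by (rule integral_mult_right_zero)
    finally show ?thesis unfolding cnd_mult[OF dominated_G0] by (simp add: mult.commute)
  qed
  ultimately show ?thesis by simp
qed

text \<open>For almost every x, \<open>sqrt n\<close> times the conditional expectation tends to a
  multiple of the conditional mean of \<open>ub\<close>, which is 0. Conditional Jensen supplies the
  dominating function, the conditional second moment of \<open>\<tau> * ub\<close>.\<close>

lemma em1_sq_limit_G0: "(\<lambda>n. real n * (\<integral>x. (cmod (cnd G0 (em1 \<tau> n) x))\<^sup>2 \<partial>\<mu>)) \<longlonglongrightarrow> 0"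
proof -
  let ?W = "\<lambda>x \<theta>. \<bar>\<tau> * ub x \<theta>\<bar>"
  have Wf: "(\<lambda>z. ?W (fst z) (snd z)) \<in> borel_measurable (\<nu> \<Otimes>\<^sub>M T)" by measurable
  have Wm: "(\<lambda>(x, \<theta>). ?W x \<theta>) \<in> borel_measurable (\<nu> \<Otimes>\<^sub>M T)" using Wf by (simp add: case_prod_beta')
  have W2m: "(\<lambda>(x, \<theta>). (?W x \<theta>)\<^sup>2) \<in> borel_measurable (\<nu> \<Otimes>\<^sub>M T)"
    using borel_measurable_power[OF Wf, of 2] by (simp add: case_prod_beta')
  have W2: "integrable (J G0) (\<lambda>z. (?W (fst z) (snd z))\<^sup>2)"
    using sq_int_integrable_sq[OF sq_int_scale[OF ub_J0_sq_int, of \<tau>]] by simp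
  have W1: "integrable (J G0) (\<lambda>z. ?W (fst z) (snd z))"
    using J0.sq_int_integrable[OF sq_int_scale[OF ub_J0_sq_int, of \<tau>]] by (rule integrable_abs)
  have em: "cnd G0 (em1 \<tau> n) \<in> borel_measurable \<mu>" for n
    unfolding measurable_mu by (rule cnd_measurable[OF dominated_G0 em1_measurable])
  note kW = cnd_AE_integrable[OF dominated_G0 Wm W1]
  have kfm: "(\<lambda>\<theta>. \<kappa> x \<theta> *\<^sub>R h x \<theta>) \<in> borel_measurable G0"
    if "(\<lambda>(x, \<theta>). h x \<theta>) \<in> borel_measurable (\<nu> \<Otimes>\<^sub>M T)" "x \<in> space \<mu>" for x and h :: "'a \<Rightarrow> 'b \<Rightarrow> complex"
  proof -
    have x: "x \<in> space \<nu>" using that by simp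
    have "(\<lambda>\<theta>. \<kappa> x \<theta>) \<in> borel_measurable T" "(\<lambda>\<theta>. h x \<theta>) \<in> borel_measurable T"
      using measurable_compose[OF measurable_Pair1'[OF x] \<kappa>_measurable] measurable_compose[OF measurable_Pair1'[OF x] that(1)]
      by simp_all
    then show ?thesis using G0(2) by (simp cong: measurable_cong_sets)
  qed
  have "(\<lambda>n. \<integral>x. (cmod (sqrt (real n) * cnd G0 (em1 \<tau> n) x))\<^sup>2 \<partial>\<mu>) \<longlonglongrightarrow> (\<integral>x. 0 \<partial>\<mu>)"
  proof (rule integral_dominated_convergence[where w = "cnd G0 (\<lambda>x \<theta>. (?W x \<theta>)\<^sup>2)"])
    show "integrable \<mu> (cnd G0 (\<lambda>x \<theta>. (?W x \<theta>)\<^sup>2))" by (rule cnd_integrable[OF dominated_G0 W2m W2])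
    show "(\<lambda>x. (cmod (sqrt (real n) * cnd G0 (em1 \<tau> n) x))\<^sup>2) \<in> borel_measurable \<mu>" for n
      using em by measurable
    show "AE x in \<mu>. (\<lambda>n. (cmod (sqrt (real n) * cnd G0 (em1 \<tau> n) x))\<^sup>2) \<longlonglongrightarrow> 0"
      using kW cnd_ub AE_space
    proof eventually_elim
      fix x assume i: "integrable G0 (\<lambda>\<theta>. \<kappa> x \<theta> *\<^sub>R ?W x \<theta>)" and z: "cnd G0 ub x = 0" and x: "x \<in> space \<mu>"
      have "(\<lambda>n. \<integral>\<theta>. \<kappa> x \<theta> *\<^sub>R (sqrt (real n) * em1 \<tau> n x \<theta>) \<partial>G0)
          \<longlonglongrightarrow> (\<integral>\<theta>. \<kappa> x \<theta> *\<^sub>R (\<i> * complex_of_real (- \<tau> * ub x \<theta>)) \<partial>G0)"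
      proof (rule integral_dominated_convergence[where w = "\<lambda>\<theta>. \<kappa> x \<theta> *\<^sub>R ?W x \<theta>"])
        show "AE \<theta> in G0. (\<lambda>n. \<kappa> x \<theta> *\<^sub>R (sqrt (real n) * em1 \<tau> n x \<theta>)) \<longlonglongrightarrow> \<kappa> x \<theta> *\<^sub>R (\<i> * complex_of_real (- \<tau> * ub x \<theta>))"
          unfolding em1_def by (intro AE_I2 tendsto_scaleR tendsto_const iexp_sqrt_limit1)
        show "AE \<theta> in G0. norm (\<kappa> x \<theta> *\<^sub>R (sqrt (real n) * em1 \<tau> n x \<theta>)) \<le> \<kappa> x \<theta> *\<^sub>R ?W x \<theta>" for n
        proof (rule AE_I2)
          fix \<theta> assume "\<theta> \<in> space G0"
          then have "0 \<le> \<kappa> x \<theta>" using \<kappa>_nonneg x dominated_space[OF dominated_G0] by simp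
          then show "norm (\<kappa> x \<theta> *\<^sub>R (sqrt (real n) * em1 \<tau> n x \<theta>)) \<le> \<kappa> x \<theta> *\<^sub>R ?W x \<theta>"
            using em1_le[of n \<tau> x \<theta>] by (simp add: norm_mult mult_left_mono)
        qed
        show "(\<lambda>\<theta>. \<kappa> x \<theta> *\<^sub>R (sqrt (real n) * em1 \<tau> n x \<theta>)) \<in> borel_measurable G0" for n
          by (rule kfm[of "\<lambda>x \<theta>. sqrt (real n) * em1 \<tau> n x \<theta>", OF _ x])
            (use em1_fst_snd in \<open>simp add: case_prod_beta'\<close>)
        show "(\<lambda>\<theta>. \<kappa> x \<theta> *\<^sub>R (\<i> * complex_of_real (- \<tau> * ub x \<theta>))) \<in> borel_measurable G0"
          by (rule kfm[of "\<lambda>x \<theta>. \<i> * complex_of_real (- \<tau> * ub x \<theta>)", OF _ x])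
            (use ub_fst_snd in \<open>simp add: case_prod_beta'\<close>)
      qed (rule i)
      also have "(\<integral>\<theta>. \<kappa> x \<theta> *\<^sub>R (\<i> * complex_of_real (- \<tau> * ub x \<theta>)) \<partial>G0) = \<i> * complex_of_real (- \<tau> * cnd G0 ub x)"
      proof -
        have "\<kappa> x \<theta> *\<^sub>R (\<i> * complex_of_real (- \<tau> * ub x \<theta>)) = (\<i> * complex_of_real (- \<tau>)) * complex_of_real (\<kappa> x \<theta> *\<^sub>R ub x \<theta>)" for \<theta>
          by (simp add: scaleR_conv_of_real)
        then show ?thesis
          unfolding cnd_def by (simp only: integral_mult_right_zero integral_complex_of_real of_real_mult mult.assoc)
      qed
      also have "\<i> * complex_of_real (- \<tau> * cnd G0 ub x) = 0" by (simp add: z)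
      finally have l: "(\<lambda>n. \<integral>\<theta>. \<kappa> x \<theta> *\<^sub>R (sqrt (real n) * em1 \<tau> n x \<theta>) \<partial>G0) \<longlonglongrightarrow> 0" .
      have e: "(\<integral>\<theta>. \<kappa> x \<theta> *\<^sub>R (sqrt (real n) * em1 \<tau> n x \<theta>) \<partial>G0) = sqrt (real n) * cnd G0 (em1 \<tau> n) x" for n
        using cnd_mult[OF dominated_G0, of "\<lambda>_. complex_of_real (sqrt (real n))" "em1 \<tau> n" x] by (simp only: cnd_def)
      have "(\<lambda>n. (cmod (sqrt (real n) * cnd G0 (em1 \<tau> n) x))\<^sup>2) \<longlonglongrightarrow> (cmod 0)\<^sup>2"
        using l unfolding e by (intro tendsto_intros)
      then show "(\<lambda>n. (cmod (sqrt (real n) * cnd G0 (em1 \<tau> n) x))\<^sup>2) \<longlonglongrightarrow> 0" by simp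
    qed
    show "AE x in \<mu>. norm ((cmod (sqrt (real n) * cnd G0 (em1 \<tau> n) x))\<^sup>2) \<le> cnd G0 (\<lambda>x \<theta>. (?W x \<theta>)\<^sup>2) x" for n
      using cnd_jensen[OF Wm W2] kW AE_space
    proof eventually_elim
      fix x assume j: "(cnd G0 ?W x)\<^sup>2 \<le> cnd G0 (\<lambda>x \<theta>. (?W x \<theta>)\<^sup>2) x" and i: "integrable G0 (\<lambda>\<theta>. \<kappa> x \<theta> *\<^sub>R ?W x \<theta>)"
        and x: "x \<in> space \<mu>"
      have e: "complex_of_real (sqrt (real n)) * cnd G0 (em1 \<tau> n) x = cnd G0 (\<lambda>x \<theta>. complex_of_real (sqrt (real n)) * em1 \<tau> n x \<theta>) x"
        using cnd_mult[OF dominated_G0, of "\<lambda>_. complex_of_real (sqrt (real n))" "em1 \<tau> n" x] by simp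
      have "cmod (sqrt (real n) * cnd G0 (em1 \<tau> n) x) \<le> (\<integral>\<theta>. \<kappa> x \<theta> *\<^sub>R ?W x \<theta> \<partial>G0)"
        unfolding e unfolding cnd_def
      proof (rule order_trans[OF integral_norm_bound], rule integral_mono_AE'[OF i])
        show "AE \<theta> in G0. norm (\<kappa> x \<theta> *\<^sub>R (complex_of_real (sqrt (real n)) * em1 \<tau> n x \<theta>)) \<le> \<kappa> x \<theta> *\<^sub>R ?W x \<theta>"
        proof (rule AE_I2)
          fix \<theta> assume "\<theta> \<in> space G0"
          then have "0 \<le> \<kappa> x \<theta>" using \<kappa>_nonneg x dominated_space[OF dominated_G0] by simp
          then show "norm (\<kappa> x \<theta> *\<^sub>R (complex_of_real (sqrt (real n)) * em1 \<tau> n x \<theta>)) \<le> \<kappa> x \<theta> *\<^sub>R ?W x \<theta>"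
            using em1_le[of n \<tau> x \<theta>] by (simp add: norm_mult mult_left_mono)
        qed
        show "AE \<theta> in G0. 0 \<le> \<kappa> x \<theta> *\<^sub>R ?W x \<theta>"
          by (rule AE_I2) (use \<kappa>_nonneg x dominated_space[OF dominated_G0] in auto)
      qed
      then have "(cmod (sqrt (real n) * cnd G0 (em1 \<tau> n) x))\<^sup>2 \<le> (cnd G0 ?W x)\<^sup>2"
        unfolding cnd_def[of G0 ?W] by (intro power_mono) auto
      then show "norm ((cmod (sqrt (real n) * cnd G0 (em1 \<tau> n) x))\<^sup>2) \<le> cnd G0 (\<lambda>x \<theta>. (?W x \<theta>)\<^sup>2) x"
        using j by simp
    qed
  qed simp
  then show ?thesis by (simp add: norm_mult power_mult_distrib)
qed

end

section \<open>Rates of the perturbation along a curve\<close>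

context utility_model
begin

text \<open>On \<open>X = x\<close>, the factor \<open>pn + Dn\<close> is the likelihood ratio \<open>pn\<close> of the curve times the conditional
  characteristic function of \<open>-ub/\<surd>n\<close>.\<close>

definition pn :: "'b measure \<Rightarrow> real \<Rightarrow> nat \<Rightarrow> 'a \<Rightarrow> real" where
  "pn G c n x = 1 + c * gs G x / sqrt (real n)"

definition Dn :: "'b measure \<Rightarrow> real \<Rightarrow> real \<Rightarrow> nat \<Rightarrow> 'a \<Rightarrow> complex" where
  "Dn G c \<tau> n x = of_real (1 - c / sqrt (real n)) * cnd G0 (em1 \<tau> n) x + of_real (c / sqrt (real n)) * cnd G (em1 \<tau> n) x"

context
  fixes G assumes G: "smooth G"
begin

interpretation JG: prob_space "J G" by (rule prob_space_J[OF smooth_dominated[OF G]])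

text \<open>Under \<open>G\<close> the residual need not be centred, and its mean
  \<open>bias G\<close> appears at order \<open>1 / sqrt n\<close>. Multiplied by the mixing weight
  \<open>c / sqrt n\<close> it reaches the same order 1/n as the Gaussian term from
  \<open>G0\<close>.\<close>

lemma em1_integral_limit: "(\<lambda>n. sqrt (real n) * (\<integral>x. cnd G (em1 \<tau> n) x \<partial>\<mu>)) \<longlonglongrightarrow> - \<i> * complex_of_real (\<tau> * bias G)"
proof -
  let ?W = "\<lambda>z. - \<tau> * ub (fst z) (snd z)"
  have Wm: "?W \<in> borel_measurable (J G)"
    by (rule measurable_J[OF smooth_dominated[OF G]]) measurable
  have L: "(\<lambda>n. \<integral>z. sqrt (real n) * (iexp (?W z / sqrt (real n)) - 1) * complex_of_real 1 \<partial>J G)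
    \<longlonglongrightarrow> \<i> * complex_of_real (\<integral>z. ?W z * 1 \<partial>J G)"
    by (rule integral_iexp_limit1[OF Wm borel_measurable_const]) (use ub_integrable[OF G] in simp)
  have S: "\<i> * complex_of_real (\<integral>z. ?W z * 1 \<partial>J G) = - \<i> * complex_of_real (\<tau> * bias G)" by (simp add: bias_def)
  have E: "(\<integral>z. sqrt (real n) * (iexp (?W z / sqrt (real n)) - 1) * complex_of_real 1 \<partial>J G)
      = sqrt (real n) * (\<integral>x. cnd G (em1 \<tau> n) x \<partial>\<mu>)" for n
  proof -
    have i: "integrable (J G) (\<lambda>z. em1 \<tau> n (fst z) (snd z))"
      by (rule integrable_J_bounded[OF smooth_dominated[OF G] em1_fst_snd em1_le2])
    have "(\<integral>z. sqrt (real n) * (iexp (?W z / sqrt (real n)) - 1) * complex_of_real 1 \<partial>J G)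
        = (\<integral>z. sqrt (real n) * em1 \<tau> n (fst z) (snd z) \<partial>J G)"
      unfolding em1_def by (simp only: of_real_1 mult_1_right)
    also have "\<dots> = sqrt (real n) * (\<integral>x. cnd G (em1 \<tau> n) x \<partial>\<mu>)"
      unfolding cnd_integral[OF smooth_dominated[OF G] em1_measurable i] by (rule integral_mult_right_zero)
    finally show ?thesis .
  qed
  show ?thesis using L by (simp only: S E)
qed

lemma cnd_em1_limit: "AE x in \<mu>. (\<lambda>n. cnd G (em1 \<tau> n) x) \<longlonglongrightarrow> 0"
  using lr_AE_integrable[OF smooth_dominated[OF G]] AE_space
proof eventually_elim
  fix x assume k: "integrable G (\<lambda>\<theta>. \<kappa> x \<theta>)" and x: "x \<in> space \<mu>"
  have "(\<lambda>n. \<integral>\<theta>. \<kappa> x \<theta> *\<^sub>R em1 \<tau> n x \<theta> \<partial>G) \<longlonglongrightarrow> (\<integral>\<theta>. 0 \<partial>G)"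
  proof (rule integral_dominated_convergence[where w = "\<lambda>\<theta>. \<kappa> x \<theta> * 2"])
    show "AE \<theta> in G. (\<lambda>n. \<kappa> x \<theta> *\<^sub>R em1 \<tau> n x \<theta>) \<longlonglongrightarrow> 0"
    proof (rule AE_I2)
      fix \<theta>
      have "(\<lambda>n. \<kappa> x \<theta> *\<^sub>R em1 \<tau> n x \<theta>) \<longlonglongrightarrow> \<kappa> x \<theta> *\<^sub>R 0"
        by (intro tendsto_scaleR tendsto_const em1_limit)
      then show "(\<lambda>n. \<kappa> x \<theta> *\<^sub>R em1 \<tau> n x \<theta>) \<longlonglongrightarrow> 0" by simp
    qed
    show "AE \<theta> in G. norm (\<kappa> x \<theta> *\<^sub>R em1 \<tau> n x \<theta>) \<le> \<kappa> x \<theta> * 2" for n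
    proof (rule AE_I2)
      fix \<theta> assume "\<theta> \<in> space G"
      then have "0 \<le> \<kappa> x \<theta>" using \<kappa>_nonneg x dominated_space[OF smooth_dominated[OF G]] by simp
      then show "norm (\<kappa> x \<theta> *\<^sub>R em1 \<tau> n x \<theta>) \<le> \<kappa> x \<theta> * 2"
        using em1_le2[of \<tau> n x \<theta>] by (simp add: mult_left_mono)
    qed
    show "(\<lambda>\<theta>. \<kappa> x \<theta> *\<^sub>R em1 \<tau> n x \<theta>) \<in> borel_measurable G" for n
    proof -
      have x': "x \<in> space \<nu>" using x by simp
      have "(\<lambda>\<theta>. \<kappa> x \<theta>) \<in> borel_measurable T" "(\<lambda>\<theta>. em1 \<tau> n x \<theta>) \<in> borel_measurable T"
        using measurable_compose[OF measurable_Pair1'[OF x'] \<kappa>_measurable] measurable_compose[OF measurable_Pair1'[OF x'] em1_measurable]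
        by simp_all
      then show ?thesis using dominated_sets[OF smooth_dominated[OF G]] by (simp cong: measurable_cong_sets)
    qed
  qed (use k in simp_all)
  then show "(\<lambda>n. cnd G (em1 \<tau> n) x) \<longlonglongrightarrow> 0" unfolding cnd_def by simp
qed

lemma cnd_em1_bound: "AE x in \<mu>. cmod (cnd G (em1 \<tau> n) x) \<le> 2 * lr G x"
  by (rule cnd_bounded(1)[OF G em1_measurable em1_le2])

lemma cnd_em1_meas: "cnd G (em1 \<tau> n) \<in> borel_measurable \<mu>"
  unfolding measurable_mu by (rule cnd_measurable[OF smooth_dominated[OF G] em1_measurable])

lemma cnd_em1_sq: "integrable \<mu> (\<lambda>x. (cmod (cnd G (em1 \<tau> n) x))\<^sup>2)"
  by (rule cnd_bounded(2)[OF G em1_measurable em1_le2])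

lemma cnd_em1_integrable: "integrable \<mu> (cnd G (em1 \<tau> n))"
  by (rule cnd_integrable[OF smooth_dominated[OF G] em1_measurable])
    (rule integrable_J_bounded[OF smooth_dominated[OF G] em1_fst_snd em1_le2])

text \<open>Convergence without a rate suffices: in the squared norm of \<open>Dn\<close> this term
  carries the weight \<open>c\<^sup>2 / n\<close>, which compensates the factor
  \<open>n\<close>.\<close>

lemma em1_sq_limit: "(\<lambda>n. \<integral>x. (cmod (cnd G (em1 \<tau> n) x))\<^sup>2 \<partial>\<mu>) \<longlonglongrightarrow> 0"
proof -
  have "(\<lambda>n. \<integral>x. (cmod (cnd G (em1 \<tau> n) x))\<^sup>2 \<partial>\<mu>) \<longlonglongrightarrow> (\<integral>x. 0 \<partial>\<mu>)"
  proof (rule integral_dominated_convergence[where w = "\<lambda>x. (2 * lr G x)\<^sup>2"])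
    show "integrable \<mu> (\<lambda>x. (2 * lr G x)\<^sup>2)" by (rule sq_int_integrable_sq[OF sq_int_scale[OF smooth_lr[OF G]]])
    show "AE x in \<mu>. (\<lambda>n. (cmod (cnd G (em1 \<tau> n) x))\<^sup>2) \<longlonglongrightarrow> 0"
      using cnd_em1_limit
    proof eventually_elim
      fix x assume "(\<lambda>n. cnd G (em1 \<tau> n) x) \<longlonglongrightarrow> 0"
      then have "(\<lambda>n. (cmod (cnd G (em1 \<tau> n) x))\<^sup>2) \<longlonglongrightarrow> (cmod 0)\<^sup>2" by (intro tendsto_intros)
      then show "(\<lambda>n. (cmod (cnd G (em1 \<tau> n) x))\<^sup>2) \<longlonglongrightarrow> 0" by simp
    qed
    show "AE x in \<mu>. norm ((cmod (cnd G (em1 \<tau> n) x))\<^sup>2) \<le> (2 * lr G x)\<^sup>2" for n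
      using cnd_em1_bound[of \<tau> n]
    proof eventually_elim
      fix x assume "cmod (cnd G (em1 \<tau> n) x) \<le> 2 * lr G x"
      then have "(cmod (cnd G (em1 \<tau> n) x))\<^sup>2 \<le> (2 * lr G x)\<^sup>2" by (intro power_mono) auto
      then show "norm ((cmod (cnd G (em1 \<tau> n) x))\<^sup>2) \<le> (2 * lr G x)\<^sup>2" by simp
    qed
    show "(\<lambda>x. (cmod (cnd G (em1 \<tau> n) x))\<^sup>2) \<in> borel_measurable \<mu>" for n
      using cnd_em1_meas by measurable
  qed simp
  then show ?thesis by simp
qed

lemma em1_score_limit: "(\<lambda>n. \<integral>x. cnd G (em1 \<tau> n) x * of_real (gs G x) \<partial>\<mu>) \<longlonglongrightarrow> 0"
proof (rule Lim_null_comparison)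
  show "\<forall>\<^sub>F n in sequentially. norm (\<integral>x. cnd G (em1 \<tau> n) x * of_real (gs G x) \<partial>\<mu>)
      \<le> sqrt (\<integral>x. (cmod (cnd G (em1 \<tau> n) x))\<^sup>2 \<partial>\<mu>) * sqrt (\<integral>x. (gs G x)\<^sup>2 \<partial>\<mu>)"
    using complex_integral_Cauchy_Schwarz(2)[OF cnd_em1_meas cnd_em1_sq gs_sq_int[OF G]] by simp
  have "(\<lambda>n. sqrt (\<integral>x. (cmod (cnd G (em1 \<tau> n) x))\<^sup>2 \<partial>\<mu>) * sqrt (\<integral>x. (gs G x)\<^sup>2 \<partial>\<mu>)) \<longlonglongrightarrow> sqrt 0 * sqrt (\<integral>x. (gs G x)\<^sup>2 \<partial>\<mu>)"
    by (intro tendsto_intros em1_sq_limit)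
  then show "(\<lambda>n. sqrt (\<integral>x. (cmod (cnd G (em1 \<tau> n) x))\<^sup>2 \<partial>\<mu>) * sqrt (\<integral>x. (gs G x)\<^sup>2 \<partial>\<mu>)) \<longlonglongrightarrow> 0" by simp
qed

lemma pn_sq_int: "sq_int \<mu> (pn G c n)"
proof -
  have "sq_int \<mu> (\<lambda>x. 1 + (c / sqrt (real n)) * gs G x)"
    by (intro sq_int_add M.sq_int_const sq_int_scale gs_sq_int[OF G])
  then show ?thesis by (simp add: pn_def[abs_def])
qed

end

lemmas cnd_em1_meas0 = cnd_em1_meas[OF smooth_G0] and cnd_em1_sq0 = cnd_em1_sq[OF smooth_G0]
  and cnd_em1_integrable0 = cnd_em1_integrable[OF smooth_G0]

context
  fixes G assumes G: "smooth G"
begin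

lemma Dn_meas: "Dn G c \<tau> n \<in> borel_measurable \<mu>"
  unfolding Dn_def using cnd_em1_meas0 cnd_em1_meas[OF G] by measurable

lemma Dn_bound: "(cmod (Dn G c \<tau> n x))\<^sup>2 \<le> 2 * (1 - c / sqrt (real n))\<^sup>2 * (cmod (cnd G0 (em1 \<tau> n) x))\<^sup>2
    + 2 * (c / sqrt (real n))\<^sup>2 * (cmod (cnd G (em1 \<tau> n) x))\<^sup>2"
proof -
  define a where "a = of_real (1 - c / sqrt (real n)) * cnd G0 (em1 \<tau> n) x"
  define b where "b = of_real (c / sqrt (real n)) * cnd G (em1 \<tau> n) x"
  have "(cmod (a + b))\<^sup>2 \<le> (cmod a + cmod b)\<^sup>2" by (intro power_mono norm_triangle_ineq) simp
  also have "\<dots> \<le> 2 * (cmod a)\<^sup>2 + 2 * (cmod b)\<^sup>2"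
    using sum_squares_bound[of "cmod a" "cmod b"] by (simp add: power2_sum)
  finally show ?thesis
    unfolding Dn_def a_def b_def by (simp only: norm_mult norm_of_real power_mult_distrib power2_abs mult.assoc)
qed

lemma Dn_bound_integrable: "integrable \<mu> (\<lambda>x. 2 * (1 - c / sqrt (real n))\<^sup>2 * (cmod (cnd G0 (em1 \<tau> n) x))\<^sup>2
    + 2 * (c / sqrt (real n))\<^sup>2 * (cmod (cnd G (em1 \<tau> n) x))\<^sup>2)"
  using cnd_em1_sq0 cnd_em1_sq[OF G] by simp

lemma Dn_sq: "integrable \<mu> (\<lambda>x. (cmod (Dn G c \<tau> n x))\<^sup>2)"
proof (rule Bochner_Integration.integrable_bound[OF Dn_bound_integrable[of c n \<tau>]])
  show "(\<lambda>x. (cmod (Dn G c \<tau> n x))\<^sup>2) \<in> borel_measurable \<mu>" using Dn_meas by measurable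
  show "AE x in \<mu>. norm ((cmod (Dn G c \<tau> n x))\<^sup>2) \<le> norm (2 * (1 - c / sqrt (real n))\<^sup>2 * (cmod (cnd G0 (em1 \<tau> n) x))\<^sup>2
    + 2 * (c / sqrt (real n))\<^sup>2 * (cmod (cnd G (em1 \<tau> n) x))\<^sup>2)"
    by (rule AE_I2, simp only: real_norm_def abs_power2, rule order_trans[OF Dn_bound abs_ge_self])
qed

lemma Dn_sq_limit: "(\<lambda>n. real n * (\<integral>x. (cmod (Dn G c \<tau> n x))\<^sup>2 \<partial>\<mu>)) \<longlonglongrightarrow> 0"
proof (rule Lim_null_comparison)
  let ?ea = "\<lambda>n. real n * (\<integral>x. (cmod (cnd G0 (em1 \<tau> n) x))\<^sup>2 \<partial>\<mu>)" and ?e = "\<lambda>n. \<integral>x. (cmod (cnd G (em1 \<tau> n) x))\<^sup>2 \<partial>\<mu>"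
  show "\<forall>\<^sub>F n in sequentially. norm (real n * (\<integral>x. (cmod (Dn G c \<tau> n x))\<^sup>2 \<partial>\<mu>))
      \<le> 2 * (1 - c / sqrt (real n))\<^sup>2 * ?ea n + 2 * c\<^sup>2 * ?e n"
    using eventually_gt_at_top[of "0::nat"]
  proof eventually_elim
    fix n :: nat assume n: "0 < n"
    have "(\<integral>x. (cmod (Dn G c \<tau> n x))\<^sup>2 \<partial>\<mu>) \<le> (\<integral>x. 2 * (1 - c / sqrt (real n))\<^sup>2 * (cmod (cnd G0 (em1 \<tau> n) x))\<^sup>2
        + 2 * (c / sqrt (real n))\<^sup>2 * (cmod (cnd G (em1 \<tau> n) x))\<^sup>2 \<partial>\<mu>)"
      by (rule integral_mono[OF Dn_sq Dn_bound_integrable Dn_bound])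
    also have "\<dots> = 2 * (1 - c / sqrt (real n))\<^sup>2 * (\<integral>x. (cmod (cnd G0 (em1 \<tau> n) x))\<^sup>2 \<partial>\<mu>)
        + 2 * (c / sqrt (real n))\<^sup>2 * (\<integral>x. (cmod (cnd G (em1 \<tau> n) x))\<^sup>2 \<partial>\<mu>)"
      using cnd_em1_sq0 cnd_em1_sq[OF G] by simp
    finally have "real n * (\<integral>x. (cmod (Dn G c \<tau> n x))\<^sup>2 \<partial>\<mu>) \<le> real n * (2 * (1 - c / sqrt (real n))\<^sup>2 * (\<integral>x. (cmod (cnd G0 (em1 \<tau> n) x))\<^sup>2 \<partial>\<mu>)
        + 2 * (c / sqrt (real n))\<^sup>2 * (\<integral>x. (cmod (cnd G (em1 \<tau> n) x))\<^sup>2 \<partial>\<mu>))"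
      by (intro mult_left_mono) auto
    also have "\<dots> = 2 * (1 - c / sqrt (real n))\<^sup>2 * ?ea n + 2 * (real n * (c / sqrt (real n))\<^sup>2) * ?e n"
      by (simp only: ring_distribs ac_simps)
    also have "real n * (c / sqrt (real n))\<^sup>2 = c\<^sup>2" using n by (simp add: power_divide)
    finally show "norm (real n * (\<integral>x. (cmod (Dn G c \<tau> n x))\<^sup>2 \<partial>\<mu>))
      \<le> 2 * (1 - c / sqrt (real n))\<^sup>2 * ?ea n + 2 * c\<^sup>2 * ?e n" by simp
  qed
  have "(\<lambda>n. c / sqrt (real n)) \<longlonglongrightarrow> 0" by real_asymp
  then have "(\<lambda>n. 2 * (1 - c / sqrt (real n))\<^sup>2 * ?ea n + 2 * c\<^sup>2 * ?e n) \<longlonglongrightarrow> 2 * (1 - 0)\<^sup>2 * 0 + 2 * c\<^sup>2 * 0"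
    by (intro tendsto_intros em1_sq_limit_G0 em1_sq_limit[OF G])
  then show "(\<lambda>n. 2 * (1 - c / sqrt (real n))\<^sup>2 * ?ea n + 2 * c\<^sup>2 * ?e n) \<longlonglongrightarrow> 0" by simp
qed

text \<open>Of the four terms two survive: the mean of \<open>em1\<close> under \<open>G0\<close>
  gives the Gaussian exponent, that under \<open>G\<close> gives the phase. The products with
  \<open>gs G\<close> vanish in the limit, for \<open>G0\<close> by orthogonality of
  \<open>ub\<close> and for \<open>G\<close> by Cauchy-Schwarz.\<close>

lemma Dn_pn_limit: "(\<lambda>n. real n * (\<integral>x. Dn G c \<tau> n x * of_real (pn G c n x) \<partial>\<mu>))
    \<longlonglongrightarrow> - (\<i> * complex_of_real (\<tau> * c * bias G)) - complex_of_real (\<tau>\<^sup>2 * s2 / 2)"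
proof -
  let ?t = "\<lambda>n::nat. complex_of_real (c / sqrt (real n))"
  let ?Ia = "\<lambda>n. \<integral>x. cnd G0 (em1 \<tau> n) x \<partial>\<mu>" and ?I = "\<lambda>n. \<integral>x. cnd G (em1 \<tau> n) x \<partial>\<mu>"
  let ?ga = "\<lambda>n. \<integral>x. cnd G0 (em1 \<tau> n) x * of_real (gs G x) \<partial>\<mu>" and ?g = "\<lambda>n. \<integral>x. cnd G (em1 \<tau> n) x * of_real (gs G x) \<partial>\<mu>"
  let ?L = "\<lambda>n. (1 - ?t n) * (real n * ?Ia n) + complex_of_real c * (sqrt (real n) * ?I n)
      + complex_of_real c * (1 - ?t n) * (sqrt (real n) * ?ga n) + (complex_of_real c)\<^sup>2 * ?g n"
  have "(\<lambda>n. c / sqrt (real n)) \<longlonglongrightarrow> 0" by real_asymp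
  from tendsto_of_real[OF this, where 'a = complex] have t: "?t \<longlonglongrightarrow> 0" by simp
  have "?L \<longlonglongrightarrow> (1 - 0) * (- complex_of_real (\<tau>\<^sup>2 * s2 / 2)) + complex_of_real c * (- \<i> * complex_of_real (\<tau> * bias G)) + complex_of_real c * (1 - 0) * 0 + (complex_of_real c)\<^sup>2 * 0"
    by (rule tendsto_add[OF tendsto_add[OF tendsto_add[OF tendsto_mult[OF tendsto_diff[OF tendsto_const t] em1_integral_limit_G0]
            tendsto_mult[OF tendsto_const em1_integral_limit[OF G]]]
          tendsto_mult[OF tendsto_mult[OF tendsto_const tendsto_diff[OF tendsto_const t]] em1_score_limit_G0[OF gs_sq_int[OF G]]]]
        tendsto_mult[OF tendsto_const em1_score_limit[OF G]]])
  also have "(1 - 0) * (- complex_of_real (\<tau>\<^sup>2 * s2 / 2)) + complex_of_real c * (- \<i> * complex_of_real (\<tau> * bias G)) + complex_of_real c * (1 - 0) * 0 + (complex_of_real c)\<^sup>2 * 0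
      = - (\<i> * complex_of_real (\<tau> * c * bias G)) - complex_of_real (\<tau>\<^sup>2 * s2 / 2)"
    by simp
  finally have L: "?L \<longlonglongrightarrow> - (\<i> * complex_of_real (\<tau> * c * bias G)) - complex_of_real (\<tau>\<^sup>2 * s2 / 2)" .
  show ?thesis
  proof (rule Lim_transform_eventually[OF L])
    show "\<forall>\<^sub>F n in sequentially. ?L n = real n * (\<integral>x. Dn G c \<tau> n x * of_real (pn G c n x) \<partial>\<mu>)"
      using eventually_gt_at_top[of "0::nat"]
    proof eventually_elim
      fix n :: nat assume n: "0 < n"
      note i0 = cnd_em1_integrable0[of \<tau> n] and i = cnd_em1_integrable[OF G, of \<tau> n]
      note g0 = complex_integral_Cauchy_Schwarz(1)[OF cnd_em1_meas0 cnd_em1_sq0 gs_sq_int[OF G], of \<tau> n]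
      note g = complex_integral_Cauchy_Schwarz(1)[OF cnd_em1_meas[OF G] cnd_em1_sq[OF G] gs_sq_int[OF G], of \<tau> n]
      have "(\<integral>x. Dn G c \<tau> n x * of_real (pn G c n x) \<partial>\<mu>)
        = (\<integral>x. (1 - ?t n) * cnd G0 (em1 \<tau> n) x + ?t n * cnd G (em1 \<tau> n) x
            + ((1 - ?t n) * ?t n) * (cnd G0 (em1 \<tau> n) x * of_real (gs G x))
            + (?t n * ?t n) * (cnd G (em1 \<tau> n) x * of_real (gs G x)) \<partial>\<mu>)"
        by (rule Bochner_Integration.integral_cong[OF refl]) (simp add: Dn_def pn_def algebra_simps add_divide_distrib)
      also have "\<dots> = (1 - ?t n) * ?Ia n + ?t n * ?I n + ((1 - ?t n) * ?t n) * ?ga n + (?t n * ?t n) * ?g n"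
        using i0 i g0 g by simp
      finally have e: "(\<integral>x. Dn G c \<tau> n x * of_real (pn G c n x) \<partial>\<mu>)
         = (1 - ?t n) * ?Ia n + ?t n * ?I n + ((1 - ?t n) * ?t n) * ?ga n + (?t n * ?t n) * ?g n" .
      define r where "r = complex_of_real (sqrt (real n))"
      have r: "r \<noteq> 0" using n by (simp add: r_def)
      have nn: "complex_of_real (real n) = r * r" unfolding r_def by (simp flip: of_real_mult)
      have tr: "?t n = c / r" by (simp add: r_def)
      have gen: "(1 - C / R) * (R * R * a) + C * (R * b) + C * (1 - C / R) * (R * d) + C\<^sup>2 * e
          = R * R * ((1 - C / R) * a + C / R * b + (1 - C / R) * (C / R) * d + C / R * (C / R) * e)"
        if "R \<noteq> 0" for R C a b d e :: complex
        using that by (simp add: power2_eq_square algebra_simps)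
      show "?L n = real n * (\<integral>x. Dn G c \<tau> n x * of_real (pn G c n x) \<partial>\<mu>)"
        unfolding e nn tr r_def[symmetric] by (rule gen[OF r])
    qed
  qed
qed

lemma pn_sq_limit: "(\<lambda>n. real n * ((\<integral>x. (pn G c n x)\<^sup>2 \<partial>\<mu>) - 1)) \<longlonglongrightarrow> c\<^sup>2 * (\<integral>x. (gs G x)\<^sup>2 \<partial>\<mu>)"
proof (rule tendsto_eventually)
  show "\<forall>\<^sub>F n in sequentially. real n * ((\<integral>x. (pn G c n x)\<^sup>2 \<partial>\<mu>) - 1) = c\<^sup>2 * (\<integral>x. (gs G x)\<^sup>2 \<partial>\<mu>)"
    using eventually_gt_at_top[of "0::nat"]
  proof eventually_elim
    fix n :: nat assume n: "0 < n"
    have "(\<integral>x. (pn G c n x)\<^sup>2 \<partial>\<mu>) = (\<integral>x. 1 + 2 * (c / sqrt (real n)) * gs G x + (c / sqrt (real n))\<^sup>2 * (gs G x)\<^sup>2 \<partial>\<mu>)"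
      by (rule Bochner_Integration.integral_cong[OF refl]) (simp add: pn_def power2_eq_square algebra_simps)
    also have "\<dots> = 1 + (c / sqrt (real n))\<^sup>2 * (\<integral>x. (gs G x)\<^sup>2 \<partial>\<mu>)"
      using M.sq_int_integrable[OF gs_sq_int[OF G]] sq_int_integrable_sq[OF gs_sq_int[OF G]] gs_mean[OF G]
      by (simp add: M.prob_space[simplified])
    finally show "real n * ((\<integral>x. (pn G c n x)\<^sup>2 \<partial>\<mu>) - 1) = c\<^sup>2 * (\<integral>x. (gs G x)\<^sup>2 \<partial>\<mu>)"
      using n by (simp add: power_divide)
  qed
qed

abbreviation zlim :: "real \<Rightarrow> real \<Rightarrow> complex" where
  "zlim c \<tau> \<equiv> - (\<i> * complex_of_real (\<tau> * c * bias G)) - complex_of_real (\<tau>\<^sup>2 * s2 / 2)"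

lemmas Dn_product_limit = M.product_L2_limit[OF pn_sq_int[OF G] Dn_meas Dn_sq pn_sq_limit Dn_pn_limit Dn_sq_limit]

section \<open>Passing from one observation to the sample\<close>

lemma mixture_facts:
  assumes t: "t \<in> {0..1}"
  shows "prob_space (J (mixture t G0 G))" "sets (J (mixture t G0 G)) = sets (\<nu> \<Otimes>\<^sub>M T)"
    "fst \<in> measurable (J (mixture t G0 G)) \<mu>"
proof -
  note s = dominated_sets[OF smooth_dominated[OF G]] dominated_prob[OF smooth_dominated[OF G]]
  have m: "prob_space (mixture t G0 G)" "sets (mixture t G0 G) = sets T"
    using prob_space_mixture[OF G0(1) s(2) _ t] s G0 by auto
  show "prob_space (J (mixture t G0 G))" by (rule prob_space_joint_law[OF sigma_finite_measure_axioms m f])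
  show j: "sets (J (mixture t G0 G)) = sets (\<nu> \<Otimes>\<^sub>M T)" by (rule sets_joint_law[OF m(2)])
  have "fst \<in> measurable (\<nu> \<Otimes>\<^sub>M T) \<nu>" by simp
  then show "fst \<in> measurable (J (mixture t G0 G)) \<mu>"
    using j by (simp cong: measurable_cong_sets)
qed

lemma integral_J_fst_mult:
  assumes \<phi>: "(\<phi> :: 'a \<Rightarrow> complex) \<in> borel_measurable \<nu>" "\<And>x. cmod (\<phi> x) \<le> B" and H: "dominated H"
    and F: "(\<lambda>(x, \<theta>). F x \<theta>) \<in> borel_measurable (\<nu> \<Otimes>\<^sub>M T)" "\<And>x \<theta>. cmod (F x \<theta>) \<le> C"
  shows "integrable (J H) (\<lambda>z. \<phi> (fst z) * F (fst z) (snd z))"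
    "(\<integral>z. \<phi> (fst z) * F (fst z) (snd z) \<partial>J H) = (\<integral>x. \<phi> x * cnd H F x \<partial>\<mu>)"
    "integrable \<mu> (\<lambda>x. \<phi> x * cnd H F x)"
proof -
  have Ff: "(\<lambda>z. F (fst z) (snd z)) \<in> borel_measurable (\<nu> \<Otimes>\<^sub>M T)" using F by (simp add: case_prod_beta')
  have m: "(\<lambda>z. \<phi> (fst z) * F (fst z) (snd z)) \<in> borel_measurable (\<nu> \<Otimes>\<^sub>M T)"
    using Ff measurable_compose[OF measurable_fst \<phi>(1)] by measurable
  then have m': "(\<lambda>(x, \<theta>). \<phi> x * F x \<theta>) \<in> borel_measurable (\<nu> \<Otimes>\<^sub>M T)" by (simp add: case_prod_beta')
  have "0 \<le> B" using order_trans[OF norm_ge_zero \<phi>(2)] .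
  then have b: "norm (\<phi> (fst z) * F (fst z) (snd z)) \<le> B * C" for z
    unfolding norm_mult by (intro mult_mono \<phi> F) auto
  show i: "integrable (J H) (\<lambda>z. \<phi> (fst z) * F (fst z) (snd z))"
    by (rule integrable_J_bounded[OF H m b])
  show "(\<integral>z. \<phi> (fst z) * F (fst z) (snd z) \<partial>J H) = (\<integral>x. \<phi> x * cnd H F x \<partial>\<mu>)"
    using cnd_integral[OF H m' i] unfolding cnd_mult[OF H] ..
  show "integrable \<mu> (\<lambda>x. \<phi> x * cnd H F x)"
    using cnd_integrable[OF H m' i] unfolding cnd_mult[OF H, abs_def] .
qed

text \<open>The joint law is affine along the curve and \<open>lr G0 = 1\<close> almost everywhere,
  so the likelihood ratios of the end points combine to \<open>pn\<close> and the exponential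
  corrections to \<open>Dn\<close>. This is the one-observation input \<open>mq\<close> of
  \<open>integral_sample_observed\<close>.\<close>

lemma integral_mixture_em1:
  assumes t: "c / sqrt (real n) \<in> {0..1}"
    and \<phi>: "(\<phi> :: 'a \<Rightarrow> complex) \<in> borel_measurable \<mu>" "\<And>x. cmod (\<phi> x) \<le> B"
  shows "(\<integral>z. \<phi> (fst z) * (1 + em1 \<tau> n (fst z) (snd z)) \<partial>J (mixture (c / sqrt (real n)) G0 G))
    = (\<integral>x. \<phi> x * (of_real (pn G c n x) + Dn G c \<tau> n x) \<partial>\<mu>)"
proof -
  let ?t = "c / sqrt (real n)"
  note s = dominated_sets[OF smooth_dominated[OF G]] dominated_prob[OF smooth_dominated[OF G]]
  have \<phi>m: "\<phi> \<in> borel_measurable \<nu>" using \<phi>(1) by (simp add: measurable_mu)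
  have one: "(\<lambda>(x, \<theta>). 1 :: complex) \<in> borel_measurable (\<nu> \<Otimes>\<^sub>M T)" by (simp add: case_prod_beta')
  have lrc: "cnd H (\<lambda>_ _. 1 :: complex) x = of_real (lr H x)" for H x
    unfolding lr_def cnd_def by (simp add: scaleR_conv_of_real)
  have dG: "dominated G" by (rule smooth_dominated[OF G])
  have e: "(\<integral>z. \<phi> (fst z) * (1 + em1 \<tau> n (fst z) (snd z)) \<partial>J H)
      = (\<integral>x. \<phi> x * of_real (lr H x) \<partial>\<mu>) + (\<integral>x. \<phi> x * cnd H (em1 \<tau> n) x \<partial>\<mu>)
    \<and> integrable (J H) (\<lambda>z. \<phi> (fst z) * (1 + em1 \<tau> n (fst z) (snd z)))" if H: "dominated H" for H
    using integral_J_fst_mult[OF \<phi>m \<phi>(2) H one, of 1] integral_J_fst_mult[OF \<phi>m \<phi>(2) H em1_measurable em1_le2, of \<tau> n]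
    by (simp add: distrib_left lrc)
  have i1: "integrable \<mu> (\<lambda>x. \<phi> x * of_real (lr H x))" if H: "dominated H" for H
    using integral_J_fst_mult(3)[OF \<phi>m \<phi>(2) H one, of 1] by (simp add: lrc)
  note i2 = integral_J_fst_mult(3)[OF \<phi>m \<phi>(2) _ em1_measurable em1_le2, of _ \<tau> n]
  have m: "(\<lambda>z. \<phi> (fst z) * (1 + em1 \<tau> n (fst z) (snd z))) \<in> borel_measurable (\<nu> \<Otimes>\<^sub>M T)"
    using em1_fst_snd measurable_compose[OF measurable_fst \<phi>m] by measurable
  have "(\<integral>z. \<phi> (fst z) * (1 + em1 \<tau> n (fst z) (snd z)) \<partial>J (mixture ?t G0 G))
      = (1 - ?t) * (\<integral>z. \<phi> (fst z) * (1 + em1 \<tau> n (fst z) (snd z)) \<partial>J G0) + ?t * (\<integral>z. \<phi> (fst z) * (1 + em1 \<tau> n (fst z) (snd z)) \<partial>J G)"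
    by (rule complex_integral_joint_law_mixture(2)[OF G0 s(2,1) t f m])
      (use e[OF dominated_G0] e[OF dG] in auto)
  also have "\<dots> = (1 - ?t) * ((\<integral>x. \<phi> x * of_real (lr G0 x) \<partial>\<mu>) + (\<integral>x. \<phi> x * cnd G0 (em1 \<tau> n) x \<partial>\<mu>))
      + ?t * ((\<integral>x. \<phi> x * of_real (lr G x) \<partial>\<mu>) + (\<integral>x. \<phi> x * cnd G (em1 \<tau> n) x \<partial>\<mu>))"
    using e[OF dominated_G0] e[OF dG] by simp
  also have "\<dots> = (\<integral>x. (1 - complex_of_real ?t) * (\<phi> x * of_real (lr G0 x) + \<phi> x * cnd G0 (em1 \<tau> n) x)
      + complex_of_real ?t * (\<phi> x * of_real (lr G x) + \<phi> x * cnd G (em1 \<tau> n) x) \<partial>\<mu>)"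
    using i1[OF dominated_G0] i1[OF dG] i2[OF dominated_G0] i2[OF dG] by simp
  also have "\<dots> = (\<integral>x. \<phi> x * (of_real (pn G c n x) + Dn G c \<tau> n x) \<partial>\<mu>)"
  proof (rule integral_cong_AE)
    show "AE x in \<mu>. (1 - complex_of_real ?t) * (\<phi> x * of_real (lr G0 x) + \<phi> x * cnd G0 (em1 \<tau> n) x)
      + complex_of_real ?t * (\<phi> x * of_real (lr G x) + \<phi> x * cnd G (em1 \<tau> n) x) = \<phi> x * (of_real (pn G c n x) + Dn G c \<tau> n x)"
      using lr_G0 by eventually_elim (simp add: Dn_def pn_def gs_def algebra_simps diff_divide_distrib)
    show "(\<lambda>x. \<phi> x * (of_real (pn G c n x) + Dn G c \<tau> n x)) \<in> borel_measurable \<mu>"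
      using \<phi>(1) sq_int_measurable[OF pn_sq_int[OF G]] Dn_meas by measurable
    show "(\<lambda>x. (1 - complex_of_real ?t) * (\<phi> x * of_real (lr G0 x) + \<phi> x * cnd G0 (em1 \<tau> n) x)
      + complex_of_real ?t * (\<phi> x * of_real (lr G x) + \<phi> x * cnd G (em1 \<tau> n) x)) \<in> borel_measurable \<mu>"
      using i1[OF dominated_G0] i1[OF dG] i2[OF dominated_G0] i2[OF dG] by measurable
  qed
  finally show ?thesis .
qed

lemma integral_sample_em1:
  assumes t: "c / sqrt (real n) \<in> {0..1}"
    and \<Phi>: "\<Phi> \<in> borel_measurable (iid \<mu> n)" "\<And>x. cmod (\<Phi> x) \<le> B"
  shows "(\<integral>\<omega>. \<Phi> (observed n \<omega>) * (\<Prod>j<n. 1 + em1 \<tau> n (fst (\<omega> j)) (snd (\<omega> j))) \<partial>sample_law \<nu> f (mixture (c / sqrt (real n)) G0 G) n)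
    = (\<integral>x. \<Phi> x * (\<Prod>j<n. of_real (pn G c n (x j)) + Dn G c \<tau> n (x j)) \<partial>iid \<mu> n)"
  unfolding sample_law_def
proof (rule integral_sample_observed[OF mixture_facts(1)[OF t] mixture_facts(3)[OF t] prob_space_\<mu> _ _ _ _ \<Phi>])
  show "(\<lambda>z. 1 + em1 \<tau> n (fst z) (snd z)) \<in> borel_measurable (J (mixture (c / sqrt (real n)) G0 G))"
  proof -
    have "(\<lambda>z. 1 + em1 \<tau> n (fst z) (snd z)) \<in> borel_measurable (\<nu> \<Otimes>\<^sub>M T)" using em1_fst_snd by measurable
    then show ?thesis using mixture_facts(2)[OF t] by (simp cong: measurable_cong_sets)
  qed
  show "cmod (1 + em1 \<tau> n (fst z) (snd z)) \<le> 1" for z :: "'a \<times> 'b" unfolding em1_def by simp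
  have "integrable \<mu> (Dn G c \<tau> n)"
    unfolding Dn_def using cnd_em1_integrable0 cnd_em1_integrable[OF G] by simp
  then show "integrable \<mu> (\<lambda>x. of_real (pn G c n x) + Dn G c \<tau> n x)"
    using M.sq_int_integrable[OF pn_sq_int[OF G]] by simp
  show "(\<integral>z. \<phi> (fst z) * (1 + em1 \<tau> n (fst z) (snd z)) \<partial>J (mixture (c / sqrt (real n)) G0 G))
    = (\<integral>x. \<phi> x * (of_real (pn G c n x) + Dn G c \<tau> n x) \<partial>\<mu>)"
    if "\<phi> \<in> borel_measurable \<mu>" "\<And>x. cmod (\<phi> x) \<le> B" for \<phi> B
    by (rule integral_mixture_em1[OF t that])
qed

end

end

section \<open>Weak convergence and characteristic functions\<close>

lemma weak_conv_m_eventually_cong: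
  "\<forall>\<^sub>F n in sequentially. M n = N n \<Longrightarrow> weak_conv_m M L \<longleftrightarrow> weak_conv_m N L"
  unfolding weak_conv_m_def weak_conv_def
  by (intro all_cong1 imp_cong refl tendsto_cong) (auto elim: eventually_mono)

text \<open>For small \<open>n\<close> the mixing weight may exceed 1 and the laws need not be
  probability measures. Putting the limit law in their place makes theorems on sequences of real
  distributions applicable.\<close>

lemma eventually_real_distribution_subst:
  assumes "\<forall>\<^sub>F n in sequentially. real_distribution (M n)" "real_distribution L"
  obtains N where "\<And>n. real_distribution (N n)" "\<forall>\<^sub>F n in sequentially. M n = N n"
proof
  show "real_distribution (if real_distribution (M n) then M n else L)" for n using assms(2) by simp
  show "\<forall>\<^sub>F n in sequentially. M n = (if real_distribution (M n) then M n else L)"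
    using assms(1) by eventually_elim simp
qed

lemma weak_conv_m_integral:
  fixes \<phi> :: "real \<Rightarrow> 'b::{banach, second_countable_topology}"
  assumes "\<forall>\<^sub>F n in sequentially. real_distribution (M n)" "real_distribution L" "weak_conv_m M L"
    and "\<And>x. isCont \<phi> x" "\<And>x. norm (\<phi> x) \<le> B"
  shows "(\<lambda>n. \<integral>x. \<phi> x \<partial>M n) \<longlonglongrightarrow> (\<integral>x. \<phi> x \<partial>L)"
proof -
  obtain N where N: "\<And>n. real_distribution (N n)" "\<forall>\<^sub>F n in sequentially. M n = N n"
    using eventually_real_distribution_subst[OF assms(1,2)] by blast
  have "weak_conv_m N L" using assms(3) weak_conv_m_eventually_cong[OF N(2)] by simp
  then have "(\<lambda>n. \<integral>x. \<phi> x \<partial>N n) \<longlonglongrightarrow> (\<integral>x. \<phi> x \<partial>L)"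
    by (rule weak_conv_imp_integral_bdd_continuous_conv[OF N(1) assms(2) _ assms(4,5)])
  then show ?thesis
    by (rule Lim_transform_eventually) (use N(2) in \<open>eventually_elim, simp\<close>)
qed

text \<open>The continuity theorem of Levy in both directions, after a change of finitely many
  terms.\<close>

lemma weak_conv_m_iff_char:
  assumes "\<forall>\<^sub>F n in sequentially. real_distribution (M n)" "real_distribution L"
  shows "weak_conv_m M L \<longleftrightarrow> (\<forall>t. (\<lambda>n. char (M n) t) \<longlonglongrightarrow> char L t)"
proof -
  obtain N where N: "\<And>n. real_distribution (N n)" "\<forall>\<^sub>F n in sequentially. M n = N n"
    using eventually_real_distribution_subst[OF assms] by blast
  have "weak_conv_m M L \<longleftrightarrow> weak_conv_m N L" by (rule weak_conv_m_eventually_cong[OF N(2)])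
  also have "\<dots> \<longleftrightarrow> (\<forall>t. (\<lambda>n. char (N n) t) \<longlonglongrightarrow> char L t)"
    using levy_continuity1[of N L, OF N(1) assms(2)] levy_continuity[of N L, OF N(1) assms(2)] by blast
  also have "\<dots> \<longleftrightarrow> (\<forall>t. (\<lambda>n. char (M n) t) \<longlonglongrightarrow> char L t)"
    by (intro all_cong1 tendsto_cong) (use N(2) in \<open>auto elim: eventually_mono\<close>)
  finally show ?thesis .
qed

lemma real_distribution_distr:
  assumes "prob_space M" "X \<in> borel_measurable M"
  shows "real_distribution (distr M borel X)"
  using prob_space.real_distribution_distr[OF assms] by simp

lemma char_distr: "X \<in> borel_measurable M \<Longrightarrow> char (distr M borel X) t = (\<integral>x. iexp (t * X x) \<partial>M)"
  unfolding char_def by (subst integral_distr) auto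

lemma mixture_self:
  assumes "t \<in> {0..1}" shows "mixture t G G = G"
proof (rule measure_eqI)
  fix A assume "A \<in> sets (mixture t G G)"
  then have "emeasure (mixture t G G) A = (ennreal (1 - t) + ennreal t) * emeasure G A"
    by (simp add: emeasure_mixture distrib_right)
  also have "ennreal (1 - t) + ennreal t = 1" using assms by (simp flip: ennreal_plus)
  finally show "emeasure (mixture t G G) A = emeasure G A" by simp
qed simp

lemma eventually_curve: "c > 0 \<Longrightarrow> \<forall>\<^sub>F n in sequentially. c / sqrt (real n) \<in> {0..1}"
proof -
  assume c: "c > 0"
  have "(\<lambda>n. c / sqrt (real n)) \<longlonglongrightarrow> 0" by real_asymp
  then have "\<forall>\<^sub>F n in sequentially. c / sqrt (real n) < 1" by (rule order_tendstoD(2)) simp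
  then show ?thesis by eventually_elim (use c in simp)
qed

section \<open>Characteristic functions of the estimation errors\<close>

context utility_model
begin

definition centred :: "(nat \<Rightarrow> (nat \<Rightarrow> 'a) \<Rightarrow> real) \<Rightarrow> nat \<Rightarrow> (nat \<Rightarrow> 'a) \<Rightarrow> real" where
  "centred S n x = (S n x - (\<Sum>j<n. u0 (x j))) / sqrt (real n)"

definition sum_error :: "(nat \<Rightarrow> (nat \<Rightarrow> 'a) \<Rightarrow> real) \<Rightarrow> nat \<Rightarrow> (nat \<Rightarrow> 'a \<times> 'b) \<Rightarrow> real" where
  "sum_error S n \<omega> = (S n (observed n \<omega>) - utility_sum u n \<omega>) / sqrt (real n)"

lemma sets_iid_\<mu>: "sets (iid \<mu> n) = sets (iid \<nu> n)"
  by (rule sets_PiM_cong) auto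

lemma estimator_measurable: "estimator \<nu> S \<Longrightarrow> S n \<in> borel_measurable (iid \<mu> n)"
  using sets_iid_\<mu>[of n] by (simp add: estimator_def cong: measurable_cong_sets)

lemma centred_measurable: "estimator \<nu> S \<Longrightarrow> centred S n \<in> borel_measurable (iid \<mu> n)"
proof -
  assume "estimator \<nu> S"
  note [measurable] = estimator_measurable[OF this]
  have [measurable]: "(\<lambda>x. u0 (x j)) \<in> borel_measurable (iid \<mu> n)" if "j < n" for j
    by (rule measurable_coord[OF _ that]) (simp add: measurable_mu u0_measurable)
  have "(\<lambda>x. \<Sum>j<n. u0 (x j)) \<in> borel_measurable (iid \<mu> n)"
    by (rule borel_measurable_sum) (auto intro: measurable_coord simp: measurable_mu u0_measurable)
  then show ?thesis unfolding centred_def by measurable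
qed

lemma sets_sample: "sets K = sets (\<nu> \<Otimes>\<^sub>M T) \<Longrightarrow> sets (iid K n) = sets (iid (\<nu> \<Otimes>\<^sub>M T) n)"
  by (rule sets_PiM_cong) auto

lemma observed_measurable_pair: "observed n \<in> measurable (iid (\<nu> \<Otimes>\<^sub>M T) n) (iid \<mu> n)"
  by (rule observed_measurable) (simp cong: measurable_cong_sets)

lemma sum_error_measurable:
  assumes "estimator \<nu> S"
  shows "sum_error S n \<in> borel_measurable (iid (\<nu> \<Otimes>\<^sub>M T) n)"
proof -
  have 1: "(\<lambda>\<omega>. S n (observed n \<omega>)) \<in> borel_measurable (iid (\<nu> \<Otimes>\<^sub>M T) n)"
    by (rule measurable_compose[OF observed_measurable_pair estimator_measurable[OF assms]])
  have 2: "utility_sum u n \<in> borel_measurable (iid (\<nu> \<Otimes>\<^sub>M T) n)"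
    unfolding utility_sum_def
    by (rule borel_measurable_sum) (use measurable_coord[OF u_fst_snd] in auto)
  show ?thesis unfolding sum_error_def using 1 2 by measurable
qed

lemma sum_error_decomp:
  "sum_error S n \<omega> = centred S n (observed n \<omega>) - score (\<lambda>z. ub (fst z) (snd z)) n \<omega>"
proof -
  have "(\<Sum>j<n. u0 (observed n \<omega> j)) = (\<Sum>j<n. u0 (fst (\<omega> j)))" by (simp add: observed_def)
  then show ?thesis
    unfolding sum_error_def centred_def score_def utility_sum_def ub_def
    by (simp add: sum_subtractf diff_divide_distrib)
qed

text \<open>The unobserved parameters enter only through the residuals, whose exponential factorises
  over the observations; what remains is a unimodular function of the observed sample.\<close>

lemma iexp_sum_error:
  "iexp (\<tau> * sum_error S n \<omega>) = iexp (\<tau> * centred S n (observed n \<omega>)) * (\<Prod>j<n. 1 + em1 \<tau> n (fst (\<omega> j)) (snd (\<omega> j)))"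
proof -
  have "(\<Prod>j<n. 1 + em1 \<tau> n (fst (\<omega> j)) (snd (\<omega> j)))
      = exp (\<Sum>j<n. \<i> * complex_of_real ((- \<tau> * ub (fst (\<omega> j)) (snd (\<omega> j))) / sqrt (real n)))"
    unfolding em1_def by (simp add: exp_sum)
  also have "(\<Sum>j<n. \<i> * complex_of_real ((- \<tau> * ub (fst (\<omega> j)) (snd (\<omega> j))) / sqrt (real n)))
      = \<i> * complex_of_real (- \<tau> * score (\<lambda>z. ub (fst z) (snd z)) n \<omega>)"
    unfolding score_def by (simp add: sum_distrib_left sum_divide_distrib sum_negf)
  finally show ?thesis
    unfolding sum_error_decomp by (simp add: algebra_simps flip: exp_add)
qed

context
  fixes G assumes G: "smooth G"
begin

lemma prob_space_sample: "t \<in> {0..1} \<Longrightarrow> prob_space (sample_law \<nu> f (mixture t G0 G) n)"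
  unfolding sample_law_def by (intro prob_space_PiM mixture_facts(1)[OF G])

lemma measurable_sample:
  "t \<in> {0..1} \<Longrightarrow> X \<in> borel_measurable (iid (\<nu> \<Otimes>\<^sub>M T) n) \<Longrightarrow> X \<in> borel_measurable (sample_law \<nu> f (mixture t G0 G) n)"
  unfolding sample_law_def using sets_sample[OF mixture_facts(2)[OF G]] by (simp cong: measurable_cong_sets)

lemma tilt_pn: "tilt (\<lambda>x. c * gs G x) n x = (\<Prod>j<n. pn G c n (x j))"
  by (simp add: tilt_def pn_def)

text \<open>Once the parameters are integrated out, both expressions integrate the same unimodular
  function of the observations. Their difference is therefore at most the L2 distance of the two
  products, whatever the estimator is.\<close>

lemma char_sum_limit:
  assumes S: "estimator \<nu> S" and c: "c > 0"
  shows "(\<lambda>n. char (distr (sample_law \<nu> f (mixture (c / sqrt (real n)) G0 G) n) borel (sum_error S n)) \<tau>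
      - exp (zlim G c \<tau>) * (\<integral>x. iexp (\<tau> * centred S n x) * of_real (tilt (\<lambda>x. c * gs G x) n x) \<partial>iid \<mu> n)) \<longlonglongrightarrow> 0"
proof (rule Lim_null_comparison)
  let ?R = "\<lambda>n x. (\<Prod>j<n. of_real (pn G c n (x j)) + Dn G c \<tau> n (x j)) - exp (zlim G c \<tau>) * of_real (\<Prod>j<n. pn G c n (x j))"
  show "\<forall>\<^sub>F n in sequentially. norm (char (distr (sample_law \<nu> f (mixture (c / sqrt (real n)) G0 G) n) borel (sum_error S n)) \<tau>
      - exp (zlim G c \<tau>) * (\<integral>x. iexp (\<tau> * centred S n x) * of_real (tilt (\<lambda>x. c * gs G x) n x) \<partial>iid \<mu> n))
      \<le> sqrt (\<integral>x. (cmod (?R n x))\<^sup>2 \<partial>iid \<mu> n)"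
    using eventually_curve[OF c]
  proof eventually_elim
    fix n assume t: "c / sqrt (real n) \<in> {0..1}"
    interpret P: prob_space "iid \<mu> n" by (rule M.prob_space_iid)
    let ?e = "\<lambda>x. iexp (\<tau> * centred S n x)"
    have [measurable]: "centred S n \<in> borel_measurable (iid \<mu> n)" by (rule centred_measurable[OF S])
    have em: "?e \<in> borel_measurable (iid \<mu> n)" by measurable
    have e1: "cmod (?e x) \<le> 1" for x by simp
    have "char (distr (sample_law \<nu> f (mixture (c / sqrt (real n)) G0 G) n) borel (sum_error S n)) \<tau>
        = (\<integral>x. ?e x * (\<Prod>j<n. of_real (pn G c n (x j)) + Dn G c \<tau> n (x j)) \<partial>iid \<mu> n)"
      unfolding char_distr[OF measurable_sample[OF t sum_error_measurable[OF S]]] iexp_sum_error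
      by (rule integral_sample_em1[OF G t em e1])
    moreover have "exp (zlim G c \<tau>) * (\<integral>x. ?e x * of_real (tilt (\<lambda>x. c * gs G x) n x) \<partial>iid \<mu> n)
        = (\<integral>x. ?e x * (exp (zlim G c \<tau>) * of_real (\<Prod>j<n. pn G c n (x j))) \<partial>iid \<mu> n)"
      unfolding tilt_pn by (subst integral_mult_right_zero[symmetric]) (simp only: ac_simps)
    moreover have "(\<integral>x. ?e x * (\<Prod>j<n. of_real (pn G c n (x j)) + Dn G c \<tau> n (x j)) \<partial>iid \<mu> n)
        - (\<integral>x. ?e x * (exp (zlim G c \<tau>) * of_real (\<Prod>j<n. pn G c n (x j))) \<partial>iid \<mu> n)
        = (\<integral>x. ?e x * ?R n x \<partial>iid \<mu> n)"
    proof -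
      have bm: "integrable (iid \<mu> n) (\<lambda>x. ?e x * F x)" if "integrable (iid \<mu> n) F" for F
        by (rule Bochner_Integration.integrable_bound[OF that]) (use em that in \<open>auto simp: norm_mult\<close>)
      have p: "integrable \<mu> (pn G c n)" by (rule M.sq_int_integrable[OF pn_sq_int[OF G]])
      have D: "integrable \<mu> (Dn G c \<tau> n)"
        unfolding Dn_def using cnd_em1_integrable0 cnd_em1_integrable[OF G] by simp
      have 1: "integrable (iid \<mu> n) (\<lambda>x. \<Prod>j<n. of_real (pn G c n (x j)) + Dn G c \<tau> n (x j))"
        using M.integrable_iid_prod[of n "\<lambda>_ x. of_real (pn G c n x) + Dn G c \<tau> n x"] p D by simp
      have 2: "integrable (iid \<mu> n) (\<lambda>x. exp (zlim G c \<tau>) * of_real (\<Prod>j<n. pn G c n (x j)))"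
        using M.integrable_iid_prod[of n "\<lambda>_ x. pn G c n x"] p
        by (intro integrable_mult_right integrable_of_real) simp
      show ?thesis
        by (subst Bochner_Integration.integral_diff[OF bm[OF 1] bm[OF 2], symmetric]) (simp only: right_diff_distrib)
    qed
    moreover have "cmod (\<integral>x. ?e x * ?R n x \<partial>iid \<mu> n) \<le> sqrt (\<integral>x. (cmod (?R n x))\<^sup>2 \<partial>iid \<mu> n)"
    proof -
      have Rm: "?R n \<in> borel_measurable (iid \<mu> n)"
      proof -
        have "(\<lambda>x. complex_of_real (pn G c n (x j)) + Dn G c \<tau> n (x j)) \<in> borel_measurable (iid \<mu> n)" if "j < n" for j
        proof (rule measurable_coord[OF _ that])
          show "(\<lambda>x. complex_of_real (pn G c n x) + Dn G c \<tau> n x) \<in> borel_measurable \<mu>"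
            using sq_int_measurable[OF pn_sq_int[OF G]] Dn_meas[OF G] by measurable
        qed
        then have "(\<lambda>x. \<Prod>j<n. complex_of_real (pn G c n (x j)) + Dn G c \<tau> n (x j)) \<in> borel_measurable (iid \<mu> n)"
          by (intro borel_measurable_prod) auto
        moreover have "(\<lambda>x. \<Prod>j<n. pn G c n (x j)) \<in> borel_measurable (iid \<mu> n)"
          by (rule borel_measurable_prod) (use measurable_coord[OF sq_int_measurable[OF pn_sq_int[OF G]]] in auto)
        ultimately show ?thesis by measurable
      qed
      have "cmod (\<integral>x. ?e x * ?R n x \<partial>iid \<mu> n) \<le> sqrt (\<integral>x. (cmod (?e x * ?R n x))\<^sup>2 \<partial>iid \<mu> n)"
      proof (rule P.cmod_integral_le_sqrt)
        show "(\<lambda>x. ?e x * ?R n x) \<in> borel_measurable (iid \<mu> n)" using em Rm by (rule borel_measurable_times)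
        show "integrable (iid \<mu> n) (\<lambda>x. (cmod (?e x * ?R n x))\<^sup>2)"
          using Dn_product_limit(2)[OF G, of n c \<tau>] by (simp add: norm_mult)
      qed
      then show ?thesis by (simp add: norm_mult)
    qed
    ultimately show "norm (char (distr (sample_law \<nu> f (mixture (c / sqrt (real n)) G0 G) n) borel (sum_error S n)) \<tau>
      - exp (zlim G c \<tau>) * (\<integral>x. iexp (\<tau> * centred S n x) * of_real (tilt (\<lambda>x. c * gs G x) n x) \<partial>iid \<mu> n))
      \<le> sqrt (\<integral>x. (cmod (?R n x))\<^sup>2 \<partial>iid \<mu> n)" by simp
  qed
  have "(\<lambda>n. sqrt (\<integral>x. (cmod (?R n x))\<^sup>2 \<partial>iid \<mu> n)) \<longlonglongrightarrow> sqrt 0"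
    by (intro tendsto_real_sqrt Dn_product_limit(1)[OF G])
  then show "(\<lambda>n. sqrt (\<integral>x. (cmod (?R n x))\<^sup>2 \<partial>iid \<mu> n)) \<longlonglongrightarrow> 0" by simp
qed

lemma sum_error_real_distribution:
  assumes S: "estimator \<nu> S" and c: "c > 0"
  shows "\<forall>\<^sub>F n in sequentially. real_distribution (distr (sample_law \<nu> f (mixture (c / sqrt (real n)) G0 G) n) borel (sum_error S n))"
  using eventually_curve[OF c]
  by eventually_elim (intro real_distribution_distr prob_space_sample measurable_sample sum_error_measurable S)

text \<open>\<open>exp (zlim G c \<tau>)\<close> is nonzero and can be divided out. Read from left
  to right this extracts information from a regular estimator; from right to left it proves
  regularity of an asymptotically linear one.\<close>

lemma weak_conv_sum_iff:
  assumes S: "estimator \<nu> S" and c: "c > 0" and L: "real_distribution L"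
  shows "weak_conv_m (\<lambda>n. distr (sample_law \<nu> f (mixture (c / sqrt (real n)) G0 G) n) borel (sum_error S n)) L \<longleftrightarrow>
    (\<forall>\<tau>. (\<lambda>n. \<integral>x. iexp (\<tau> * centred S n x) * of_real (tilt (\<lambda>x. c * gs G x) n x) \<partial>iid \<mu> n)
      \<longlonglongrightarrow> iexp (\<tau> * c * bias G) * (char L \<tau> * of_real (exp (\<tau>\<^sup>2 * s2 / 2))))"
  unfolding weak_conv_m_iff_char[OF sum_error_real_distribution[OF S c] L]
proof (rule all_cong1)
  fix \<tau>
  define A where "A n = char (distr (sample_law \<nu> f (mixture (c / sqrt (real n)) G0 G) n) borel (sum_error S n)) \<tau>" for n
  define B where "B n = (\<integral>x. iexp (\<tau> * centred S n x) * of_real (tilt (\<lambda>x. c * gs G x) n x) \<partial>iid \<mu> n)" for n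
  define e where "e = exp (zlim G c \<tau>)"
  have AB: "(\<lambda>n. A n - e * B n) \<longlonglongrightarrow> 0" unfolding A_def B_def e_def by (rule char_sum_limit[OF S c])
  have e0: "e \<noteq> 0" by (simp add: e_def)
  have ei: "iexp (\<tau> * c * bias G) * (char L \<tau> * of_real (exp (\<tau>\<^sup>2 * s2 / 2))) = inverse e * char L \<tau>"
    unfolding e_def exp_minus[symmetric] by (simp add: exp_of_real[symmetric] algebra_simps flip: exp_add)
  have "A \<longlonglongrightarrow> char L \<tau> \<longleftrightarrow> B \<longlonglongrightarrow> inverse e * char L \<tau>"
  proof
    assume "A \<longlonglongrightarrow> char L \<tau>"
    then have *: "(\<lambda>n. inverse e * (A n - (A n - e * B n))) \<longlonglongrightarrow> inverse e * (char L \<tau> - 0)"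
      by (intro tendsto_mult tendsto_const tendsto_diff AB)
    have "inverse e * (A n - (A n - e * B n)) = B n" for n using e0 by simp
    then show "B \<longlonglongrightarrow> inverse e * char L \<tau>" using * by (simp only: diff_zero)
  next
    assume "B \<longlonglongrightarrow> inverse e * char L \<tau>"
    from tendsto_add[OF AB tendsto_mult[OF tendsto_const this, of e]]
    show "A \<longlonglongrightarrow> char L \<tau>" using e0 by (simp add: mult.assoc[symmetric])
  qed
  then show "A \<longlonglongrightarrow> char L \<tau> \<longleftrightarrow> B \<longlonglongrightarrow> iexp (\<tau> * c * bias G) * (char L \<tau> * of_real (exp (\<tau>\<^sup>2 * s2 / 2)))"
    unfolding ei .
qed

end

end

section \<open>Second moments of limit laws\<close>

lemma one_minus_sq_le_cos: "1 - x\<^sup>2 / 2 \<le> cos (x::real)"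
proof -
  have "cos x = 1 - 2 * (sin (x / 2))\<^sup>2" using cos_double_sin[of "x / 2"] by simp
  moreover have "(sin (x / 2))\<^sup>2 \<le> (x / 2)\<^sup>2"
    using abs_sin_x_le_abs_x[of "x / 2"] abs_le_square_iff by blast
  ultimately show ?thesis by (simp add: power_divide)
qed

text \<open>From \<open>cos y \<ge> 1 - y\<^sup>2 / 2\<close>; centring at \<open>m\<close> costs
  only a unimodular factor. It is used with the mean of the law for variances and with
  \<open>m = 0\<close> for second moments.\<close>

lemma (in real_distribution) char_lower_bound:
  assumes fin: "(\<integral>\<^sup>+x. ennreal ((x - m)\<^sup>2) \<partial>M) = ennreal V" and V: "0 \<le> V"
  shows "1 - \<tau>\<^sup>2 * V / 2 \<le> Re (iexp (- (\<tau> * m)) * char M \<tau>)"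
proof -
  have i: "integrable M (\<lambda>x. (x - m)\<^sup>2)"
    by (rule integrableI_nonneg) (use fin in auto)
  have "(\<integral>x. (x - m)\<^sup>2 \<partial>M) = V"
    using nn_integral_eq_integral[OF i] fin V by simp
  then have "1 - \<tau>\<^sup>2 * V / 2 = (\<integral>x. 1 - \<tau>\<^sup>2 * (x - m)\<^sup>2 / 2 \<partial>M)"
    using i by (simp add: prob_space[simplified])
  also have "\<dots> \<le> (\<integral>x. cos (\<tau> * (x - m)) \<partial>M)"
  proof (rule integral_mono)
    show "integrable M (\<lambda>x. 1 - \<tau>\<^sup>2 * (x - m)\<^sup>2 / 2)" using i by simp
    show "integrable M (\<lambda>x. cos (\<tau> * (x - m)))" by (rule integrable_const_bound[of _ 1]) auto
    show "1 - \<tau>\<^sup>2 * (x - m)\<^sup>2 / 2 \<le> cos (\<tau> * (x - m))" for x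
      using one_minus_sq_le_cos[of "\<tau> * (x - m)"] by (simp add: power_mult_distrib)
  qed
  also have "\<dots> = Re (\<integral>x. iexp (\<tau> * (x - m)) \<partial>M)"
  proof -
    have "integrable M (\<lambda>x. iexp (\<tau> * (x - m)))" by (rule integrable_const_bound[of _ 1]) auto
    from integral_Re[OF this] show ?thesis by (simp add: Re_exp)
  qed
  also have "(\<integral>x. iexp (\<tau> * (x - m)) \<partial>M) = iexp (- (\<tau> * m)) * char M \<tau>"
    unfolding char_def by (subst integral_mult_right_zero[symmetric]) (simp add: algebra_simps flip: exp_add)
  finally show ?thesis .
qed

lemma (in real_distribution) extended_variance_le_second_moment: "extended_variance M \<le> second_moment M"
proof (cases "second_moment M < \<infinity>")
  case True
  have i2: "integrable M (\<lambda>x. x\<^sup>2)"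
    by (rule integrableI_nonneg) (use True in \<open>auto simp: second_moment_def\<close>)
  have i: "integrable M (\<lambda>x. x)" by (rule square_integrable_imp_integrable[OF _ i2]) simp
  define m where "m = (\<integral>x. x \<partial>M)"
  have e: "(x - m)\<^sup>2 = x\<^sup>2 - 2 * m * x + m\<^sup>2" for x by (simp add: power2_diff)
  have "(\<integral>x. (x - m)\<^sup>2 \<partial>M) = (\<integral>x. x\<^sup>2 \<partial>M) - m\<^sup>2"
    unfolding e using i i2 by (simp add: m_def[symmetric] prob_space[simplified] power2_eq_square)
  moreover have "extended_variance M = ennreal (\<integral>x. (x - m)\<^sup>2 \<partial>M)"
    unfolding extended_variance_def m_def[symmetric]
  proof (rule nn_integral_eq_integral)
    show "integrable M (\<lambda>x. (x - m)\<^sup>2)" unfolding e using i i2 by simp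
  qed simp
  moreover have "second_moment M = ennreal (\<integral>x. x\<^sup>2 \<partial>M)"
    unfolding second_moment_def by (rule nn_integral_eq_integral[OF i2]) simp
  ultimately show ?thesis by (simp add: ennreal_leI)
qed (simp add: not_less top_unique)

text \<open>A push-forward rather than a density, so that \<open>r = 0\<close> gives the point mass
  at 0; this degenerate limit can occur.\<close>

definition scaled_normal :: "real \<Rightarrow> real measure" where
  "scaled_normal r = distr std_normal_distribution borel (\<lambda>x. r * x)"

lemma prob_space_std_normal: "prob_space std_normal_distribution"
  by (rule real_distribution.axioms(1)[OF real_dist_normal_dist])

lemma real_distribution_scaled_normal: "real_distribution (scaled_normal r)"
  unfolding scaled_normal_def by (rule real_distribution_distr[OF prob_space_std_normal]) simp

lemma char_scaled_normal: "char (scaled_normal r) \<tau> = of_real (exp (- (r\<^sup>2 * \<tau>\<^sup>2 / 2)))"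
proof -
  have "char (scaled_normal r) \<tau> = char std_normal_distribution (\<tau> * r)"
    unfolding scaled_normal_def by (subst char_distr) (simp_all add: char_def mult.assoc)
  then show ?thesis by (simp add: char_std_normal_distribution power_mult_distrib mult.commute)
qed

lemma second_moment_scaled_normal: "second_moment (scaled_normal r) = ennreal (r\<^sup>2)"
proof -
  have h: "has_bochner_integral lborel (\<lambda>x. std_normal_density x * x ^ (2 * 1)) (fact (2 * 1) / (2 ^ 1 * fact 1))"
    by (rule std_normal_moment_even)
  then have i: "integrable lborel (\<lambda>x. std_normal_density x * x\<^sup>2)" and I: "(\<integral>x. std_normal_density x * x\<^sup>2 \<partial>lborel) = 1"
    by (auto simp: has_bochner_integral_iff fact_numeral)
  have "second_moment (scaled_normal r) = (\<integral>\<^sup>+x. ennreal ((r * x)\<^sup>2) \<partial>std_normal_distribution)"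
    unfolding second_moment_def scaled_normal_def by (subst nn_integral_distr) auto
  also have "\<dots> = (\<integral>\<^sup>+x. ennreal (std_normal_density x) * ennreal ((r * x)\<^sup>2) \<partial>lborel)"
    by (subst nn_integral_density) auto
  also have "\<dots> = (\<integral>\<^sup>+x. ennreal (r\<^sup>2 * (std_normal_density x * x\<^sup>2)) \<partial>lborel)"
    by (intro nn_integral_cong) (simp add: power_mult_distrib ac_simps flip: ennreal_mult)
  also have "\<dots> = ennreal (r\<^sup>2)"
    by (subst nn_integral_eq_integral) (use i I in auto)
  finally show ?thesis .
qed

section \<open>Regular estimators\<close>

locale class_model = utility_model +
  fixes \<G> :: "'b measure set"
  assumes \<G>: "convex_class T \<G>"
    and u_fin: "\<forall>G\<in>\<G>. (\<integral>\<^sup>+z. ennreal ((u (fst z) (snd z))\<^sup>2) \<partial>joint_law \<nu> f G) < \<infinity>"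
    and G0_class: "G0 \<in> \<G>"
begin

abbreviation Loc :: "'b measure set" where "Loc \<equiv> local_class \<nu> f \<G> G0"

lemma nn_integral_J0_fst:
  assumes "\<phi> \<in> borel_measurable \<nu>"
  shows "(\<integral>\<^sup>+z. \<phi> (fst z) \<partial>J G0) = (\<integral>\<^sup>+x. \<phi> x \<partial>\<mu>)"
proof -
  have m: "(\<lambda>z. \<phi> (fst z)) \<in> borel_measurable (\<nu> \<Otimes>\<^sub>M T)" by (rule measurable_compose[OF measurable_fst assms])
  have "(\<integral>\<^sup>+z. \<phi> (fst z) \<partial>J G0) = (\<integral>\<^sup>+x. \<integral>\<^sup>+\<theta>. ennreal (f x \<theta>) * \<phi> x \<partial>G0 \<partial>\<nu>)"
    using nn_integral_joint_law(1)[OF G0 f m] by simp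
  also have "\<dots> = (\<integral>\<^sup>+x. f0 x * \<phi> x \<partial>\<nu>)"
  proof (rule nn_integral_cong)
    fix x assume x: "x \<in> space \<nu>"
    have "(\<lambda>\<theta>. f x \<theta>) \<in> borel_measurable T"
      using measurable_compose[OF measurable_Pair1'[OF x] f_measurable] by simp
    then have "(\<lambda>\<theta>. f x \<theta>) \<in> borel_measurable G0" using G0(2) by (simp cong: measurable_cong_sets)
    then show "(\<integral>\<^sup>+\<theta>. ennreal (f x \<theta>) * \<phi> x \<partial>G0) = f0 x * \<phi> x"
      by (subst nn_integral_multc) (auto simp: f0_def marginal_density_def)
  qed
  also have "\<dots> = (\<integral>\<^sup>+x. \<phi> x \<partial>\<mu>)" unfolding \<mu>_def by (rule nn_integral_density[symmetric]) (use assms in auto)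
  finally show ?thesis .
qed

lemma Loc_class: "G \<in> Loc \<Longrightarrow> G \<in> \<G>"
  by (simp add: local_class_def)

text \<open>The marginal density of \<open>G\<close> has mass one on the set where \<open>f0\<close>
  is positive, so it vanishes almost everywhere off that set, which is domination; the
  square-integrable quotient is then \<open>lr G\<close>.\<close>

lemma Loc_smooth:
  assumes "G \<in> Loc" shows "smooth G"
proof -
  have G: "G \<in> \<G>" by (rule Loc_class[OF assms])
  then have p: "prob_space G" "sets G = sets T" using \<G> by (auto simp: convex_class_def)
  let ?fG = "marginal_density f G"
  note [measurable] = marginal_density_measurable[OF p]
  have one: "(\<integral>\<^sup>+x. ?fG x * indicator {x. 0 < f0 x} x \<partial>\<nu>) = 1"
    using assms by (simp add: local_class_def f0_def)
  have "1 = (\<integral>\<^sup>+x. ?fG x * indicator {x. 0 < f0 x} x + ?fG x * indicator {x. f0 x = 0} x \<partial>\<nu>)"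
  proof (subst nn_integral_marginal_density[OF p, symmetric], rule nn_integral_cong)
    show "?fG x = ?fG x * indicator {x. 0 < f0 x} x + ?fG x * indicator {x. f0 x = 0} x" for x
      by (cases "f0 x = 0") (auto simp: indicator_def zero_less_iff_neq_zero)
  qed
  also have "\<dots> = 1 + (\<integral>\<^sup>+x. ?fG x * indicator {x. f0 x = 0} x \<partial>\<nu>)"
    by (subst nn_integral_add) (auto simp: one)
  finally have "(\<integral>\<^sup>+x. ?fG x * indicator {x. f0 x = 0} x \<partial>\<nu>) = 0"
    by (cases "\<integral>\<^sup>+x. ?fG x * indicator {x. f0 x = 0} x \<partial>\<nu>") (auto simp flip: ennreal_1 ennreal_plus)
  then have "AE x in \<nu>. ?fG x * indicator {x. f0 x = 0} x = 0"
    by (subst (asm) nn_integral_0_iff_AE) auto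
  then have "AE x in \<nu>. f0 x = 0 \<longrightarrow> ?fG x = 0"
    by eventually_elim (auto simp: indicator_def split: if_splits)
  then have dom: "dominated G" using p by (simp add: dominated_def)
  have "(\<integral>\<^sup>+z. (?fG (fst z) / f0 (fst z))\<^sup>2 \<partial>J G0) < \<infinity>"
    using assms by (simp add: local_class_def f0_def)
  also have "(\<integral>\<^sup>+z. (?fG (fst z) / f0 (fst z))\<^sup>2 \<partial>J G0) = (\<integral>\<^sup>+x. (?fG x / f0 x)\<^sup>2 \<partial>\<mu>)"
    by (rule nn_integral_J0_fst) measurable
  also have "\<dots> = (\<integral>\<^sup>+x. ennreal ((lr G x)\<^sup>2) \<partial>\<mu>)"
  proof (rule nn_integral_cong_AE, use lr_marginal[OF dom] AE_space in eventually_elim)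
    fix x assume "?fG x / f0 x = ennreal (lr G x)" "x \<in> space \<mu>"
    then show "(?fG x / f0 x)\<^sup>2 = ennreal ((lr G x)\<^sup>2)"
      using lr_nonneg[OF dom, of x] by (simp add: ennreal_power)
  qed
  finally have "integrable \<mu> (\<lambda>x. (lr G x)\<^sup>2)"
    using lr_measurable[OF dom] by (intro integrableI_nonneg) (auto simp: measurable_mu)
  then have lr: "sq_int \<mu> (lr G)" using lr_measurable[OF dom] by (simp add: sq_int_def measurable_mu)
  have "integrable (J G) (\<lambda>z. (u (fst z) (snd z))\<^sup>2)"
    using u_fin G measurable_J[OF dom u_fst_snd] by (intro integrableI_nonneg) auto
  then show ?thesis using dom lr by (simp add: smooth_def)
qed

text \<open>Makes the constant curve available: regularity applied to \<open>G = G0\<close> gives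
  the limits under \<open>G0\<close> itself.\<close>

lemma G0_Loc: "G0 \<in> Loc"
proof -
  have "(\<integral>\<^sup>+z. (f0 (fst z) / f0 (fst z))\<^sup>2 \<partial>J G0) = (\<integral>\<^sup>+x. (f0 x / f0 x)\<^sup>2 \<partial>\<mu>)"
    by (rule nn_integral_J0_fst) measurable
  also have "\<dots> = (\<integral>\<^sup>+x. 1 \<partial>\<mu>)"
    by (rule nn_integral_cong_AE, use f0_pos in eventually_elim) (auto simp: ennreal_divide_self)
  also have "\<dots> = 1" using M.emeasure_space_1 by simp
  finally have 1: "(\<integral>\<^sup>+z. (f0 (fst z) / f0 (fst z))\<^sup>2 \<partial>J G0) < \<infinity>" by simp
  have "(\<integral>\<^sup>+x. f0 x * indicator {x. f0 x > 0} x \<partial>\<nu>) = (\<integral>\<^sup>+x. f0 x \<partial>\<nu>)"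
    by (rule nn_integral_cong) (auto simp: indicator_def zero_less_iff_neq_zero)
  also have "\<dots> = 1" unfolding f0_def by (rule nn_integral_marginal_density[OF G0])
  finally show ?thesis using 1 G0_class by (simp add: local_class_def f0_def)
qed

lemma regular_sum_iff:
  "regular_sum_with_limit \<nu> f u \<G> G0 S L \<longleftrightarrow> estimator \<nu> S \<and> real_distribution L \<and>
    (\<forall>c>0. \<forall>G\<in>Loc. \<forall>\<tau>. (\<lambda>n. \<integral>x. iexp (\<tau> * centred S n x) * of_real (tilt (\<lambda>x. c * gs G x) n x) \<partial>iid \<mu> n)
      \<longlonglongrightarrow> iexp (\<tau> * c * bias G) * (char L \<tau> * of_real (exp (\<tau>\<^sup>2 * s2 / 2))))"
  unfolding regular_sum_with_limit_def sum_error_def[symmetric]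
  using weak_conv_sum_iff[OF Loc_smooth] by blast

text \<open>The score of the constant curve vanishes only almost everywhere, so the tilt is compared
  with 1 in L2: its first and second moments are both 1.\<close>

lemma integral_tilt_null:
  assumes e: "(e :: (nat \<Rightarrow> 'a) \<Rightarrow> complex) \<in> borel_measurable (iid \<mu> n)" "\<And>x. cmod (e x) \<le> 1"
    and h: "sq_int \<mu> h" "AE x in \<mu>. h x = 0"
  shows "(\<integral>x. e x * of_real (tilt h n x) \<partial>iid \<mu> n) = (\<integral>x. e x \<partial>iid \<mu> n)"
proof -
  interpret P: prob_space "iid \<mu> n" by (rule M.prob_space_iid)
  have h0: "(\<integral>x. h x \<partial>\<mu>) = 0" by (rule integral_eq_zero_AE[OF h(2)])
  have h2: "(\<integral>x. (h x)\<^sup>2 \<partial>\<mu>) = 0" by (rule integral_eq_zero_AE) (use h(2) in \<open>eventually_elim, simp\<close>)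
  note t = M.sq_int_tilt[OF h(1) h0, of n]
  have d: "sq_int (iid \<mu> n) (\<lambda>x. tilt h n x - 1)" by (rule sq_int_diff[OF t P.sq_int_const])
  have "(\<integral>x. (tilt h n x - 1)\<^sup>2 \<partial>iid \<mu> n) = (\<integral>x. (tilt h n x)\<^sup>2 - 2 * tilt h n x + 1 \<partial>iid \<mu> n)"
    by (simp add: power2_diff algebra_simps)
  also have "\<dots> = 0"
    using sq_int_integrable_sq[OF t] P.sq_int_integrable[OF t] M.integral_tilt_sq[OF h(1) h0, of n] M.integral_tilt[OF h(1) h0, of n] h2
    by (simp add: P.prob_space)
  finally have "cmod (\<integral>x. e x * of_real (tilt h n x - 1) \<partial>iid \<mu> n) \<le> 0"
    using P.cmod_integral_bounded_mult(2)[OF e d] by simp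
  then have "(\<integral>x. e x * of_real (tilt h n x - 1) \<partial>iid \<mu> n) = 0" by simp
  moreover have "(\<integral>x. e x * of_real (tilt h n x - 1) \<partial>iid \<mu> n) = (\<integral>x. e x * of_real (tilt h n x) \<partial>iid \<mu> n) - (\<integral>x. e x * of_real 1 \<partial>iid \<mu> n)"
    by (subst Bochner_Integration.integral_diff[OF P.cmod_integral_bounded_mult(1)[OF e t] P.cmod_integral_bounded_mult(1)[OF e P.sq_int_const], symmetric])
      (simp add: right_diff_distrib)
  ultimately show ?thesis by simp
qed

lemma gs_G0: "AE x in \<mu>. gs G0 x = 0"
  using lr_G0 by eventually_elim (simp add: gs_def)

text \<open>The untilted limit comes from \<open>c = 1\<close> and \<open>G = G0\<close>, where the
  tilt has no effect and \<open>b G0 = 0\<close> removes the phase.\<close>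

lemma tilted_limitsI:
  assumes Y: "\<And>n. Y n \<in> borel_measurable (iid \<mu> n)"
    and lim: "\<And>c G \<tau>. c > 0 \<Longrightarrow> G \<in> Loc \<Longrightarrow>
      (\<lambda>n. \<integral>x. iexp (\<tau> * Y n x) * of_real (tilt (\<lambda>x. c * gs G x) n x) \<partial>iid \<mu> n) \<longlonglongrightarrow> iexp (\<tau> * c * b G) * \<psi> \<tau>"
    and psi: "(\<psi> \<longlongrightarrow> 1) (at 0)" and b0: "b G0 = 0"
  shows "tilted_limits \<mu> Loc gs b Y \<psi>"
proof
  show "(\<lambda>n. \<integral>x. iexp (\<tau> * Y n x) \<partial>iid \<mu> n) \<longlonglongrightarrow> \<psi> \<tau>" for \<tau>
  proof -
    have [measurable]: "Y n \<in> borel_measurable (iid \<mu> n)" for n by (rule Y)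
    have "(\<integral>x. iexp (\<tau> * Y n x) * of_real (tilt (\<lambda>x. 1 * gs G0 x) n x) \<partial>iid \<mu> n) = (\<integral>x. iexp (\<tau> * Y n x) \<partial>iid \<mu> n)" for n
      by (rule integral_tilt_null) (use gs_sq_int[OF smooth_G0] gs_G0 in \<open>simp_all, measurable\<close>)
    then show ?thesis using lim[of 1 G0 \<tau>] G0_Loc b0 by simp
  qed
  show "Loc \<noteq> {}" using G0_Loc by blast
qed (use Y lim psi gs_sq_int gs_mean Loc_smooth in auto)

lemma char_tendsto_1: "real_distribution L \<Longrightarrow> (char L \<longlongrightarrow> 1) (at 0)"
  using real_distribution.isCont_char[of L 0] real_distribution.char_zero[of L] by (simp add: isCont_def)

lemma regular_sum_tilted_limits:
  assumes "regular_sum_with_limit \<nu> f u \<G> G0 S L"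
  shows "tilted_limits \<mu> Loc gs bias (centred S) (\<lambda>\<tau>. char L \<tau> * of_real (exp (\<tau>\<^sup>2 * s2 / 2)))"
proof (rule tilted_limitsI)
  have S: "estimator \<nu> S" "real_distribution L" using assms by (auto simp: regular_sum_iff)
  show "centred S n \<in> borel_measurable (iid \<mu> n)" for n by (rule centred_measurable[OF S(1)])
  have "((\<lambda>\<tau>. char L \<tau> * of_real (exp (\<tau>\<^sup>2 * s2 / 2))) \<longlongrightarrow> 1 * of_real (exp (0\<^sup>2 * s2 / 2))) (at 0)"
    by (intro tendsto_mult char_tendsto_1 S tendsto_of_real tendsto_exp tendsto_divide tendsto_power tendsto_ident_at tendsto_const) simp
  then show "((\<lambda>\<tau>. char L \<tau> * of_real (exp (\<tau>\<^sup>2 * s2 / 2))) \<longlongrightarrow> 1) (at 0)" by simp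
qed (use assms bias_G0 in \<open>auto simp: regular_sum_iff\<close>)

lemma mean_utility_J: "mean_utility \<nu> f u G = (\<integral>z. u (fst z) (snd z) \<partial>J G)"
  by (simp add: mean_utility_def)

text \<open>The mean is affine along the curve, so recentring the error from the moving parameter to
  \<open>G0\<close> shifts it by exactly \<open>c\<close> times the increment of the mean.\<close>

lemma regular_mean_tilted_limits:
  assumes reg: "regular_mean_with_limit \<nu> f u \<G> G0 m L"
  shows "tilted_limits \<mu> Loc gs (\<lambda>G. mean_utility \<nu> f u G - mean_utility \<nu> f u G0)
    (\<lambda>n x. sqrt (real n) * (m n x - mean_utility \<nu> f u G0)) (char L)"
proof (rule tilted_limitsI)
  have m: "estimator \<nu> m" "real_distribution L" using reg by (auto simp: regular_mean_with_limit_def)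
  show "(char L \<longlongrightarrow> 1) (at 0)" by (rule char_tendsto_1[OF m(2)])
  let ?mu = "mean_utility \<nu> f u"
  let ?Y = "\<lambda>n x. sqrt (real n) * (m n x - ?mu G0)"
  show Y: "?Y n \<in> borel_measurable (iid \<mu> n)" for n using estimator_measurable[OF m(1)] by measurable
  fix c :: real and G \<tau> assume c: "c > 0" and G: "G \<in> Loc"
  note sm = Loc_smooth[OF G]
  note sG = dominated_prob[OF smooth_dominated[OF sm]] dominated_sets[OF smooth_dominated[OF sm]]
  let ?X = "\<lambda>n \<omega>. sqrt (real n) * (m n (observed n \<omega>) - ?mu (mixture (c / sqrt (real n)) G0 G))"
  let ?P = "\<lambda>n. sample_law \<nu> f (mixture (c / sqrt (real n)) G0 G) n"
  have Xm: "?X n \<in> borel_measurable (iid (\<nu> \<Otimes>\<^sub>M T) n)" for n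
    using measurable_compose[OF observed_measurable_pair estimator_measurable[OF m(1)]] by measurable
  have rd: "\<forall>\<^sub>F n in sequentially. real_distribution (distr (?P n) borel (?X n))"
    using eventually_curve[OF c]
    by eventually_elim (intro real_distribution_distr prob_space_sample[OF sm] measurable_sample[OF sm] Xm)
  have "weak_conv_m (\<lambda>n. distr (?P n) borel (?X n)) L"
    using reg c G by (auto simp: regular_mean_with_limit_def)
  then have ch: "(\<lambda>n. char (distr (?P n) borel (?X n)) \<tau>) \<longlonglongrightarrow> char L \<tau>"
    using weak_conv_m_iff_char[OF rd m(2)] by blast
  have "\<forall>\<^sub>F n in sequentially. iexp (\<tau> * c * (?mu G - ?mu G0)) * char (distr (?P n) borel (?X n)) \<tau>
      = (\<integral>x. iexp (\<tau> * ?Y n x) * of_real (tilt (\<lambda>x. c * gs G x) n x) \<partial>iid \<mu> n)"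
    using eventually_curve[OF c] eventually_gt_at_top[of "0::nat"]
  proof eventually_elim
    fix n :: nat assume t: "c / sqrt (real n) \<in> {0..1}" and n: "0 < n"
    let ?t = "c / sqrt (real n)"
    have mm: "?mu (mixture ?t G0 G) = (1 - ?t) * ?mu G0 + ?t * ?mu G"
      unfolding mean_utility_J
      by (rule integral_joint_law_mixture(2)[OF G0 sG t f u_fst_snd u_integrable[OF smooth_G0] u_integrable[OF sm]])
    have X: "?X n \<omega> = ?Y n (observed n \<omega>) - c * (?mu G - ?mu G0)" for \<omega>
      unfolding mm using n by (simp add: field_simps)
    have e: "iexp (\<tau> * c * (?mu G - ?mu G0)) * iexp (\<tau> * ?X n \<omega>) = iexp (\<tau> * ?Y n (observed n \<omega>))" for \<omega>
      unfolding X by (simp add: algebra_simps flip: exp_add)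
    have em: "(\<lambda>x. iexp (\<tau> * ?Y n x)) \<in> borel_measurable (iid \<mu> n)" using Y[of n] by measurable
    \<comment> \<open>Frequency 0 switches off the residual factors and reduces the sample identity
      to the likelihood ratio of the observations; the actual \<tau> sits in the test
      function.\<close>
    have z: "em1 0 n x \<theta> = 0" for x \<theta> by (simp add: em1_def)
    have D: "Dn G c 0 n x = 0" for x
      unfolding Dn_def cnd_def z by simp
    have "iexp (\<tau> * c * (?mu G - ?mu G0)) * char (distr (?P n) borel (?X n)) \<tau>
        = (\<integral>\<omega>. iexp (\<tau> * ?Y n (observed n \<omega>)) \<partial>?P n)"
      unfolding char_distr[OF measurable_sample[OF sm t Xm]] e[symmetric] by (rule integral_mult_right_zero[symmetric])
    also have "\<dots> = (\<integral>x. iexp (\<tau> * ?Y n x) * of_real (tilt (\<lambda>x. c * gs G x) n x) \<partial>iid \<mu> n)"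
      using integral_sample_em1[OF sm t em, of 1 0] by (simp add: z D tilt_def pn_def)
    finally show "iexp (\<tau> * c * (?mu G - ?mu G0)) * char (distr (?P n) borel (?X n)) \<tau>
      = (\<integral>x. iexp (\<tau> * ?Y n x) * of_real (tilt (\<lambda>x. c * gs G x) n x) \<partial>iid \<mu> n)" .
  qed
  then show "(\<lambda>n. \<integral>x. iexp (\<tau> * ?Y n x) * of_real (tilt (\<lambda>x. c * gs G x) n x) \<partial>iid \<mu> n)
      \<longlonglongrightarrow> iexp (\<tau> * c * (?mu G - ?mu G0)) * char L \<tau>"
    by (rule Lim_transform_eventually[OF tendsto_mult[OF tendsto_const ch]])
qed simp

section \<open>The optimal predictor\<close>

lemma graph_inner:
  assumes "(h, p) \<in> lin_graph Loc gs b" and w: "sq_int \<mu> w" and wb: "\<And>G. G \<in> Loc \<Longrightarrow> (\<integral>x. w x * gs G x \<partial>\<mu>) = b G"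
  shows "(\<integral>x. w x * h x \<partial>\<mu>) = p"
  using assms(1)
proof (induction rule: lin_graph.induct)
  case (add h p k q)
  have "sq_int \<mu> h" "sq_int \<mu> k"
    using lin_graph_sq_int[OF add(1)] lin_graph_sq_int[OF add(2)] gs_sq_int Loc_smooth by auto
  from sq_int_mult[OF w this(1)] sq_int_mult[OF w this(2)] add.IH show ?case
    by (simp add: distrib_left)
next
  case (scale h p a)
  have "(\<integral>x. w x * (a * h x) \<partial>\<mu>) = a * (\<integral>x. w x * h x \<partial>\<mu>)"
    by (subst integral_mult_right_zero[symmetric]) (simp add: ac_simps)
  then show ?case using scale.IH by simp
qed (rule wb)

text \<open>Unbiasedness at \<open>G\<close> says that the inner product of \<open>v - u0\<close>
  with \<open>lr G = 1 + gs G\<close> is \<open>bias G\<close>. The case \<open>G0\<close>, whose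
  score and bias vanish, separates off the mean of \<open>v - u0\<close>.\<close>

lemma unbiased_iff:
  assumes v: "sq_int \<mu> v"
  shows "v \<in> unbiased_class \<nu> f u \<G> G0 \<longleftrightarrow>
    (\<integral>x. v x - u0 x \<partial>\<mu>) = 0 \<and> (\<forall>G\<in>Loc. (\<integral>x. (v x - u0 x) * gs G x \<partial>\<mu>) = bias G)"
proof -
  have vm: "v \<in> borel_measurable \<nu>" using sq_int_measurable[OF v] measurable_mu by simp
  note d = sq_int_diff[OF v u0_sq_int]
  have lr: "(\<integral>x. (v x - u0 x) * lr G x \<partial>\<mu>) = (\<integral>z. v (fst z) \<partial>J G) - mean_utility \<nu> f u G + bias G"
    if G: "G \<in> Loc" for G
  proof -
    note s = Loc_smooth[OF G]
    have "(\<integral>x. (v x - u0 x) * lr G x \<partial>\<mu>) = (\<integral>x. v x * lr G x \<partial>\<mu>) - (\<integral>x. u0 x * lr G x \<partial>\<mu>)"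
      using sq_int_mult[OF v smooth_lr[OF s]] sq_int_mult[OF u0_sq_int smooth_lr[OF s]] by (simp add: left_diff_distrib)
    then show ?thesis using sq_int_lr_J(2)[OF s v] bias_eq[OF s] by (simp add: mean_utility_J)
  qed
  have gsd: "(\<integral>x. (v x - u0 x) * gs G x \<partial>\<mu>) = (\<integral>x. (v x - u0 x) * lr G x \<partial>\<mu>) - (\<integral>x. v x - u0 x \<partial>\<mu>)"
    if G: "G \<in> Loc" for G
  proof -
    have "(\<integral>x. (v x - u0 x) * gs G x \<partial>\<mu>) = (\<integral>x. (v x - u0 x) * lr G x - (v x - u0 x) \<partial>\<mu>)"
      by (simp add: gs_def right_diff_distrib)
    then show ?thesis
      using sq_int_mult[OF d smooth_lr[OF Loc_smooth[OF G]]] M.sq_int_integrable[OF d] by simp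
  qed
  have g0: "(\<integral>x. (v x - u0 x) * gs G0 x \<partial>\<mu>) = 0"
    by (rule integral_eq_zero_AE) (use gs_G0 in \<open>eventually_elim, simp\<close>)
  have unb: "v \<in> unbiased_class \<nu> f u \<G> G0 \<longleftrightarrow> (\<forall>G\<in>Loc. (\<integral>z. v (fst z) \<partial>J G) = mean_utility \<nu> f u G)"
    unfolding unbiased_class_def using vm sq_int_lr_J(1)[OF Loc_smooth v] by auto
  show ?thesis
  proof
    assume "v \<in> unbiased_class \<nu> f u \<G> G0"
    then have *: "\<And>G. G \<in> Loc \<Longrightarrow> (\<integral>x. (v x - u0 x) * lr G x \<partial>\<mu>) = bias G" using unb lr by auto
    have "(\<integral>x. v x - u0 x \<partial>\<mu>) = 0" using gsd[OF G0_Loc] g0 *[OF G0_Loc] bias_G0 by simp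
    then show "(\<integral>x. v x - u0 x \<partial>\<mu>) = 0 \<and> (\<forall>G\<in>Loc. (\<integral>x. (v x - u0 x) * gs G x \<partial>\<mu>) = bias G)"
      using gsd * by auto
  next
    assume *: "(\<integral>x. v x - u0 x \<partial>\<mu>) = 0 \<and> (\<forall>G\<in>Loc. (\<integral>x. (v x - u0 x) * gs G x \<partial>\<mu>) = bias G)"
    then show "v \<in> unbiased_class \<nu> f u \<G> G0" unfolding unb using gsd lr by auto
  qed
qed

text \<open>Pythagoras: \<open>v - u0\<close> is a function of X and hence orthogonal to the
  residual \<open>ub\<close>, whose squared norm \<open>s2\<close> no predictor can reduce.\<close>

lemma risk_eq:
  assumes v: "sq_int \<mu> v"
  shows "risk \<nu> f u G0 v = ennreal ((\<integral>x. (v x - u0 x)\<^sup>2 \<partial>\<mu>) + s2)"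
proof -
  note d = sq_int_diff[OF v u0_sq_int]
  have dm: "(\<lambda>x. (v x - u0 x)\<^sup>2) \<in> borel_measurable \<nu>"
    using sq_int_measurable[OF d] measurable_mu by simp
  have e: "(v (fst z) - u (fst z) (snd z))\<^sup>2 = (v (fst z) - u0 (fst z))\<^sup>2 - 2 * (ub (fst z) (snd z) * (v (fst z) - u0 (fst z)))
      + (ub (fst z) (snd z))\<^sup>2" for z :: "'a \<times> 'b"
    by (simp add: ub_def power2_eq_square algebra_simps)
  have i1: "integrable (J G0) (\<lambda>z. (v (fst z) - u0 (fst z))\<^sup>2)"
    using integrable_J0_fst(1)[OF dm] sq_int_integrable_sq[OF d] by simp
  note i2 = ub_orthogonal[OF d] and i3 = sq_int_integrable_sq[OF ub_J0_sq_int]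
  have "integrable (J G0) (\<lambda>z. (v (fst z) - u (fst z) (snd z))\<^sup>2)"
    unfolding e using i1 i2(1) i3 by simp
  then have "risk \<nu> f u G0 v = ennreal (\<integral>z. (v (fst z) - u (fst z) (snd z))\<^sup>2 \<partial>J G0)"
    unfolding risk_def by (rule nn_integral_eq_integral) simp
  also have "(\<integral>z. (v (fst z) - u (fst z) (snd z))\<^sup>2 \<partial>J G0) = (\<integral>z. (v (fst z) - u0 (fst z))\<^sup>2 \<partial>J G0) + s2"
    unfolding e s2_def using i1 i2 i3 by simp
  also have "(\<integral>z. (v (fst z) - u0 (fst z))\<^sup>2 \<partial>J G0) = (\<integral>x. (v x - u0 x)\<^sup>2 \<partial>\<mu>)"
    by (rule integrable_J0_fst(2)[OF dm sq_int_integrable_sq[OF d]])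
  finally show ?thesis .
qed

lemma finite_risk_sq_int:
  assumes vm: "v \<in> borel_measurable \<nu>" and r: "risk \<nu> f u G0 v < \<infinity>"
  shows "sq_int \<mu> v"
proof -
  have m: "(\<lambda>z. v (fst z) - u (fst z) (snd z)) \<in> borel_measurable (J G0)"
    by (rule measurable_J[OF dominated_G0])
      (intro borel_measurable_diff u_fst_snd measurable_compose[OF measurable_fst vm])
  have "integrable (J G0) (\<lambda>z. (v (fst z) - u (fst z) (snd z))\<^sup>2)"
    by (rule integrableI_nonneg) (use m r in \<open>auto simp: risk_def\<close>)
  then have "sq_int (J G0) (\<lambda>z. v (fst z) - u (fst z) (snd z))" using m by (simp add: sq_int_def)
  from sq_int_add[OF this u_J0_sq_int] have "integrable (J G0) (\<lambda>z. (v (fst z))\<^sup>2)" by (simp add: sq_int_def)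
  moreover have "(\<lambda>x. (v x)\<^sup>2) \<in> borel_measurable \<nu>" using vm by measurable
  ultimately show ?thesis
    using integrable_J0_fst(1)[of "\<lambda>x. (v x)\<^sup>2"] vm by (simp add: sq_int_def measurable_mu)
qed

abbreviation rep :: "('a \<Rightarrow> real) \<Rightarrow> bool" where "rep \<equiv> tangent_rep \<mu> Loc gs bias"

lemma rep_facts:
  assumes w: "rep w"
  shows "sq_int \<mu> w" "(\<integral>x. w x \<partial>\<mu>) = 0" "\<And>G. G \<in> Loc \<Longrightarrow> (\<integral>x. w x * gs G x \<partial>\<mu>) = bias G"
proof -
  show s: "sq_int \<mu> w" using w by (simp add: tangent_rep_def)
  have mean: "(h, p) \<in> lin_graph Loc gs bias \<Longrightarrow> (\<integral>x. 1 * h x \<partial>\<mu>) = 0 \<and> sq_int \<mu> h" for h p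
  proof (induction rule: lin_graph.induct)
    case (add h p k q)
    then show ?case using M.sq_int_integrable[of h] M.sq_int_integrable[of k] by (auto intro: sq_int_add)
  qed (use gs_mean gs_sq_int Loc_smooth sq_int_scale in auto)
  then show "(\<integral>x. w x \<partial>\<mu>) = 0"
    using M.tangent_rep_orthogonal[OF w M.sq_int_const[of 1]] by simp
  show "\<And>G. G \<in> Loc \<Longrightarrow> (\<integral>x. w x * gs G x \<partial>\<mu>) = bias G"
    using w lin_graph.base[of _ Loc gs bias] unfolding tangent_rep_def by fast
qed

text \<open>\<open>v\<close> and \<open>w\<close> represent the same functional, so
  \<open>v - w\<close> is orthogonal to every score, and therefore to \<open>w\<close>, which lies
  in their closed span.\<close>

lemma rep_pythagoras:
  assumes w: "rep w" and v: "sq_int \<mu> v" "\<And>G. G \<in> Loc \<Longrightarrow> (\<integral>x. v x * gs G x \<partial>\<mu>) = bias G"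
  shows "(\<integral>x. (v x)\<^sup>2 \<partial>\<mu>) = (\<integral>x. (w x)\<^sup>2 \<partial>\<mu>) + (\<integral>x. (v x - w x)\<^sup>2 \<partial>\<mu>)"
proof -
  note wf = rep_facts[OF w]
  note d = sq_int_diff[OF v(1) wf(1)]
  have "(\<integral>x. w x * (v x - w x) \<partial>\<mu>) = 0"
  proof (rule M.tangent_rep_orthogonal[OF w d])
    fix h p assume hp: "(h, p) \<in> lin_graph Loc gs bias"
    have hs: "sq_int \<mu> h" using lin_graph_sq_int[OF hp] gs_sq_int Loc_smooth by auto
    have "(\<integral>x. h x * (v x - w x) \<partial>\<mu>) = (\<integral>x. v x * h x \<partial>\<mu>) - (\<integral>x. w x * h x \<partial>\<mu>)"
      by (subst Bochner_Integration.integral_diff[OF sq_int_mult[OF v(1) hs] sq_int_mult[OF wf(1) hs], symmetric])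
        (simp add: algebra_simps)
    then show "(\<integral>x. h x * (v x - w x) \<partial>\<mu>) = 0"
      using graph_inner[OF hp v(1) v(2)] graph_inner[OF hp wf(1) wf(3)] by simp
  qed
  moreover have "(\<integral>x. (v x)\<^sup>2 \<partial>\<mu>) = (\<integral>x. (w x)\<^sup>2 + 2 * (w x * (v x - w x)) + (v x - w x)\<^sup>2 \<partial>\<mu>)"
    by (simp add: power2_eq_square algebra_simps)
  moreover have "(\<integral>x. (w x)\<^sup>2 + 2 * (w x * (v x - w x)) + (v x - w x)\<^sup>2 \<partial>\<mu>)
      = (\<integral>x. (w x)\<^sup>2 \<partial>\<mu>) + 2 * (\<integral>x. w x * (v x - w x) \<partial>\<mu>) + (\<integral>x. (v x - w x)\<^sup>2 \<partial>\<mu>)"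
    using sq_int_integrable_sq[OF wf(1)] sq_int_mult[OF wf(1) d] sq_int_integrable_sq[OF d] by simp
  ultimately show ?thesis by simp
qed

lemma rep_unbiased: "rep w \<Longrightarrow> (\<lambda>x. u0 x + w x) \<in> unbiased_class \<nu> f u \<G> G0"
  using unbiased_iff[OF sq_int_add[OF u0_sq_int rep_facts(1)]] rep_facts(2,3) by simp

text \<open>An unbiased \<open>v\<close> of finite risk represents \<open>bias\<close> by inner
  products with \<open>v - u0\<close>, so Cauchy-Schwarz bounds the functional; the representer
  found is the projection of \<open>v - u0\<close> on the closed tangent space.\<close>

lemma finite_risk_rep_exists:
  assumes v: "v \<in> unbiased_class \<nu> f u \<G> G0" "risk \<nu> f u G0 v < \<infinity>"
  obtains w where "rep w"
proof -
  have s: "sq_int \<mu> v" by (rule finite_risk_sq_int) (use v in \<open>auto simp: unbiased_class_def\<close>)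
  note d = sq_int_diff[OF s u0_sq_int]
  have b: "\<And>G. G \<in> Loc \<Longrightarrow> (\<integral>x. (v x - u0 x) * gs G x \<partial>\<mu>) = bias G" using v(1) unbiased_iff[OF s] by blast
  show thesis
  proof (rule M.tangent_rep_exists[OF _ _ _ that])
    show "Loc \<noteq> {}" using G0_Loc by blast
    show "sq_int \<mu> (gs G)" if "G \<in> Loc" for G using gs_sq_int[OF Loc_smooth[OF that]] .
    show "\<bar>p\<bar> \<le> sqrt (\<integral>x. (v x - u0 x)\<^sup>2 \<partial>\<mu>) * sqrt (\<integral>x. (h x)\<^sup>2 \<partial>\<mu>)" if hp: "(h, p) \<in> lin_graph Loc gs bias" for h p
      using integral_Cauchy_Schwarz[OF d lin_graph_sq_int[OF hp]] gs_sq_int Loc_smooth graph_inner[OF hp d b] by simp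
  qed
qed

text \<open>The risk is \<open>s2\<close> plus a squared length, and the Pythagorean identity makes
  \<open>w\<close> the shortest representer.\<close>

lemma rep_optimal:
  assumes w: "rep w" shows "is_optimal_v \<nu> f u \<G> G0 (\<lambda>x. u0 x + w x)"
  unfolding is_optimal_v_def is_arg_min_def
proof (intro conjI notI)
  note s = sq_int_add[OF u0_sq_int rep_facts(1)[OF w]]
  show "(\<lambda>x. u0 x + w x) \<in> unbiased_class \<nu> f u \<G> G0" by (rule rep_unbiased[OF w])
  show fin: "risk \<nu> f u G0 (\<lambda>x. u0 x + w x) < \<infinity>" unfolding risk_eq[OF s] by simp
  assume "\<exists>y. y \<in> unbiased_class \<nu> f u \<G> G0 \<and> risk \<nu> f u G0 y < risk \<nu> f u G0 (\<lambda>x. u0 x + w x)"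
  then obtain v where v: "v \<in> unbiased_class \<nu> f u \<G> G0" "risk \<nu> f u G0 v < risk \<nu> f u G0 (\<lambda>x. u0 x + w x)" by blast
  have vs: "sq_int \<mu> v" by (rule finite_risk_sq_int) (use v fin in \<open>auto simp: unbiased_class_def\<close>)
  have b: "\<And>G. G \<in> Loc \<Longrightarrow> (\<integral>x. (v x - u0 x) * gs G x \<partial>\<mu>) = bias G" using v(1) unbiased_iff[OF vs] by blast
  have "(\<integral>x. (w x)\<^sup>2 \<partial>\<mu>) \<le> (\<integral>x. (v x - u0 x)\<^sup>2 \<partial>\<mu>)"
    using rep_pythagoras[OF w sq_int_diff[OF vs u0_sq_int] b] by simp
  then have "risk \<nu> f u G0 (\<lambda>x. u0 x + w x) \<le> risk \<nu> f u G0 v"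
    unfolding risk_eq[OF s] risk_eq[OF vs] by (intro ennreal_leI) simp
  then show False using v(2) by simp
qed

text \<open>Minimal risk leaves no room for the orthogonal part in the Pythagorean identity.\<close>

lemma optimal_AE:
  assumes w: "rep w" and v: "is_optimal_v \<nu> f u \<G> G0 v"
  shows "AE x in \<mu>. v x - u0 x = w x" and "sq_int \<mu> (\<lambda>x. v x - u0 x)"
proof -
  have v': "v \<in> unbiased_class \<nu> f u \<G> G0" "risk \<nu> f u G0 v < \<infinity>" using v by (auto simp: is_optimal_v_def is_arg_min_def)
  have vs: "sq_int \<mu> v" by (rule finite_risk_sq_int) (use v' in \<open>auto simp: unbiased_class_def\<close>)
  note s = sq_int_add[OF u0_sq_int rep_facts(1)[OF w]]
  show d: "sq_int \<mu> (\<lambda>x. v x - u0 x)" by (rule sq_int_diff[OF vs u0_sq_int])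
  have b: "\<And>G. G \<in> Loc \<Longrightarrow> (\<integral>x. (v x - u0 x) * gs G x \<partial>\<mu>) = bias G" using v'(1) unbiased_iff[OF vs] by blast
  have s2: "0 \<le> s2" by (simp add: s2_def)
  have "\<not> risk \<nu> f u G0 (\<lambda>x. u0 x + w x) < risk \<nu> f u G0 v"
    using v rep_unbiased[OF w] by (auto simp: is_optimal_v_def is_arg_min_def)
  then have "(\<integral>x. (v x - u0 x)\<^sup>2 \<partial>\<mu>) \<le> (\<integral>x. (w x)\<^sup>2 \<partial>\<mu>)"
    unfolding risk_eq[OF s] risk_eq[OF vs] using s2 by (simp add: ennreal_less_iff not_less)
  then have "(\<integral>x. (v x - u0 x - w x)\<^sup>2 \<partial>\<mu>) \<le> 0" using rep_pythagoras[OF w d b] by simp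
  then have "(\<integral>x. (v x - u0 x - w x)\<^sup>2 \<partial>\<mu>) = 0" by (simp add: antisym)
  then have "AE x in \<mu>. (v x - u0 x - w x)\<^sup>2 = 0"
    using sq_int_integrable_sq[OF sq_int_diff[OF d rep_facts(1)[OF w]]] by (subst (asm) integral_nonneg_eq_0_iff_AE) auto
  then show "AE x in \<mu>. v x - u0 x = w x" by eventually_elim simp
qed

text \<open>Lets an arbitrary version of the optimal predictor take the place of the one built from
  \<open>w\<close>.\<close>

lemma rep_AE_cong:
  assumes w: "rep w" and v: "AE x in \<mu>. v x = w x" "sq_int \<mu> v"
  shows "rep v"
proof -
  note [measurable] = sq_int_measurable[OF v(2)] sq_int_measurable[OF rep_facts(1)[OF w]]
  obtain s where s: "\<And>n. sq_int \<mu> (s n)" "\<And>n. \<exists>p. (s n, p) \<in> lin_graph Loc gs bias"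
    "(\<lambda>n. \<integral>x. (s n x - w x)\<^sup>2 \<partial>\<mu>) \<longlonglongrightarrow> 0"
    using w unfolding tangent_rep_def by auto
  have 1: "(\<integral>x. (s n x - v x)\<^sup>2 \<partial>\<mu>) = (\<integral>x. (s n x - w x)\<^sup>2 \<partial>\<mu>)" for n
  proof -
    note [measurable] = sq_int_measurable[OF s(1)]
    have "AE x in \<mu>. (s n x - v x)\<^sup>2 = (s n x - w x)\<^sup>2" using v(1) by eventually_elim simp
    then show ?thesis by (intro integral_cong_AE) measurable
  qed
  have 2: "(\<integral>x. v x * h x \<partial>\<mu>) = p" if hp: "(h, p) \<in> lin_graph Loc gs bias" for h p
  proof -
    note [measurable] = sq_int_measurable[OF lin_graph_sq_int[OF hp gs_sq_int[OF Loc_smooth]]]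
    have "AE x in \<mu>. v x * h x = w x * h x" using v(1) by eventually_elim simp
    then have "(\<integral>x. v x * h x \<partial>\<mu>) = (\<integral>x. w x * h x \<partial>\<mu>)" by (intro integral_cong_AE) measurable
    then show ?thesis using w hp unfolding tangent_rep_def by auto
  qed
  show ?thesis
    unfolding tangent_rep_def using v(2) 2 s 1 by (intro conjI exI[of _ s]) auto
qed

lemma regular_sum_rep_exists:
  assumes "regular_sum_with_limit \<nu> f u \<G> G0 S L" obtains w where "rep w"
proof -
  interpret R: tilted_limits \<mu> Loc gs bias "centred S" "\<lambda>\<tau>. char L \<tau> * of_real (exp (\<tau>\<^sup>2 * s2 / 2))"
    by (rule regular_sum_tilted_limits[OF assms])
  show thesis by (rule R.rep_exists[OF that])
qed

text \<open>The functional is here the increment of the mean instead of \<open>bias\<close>, so the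
  unbiased function is the mean at \<open>G0\<close> plus the representer. Passing to the criterion
  \<open>unbiased_iff\<close> subtracts the inner product of \<open>u0\<close> with the score, which
  turns the increment into \<open>bias\<close>.\<close>

lemma regular_mean_unbiased_exists:
  assumes "regular_mean_with_limit \<nu> f u \<G> G0 m L"
  shows "unbiased_class \<nu> f u \<G> G0 \<noteq> {}"
proof -
  let ?b = "\<lambda>G. mean_utility \<nu> f u G - mean_utility \<nu> f u G0"
  interpret R: tilted_limits \<mu> Loc gs ?b "\<lambda>n x. sqrt (real n) * (m n x - mean_utility \<nu> f u G0)" "char L"
    by (rule regular_mean_tilted_limits[OF assms])
  obtain w where w: "tangent_rep \<mu> Loc gs ?b w" by (rule R.rep_exists)
  have wg: "(\<integral>x. w x * gs G x \<partial>\<mu>) = ?b G" if "G \<in> Loc" for G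
    using w lin_graph.base[OF that, of gs ?b] unfolding tangent_rep_def by fast
  have ws: "sq_int \<mu> w" using w by (simp add: tangent_rep_def)
  have w0: "(\<integral>x. w x \<partial>\<mu>) = 0" by (rule R.rep_mean[OF w])
  let ?v = "\<lambda>x. mean_utility \<nu> f u G0 + w x"
  have vs: "sq_int \<mu> ?v" by (intro sq_int_add M.sq_int_const ws)
  have u0m: "(\<integral>x. u0 x \<partial>\<mu>) = mean_utility \<nu> f u G0"
  proof -
    have "(\<integral>x. u0 x \<partial>\<mu>) = (\<integral>z. u (fst z) (snd z) \<partial>J G0)"
      unfolding u0_def by (rule cnd_integral[OF dominated_G0 u u_integrable[OF smooth_G0]])
    then show ?thesis by (simp add: mean_utility_J)
  qed
  have 1: "(\<integral>x. ?v x - u0 x \<partial>\<mu>) = 0"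
    using M.sq_int_integrable[OF ws] M.sq_int_integrable[OF u0_sq_int] u0m w0 by (simp add: M.prob_space[simplified])
  have 2: "(\<integral>x. (?v x - u0 x) * gs G x \<partial>\<mu>) = bias G" if G: "G \<in> Loc" for G
  proof -
    note s = Loc_smooth[OF G]
    note gi = M.sq_int_integrable[OF gs_sq_int[OF s]]
    have "(\<integral>x. (?v x - u0 x) * gs G x \<partial>\<mu>)
        = (\<integral>x. mean_utility \<nu> f u G0 * gs G x + w x * gs G x - u0 x * gs G x \<partial>\<mu>)"
      by (simp add: algebra_simps)
    also have "\<dots> = ?b G - (\<integral>x. u0 x * gs G x \<partial>\<mu>)"
      using gi sq_int_mult[OF ws gs_sq_int[OF s]] sq_int_mult[OF u0_sq_int gs_sq_int[OF s]] wg[OF G] gs_mean[OF s] by simp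
    also have "(\<integral>x. u0 x * gs G x \<partial>\<mu>) = (\<integral>x. u0 x * lr G x - u0 x \<partial>\<mu>)" by (simp add: gs_def right_diff_distrib)
    also have "\<dots> = (\<integral>x. u0 x * lr G x \<partial>\<mu>) - mean_utility \<nu> f u G0"
      using sq_int_mult[OF u0_sq_int smooth_lr[OF s]] M.sq_int_integrable[OF u0_sq_int] u0m by simp
    finally show ?thesis using bias_eq[OF s] by (simp add: mean_utility_J)
  qed
  have "?v \<in> unbiased_class \<nu> f u \<G> G0" unfolding unbiased_iff[OF vs] using 1 2 by blast
  then show ?thesis by blast
qed

end

section \<open>Efficiency\<close>

context class_model
begin

text \<open>Suppose the variance \<open>V\<close> of the limit law were below
  \<open>B = A + s2\<close>. With \<open>s = \<tau>\<^sup>2\<close>, its characteristic function has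
  squared modulus at least \<open>1 - s * V\<close>, while \<open>char_bound\<close> with the
  Gaussian factor restored allows only about \<open>1 - s * B\<close>; a small \<open>s\<close>
  gives the contradiction.\<close>

lemma variance_lower_bound:
  assumes reg: "regular_sum_with_limit \<nu> f u \<G> G0 S L" and w: "rep w"
  shows "ennreal ((\<integral>x. (w x)\<^sup>2 \<partial>\<mu>) + s2) \<le> extended_variance L"
proof (rule ccontr)
  define A where "A = (\<integral>x. (w x)\<^sup>2 \<partial>\<mu>)"
  have A: "0 \<le> A" and s2: "0 \<le> s2" by (simp_all add: A_def s2_def)
  interpret R: tilted_limits \<mu> Loc gs bias "centred S" "\<lambda>\<tau>. char L \<tau> * of_real (exp (\<tau>\<^sup>2 * s2 / 2))"
    by (rule regular_sum_tilted_limits[OF reg])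
  interpret L: real_distribution L using reg by (simp add: regular_sum_iff)
  define m where "m = (\<integral>y. y \<partial>L)"
  assume "\<not> ennreal ((\<integral>x. (w x)\<^sup>2 \<partial>\<mu>) + s2) \<le> extended_variance L"
  then have less: "extended_variance L < ennreal (A + s2)" by (simp add: A_def)
  then obtain V where V: "extended_variance L = ennreal V" "0 \<le> V"
    by (cases "extended_variance L") auto
  have VB: "V < A + s2" using less V by (simp add: ennreal_less_iff)
  have ev: "(\<integral>\<^sup>+x. ennreal ((x - m)\<^sup>2) \<partial>L) = ennreal V" using V(1) by (simp add: extended_variance_def m_def)
  define B where "B = A + s2"
  have B: "V < B" "0 < B" using VB V by (auto simp: B_def)
  \<comment> \<open>The first entry secures \<open>s * V \<le> 1\<close>, so that the lower bounds
    are nonnegative and may be squared and multiplied. The second makes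
    \<open>s * (V * B) < B - V\<close>, which is incompatible with
    \<open>(1 - s * V) * (1 + s * B) \<le> 1\<close>.\<close>
  define s where "s = min (1 / (V + 1)) ((B - V) / (2 * (V * B + 1)))"
  have VB1: "0 < V * B + 1" using V B by (simp add: add_nonneg_pos)
  have s: "0 < s" using V B VB1 by (simp add: s_def)
  have "s \<le> 1 / (V + 1)" by (simp add: s_def)
  then have sV: "s * V \<le> 1" using V s by (simp add: pos_le_divide_eq algebra_simps)
  have "s \<le> (B - V) / (2 * (V * B + 1))" by (simp add: s_def)
  then have "s * (2 * (V * B + 1)) \<le> B - V" using VB1 by (simp add: pos_le_divide_eq)
  moreover have "s * (V * B) < s * (2 * (V * B + 1))"
  proof (rule mult_strict_left_mono[OF _ s])
    have "p < 2 * (p + 1)" if "0 < p + 1" for p :: real using that by simp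
    then show "V * B < 2 * (V * B + 1)" using VB1 by blast
  qed
  ultimately have sVB: "s * (V * B) < B - V" by linarith
  define \<tau> where "\<tau> = sqrt s"
  have \<tau>: "\<tau>\<^sup>2 = s" using s by (simp add: \<tau>_def)
  define c where "c = (cmod (char L \<tau>))\<^sup>2"
  have "1 - s * V / 2 \<le> cmod (char L \<tau>)"
  proof -
    have "1 - \<tau>\<^sup>2 * V / 2 \<le> Re (iexp (- (\<tau> * m)) * char L \<tau>)" by (rule L.char_lower_bound[OF ev V(2)])
    also have "\<dots> \<le> cmod (iexp (- (\<tau> * m)) * char L \<tau>)" by (rule complex_Re_le_cmod)
    also have "\<dots> = cmod (char L \<tau>)" by (simp only: norm_mult norm_exp_i_times mult_1)
    finally show ?thesis by (simp add: \<tau>)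
  qed
  then have "(1 - s * V / 2)\<^sup>2 \<le> c" unfolding c_def using sV by (intro power_mono) auto
  moreover have "1 - s * V \<le> (1 - s * V / 2)\<^sup>2" by (simp add: power2_diff)
  ultimately have c: "1 - s * V \<le> c" by linarith
  have "(cmod (char L \<tau> * of_real (exp (\<tau>\<^sup>2 * s2 / 2))))\<^sup>2 = c * exp (s * s2)"
    unfolding norm_mult power_mult_distrib c_def \<tau> by (simp add: power2_eq_square flip: exp_add)
  then have "A * (s * (c * exp (s * s2))) \<le> 1 - c * exp (s * s2)"
    using R.char_bound[OF w, of \<tau>] by (simp add: A_def \<tau>)
  then have "c * exp (s * s2) * (1 + A * s) \<le> 1" by (simp add: algebra_simps)
  moreover have "(1 - s * V) * (1 + s * s2) * (1 + A * s) \<le> c * exp (s * s2) * (1 + A * s)"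
    using c sV s s2 A by (intro mult_mono exp_ge_add_one_self) auto
  moreover have "(1 - s * V) * (1 + s * B) \<le> (1 - s * V) * (1 + s * s2) * (1 + A * s)"
  proof -
    have "1 + s * B \<le> (1 + s * s2) * (1 + A * s)" using s s2 A by (simp add: B_def algebra_simps)
    then have "(1 - s * V) * (1 + s * B) \<le> (1 - s * V) * ((1 + s * s2) * (1 + A * s))"
      using sV by (intro mult_left_mono) auto
    then show ?thesis by (simp only: mult.assoc)
  qed
  ultimately have "(1 - s * V) * (1 + s * B) \<le> 1" by linarith
  then have "s * (B - V - s * (V * B)) \<le> 0" by (simp add: algebra_simps)
  then show False using s sVB by (simp add: mult_le_0_iff)
qed

text \<open>For the score itself the tilted limits are known. By \<open>approx\<close> the two
  exponentials are close in L2 under the base law, and the tilts are bounded in L2 uniformly in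
  \<open>n\<close>, so Cauchy-Schwarz carries the approximation over to the tilted laws.\<close>

lemma regular_from_representation:
  assumes S: "estimator \<nu> S" and w: "rep w"
    and approx: "\<And>\<epsilon>. \<epsilon> > 0 \<Longrightarrow> (\<lambda>n. measure (iid \<mu> n) {x\<in>space (iid \<mu> n). \<bar>centred S n x - score w n x\<bar> > \<epsilon>}) \<longlonglongrightarrow> 0"
  shows "regular_sum_with_limit \<nu> f u \<G> G0 S (scaled_normal (sqrt ((\<integral>x. (w x)\<^sup>2 \<partial>\<mu>) + s2)))"
  unfolding regular_sum_iff
proof (intro conjI S real_distribution_scaled_normal allI impI ballI)
  define A where "A = (\<integral>x. (w x)\<^sup>2 \<partial>\<mu>)"
  have A: "0 \<le> A" and s2: "0 \<le> s2" by (simp_all add: A_def s2_def)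
  note wf = rep_facts[OF w]
  fix c :: real and G \<tau> assume c: "c > 0" and G: "G \<in> Loc"
  note sm = Loc_smooth[OF G]
  let ?h = "\<lambda>x. c * gs G x"
  have h: "sq_int \<mu> ?h" "(\<integral>x. ?h x \<partial>\<mu>) = 0" using sq_int_scale[OF gs_sq_int[OF sm]] gs_mean[OF sm] by auto
  let ?L = "scaled_normal (sqrt ((\<integral>x. (w x)\<^sup>2 \<partial>\<mu>) + s2))"
  have "(\<integral>x. w x * ?h x \<partial>\<mu>) = c * bias G"
    unfolding wf(3)[OF G, symmetric] by (subst integral_mult_right_zero[symmetric]) (simp add: ac_simps)
  then have "(\<lambda>n. \<integral>x. iexp (\<tau> * score w n x) * of_real (tilt ?h n x) \<partial>iid \<mu> n)
      \<longlonglongrightarrow> exp (\<i> * \<tau> * (c * bias G) - \<tau>\<^sup>2 * A / 2)"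
    using M.score_tilt_limit[OF wf(1,2) h, of \<tau>] by (simp add: A_def)
  moreover have "exp (\<i> * \<tau> * (c * bias G) - \<tau>\<^sup>2 * A / 2) = iexp (\<tau> * c * bias G) * (char ?L \<tau> * of_real (exp (\<tau>\<^sup>2 * s2 / 2)))"
  proof -
    have "char ?L \<tau> * of_real (exp (\<tau>\<^sup>2 * s2 / 2)) = of_real (exp (- (\<tau>\<^sup>2 * A / 2)))"
      unfolding char_scaled_normal using A s2
      by (simp add: A_def[symmetric] algebra_simps add_divide_distrib flip: of_real_mult exp_add)
    then show ?thesis by (simp add: exp_of_real[symmetric] algebra_simps flip: exp_add)
  qed
  ultimately have lim: "(\<lambda>n. \<integral>x. iexp (\<tau> * score w n x) * of_real (tilt ?h n x) \<partial>iid \<mu> n)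
      \<longlonglongrightarrow> iexp (\<tau> * c * bias G) * (char ?L \<tau> * of_real (exp (\<tau>\<^sup>2 * s2 / 2)))" by simp
  define Q where "Q n = (\<integral>x. (cmod (iexp (\<tau> * centred S n x) - iexp (\<tau> * score w n x)))\<^sup>2 \<partial>iid \<mu> n)" for n
  define H where "H = (\<integral>x. (?h x)\<^sup>2 \<partial>\<mu>)"
  have cm [measurable]: "centred S n \<in> borel_measurable (iid \<mu> n)" for n by (rule centred_measurable[OF S])
  have scm [measurable]: "score w n \<in> borel_measurable (iid \<mu> n)" for n
    by (rule score_measurable[OF sq_int_measurable[OF wf(1)]])
  have d2: "(cmod (iexp a - iexp b))\<^sup>2 \<le> 4" for a b
  proof -
    have "cmod (iexp a - iexp b) \<le> 2" using norm_triangle_ineq4[of "iexp a" "iexp b"] by simp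
    then have "(cmod (iexp a - iexp b))\<^sup>2 \<le> 2\<^sup>2" by (intro power_mono) auto
    then show ?thesis by simp
  qed
  have dl: "cmod (iexp a - iexp b) \<le> \<bar>a - b\<bar>" for a b
  proof -
    have "iexp a - iexp b = iexp b * (iexp (a - b) - 1)" by (simp add: algebra_simps flip: exp_add)
    then have "cmod (iexp a - iexp b) = cmod (iexp (a - b) - 1)" by (simp only: norm_mult norm_exp_i_times mult_1)
    then show ?thesis using iexp_approx_0[of "a - b"] by simp
  qed
  have di: "integrable (iid \<mu> n) (\<lambda>x. (cmod (iexp (\<tau> * centred S n x) - iexp (\<tau> * score w n x)))\<^sup>2)" for n
  proof -
    interpret P: prob_space "iid \<mu> n" by (rule M.prob_space_iid)
    show ?thesis by (rule P.integrable_const_bound[of _ 4]) (rule AE_I2, simp only: real_norm_def abs_power2, rule d2, measurable)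
  qed
  have Q: "Q \<longlonglongrightarrow> 0"
  proof (rule LIMSEQ_I)
    fix e :: real assume e: "e > 0"
    \<comment> \<open>On the good event the squared difference is at most
      \<open>\<tau>\<^sup>2 * \<epsilon>\<^sup>2 \<le> e / 2\<close>; the exceptional event
      contributes at most 4 times its probability, which is kept below \<open>e / 8\<close>.\<close>
    define \<epsilon> where "\<epsilon> = sqrt (e / (2 * (\<tau>\<^sup>2 + 1)))"
    have \<tau>1: "0 < \<tau>\<^sup>2 + 1" by (simp add: add_nonneg_pos)
    have \<epsilon>: "\<epsilon> > 0" "\<epsilon>\<^sup>2 = e / (2 * (\<tau>\<^sup>2 + 1))" using e \<tau>1 by (auto simp: \<epsilon>_def)
    have \<epsilon>e: "\<tau>\<^sup>2 * \<epsilon>\<^sup>2 \<le> e / 2"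
    proof -
      have "\<tau>\<^sup>2 * \<epsilon>\<^sup>2 \<le> (\<tau>\<^sup>2 + 1) * \<epsilon>\<^sup>2" by (intro mult_right_mono) auto
      also have "\<dots> = e / 2" unfolding \<epsilon>(2) using \<tau>1 by (simp add: field_simps)
      finally show ?thesis .
    qed
    let ?p = "\<lambda>n. measure (iid \<mu> n) {x\<in>space (iid \<mu> n). \<bar>centred S n x - score w n x\<bar> > \<epsilon>}"
    have "\<forall>\<^sub>F n in sequentially. ?p n < e / 8"
      by (rule order_tendstoD(2)[OF approx[OF \<epsilon>(1)]]) (use e in simp)
    then obtain N where N: "\<And>n. n \<ge> N \<Longrightarrow> ?p n < e / 8" by (auto simp: eventually_sequentially)
    have "norm (Q n - 0) < e" if n: "n \<ge> N" for n
    proof -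
      interpret P: prob_space "iid \<mu> n" by (rule M.prob_space_iid)
      let ?E = "{x\<in>space (iid \<mu> n). \<bar>centred S n x - score w n x\<bar> > \<epsilon>}"
      have E: "?E \<in> sets (iid \<mu> n)" by measurable
      have Ei: "integrable (iid \<mu> n) (indicator ?E :: _ \<Rightarrow> real)"
        by (rule integrable_real_indicator[OF E]) (simp add: less_top[symmetric])
      have "Q n \<le> (\<integral>x. \<tau>\<^sup>2 * \<epsilon>\<^sup>2 + 4 * indicator ?E x \<partial>iid \<mu> n)"
        unfolding Q_def
      proof (rule integral_mono[OF di])
        show "integrable (iid \<mu> n) (\<lambda>x. \<tau>\<^sup>2 * \<epsilon>\<^sup>2 + 4 * indicator ?E x)"
          using Ei by simp
        fix x assume x: "x \<in> space (iid \<mu> n)"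
        show "(cmod (iexp (\<tau> * centred S n x) - iexp (\<tau> * score w n x)))\<^sup>2 \<le> \<tau>\<^sup>2 * \<epsilon>\<^sup>2 + 4 * indicator ?E x"
        proof (cases "x \<in> ?E")
          case True
          then show ?thesis using d2[of "\<tau> * centred S n x" "\<tau> * score w n x"] by (simp add: add_nonneg_pos add_increasing)
        next
          case False
          then have l: "\<bar>centred S n x - score w n x\<bar> \<le> \<epsilon>" using x by simp
          have "cmod (iexp (\<tau> * centred S n x) - iexp (\<tau> * score w n x)) \<le> \<bar>\<tau>\<bar> * \<epsilon>"
            using dl[of "\<tau> * centred S n x" "\<tau> * score w n x"] mult_left_mono[OF l abs_ge_zero[of \<tau>]]
            by (simp add: abs_mult[symmetric] right_diff_distrib)
          then have "(cmod (iexp (\<tau> * centred S n x) - iexp (\<tau> * score w n x)))\<^sup>2 \<le> (\<bar>\<tau>\<bar> * \<epsilon>)\<^sup>2"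
            by (intro power_mono) auto
          then show ?thesis using False by (simp add: power_mult_distrib)
        qed
      qed
      also have "\<dots> = \<tau>\<^sup>2 * \<epsilon>\<^sup>2 + 4 * ?p n" using E Ei by (simp add: P.prob_space)
      also have "\<dots> < e" using \<epsilon>e N[OF n] by linarith
      finally have "Q n < e" .
      moreover have "0 \<le> Q n" by (simp add: Q_def)
      ultimately show ?thesis by simp
    qed
    then show "\<exists>no. \<forall>n\<ge>no. norm (Q n - 0) < e" by blast
  qed
  have "(\<lambda>n. (\<integral>x. iexp (\<tau> * centred S n x) * of_real (tilt ?h n x) \<partial>iid \<mu> n)
      - (\<integral>x. iexp (\<tau> * score w n x) * of_real (tilt ?h n x) \<partial>iid \<mu> n)) \<longlonglongrightarrow> 0"
  proof (rule Lim_null_comparison)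
    show "\<forall>\<^sub>F n in sequentially. norm ((\<integral>x. iexp (\<tau> * centred S n x) * of_real (tilt ?h n x) \<partial>iid \<mu> n)
      - (\<integral>x. iexp (\<tau> * score w n x) * of_real (tilt ?h n x) \<partial>iid \<mu> n)) \<le> sqrt (Q n) * sqrt (exp H)"
    proof (rule always_eventually, rule allI)
      fix n
      interpret P: prob_space "iid \<mu> n" by (rule M.prob_space_iid)
      note t = M.sq_int_tilt[OF h, of n]
      have e: "(\<lambda>x. iexp (\<tau> * centred S n x)) \<in> borel_measurable (iid \<mu> n)" "(\<lambda>x. iexp (\<tau> * score w n x)) \<in> borel_measurable (iid \<mu> n)"
        by measurable
      have "(\<integral>x. iexp (\<tau> * centred S n x) * of_real (tilt ?h n x) \<partial>iid \<mu> n) - (\<integral>x. iexp (\<tau> * score w n x) * of_real (tilt ?h n x) \<partial>iid \<mu> n)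
          = (\<integral>x. (iexp (\<tau> * centred S n x) - iexp (\<tau> * score w n x)) * of_real (tilt ?h n x) \<partial>iid \<mu> n)"
        unfolding left_diff_distrib
        by (rule Bochner_Integration.integral_diff[symmetric]) (rule P.cmod_integral_bounded_mult(1)[OF _ _ t], use e in simp_all)+
      also have "cmod \<dots> \<le> sqrt (Q n) * sqrt (\<integral>x. (tilt ?h n x)\<^sup>2 \<partial>iid \<mu> n)"
        unfolding Q_def by (rule complex_integral_Cauchy_Schwarz(2)[OF borel_measurable_diff[OF e] di t])
      also have "\<dots> \<le> sqrt (Q n) * sqrt (exp H)"
        unfolding H_def by (intro mult_left_mono real_sqrt_le_mono M.integral_tilt_sq_le h) (simp add: Q_def)
      finally show "norm ((\<integral>x. iexp (\<tau> * centred S n x) * of_real (tilt ?h n x) \<partial>iid \<mu> n)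
        - (\<integral>x. iexp (\<tau> * score w n x) * of_real (tilt ?h n x) \<partial>iid \<mu> n)) \<le> sqrt (Q n) * sqrt (exp H)" .
    qed
    have "(\<lambda>n. sqrt (Q n) * sqrt (exp H)) \<longlonglongrightarrow> sqrt 0 * sqrt (exp H)" by (intro tendsto_intros Q)
    then show "(\<lambda>n. sqrt (Q n) * sqrt (exp H)) \<longlonglongrightarrow> 0" by simp
  qed
  from tendsto_add[OF this lim]
  show "(\<lambda>n. \<integral>x. iexp (\<tau> * centred S n x) * of_real (tilt ?h n x) \<partial>iid \<mu> n)
      \<longlonglongrightarrow> iexp (\<tau> * c * bias G) * (char ?L \<tau> * of_real (exp (\<tau>\<^sup>2 * s2 / 2)))" by simp
qed

text \<open>The infimum is attained by the sum of \<open>u0 + w\<close> over the observations: its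
  centred version is exactly the score of \<open>w\<close>, and the limit is a scaled normal law
  whose second moment bounds its variance.\<close>

lemma variance_bound_eq:
  assumes w: "rep w"
  shows "variance_bound \<nu> f u \<G> G0 = ennreal ((\<integral>x. (w x)\<^sup>2 \<partial>\<mu>) + s2)"
proof (rule antisym)
  define A where "A = (\<integral>x. (w x)\<^sup>2 \<partial>\<mu>)"
  have A: "0 \<le> A" and s2: "0 \<le> s2" by (simp_all add: A_def s2_def)
  show "ennreal ((\<integral>x. (w x)\<^sup>2 \<partial>\<mu>) + s2) \<le> variance_bound \<nu> f u \<G> G0"
    unfolding variance_bound_def by (rule INF_greatest) (use variance_lower_bound[OF _ w] in blast)
  let ?S = "\<lambda>n x. \<Sum>j<n. u0 (x j) + w (x j)"
  let ?L = "scaled_normal (sqrt ((\<integral>x. (w x)\<^sup>2 \<partial>\<mu>) + s2))"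
  have wm: "w \<in> borel_measurable \<nu>" using sq_int_measurable[OF rep_facts(1)[OF w]] measurable_mu by simp
  have S: "estimator \<nu> ?S"
    unfolding estimator_def
  proof
    fix n
    have "(\<lambda>x. u0 (x j) + w (x j)) \<in> borel_measurable (iid \<nu> n)" if "j < n" for j
      by (rule measurable_coord[OF borel_measurable_add[OF u0_measurable wm] that])
    then show "?S n \<in> borel_measurable (iid \<nu> n)" by (intro borel_measurable_sum) auto
  qed
  have "centred ?S n x = score w n x" for n x
    by (simp add: centred_def score_def sum.distrib)
  then have "regular_sum_with_limit \<nu> f u \<G> G0 ?S ?L"
    by (intro regular_from_representation[OF S w]) simp
  then have "variance_bound \<nu> f u \<G> G0 \<le> extended_variance ?L"
    unfolding variance_bound_def by (intro INF_lower) blast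
  also have "\<dots> \<le> second_moment ?L"
    by (rule real_distribution.extended_variance_le_second_moment[OF real_distribution_scaled_normal])
  also have "\<dots> = ennreal ((\<integral>x. (w x)\<^sup>2 \<partial>\<mu>) + s2)"
    using A s2 by (simp add: second_moment_scaled_normal A_def[symmetric])
  finally show "variance_bound \<nu> f u \<G> G0 \<le> ennreal ((\<integral>x. (w x)\<^sup>2 \<partial>\<mu>) + s2)" .
qed

text \<open>The sample identity with trivial weights; under \<open>G0\<close> the likelihood ratio
  of one observation is 1 almost everywhere.\<close>

lemma measure_sample_observed:
  assumes A: "A \<in> sets (iid \<mu> n)"
  shows "measure (sample_law \<nu> f G0 n) {\<omega>\<in>space (sample_law \<nu> f G0 n). observed n \<omega> \<in> A} = measure (iid \<mu> n) A"
proof -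
  interpret P: prob_space "iid \<mu> n" by (rule M.prob_space_iid)
  have PS: "prob_space (sample_law \<nu> f G0 n)" unfolding sample_law_def by (intro prob_space_PiM J0.prob_space_axioms)
  interpret PS: prob_space "sample_law \<nu> f G0 n" by (rule PS)
  have fst_J: "fst \<in> measurable (J G0) \<mu>"
    using measurable_J[OF dominated_G0 measurable_fst] by (simp cong: measurable_cong_sets)
  have om: "observed n \<in> measurable (sample_law \<nu> f G0 n) (iid \<mu> n)"
    unfolding sample_law_def by (rule observed_measurable[OF fst_J])
  have E: "{\<omega>\<in>space (sample_law \<nu> f G0 n). observed n \<omega> \<in> A} \<in> sets (sample_law \<nu> f G0 n)"
    using measurable_sets[OF om A] by (simp add: vimage_def Int_def conj_commute)
  let ?\<Phi> = "\<lambda>x. complex_of_real (indicator A x)"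
  have \<Phi>: "?\<Phi> \<in> borel_measurable (iid \<mu> n)" "\<And>x. cmod (?\<Phi> x) \<le> 1" using A by (auto simp: indicator_def)
  have "(\<integral>\<omega>. ?\<Phi> (observed n \<omega>) * (\<Prod>j<n. 1) \<partial>iid (J G0) n) = (\<integral>x. ?\<Phi> x * (\<Prod>j<n. 1) \<partial>iid \<mu> n)"
  proof (rule integral_sample_observed[OF J0.prob_space_axioms fst_J prob_space_\<mu> _ _ _ _ \<Phi>])
    fix \<phi> :: "'a \<Rightarrow> complex" and B assume \<phi>: "\<phi> \<in> borel_measurable \<mu>" "\<And>x. cmod (\<phi> x) \<le> B"
    have m: "\<phi> \<in> borel_measurable \<nu>" using \<phi>(1) measurable_mu by simp
    have one: "(\<lambda>(x, \<theta>). 1 :: complex) \<in> borel_measurable (\<nu> \<Otimes>\<^sub>M T)" by (simp add: case_prod_beta')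
    have lrc: "cnd G0 (\<lambda>_ _. 1 :: complex) x = of_real (lr G0 x)" for x
      unfolding lr_def cnd_def by (simp add: scaleR_conv_of_real)
    have "(\<integral>z. \<phi> (fst z) * 1 \<partial>J G0) = (\<integral>x. \<phi> x * of_real (lr G0 x) \<partial>\<mu>)"
      using integral_J_fst_mult(2)[OF smooth_G0 m \<phi>(2) dominated_G0 one, of 1] by (simp add: lrc)
    also have "\<dots> = (\<integral>x. \<phi> x * 1 \<partial>\<mu>)"
    proof (rule integral_cong_AE)
      show "AE x in \<mu>. \<phi> x * of_real (lr G0 x) = \<phi> x * 1" using lr_G0 by eventually_elim simp
    qed (use \<phi>(1) sq_int_measurable[OF lr_G0_sq_int] in measurable)
    finally show "(\<integral>z. \<phi> (fst z) * 1 \<partial>J G0) = (\<integral>x. \<phi> x * 1 \<partial>\<mu>)" .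
  qed auto
  then have "(\<integral>\<omega>. complex_of_real (indicator A (observed n \<omega>)) \<partial>sample_law \<nu> f G0 n) = (\<integral>x. complex_of_real (indicator A x) \<partial>iid \<mu> n)"
    by (simp add: sample_law_def)
  then have "(\<integral>\<omega>. indicator A (observed n \<omega>) \<partial>sample_law \<nu> f G0 n) = (\<integral>x. indicator A x \<partial>iid \<mu> n :: real)"
    unfolding integral_complex_of_real by (simp only: of_real_eq_iff)
  also have "(\<integral>\<omega>. indicator A (observed n \<omega>) \<partial>sample_law \<nu> f G0 n)
      = (\<integral>\<omega>. indicator {\<omega>\<in>space (sample_law \<nu> f G0 n). observed n \<omega> \<in> A} \<omega> \<partial>sample_law \<nu> f G0 n :: real)"
    by (rule Bochner_Integration.integral_cong) (auto simp: indicator_def)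
  finally show ?thesis using E A by simp
qed

text \<open>The sum of \<open>u0\<close> cancels in the difference and the event depends on the
  observations alone, so it can be measured under the law of X.\<close>

lemma asymptotically_sum_iff:
  assumes S: "estimator \<nu> S" and v: "v \<in> borel_measurable \<nu>"
  shows "asymptotically_sum_of \<nu> f G0 S v \<longleftrightarrow>
    (\<forall>\<epsilon>>0. (\<lambda>n. measure (iid \<mu> n) {x\<in>space (iid \<mu> n). \<bar>centred S n x - score (\<lambda>x. v x - u0 x) n x\<bar> > \<epsilon>}) \<longlonglongrightarrow> 0)"
  unfolding asymptotically_sum_of_def
proof (intro all_cong1 imp_cong refl tendsto_cong)
  fix \<epsilon> :: real assume \<epsilon>: "\<epsilon> > 0"
  show "\<forall>\<^sub>F n in sequentially.
      measure (sample_law \<nu> f G0 n) {\<omega>\<in>space (sample_law \<nu> f G0 n). \<bar>S n (observed n \<omega>) - (\<Sum>j<n. v (fst (\<omega> j)))\<bar> > \<epsilon> * sqrt (real n)}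
      = measure (iid \<mu> n) {x\<in>space (iid \<mu> n). \<bar>centred S n x - score (\<lambda>x. v x - u0 x) n x\<bar> > \<epsilon>}"
    using eventually_gt_at_top[of "0::nat"]
  proof eventually_elim
    fix n :: nat assume n: "0 < n"
    let ?A = "{x\<in>space (iid \<mu> n). \<bar>centred S n x - score (\<lambda>x. v x - u0 x) n x\<bar> > \<epsilon>}"
    have [measurable]: "centred S n \<in> borel_measurable (iid \<mu> n)" by (rule centred_measurable[OF S])
    have [measurable]: "score (\<lambda>x. v x - u0 x) n \<in> borel_measurable (iid \<mu> n)"
      by (rule score_measurable) (use v in \<open>simp add: measurable_mu\<close>)
    have A: "?A \<in> sets (iid \<mu> n)" by measurable
    have fst_J: "fst \<in> measurable (J G0) \<mu>"
      using measurable_J[OF dominated_G0 measurable_fst] by (simp cong: measurable_cong_sets)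
    have om: "observed n \<in> measurable (sample_law \<nu> f G0 n) (iid \<mu> n)"
      unfolding sample_law_def by (rule observed_measurable[OF fst_J])
    have e: "centred S n x - score (\<lambda>x. v x - u0 x) n x = (S n x - (\<Sum>j<n. v (x j))) / sqrt (real n)" for x
      by (simp add: centred_def score_def sum_subtractf diff_divide_distrib)
    have "\<epsilon> < \<bar>centred S n x - score (\<lambda>x. v x - u0 x) n x\<bar> \<longleftrightarrow> \<epsilon> * sqrt (real n) < \<bar>S n x - (\<Sum>j<n. v (x j))\<bar>" for x
      unfolding e using n by (simp add: pos_less_divide_eq)
    moreover have "(\<Sum>j<n. v (observed n \<omega> j)) = (\<Sum>j<n. v (fst (\<omega> j)))" for \<omega> :: "nat \<Rightarrow> 'a \<times> 'b"
      by (simp add: observed_def)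
    ultimately have "{\<omega>\<in>space (sample_law \<nu> f G0 n). \<bar>S n (observed n \<omega>) - (\<Sum>j<n. v (fst (\<omega> j)))\<bar> > \<epsilon> * sqrt (real n)}
        = {\<omega>\<in>space (sample_law \<nu> f G0 n). observed n \<omega> \<in> ?A}"
      using measurable_space[OF om] by (auto simp del: of_nat_sum)
    then show "measure (sample_law \<nu> f G0 n) {\<omega>\<in>space (sample_law \<nu> f G0 n). \<bar>S n (observed n \<omega>) - (\<Sum>j<n. v (fst (\<omega> j)))\<bar> > \<epsilon> * sqrt (real n)}
        = measure (iid \<mu> n) ?A"
      using measure_sample_observed[OF A] by simp
  qed
qed

text \<open>\<open>S - S\<^sub>n\<close> is tight because it converges weakly, and \<open>S\<^sub>n\<close> differs from \<open>\<Sum>\<^sub>j u\<^sub>0(X\<^sub>j)\<close> by a sum of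
  centred variables of variance \<open>s2\<close>.\<close>

lemma regular_sum_tight:
  assumes reg: "regular_sum_with_limit \<nu> f u \<G> G0 S L" and \<delta>: "\<delta> > 0"
  shows "\<exists>K>0. \<forall>\<^sub>F n in sequentially. measure (iid \<mu> n) {x\<in>space (iid \<mu> n). \<bar>centred S n x\<bar> > K} < \<delta>"
proof -
  have S: "estimator \<nu> S" and L: "real_distribution L" using reg by (auto simp: regular_sum_with_limit_def)
  interpret L: real_distribution L by (rule L)
  \<comment> \<open>A continuous cutoff between the indicators of
    \<open>\<bar>x\<bar> \<ge> k + 1\<close> and \<open>\<bar>x\<bar> > k\<close>, to which weak
    convergence applies.\<close>
  define \<phi> where "\<phi> k x = max 0 (min 1 (\<bar>x\<bar> - real k))" for k :: nat and x :: real
  have \<phi>c: "isCont (\<phi> k) x" for k x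
    unfolding \<phi>_def by (intro continuous_intros)
  have \<phi>m [measurable]: "\<phi> k \<in> borel_measurable borel" for k
    unfolding \<phi>_def by measurable
  have \<phi>b: "0 \<le> \<phi> k x" "\<phi> k x \<le> 1" for k x by (auto simp: \<phi>_def)
  have "(\<lambda>k. \<integral>x. \<phi> k x \<partial>L) \<longlonglongrightarrow> (\<integral>x. 0 \<partial>L)"
  proof (rule integral_dominated_convergence[where w = "\<lambda>_. 1"])
    show "AE x in L. (\<lambda>k. \<phi> k x) \<longlonglongrightarrow> 0"
    proof (rule AE_I2, rule tendsto_eventually)
      fix x :: real
      show "\<forall>\<^sub>F k in sequentially. \<phi> k x = 0"
        using eventually_ge_at_top[of "nat \<lceil>\<bar>x\<bar>\<rceil>"]
        by eventually_elim (auto simp: \<phi>_def max_def min_def nat_le_iff ceiling_le_iff)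
    qed
  qed (use \<phi>b in auto)
  then have "(\<lambda>k. \<integral>x. \<phi> k x \<partial>L) \<longlonglongrightarrow> 0" by simp
  then have "\<forall>\<^sub>F k in sequentially. (\<integral>x. \<phi> k x \<partial>L) < \<delta> / 2"
    by (rule order_tendstoD(2)) (use \<delta> in simp)
  then obtain k where k: "(\<integral>x. \<phi> k x \<partial>L) < \<delta> / 2" by (auto simp: eventually_sequentially)
  \<comment> \<open>The constant curve at \<open>c = 1\<close>, which for \<open>n \<ge> 1\<close>
    is the sample under \<open>G0\<close>.\<close>
  let ?P = "\<lambda>n. sample_law \<nu> f (mixture (1 / sqrt (real n)) G0 G0) n"
  have wc: "weak_conv_m (\<lambda>n. distr (?P n) borel (sum_error S n)) L"
    using reg G0_Loc unfolding regular_sum_with_limit_def sum_error_def[symmetric] by auto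
  have "(\<lambda>n. \<integral>x. \<phi> k x \<partial>distr (?P n) borel (sum_error S n)) \<longlonglongrightarrow> (\<integral>x. \<phi> k x \<partial>L)"
    by (rule weak_conv_m_integral[OF sum_error_real_distribution[OF smooth_G0 S zero_less_one] L wc \<phi>c, of k 1])
      (use \<phi>b in auto)
  then have ev: "\<forall>\<^sub>F n in sequentially. (\<integral>x. \<phi> k x \<partial>distr (?P n) borel (sum_error S n)) < \<delta> / 2"
    by (rule order_tendstoD(2)[OF _ k])
  have s2: "0 \<le> s2" by (simp add: s2_def)
  \<comment> \<open>Chebyshev for the normalised residuals, of variance at most \<open>s2\<close>;
    the added 1 keeps \<open>K'\<close> positive when \<open>s2 = 0\<close>.\<close>
  define K' where "K' = sqrt (2 * (s2 + 1) / \<delta>)"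
  have K': "K' > 0" "K'\<^sup>2 = 2 * (s2 + 1) / \<delta>" using \<delta> s2 by (auto simp: K'_def)
  have s2K: "s2 / K'\<^sup>2 \<le> \<delta> / 2" unfolding K'(2) using \<delta> s2 by (simp add: field_simps)
  define K where "K = real k + 1 + K'"
  show ?thesis
  proof (intro exI[of _ K] conjI)
    show "K > 0" using K' by (simp add: K_def add_nonneg_pos)
    show "\<forall>\<^sub>F n in sequentially. measure (iid \<mu> n) {x\<in>space (iid \<mu> n). \<bar>centred S n x\<bar> > K} < \<delta>"
      using ev eventually_curve[OF zero_less_one]
    proof eventually_elim
      fix n assume e: "(\<integral>x. \<phi> k x \<partial>distr (?P n) borel (sum_error S n)) < \<delta> / 2" and t: "1 / sqrt (real n) \<in> {0..1}"
      have PP: "?P n = sample_law \<nu> f G0 n" by (simp only: mixture_self[OF t])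
      have Pi: "sample_law \<nu> f G0 n = iid (J G0) n" by (simp add: sample_law_def)
      interpret P: prob_space "sample_law \<nu> f G0 n" using prob_space_sample[OF smooth_G0 t, of n] unfolding PP .
      have We [measurable]: "sum_error S n \<in> borel_measurable (sample_law \<nu> f G0 n)"
        using measurable_sample[OF smooth_G0 t sum_error_measurable[OF S, of n]] unfolding PP .
      let ?R = "score (\<lambda>z. ub (fst z) (snd z)) n"
      have Rm [measurable]: "?R \<in> borel_measurable (sample_law \<nu> f G0 n)"
        unfolding Pi by (rule score_measurable[OF sq_int_measurable[OF ub_J0_sq_int]])
      have [measurable]: "centred S n \<in> borel_measurable (iid \<mu> n)" by (rule centred_measurable[OF S])
      let ?A = "{x\<in>space (iid \<mu> n). \<bar>centred S n x\<bar> > K}"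
      have A: "?A \<in> sets (iid \<mu> n)" by measurable
      let ?s = "space (sample_law \<nu> f G0 n)"
      have "{\<omega>\<in>?s. observed n \<omega> \<in> ?A} \<subseteq> {\<omega>\<in>?s. \<bar>sum_error S n \<omega>\<bar> \<ge> real k + 1} \<union> {\<omega>\<in>?s. (?R \<omega>)\<^sup>2 \<ge> K'\<^sup>2}"
      proof safe
        fix \<omega> assume a: "K < \<bar>centred S n (observed n \<omega>)\<bar>" and b: "\<not> K'\<^sup>2 \<le> (?R \<omega>)\<^sup>2"
        have "\<bar>?R \<omega>\<bar> < K'" using b K'(1) abs_le_square_iff[of K' "?R \<omega>"] by auto
        then show "real k + 1 \<le> \<bar>sum_error S n \<omega>\<bar>" using a unfolding sum_error_decomp K_def by linarith
      qed
      then have "measure (sample_law \<nu> f G0 n) {\<omega>\<in>?s. observed n \<omega> \<in> ?A}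
          \<le> measure (sample_law \<nu> f G0 n) ({\<omega>\<in>?s. \<bar>sum_error S n \<omega>\<bar> \<ge> real k + 1} \<union> {\<omega>\<in>?s. (?R \<omega>)\<^sup>2 \<ge> K'\<^sup>2})"
        by (intro P.finite_measure_mono) measurable
      also have "\<dots> \<le> measure (sample_law \<nu> f G0 n) {\<omega>\<in>?s. \<bar>sum_error S n \<omega>\<bar> \<ge> real k + 1}
          + measure (sample_law \<nu> f G0 n) {\<omega>\<in>?s. (?R \<omega>)\<^sup>2 \<ge> K'\<^sup>2}"
        by (intro measure_Un_le) measurable
      also have "measure (sample_law \<nu> f G0 n) {\<omega>\<in>?s. \<bar>sum_error S n \<omega>\<bar> \<ge> real k + 1} < \<delta> / 2"
      proof -
        let ?E = "{\<omega>\<in>?s. \<bar>sum_error S n \<omega>\<bar> \<ge> real k + 1}"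
        have E: "?E \<in> sets (sample_law \<nu> f G0 n)" by measurable
        have "measure (sample_law \<nu> f G0 n) ?E = (\<integral>\<omega>. indicator ?E \<omega> \<partial>sample_law \<nu> f G0 n)" using E by simp
        also have "\<dots> \<le> (\<integral>\<omega>. \<phi> k (sum_error S n \<omega>) \<partial>sample_law \<nu> f G0 n)"
        proof (rule integral_mono)
          show "integrable (sample_law \<nu> f G0 n) (\<lambda>\<omega>. \<phi> k (sum_error S n \<omega>))"
            by (rule P.integrable_const_bound[of _ 1]) (use \<phi>b in \<open>auto, measurable\<close>)
          show "indicator ?E \<omega> \<le> \<phi> k (sum_error S n \<omega>)" for \<omega>
            by (auto simp: indicator_def \<phi>_def)
          show "integrable (sample_law \<nu> f G0 n) (indicator ?E :: _ \<Rightarrow> real)"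
            by (rule integrable_real_indicator[OF E]) (simp add: less_top[symmetric])
        qed
        also have "\<dots> = (\<integral>x. \<phi> k x \<partial>distr (?P n) borel (sum_error S n))"
          unfolding PP by (subst integral_distr) auto
        finally show ?thesis using e by linarith
      qed
      also have "measure (sample_law \<nu> f G0 n) {\<omega>\<in>?s. (?R \<omega>)\<^sup>2 \<ge> K'\<^sup>2} \<le> \<delta> / 2"
      proof -
        note sc = J0.sq_int_score[OF ub_J0_sq_int ub_mean, of n, folded Pi]
        have "measure (sample_law \<nu> f G0 n) {\<omega>\<in>?s. (?R \<omega>)\<^sup>2 \<ge> K'\<^sup>2} \<le> (\<integral>\<omega>. (?R \<omega>)\<^sup>2 \<partial>sample_law \<nu> f G0 n) / K'\<^sup>2"
          using integral_Markov_inequality_measure[of "sample_law \<nu> f G0 n" "\<lambda>\<omega>. (?R \<omega>)\<^sup>2" ?s "K'\<^sup>2"]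
            sq_int_integrable_sq[OF sc] zero_less_power[OF K'(1), of 2] by simp
        also have "\<dots> \<le> s2 / K'\<^sup>2"
          using J0.integral_score_sq_le[OF ub_J0_sq_int ub_mean, of n, folded Pi] unfolding s2_def
          by (intro divide_right_mono) auto
        finally show ?thesis using s2K by linarith
      qed
      finally show "measure (iid \<mu> n) ?A < \<delta>" unfolding measure_sample_observed[OF A] by simp
    qed
  qed
qed

text \<open>A second moment equal to the bound keeps \<open>Re (\<psi> (2 * \<tau>))\<close> above
  nearly \<open>1 - 2 * \<tau>\<^sup>2 * A\<close> for small \<tau>, which is the hypothesis
  \<open>efficient\<close> of \<open>score_approximation\<close>: to first order in
  \<open>\<tau>\<^sup>2\<close> the Gaussian factor cancels the share \<open>s2\<close> of the
  second moment.\<close>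

lemma efficient_asymptotically_sum:
  assumes reg: "regular_sum_with_limit \<nu> f u \<G> G0 S L"
    and eff: "second_moment L = variance_bound \<nu> f u \<G> G0" and w: "rep w"
  shows "asymptotically_sum_of \<nu> f G0 S (\<lambda>x. u0 x + w x)"
proof -
  define A where "A = (\<integral>x. (w x)\<^sup>2 \<partial>\<mu>)"
  have A: "0 \<le> A" and s2: "0 \<le> s2" by (simp_all add: A_def s2_def)
  have S: "estimator \<nu> S" and L: "real_distribution L" using reg by (auto simp: regular_sum_with_limit_def)
  interpret L: real_distribution L by (rule L)
  let ?\<psi> = "\<lambda>\<tau>. char L \<tau> * of_real (exp (\<tau>\<^sup>2 * s2 / 2))"
  interpret R: tilted_limits \<mu> Loc gs bias "centred S" ?\<psi>
    by (rule regular_sum_tilted_limits[OF reg])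
  define B where "B = A + s2"
  have B: "0 \<le> B" using A s2 by (simp add: B_def)
  have m2: "(\<integral>\<^sup>+x. ennreal ((x - 0)\<^sup>2) \<partial>L) = ennreal B"
    using eff variance_bound_eq[OF w] by (simp add: second_moment_def B_def A_def)
  have Re_char: "1 - \<tau>\<^sup>2 * B / 2 \<le> Re (char L \<tau>)" for \<tau>
    using L.char_lower_bound[OF m2 B, of \<tau>] by simp
  have lim: "(\<lambda>n. measure (iid \<mu> n) {x\<in>space (iid \<mu> n). \<bar>centred S n x - score w n x\<bar> > \<epsilon>}) \<longlonglongrightarrow> 0" if \<epsilon>: "\<epsilon> > 0" for \<epsilon>
  proof (rule R.score_approximation[OF w _ _ \<epsilon>])
    show "\<exists>K>0. \<forall>\<^sub>F n in sequentially. measure (iid \<mu> n) {x\<in>space (iid \<mu> n). \<bar>centred S n x\<bar> > K} < \<delta>" if "\<delta> > 0" for \<delta>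
      by (rule regular_sum_tight[OF reg that])
    show "\<forall>\<^sub>F \<tau> in at_right 0. (1 - Re (?\<psi> (2 * \<tau>))) / (2 * \<tau>\<^sup>2) \<le> (\<integral>x. (w x)\<^sup>2 \<partial>\<mu>) + \<delta>" if \<delta>: "\<delta> > 0" for \<delta>
    proof -
      have small: "\<forall>\<^sub>F \<tau> in at_right 0. 2 * \<tau>\<^sup>2 * C < d" if "d > 0" for C d :: real
      proof -
        have "((\<lambda>\<tau>. 2 * \<tau>\<^sup>2 * C) \<longlongrightarrow> 2 * 0\<^sup>2 * C) (at_right 0)" by (intro tendsto_intros)
        then show ?thesis by (rule order_tendstoD(2)) (use that in simp)
      qed
      have "\<forall>\<^sub>F \<tau> in at_right 0. 2 * \<tau>\<^sup>2 * (B * s2) < \<delta>" "\<forall>\<^sub>F \<tau> in at_right 0. 2 * \<tau>\<^sup>2 * B < 1"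
        using small \<delta> by auto
      moreover have "\<forall>\<^sub>F \<tau> in at_right (0::real). \<tau> > 0" by (rule eventually_at_right_less)
      ultimately show ?thesis
      proof eventually_elim
        fix \<tau> :: real assume 1: "2 * \<tau>\<^sup>2 * (B * s2) < \<delta>" and 2: "2 * \<tau>\<^sup>2 * B < 1" and \<tau>: "0 < \<tau>"
        \<comment> \<open>Half the square of the frequency \<open>2 * \<tau>\<close>, so that both
          exponents become multiples of \<open>s\<close>.\<close>
        define s where "s = 2 * \<tau>\<^sup>2"
        have s: "0 < s" using \<tau> by (simp add: s_def)
        have R: "Re (?\<psi> (2 * \<tau>)) = Re (char L (2 * \<tau>)) * exp (s * s2)"
          by (simp add: s_def power_mult_distrib)
        have "1 - s * B \<le> Re (char L (2 * \<tau>))" using Re_char[of "2 * \<tau>"] by (simp add: s_def power_mult_distrib ac_simps)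
        moreover have "0 \<le> 1 - s * B" using 2 by (simp add: s_def)
        moreover have "1 + s * s2 \<le> exp (s * s2)" by (rule exp_ge_add_one_self)
        ultimately have "(1 - s * B) * (1 + s * s2) \<le> Re (?\<psi> (2 * \<tau>))"
          unfolding R using s s2 by (intro mult_mono) auto
        then have "1 - Re (?\<psi> (2 * \<tau>)) \<le> 1 - (1 - s * B) * (1 + s * s2)" by linarith
        also have "\<dots> = s * (A + s * (B * s2))" by (simp add: B_def algebra_simps)
        also have "\<dots> \<le> s * (A + \<delta>)" using 1 s by (intro mult_left_mono) (simp_all add: s_def)
        finally show "(1 - Re (?\<psi> (2 * \<tau>))) / (2 * \<tau>\<^sup>2) \<le> (\<integral>x. (w x)\<^sup>2 \<partial>\<mu>) + \<delta>"
          unfolding s_def[symmetric] A_def[symmetric] using s by (simp add: pos_divide_le_eq mult.commute)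
      qed
    qed
  qed
  have wm: "w \<in> borel_measurable \<nu>" using sq_int_measurable[OF rep_facts(1)[OF w]] measurable_mu by simp
  show ?thesis
    unfolding asymptotically_sum_iff[OF S borel_measurable_add[OF u0_measurable wm]] using lim by simp
qed

text \<open>If no unbiased function has finite risk, both sides are false, because an efficient
  estimator is regular and its limits produce a representer, hence an optimal predictor. Otherwise
  the representer links them: efficiency forces asymptotic linearity, and linearity gives a normal
  limit attaining the bound.\<close>

lemma efficient_iff:
  assumes S: "estimator \<nu> S"
  shows "asymptotically_efficient \<nu> f u \<G> G0 S \<longleftrightarrow>
    (\<exists>v0. is_optimal_v \<nu> f u \<G> G0 v0 \<and> asymptotically_sum_of \<nu> f G0 S v0)"
proof
  assume "asymptotically_efficient \<nu> f u \<G> G0 S"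
  then obtain L where L: "regular_sum_with_limit \<nu> f u \<G> G0 S L" "second_moment L = variance_bound \<nu> f u \<G> G0"
    by (auto simp: asymptotically_efficient_def)
  obtain w where "rep w" by (rule regular_sum_rep_exists[OF L(1)])
  then show "\<exists>v0. is_optimal_v \<nu> f u \<G> G0 v0 \<and> asymptotically_sum_of \<nu> f G0 S v0"
    using rep_optimal efficient_asymptotically_sum[OF L] by blast
next
  assume "\<exists>v0. is_optimal_v \<nu> f u \<G> G0 v0 \<and> asymptotically_sum_of \<nu> f G0 S v0"
  then obtain v where v: "is_optimal_v \<nu> f u \<G> G0 v" "asymptotically_sum_of \<nu> f G0 S v" by blast
  then have v': "v \<in> unbiased_class \<nu> f u \<G> G0" "risk \<nu> f u G0 v < \<infinity>" by (auto simp: is_optimal_v_def is_arg_min_def)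
  then have vm: "v \<in> borel_measurable \<nu>" by (simp add: unbiased_class_def)
  obtain w where w: "rep w" by (rule finite_risk_rep_exists[OF v'])
  have r: "rep (\<lambda>x. v x - u0 x)" by (rule rep_AE_cong[OF w optimal_AE[OF w v(1)]])
  let ?A = "(\<integral>x. (v x - u0 x)\<^sup>2 \<partial>\<mu>) + s2"
  have "regular_sum_with_limit \<nu> f u \<G> G0 S (scaled_normal (sqrt ?A))"
    by (rule regular_from_representation[OF S r]) (use v(2) asymptotically_sum_iff[OF S vm] in blast)
  moreover have "second_moment (scaled_normal (sqrt ?A)) = variance_bound \<nu> f u \<G> G0"
    unfolding second_moment_scaled_normal variance_bound_eq[OF r] by (simp add: s2_def)
  ultimately show "asymptotically_efficient \<nu> f u \<G> G0 S" by (auto simp: asymptotically_efficient_def)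
qed

text \<open>Every version agrees with \<open>u0 + w\<close> almost everywhere under the law of
  X.\<close>

lemma optimal_unique:
  assumes v0: "is_optimal_v \<nu> f u \<G> G0 v0" and v1: "is_optimal_v \<nu> f u \<G> G0 v1"
  shows "AE z in J G0. v0 (fst z) = v1 (fst z)"
proof -
  have v: "v0 \<in> unbiased_class \<nu> f u \<G> G0" "risk \<nu> f u G0 v0 < \<infinity>" "v1 \<in> unbiased_class \<nu> f u \<G> G0"
    using v0 v1 by (auto simp: is_optimal_v_def is_arg_min_def)
  then have [measurable]: "v0 \<in> borel_measurable \<nu>" "v1 \<in> borel_measurable \<nu>" by (auto simp: unbiased_class_def)
  obtain w where w: "rep w" by (rule finite_risk_rep_exists[OF v(1,2)])
  have "AE x in \<mu>. v0 x = v1 x"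
    using optimal_AE(1)[OF w v0] optimal_AE(1)[OF w v1] by eventually_elim simp
  then show ?thesis by (intro AE_J0_fst) measurable
qed

end

theorem theorem2p3:
  fixes \<nu> :: "'x measure" and T :: "'p measure"
    and f :: "'x \<Rightarrow> 'p \<Rightarrow> real" and u :: "'x \<Rightarrow> 'p \<Rightarrow> real"
    and \<G> :: "'p measure set" and G0 :: "'p measure"
  assumes "sigma_finite_measure \<nu>"
    and "conditional_density \<nu> T f"
    and "(\<lambda>(x, \<theta>). u x \<theta>) \<in> borel_measurable (\<nu> \<Otimes>\<^sub>M T)"
    and "convex_class T \<G>"
    and "\<forall>G\<in>\<G>. (\<integral>\<^sup>+z. ennreal ((u (fst z) (snd z))\<^sup>2) \<partial>joint_law \<nu> f G) < \<infinity>"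
    and "G0 \<in> \<G>"
  shows
    "(unbiased_class \<nu> f u \<G> G0 \<noteq> {} \<longrightarrow>
        ((\<exists>v\<in>unbiased_class \<nu> f u \<G> G0. risk \<nu> f u G0 v < \<infinity>) \<longrightarrow>
           (\<exists>v0. is_optimal_v \<nu> f u \<G> G0 v0)) \<and>
        (\<forall>v0 v1. is_optimal_v \<nu> f u \<G> G0 v0 \<and> is_optimal_v \<nu> f u \<G> G0 v1 \<longrightarrow>
           (AE z in joint_law \<nu> f G0. v0 (fst z) = v1 (fst z))) \<and>
        (\<forall>S. estimator \<nu> S \<longrightarrow>
           (asymptotically_efficient \<nu> f u \<G> G0 S \<longleftrightarrow>
            (\<exists>v0. is_optimal_v \<nu> f u \<G> G0 v0 \<and> asymptotically_sum_of \<nu> f G0 S v0))))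
     \<and>
     (unbiased_class \<nu> f u \<G> G0 = {} \<longrightarrow>
        \<not> (\<exists>m L. regular_mean_with_limit \<nu> f u \<G> G0 m L) \<and>
        \<not> (\<exists>S L. regular_sum_with_limit \<nu> f u \<G> G0 S L))"
proof -
  have G0: "prob_space G0" "sets G0 = sets T" using assms(4,6) by (auto simp: convex_class_def)
  have u: "(\<lambda>z. u (fst z) (snd z)) \<in> borel_measurable (\<nu> \<Otimes>\<^sub>M T)" using assms(3) by (simp add: case_prod_beta')
  have u2: "integrable (joint_law \<nu> f G0) (\<lambda>z. (u (fst z) (snd z))\<^sup>2)"
    using measurable_joint_law[OF G0(2) u] assms(5,6) by (intro integrableI_nonneg) auto
  interpret class_model \<nu> T f G0 u \<G>
    using assms G0 u2
    by (simp add: class_model_def class_model_axioms_def utility_model_def utility_model_axioms_def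
        base_model_def base_model_axioms_def)
  show ?thesis
  proof (intro conjI impI allI)
    show "\<exists>v0. is_optimal_v \<nu> f u \<G> G0 v0" if "\<exists>v\<in>unbiased_class \<nu> f u \<G> G0. risk \<nu> f u G0 v < \<infinity>"
      using that finite_risk_rep_exists rep_optimal by blast
    show "AE z in joint_law \<nu> f G0. v0 (fst z) = v1 (fst z)"
      if "is_optimal_v \<nu> f u \<G> G0 v0 \<and> is_optimal_v \<nu> f u \<G> G0 v1" for v0 v1
      using that optimal_unique by blast
    show "asymptotically_efficient \<nu> f u \<G> G0 S \<longleftrightarrow>
        (\<exists>v0. is_optimal_v \<nu> f u \<G> G0 v0 \<and> asymptotically_sum_of \<nu> f G0 S v0)" if "estimator \<nu> S" for S
      using that by (rule efficient_iff)
    show "\<not> (\<exists>m L. regular_mean_with_limit \<nu> f u \<G> G0 m L)" if "unbiased_class \<nu> f u \<G> G0 = {}"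
      using that regular_mean_unbiased_exists by blast
    show "\<not> (\<exists>S L. regular_sum_with_limit \<nu> f u \<G> G0 S L)" if "unbiased_class \<nu> f u \<G> G0 = {}"
      using that regular_sum_rep_exists rep_unbiased by blast
  qed
qed

end
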